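(* Let $X$ be a symplectic manifold and let $\mathbb{L}_0,\mathbb{L}_1$ be two reference Lagrangians with formal deformation spaces $U_0,U_1$, potentials $W_i:U_i\to\Lambda$ and localized mirror functors $\mathcal{F}^{\mathbb{L}_i}:\mathrm{Fuk}(X)\to \mathrm{MF}(W_i)$, $i=0,1$. Suppose that $(\mathbb{L}_0,b_0)$ and $(\mathbb{L}_1,b_1)$ are isomorphic on $U_0\cap U_1$, i.e. there are open subsets $V_i\subset U_i$ and a homeomorphism $\phi:V_0\to V_1$ (in the Novikov topology) such that for each $b_0\in V_0$, with $b_1=\phi(b_0)\in V_1$, there are isomorphisms $\alpha\in \mathrm{Hom}((\mathbb{L}_0,b_0),(\mathbb{L}_1,b_1))$, $\beta\in\mathrm{Hom}((\mathbb{L}_1,b_1),(\mathbb{L}_0,b_0))$, meaning $$m_1^{b_0,b_1}(\alpha)=0,\quad m_1^{b_1,b_0}(\beta)=0,\quad m_2^{b_0,b_1,b_0}(\alpha,\beta)=\mathbf{1}_{\mathbb{L}_0}+m_1^{b_0,b_0}(\gamma_0),\quad m_2^{b_1,b_0,b_1}(\beta,\alpha)=\mathbf{1}_{\mathbb{L}_1}+m_1^{b_1,b_1}(\gamma_1)$$ for some $\gamma_i\in\mathrm{Hom}((\mathbb{L}_i,b_i),(\mathbb{L}_i,b_i))$. Identify $V_0$ with $V_1$ via $\phi$ and denote the result by $U_0\cap U_1$. Then: 1. The potential functions agree: $W_0(b_0)=W_1(b_1)$ for $b_0\in V_0$, $b_1=\phi(b_0)\in V_1$; this defines the potential $W_{01}$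 on $U_0\cap U_1$. 2. The $A_\infty$-functors $\mathcal{F}^{\mathbb{L}_i}:\mathrm{Fuk}(X)\to\mathrm{MF}(W_i)$ composed with the restrictions $r_i:\mathrm{MF}(W_i)\to\mathrm{MF}(W_i|_{V_i})$, $i=0,1$, are quasi-isomorphic to each other: $r_0\circ\mathcal{F}^{\mathbb{L}_0}\cong r_1\circ\mathcal{F}^{\mathbb{L}_1}$. Moreover, the required natural transformations as well as the homotopies for this quasi-isomorphism are explicitly given using $\alpha,\beta$. 3. There exists an $A_\infty$-functor $$\mathcal{F}^{\mathrm{global}}:\mathrm{Fuk}(X)\to \mathrm{MF}(W_0)\times^h_{\mathrm{MF}(W_{01})}\mathrm{MF}(W_1)$$ from $\mathrm{Fuk}(X)$ to the homotopy fiber product of the two dg-categories $\mathrm{MF}(W_0)$ and $\mathrm{MF}(W_1)$.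
   Context: Novikov field: $\Lambda=\{\sum_{i\ge0} a_iT^{A_i}\mid a_i\in\mathbb{C},A_i\in\mathbb{R},A_i\to\infty\}$, with valuation $\mathrm{val}$ the minimal exponent; $\Lambda_0=\{\mathrm{val}\ge0\}$, $\Lambda_+=\{\mathrm{val}>0\}$. $A_\infty$ conventions: $\mathrm{Fuk}(X)$ is a $\mathbb{Z}/2$-graded filtered unital $A_\infty$-category over $\Lambda$, with operations $m_k:\mathrm{Hom}(L_0,L_1)\otimes\cdots\otimes\mathrm{Hom}(L_{k-1},L_k)\to\mathrm{Hom}(L_0,L_k)$, satisfying $\sum(-1)^{|\mathbf{a}^{(1)}|'}m(\mathbf{a}^{(1)},m(\mathbf{a}^{(2)}),\mathbf{a}^{(3)})=0$ (sum over decompositions of the input string into three consecutive substrings), where $|a|'=|a|-1$, added up over a string. Units: $m_2(\mathbf{1},x)=x=(-1)^{|x|}m_2(x,\mathbf{1})$, and all other $m_k$ with an input $\mathbf 1$ vanish. The isomorphisms $\alpha,\beta$ have degree $0$, i.e. $|\alpha|'=|\beta|'=-1$. Deformations: for an object $\mathbb{L}$ and odd $b\in\mathrm{Hom}(\mathbb{L},\mathbb{L})$ of positive valuation, $m_0^b=\sum_k m_k(b,\dots,b)$; $b$ is weak Maurer–Cartan if $m_0^b=W(b)\mathbf{1}_{\mathbb{L}}$. For such $b_i$, $m_k^{b_0,\dots,b_k}(x_1,\dots,x_k)=\sum m(b_0,\dots,b_0,x_1,b_1,\dots,b_1,x_2,\dots,x_k,b_k,\dots,b_k)$, summing over all numbers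 of insertions. For each reference Lagrangian $\mathbb{L}$ one takes odd generators $X_1,\dots,X_n$ of $\mathrm{Hom}(\mathbb{L},\mathbb{L})$ and sets $b=\sum x_jX_j$; for simplicity it is assumed that all such $b$ with $x_j\in\Lambda_+$ (or $\Lambda_0$, given convergence) are weak Maurer–Cartan. The formal deformation space $U$ is the space of these $b$, and $W$ is a function on $U$. Matrix factorizations: $\mathrm{MF}(W)$ is the dg-category of matrix factorizations of $W$: $\mathbb{Z}/2$-graded free modules over the ring of functions on the given domain with an odd endomorphism $\delta$, $\delta^2=W\cdot\mathrm{id}$; morphisms are module maps with $df=\delta f-(-1)^{|f|}f\delta$. A dg-category is regarded as an $A_\infty$-category by $\mathrm{Hom}_{A_\infty}(E,F)=\mathrm{Hom}_{dg}(F,E)$, $m_1=d$, $m_2(\varphi,\psi)=(-1)^{|\varphi|}\varphi\circ\psi$, $m_k=0$ for $k\ge3$. Localized mirror functor: $\mathcal{F}^{\mathbb{L}}(L)=(\mathrm{Hom}(L,(\mathbb{L},b)),-m_1^{0,b})$, and $\mathcal{F}^{\mathbb{L}}_k(a_1,\dots,a_k)$ is the map $y\mapsto\sum_{j\ge0}m_{k+1+j}(a_1,\dots,a_k,y,b,\dots,b)$. Quasi-isomorphic functors: $A_\infty$-functors $\mathcal{F}_1,\mathcal{F}_2:\mathcal{C}\to\mathcal{D}$ are quasi-isomorphic if there are $A_\infty$ natural transformations $N_{12}:\mathcal{F}_1\to\mathcal{F}_2$, $N_{21}:\mathcal{F}_2\to\mathcal{F}_1$ (closed pre-natural transformations) such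 that both compositions differ from the identity natural transformation by $M_1(H)$ for some pre-natural transformation $H$, where $M_1$ is the standard differential on pre-natural transformations. Homotopy fiber product of dg-functors $G:B\to D$, $L:C\to D$: objects of $B\times^h_DC$ are triples $(M\in B,N\in C,\varphi\in D^0(G(M),L(N)))$ with $[\varphi]$ invertible in $H^0(D)$; $\mathrm{Hom}^i((M_1,N_1,\varphi_1),(M_2,N_2,\varphi_2))=B^i(M_1,M_2)\oplus C^i(N_1,N_2)\oplus D^{i-1}(G(M_1),L(N_2))$; $d(\mu,\nu,\gamma)=(d\mu,d\nu,-d\gamma-\varphi_2G(\mu)+L(\nu)\varphi_1)$; $(\mu',\nu',\gamma')(\mu,\nu,\gamma)=(\mu'\mu,\nu'\nu,\gamma'G(\mu)+(-1)^{i'}L(\nu')\gamma)$ with $i'=\deg(\mu',\nu',\gamma')$. Here $D=\mathrm{MF}(W_{01})$ and the functors are the restrictions; because the $A_\infty$ convention reverses morphisms, the comparison morphism attached to $L$ is a dg-morphism from $\mathcal{F}^{\mathbb{L}_1}(L)|_{V_1}$ to $\mathcal{F}^{\mathbb{L}_0}(L)|_{V_0}$.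
   Formalization: It is additionally assumed that for each b_0 in V_0 the isomorphisms α and β are not both zero; otherwise W_0(b_0)=W_1(b_1) can fail, e.g. α=β=0 when both units are exact. *)

theory Defs
  imports "HOL-Analysis.Analysis" "HOL-Library.Function_Algebras" "HOL-Library.Z2"
begin

section \<open>The Novikov field\<close>

text \<open>The element \<open>\<Sum>\<^sub>i a\<^sub>i T\<^sup>A\<^sup>i\<close> with \<open>A\<^sub>i \<rightarrow> \<infinity>\<close> is stored as its coefficient function
  \<open>\<real> \<rightarrow> \<complex>\<close>; the condition \<open>A\<^sub>i \<rightarrow> \<infinity>\<close> says that only finitely many exponents lie below any bound.\<close>

typedef novikov = "{f :: real \<Rightarrow> complex. \<forall>C. finite {r. r \<le> C \<and> f r \<noteq> 0}}"
  morphisms ncoeff Abs_novikov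
  by (intro exI[of _ "\<lambda>_. 0"]) simp

setup_lifting type_definition_novikov

lemma novikov_eqI: "(\<And>r. ncoeff x r = ncoeff y r) \<Longrightarrow> x = y"
  by (metis ncoeff_inject ext)

lemma ncoeff_finite: "finite {r. r \<le> C \<and> ncoeff x r \<noteq> 0}"
  using ncoeff[of x] by simp

lemma novikov_support_bound:
  fixes f :: "real \<Rightarrow> complex"
  assumes "\<forall>C. finite {r. r \<le> C \<and> f r \<noteq> 0}"
  shows "\<exists>m. \<forall>r. f r \<noteq> 0 \<longrightarrow> m \<le> r"
proof -
  let ?A = "{r. r \<le> 0 \<and> f r \<noteq> 0}"
  have fin: "finite (insert 0 ?A)" using assms by simp
  have "Min (insert 0 ?A) \<le> r" if "f r \<noteq> 0" for r
  proof (cases "r \<le> 0")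
    case True then show ?thesis using fin that by (intro Min_le) auto
  next
    case False
    have "Min (insert 0 ?A) \<le> 0" using fin by (intro Min_le) auto
    then show ?thesis using False by linarith
  qed
  then show ?thesis by blast
qed

definition novikov_conv :: "(real \<Rightarrow> complex) \<Rightarrow> (real \<Rightarrow> complex) \<Rightarrow> real \<Rightarrow> complex" where
  "novikov_conv f g r = (\<Sum>s | f s \<noteq> 0 \<and> g (r - s) \<noteq> 0. f s * g (r - s))"

lemma novikov_conv_nonzero:
  assumes "novikov_conv f g r \<noteq> 0"
  shows "\<exists>s. f s \<noteq> 0 \<and> g (r - s) \<noteq> 0"
proof (rule ccontr)
  assume "\<not> ?thesis"
  then have e: "{s. f s \<noteq> 0 \<and> g (r - s) \<noteq> 0} = {}" by auto
  show False using assms unfolding novikov_conv_def e by simp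
qed

lemma novikov_conv_support_finite:
  fixes f g :: "real \<Rightarrow> complex"
  assumes f: "\<forall>C. finite {r. r \<le> C \<and> f r \<noteq> (0::complex)}"
    and g: "\<forall>C. finite {r. r \<le> C \<and> g r \<noteq> (0::complex)}"
  shows "finite {s. f s \<noteq> 0 \<and> g (r - s) \<noteq> 0}"
proof -
  obtain m where m: "\<forall>r. g r \<noteq> 0 \<longrightarrow> m \<le> r" using novikov_support_bound[OF g] by blast
  have "{s. f s \<noteq> 0 \<and> g (r - s) \<noteq> 0} \<subseteq> {s. s \<le> r - m \<and> f s \<noteq> 0}"
    using m by force
  then show ?thesis using f finite_subset by blast
qed

lemma novikov_conv_superset:
  assumes "finite S" "{s. f s \<noteq> 0 \<and> g (r - s) \<noteq> 0} \<subseteq> S"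
  shows "novikov_conv f g r = (\<Sum>s\<in>S. f s * g (r - s))"
  unfolding novikov_conv_def using assms by (intro sum.mono_neutral_left) auto

lemma novikov_conv_closed:
  fixes f g :: "real \<Rightarrow> complex"
  assumes f: "\<forall>C. finite {r. r \<le> C \<and> f r \<noteq> (0::complex)}"
    and g: "\<forall>C. finite {r. r \<le> C \<and> g r \<noteq> (0::complex)}"
  shows "finite {r. r \<le> C \<and> novikov_conv f g r \<noteq> 0}"
proof -
  obtain m where m: "\<forall>r. g r \<noteq> 0 \<longrightarrow> m \<le> r" using novikov_support_bound[OF g] by blast
  obtain n where n: "\<forall>r. f r \<noteq> 0 \<longrightarrow> n \<le> r" using novikov_support_bound[OF f] by blast
  let ?B = "{s. s \<le> C - m \<and> f s \<noteq> 0} \<times> {t. t \<le> C - n \<and> g t \<noteq> 0}"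
  have "{r. r \<le> C \<and> novikov_conv f g r \<noteq> 0} \<subseteq> (\<lambda>(s,t). s + t) ` ?B"
  proof
    fix r assume "r \<in> {r. r \<le> C \<and> novikov_conv f g r \<noteq> 0}"
    then have r: "r \<le> C" "novikov_conv f g r \<noteq> 0" by auto
    then obtain s where s: "f s \<noteq> 0" "g (r - s) \<noteq> 0"
      using novikov_conv_nonzero by blast
    have "n \<le> s" "m \<le> r - s" using m n s by auto
    then have "(s, r - s) \<in> ?B" using r s by auto
    then show "r \<in> (\<lambda>(s,t). s + t) ` ?B" by (intro image_eqI[of _ _ "(s, r - s)"]) auto
  qed
  then show ?thesis using f g by (meson finite_SigmaI finite_imageI finite_subset)
qed

lemma novikov_conv_commute:
  "novikov_conv f g r = novikov_conv g f r"
  unfolding novikov_conv_def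
  by (rule sum.reindex_bij_witness[of _ "\<lambda>s. r - s" "\<lambda>s. r - s"]) auto

lemma novikov_conv_assoc:
  fixes f g h :: "real \<Rightarrow> complex"
  assumes f: "\<forall>C. finite {r. r \<le> C \<and> f r \<noteq> (0::complex)}"
    and g: "\<forall>C. finite {r. r \<le> C \<and> g r \<noteq> (0::complex)}"
    and h: "\<forall>C. finite {r. r \<le> C \<and> h r \<noteq> (0::complex)}"
  shows "novikov_conv (novikov_conv f g) h r = novikov_conv f (novikov_conv g h) r"
proof -
  obtain a where a: "\<And>r. f r \<noteq> 0 \<Longrightarrow> a \<le> r" using novikov_support_bound[OF f] by blast
  obtain b where b: "\<And>r. g r \<noteq> 0 \<Longrightarrow> b \<le> r" using novikov_support_bound[OF g] by blast
  obtain c where c: "\<And>r. h r \<noteq> 0 \<Longrightarrow> c \<le> r" using novikov_support_bound[OF h] by blast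
  define S where "S = {s. s \<le> r - b - c \<and> f s \<noteq> 0}"
  define T where "T = {t. t \<le> r - a - c \<and> g t \<noteq> 0}"
  define X where "X = (\<lambda>(s,t). s + t) ` (S \<times> T)"
  have fin: "finite S" "finite T" "finite X" unfolding S_def T_def X_def using f g by auto
  have inner: "novikov_conv f g x * h (r - x) = (\<Sum>s\<in>S. f s * g (x - s)) * h (r - x)" for x
  proof (cases "h (r - x) = 0")
    case False
    have "{s. f s \<noteq> 0 \<and> g (x - s) \<noteq> 0} \<subseteq> S"
      unfolding S_def using b c[OF False] by force
    then show ?thesis using novikov_conv_superset[OF fin(1)] by metis
  qed simp
  have "{x. novikov_conv f g x \<noteq> 0 \<and> h (r - x) \<noteq> 0} \<subseteq> X"
  proof
    fix x assume "x \<in> {x. novikov_conv f g x \<noteq> 0 \<and> h (r - x) \<noteq> 0}"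
    then have x: "novikov_conv f g x \<noteq> 0" "h (r - x) \<noteq> 0" by auto
    then obtain s where s: "f s \<noteq> 0" "g (x - s) \<noteq> 0"
      using novikov_conv_nonzero by blast
    have "a \<le> s" "b \<le> x - s" "c \<le> r - x" using a b c s x by auto
    then have "s \<in> S" "x - s \<in> T" using s unfolding S_def T_def by auto
    then show "x \<in> X" unfolding X_def by (intro image_eqI[of _ _ "(s, x - s)"]) auto
  qed
  then have "novikov_conv (novikov_conv f g) h r = (\<Sum>x\<in>X. novikov_conv f g x * h (r - x))"
    by (rule novikov_conv_superset[OF fin(3)])
  also have "\<dots> = (\<Sum>x\<in>X. \<Sum>s\<in>S. f s * g (x - s) * h (r - x))"
    by (simp add: inner sum_distrib_right)
  also have "\<dots> = (\<Sum>s\<in>S. \<Sum>x\<in>X. f s * g (x - s) * h (r - x))" by (rule sum.swap)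
  also have "\<dots> = (\<Sum>s\<in>S. f s * novikov_conv g h (r - s))"
  proof (rule sum.cong[OF refl])
    fix s assume s: "s \<in> S"
    let ?Y = "(\<lambda>x. x - s) ` X"
    have "{t. g t \<noteq> 0 \<and> h (r - s - t) \<noteq> 0} \<subseteq> ?Y"
    proof
      fix t assume "t \<in> {t. g t \<noteq> 0 \<and> h (r - s - t) \<noteq> 0}"
      then have t: "g t \<noteq> 0" "h (r - s - t) \<noteq> 0" by auto
      have "a \<le> s" "c \<le> r - s - t" using a c s t unfolding S_def by auto
      then have "t \<in> T" using t unfolding T_def by auto
      then have "s + t \<in> X" using s unfolding X_def by (intro image_eqI[of _ _ "(s, t)"]) auto
      then show "t \<in> ?Y" by (intro image_eqI[of _ _ "s + t"]) auto
    qed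
    then have "novikov_conv g h (r - s) = (\<Sum>t\<in>?Y. g t * h (r - s - t))"
      by (intro novikov_conv_superset) (use fin in auto)
    also have "\<dots> = (\<Sum>x\<in>X. g (x - s) * h (r - x))"
      by (subst sum.reindex) (auto simp: inj_on_def)
    finally show "(\<Sum>x\<in>X. f s * g (x - s) * h (r - x)) = f s * novikov_conv g h (r - s)"
      by (simp add: sum_distrib_left mult.assoc)
  qed
  also have "\<dots> = novikov_conv f (novikov_conv g h) r"
  proof (rule novikov_conv_superset[OF fin(1), symmetric], rule subsetI)
    fix s assume "s \<in> {s. f s \<noteq> 0 \<and> novikov_conv g h (r - s) \<noteq> 0}"
    then have s: "f s \<noteq> 0" "novikov_conv g h (r - s) \<noteq> 0" by auto
    then obtain t where t: "g t \<noteq> 0" "h (r - s - t) \<noteq> 0"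
      using novikov_conv_nonzero by blast
    then have "b \<le> t" "c \<le> r - s - t" using b c by auto
    then show "s \<in> S" using s unfolding S_def by auto
  qed
  finally show ?thesis .
qed

instantiation novikov :: comm_ring_1
begin

lift_definition zero_novikov :: novikov is "\<lambda>_. 0" by simp
lift_definition one_novikov :: novikov is "\<lambda>r. if r = 0 then 1 else 0"
  by (auto intro: finite_subset[of _ "{0}"])
lift_definition plus_novikov :: "novikov \<Rightarrow> novikov \<Rightarrow> novikov" is "\<lambda>f g r. f r + g r"
proof -
  fix f g :: "real \<Rightarrow> complex" and C
  assume "\<And>C. finite {r. r \<le> C \<and> f r \<noteq> 0}" "\<And>C. finite {r. r \<le> C \<and> g r \<noteq> 0}"
  then have "finite ({r. r \<le> C \<and> f r \<noteq> 0} \<union> {r. r \<le> C \<and> g r \<noteq> 0})" by blast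
  then show "finite {r. r \<le> C \<and> f r + g r \<noteq> 0}" by (rule rev_finite_subset) auto
qed
lift_definition uminus_novikov :: "novikov \<Rightarrow> novikov" is "\<lambda>f r. - f r" by simp
lift_definition minus_novikov :: "novikov \<Rightarrow> novikov \<Rightarrow> novikov" is "\<lambda>f g r. f r - g r"
proof -
  fix f g :: "real \<Rightarrow> complex" and C
  assume "\<And>C. finite {r. r \<le> C \<and> f r \<noteq> 0}" "\<And>C. finite {r. r \<le> C \<and> g r \<noteq> 0}"
  then have "finite ({r. r \<le> C \<and> f r \<noteq> 0} \<union> {r. r \<le> C \<and> g r \<noteq> 0})" by blast
  then show "finite {r. r \<le> C \<and> f r - g r \<noteq> 0}" by (rule rev_finite_subset) auto
qed
lift_definition times_novikov :: "novikov \<Rightarrow> novikov \<Rightarrow> novikov" is novikov_conv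
  by (intro allI novikov_conv_closed) blast+

instance
proof
  fix a b c :: novikov
  show "a * b * c = a * (b * c)"
    by transfer (auto simp: fun_eq_iff novikov_conv_assoc)
  show "a * b = b * a"
    by transfer (auto simp: fun_eq_iff novikov_conv_commute)
  show "1 * a = a"
  proof (rule novikov_eqI)
    fix r
    have "novikov_conv (\<lambda>r. if r = 0 then 1 else 0) (ncoeff a) r =
        (\<Sum>s\<in>{0}. (if s = 0 then 1 else 0) * ncoeff a (r - s))"
      by (rule novikov_conv_superset) auto
    then show "ncoeff (1 * a) r = ncoeff a r"
      by (simp add: times_novikov.rep_eq one_novikov.rep_eq)
  qed
  show "(a + b) * c = a * c + b * c"
  proof (rule novikov_eqI)
    fix r
    let ?S = "{s. ncoeff a s \<noteq> 0 \<and> ncoeff c (r - s) \<noteq> 0} \<union> {s. ncoeff b s \<noteq> 0 \<and> ncoeff c (r - s) \<noteq> 0}"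
    have fin: "finite ?S"
      using novikov_conv_support_finite ncoeff_finite by simp
    show "ncoeff ((a + b) * c) r = ncoeff (a * c + b * c) r"
      unfolding times_novikov.rep_eq plus_novikov.rep_eq
      by (subst (1 2 3) novikov_conv_superset[OF fin])
         (auto simp: plus_novikov.rep_eq algebra_simps sum.distrib)
  qed
  show "(0::novikov) \<noteq> 1" by transfer (metis zero_neq_one)
qed (transfer; auto simp: fun_eq_iff)+

end

lemma ncoeff_zero [simp]: "ncoeff 0 r = 0" by transfer simp
lemma ncoeff_one: "ncoeff 1 r = (if r = 0 then 1 else 0)" by transfer simp
lemma ncoeff_add [simp]: "ncoeff (x + y) r = ncoeff x r + ncoeff y r" by transfer simp
lemma ncoeff_diff [simp]: "ncoeff (x - y) r = ncoeff x r - ncoeff y r" by transfer simp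
lemma ncoeff_minus [simp]: "ncoeff (- x) r = - ncoeff x r" by transfer simp
lemma ncoeff_sum: "ncoeff (sum f A) r = (\<Sum>i\<in>A. ncoeff (f i) r)"
  by (induction A rule: infinite_finite_induct) auto
lemma ncoeff_mult: "ncoeff (x * y) r = novikov_conv (ncoeff x) (ncoeff y) r"
  by transfer simp

lemma ncoeff_mult_below:
  assumes "\<And>r. r < d \<Longrightarrow> ncoeff x r = 0" "\<And>r. r < e \<Longrightarrow> ncoeff y r = 0" "r < d + e"
  shows "ncoeff (x * y) r = 0"
proof -
  have e: "{s. ncoeff x s \<noteq> 0 \<and> ncoeff y (r - s) \<noteq> 0} = {}"
    using assms by (force simp: not_less)
  show ?thesis unfolding ncoeff_mult novikov_conv_def e by simp
qed

lemma ncoeff_power_below: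
  assumes "\<And>r. r < e \<Longrightarrow> ncoeff x r = 0" "r < real n * e"
  shows "ncoeff (x ^ n) r = 0"
  using assms(2)
proof (induction n arbitrary: r)
  case 0 then show ?case by (simp add: ncoeff_one)
next
  case (Suc n)
  have "ncoeff (x * x ^ n) r = 0"
    by (rule ncoeff_mult_below[of e x "real n * e"]) (use assms(1) Suc in \<open>auto simp: algebra_simps\<close>)
  then show ?case by simp
qed

lemma novikov_inverse_unit:
  assumes e: "e > 0" and g: "\<And>r. r < e \<Longrightarrow> ncoeff g r = 0"
  shows "\<exists>h. (1 - g) * h = 1"
proof -
  define N where "N r = nat \<lceil>r / e\<rceil>" for r
  have N: "r < real n * e" if "n > N r" for n r
  proof -
    have "r / e < real n" using that unfolding N_def by linarith
    then show ?thesis using e by (simp add: field_simps)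
  qed
  have Nmono: "N r \<le> N s" if "r \<le> s" for r s
    unfolding N_def using that e by (intro nat_mono ceiling_mono divide_right_mono) auto
  define p where "p n = (\<Sum>k\<le>n. g ^ k)" for n
  define f where "f r = ncoeff (p (N r)) r" for r
  have f: "f r = ncoeff (p n) r" if "N r \<le> n" for r n
    unfolding f_def p_def ncoeff_sum
    by (rule sum.mono_neutral_left)
       (use that N in \<open>auto simp: not_le intro!: ncoeff_power_below[OF g]\<close>)
  have lf: "\<forall>C. finite {r. r \<le> C \<and> f r \<noteq> 0}"
  proof
    fix C
    have "f r = ncoeff (p (N C)) r" if "r \<le> C" for r
      by (rule f[OF Nmono[OF that]])
    then have "{r. r \<le> C \<and> f r \<noteq> 0} = {r. r \<le> C \<and> ncoeff (p (N C)) r \<noteq> 0}"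
      by (auto simp: conj_commute cong: conj_cong)
    then show "finite {r. r \<le> C \<and> f r \<noteq> 0}" using ncoeff_finite by simp
  qed
  define h where "h = Abs_novikov f"
  have h: "ncoeff h = f" unfolding h_def using lf by (simp add: Abs_novikov_inverse)
  have geo: "(1 - g) * p n = 1 - g ^ Suc n" for n
  proof (induction n)
    case (Suc n)
    have "p (Suc n) = p n + g ^ Suc n" by (simp add: p_def)
    then have "(1 - g) * p (Suc n) = (1 - g) * p n + (1 - g) * g ^ Suc n"
      by (simp only: distrib_left)
    then show ?case unfolding Suc by (simp add: algebra_simps)
  qed (simp add: p_def)
  have "(1 - g) * h = 1"
  proof (rule novikov_eqI)
    fix r
    have pos: "0 \<le> s" if "ncoeff (1 - g) s \<noteq> 0" for s
      using that g[of s] e by (auto simp: ncoeff_one not_le split: if_splits)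
        (meson less_le_trans not_le order_less_trans)
    have eq: "ncoeff h (r - s) = ncoeff (p (N r)) (r - s)" if "ncoeff (1 - g) s \<noteq> 0" for s
      using f Nmono pos[OF that] by (simp add: h)
    have "ncoeff ((1 - g) * h) r = ncoeff ((1 - g) * p (N r)) r"
      unfolding ncoeff_mult novikov_conv_def by (rule sum.cong) (use eq in \<open>auto simp del: ncoeff_diff\<close>)
    also have "\<dots> = ncoeff (1 - g ^ Suc (N r)) r" by (simp only: geo)
    also have "\<dots> = ncoeff 1 r"
      using ncoeff_power_below[OF g N[of r "Suc (N r)"]] by simp
    finally show "ncoeff ((1 - g) * h) r = ncoeff 1 r" .
  qed
  then show ?thesis by blast
qed

lemma novikov_inverse_exists:
  assumes "(x::novikov) \<noteq> 0"
  shows "\<exists>y. x * y = 1"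
proof -
  obtain r0 where r0: "ncoeff x r0 \<noteq> 0" using assms novikov_eqI[of x 0] by auto
  define A where "A = {r. r \<le> r0 \<and> ncoeff x r \<noteq> 0}"
  have A: "finite A" "A \<noteq> {}" unfolding A_def using ncoeff_finite r0 by auto
  define m where "m = Min A"
  have mA: "m \<in> A" unfolding m_def using A by (rule Min_in)
  have below: "ncoeff x r = 0" if "r < m" for r
  proof (rule ccontr)
    assume "ncoeff x r \<noteq> 0"
    then have "r \<in> A" using that mA unfolding A_def by auto
    then show False using that Min_le[OF A(1)] unfolding m_def by (metis not_le)
  qed
  define t where "t = Abs_novikov (\<lambda>r. if r = - m then 1 / ncoeff x m else 0)"
  have t: "ncoeff t = (\<lambda>r. if r = - m then 1 / ncoeff x m else 0)"
    unfolding t_def by (rule Abs_novikov_inverse) (auto intro: finite_subset[of _ "{-m}"])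
  have tx: "ncoeff (t * x) r = ncoeff x (r + m) / ncoeff x m" for r
  proof -
    have "ncoeff (t * x) r = (\<Sum>s\<in>{-m}. ncoeff t s * ncoeff x (r - s))"
      unfolding ncoeff_mult by (rule novikov_conv_superset) (auto simp: t split: if_splits)
    then show ?thesis by (simp add: t)
  qed
  define g where "g = 1 - t * x"
  have g0: "ncoeff g r = 0" if "r \<le> 0" for r
  proof (cases "r = 0")
    case True
    then show ?thesis using mA by (simp add: g_def tx ncoeff_one A_def)
  next
    case False
    then show ?thesis using that below[of "r + m"] by (simp add: g_def tx ncoeff_one)
  qed
  define B where "B = insert 1 {r. r \<le> 1 \<and> ncoeff g r \<noteq> 0}"
  have B: "finite B" "B \<noteq> {}" unfolding B_def using ncoeff_finite by auto
  have "\<forall>r\<in>B. 0 < r" using g0 unfolding B_def by (auto simp: not_le[symmetric])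
  then have e: "Min B > 0" using B by simp
  have ge: "ncoeff g r = 0" if "r < Min B" for r
  proof (rule ccontr)
    assume "ncoeff g r \<noteq> 0"
    moreover have "Min B \<le> 1" using B(1) by (intro Min_le) (auto simp: B_def)
    ultimately have "r \<in> B" using that unfolding B_def by auto
    then show False using that Min_le[OF B(1)] by (metis not_le)
  qed
  obtain h where "(1 - g) * h = 1" using novikov_inverse_unit[OF e ge] by blast
  then have "x * (t * h) = 1" by (simp add: g_def mult_ac)
  then show ?thesis by blast
qed

instantiation novikov :: field
begin

definition inverse_novikov :: "novikov \<Rightarrow> novikov" where
  "inverse_novikov x = (if x = 0 then 0 else (SOME y. x * y = 1))"
definition divide_novikov :: "novikov \<Rightarrow> novikov \<Rightarrow> novikov" where
  "divide_novikov x y = x * inverse y"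

instance
proof
  fix a b :: novikov
  show "inverse a * a = 1" if "a \<noteq> 0"
    using someI_ex[OF novikov_inverse_exists[OF that]] that
    by (simp add: inverse_novikov_def mult.commute)
qed (auto simp: divide_novikov_def inverse_novikov_def)

end

definition nval :: "novikov \<Rightarrow> ereal" where
  "nval x = (INF r\<in>{r. ncoeff x r \<noteq> 0}. ereal r)"

definition \<Lambda>0 :: "novikov set" where
  "\<Lambda>0 = {x. 0 \<le> nval x}"

definition \<Lambda>plus :: "novikov set" where
  "\<Lambda>plus = {x. 0 < nval x}"

text \<open>The Novikov topology: the sets \<open>{y. E \<le> nval (y - x)}\<close> form a neighbourhood base at \<open>x\<close>.\<close>

instantiation novikov :: t2_space
begin

definition open_novikov :: "novikov set \<Rightarrow> bool" where
  "open_novikov S \<longleftrightarrow> (\<forall>x\<in>S. \<exists>E::real. \<forall>y. ereal E \<le> nval (y - x) \<longrightarrow> y \<in> S)"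

instance
proof
  have le: "ereal E \<le> nval x \<longleftrightarrow> (\<forall>r<E. ncoeff x r = 0)" for E x
    unfolding nval_def le_INF_iff by (auto simp: not_less[symmetric])
  show "open (UNIV :: novikov set)" by (simp add: open_novikov_def)
  show "open (S \<inter> T)" if S: "open S" and T: "open T" for S T :: "novikov set"
    unfolding open_novikov_def
  proof
    fix x assume x: "x \<in> S \<inter> T"
    obtain E where E: "\<And>y. ereal E \<le> nval (y - x) \<Longrightarrow> y \<in> S" using S x unfolding open_novikov_def by blast
    obtain F where F: "\<And>y. ereal F \<le> nval (y - x) \<Longrightarrow> y \<in> T" using T x unfolding open_novikov_def by blast
    have "\<forall>y. ereal (max E F) \<le> nval (y - x) \<longrightarrow> y \<in> S \<inter> T"
      using E F by (metis IntI dual_order.trans ereal_less_eq(3) max.cobounded1 max.cobounded2)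
    then show "\<exists>E. \<forall>y. ereal E \<le> nval (y - x) \<longrightarrow> y \<in> S \<inter> T" by blast
  qed
  show "open (\<Union>K)" if "\<forall>S\<in>K. open S" for K :: "novikov set set"
    using that unfolding open_novikov_def by (meson UnionE UnionI)
  show "\<exists>U V. open U \<and> open V \<and> x \<in> U \<and> y \<in> V \<and> U \<inter> V = {}" if xy: "x \<noteq> y" for x y :: novikov
  proof -
    obtain r where r: "ncoeff x r \<noteq> ncoeff y r" using xy novikov_eqI by blast
    have op: "open {z. ncoeff z r = c}" for c
      unfolding open_novikov_def by (auto simp: le intro!: exI[of _ "r + 1"])
    show ?thesis
      by (rule exI[of _ "{z. ncoeff z r = ncoeff x r}"], rule exI[of _ "{z. ncoeff z r = ncoeff y r}"])
         (use op r in auto)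
  qed
qed

end

class novikov_module = ab_group_add +
  fixes nscale :: "novikov \<Rightarrow> 'a \<Rightarrow> 'a" (infixr "\<odot>" 75)
  assumes nscale_add_right: "c \<odot> (x + y) = c \<odot> x + c \<odot> y"
    and nscale_add_left: "(c + d) \<odot> x = c \<odot> x + d \<odot> x"
    and nscale_nscale: "c \<odot> (d \<odot> x) = (c * d) \<odot> x"
    and nscale_one: "1 \<odot> x = x"

instantiation novikov :: novikov_module
begin
definition nscale_novikov :: "novikov \<Rightarrow> novikov \<Rightarrow> novikov" where "nscale_novikov = (*)"
instance by standard (auto simp: nscale_novikov_def algebra_simps)
end

instantiation "fun" :: (type, novikov_module) novikov_module
begin
definition nscale_fun :: "novikov \<Rightarrow> ('a \<Rightarrow> 'b) \<Rightarrow> 'a \<Rightarrow> 'b" where "nscale_fun c f = (\<lambda>x. c \<odot> f x)"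
instance by standard
    (auto simp: nscale_fun_def fun_eq_iff nscale_add_right nscale_add_left nscale_nscale nscale_one)
end

instantiation prod :: (novikov_module, novikov_module) novikov_module
begin
definition nscale_prod :: "novikov \<Rightarrow> 'a \<times> 'b \<Rightarrow> 'a \<times> 'b" where
  "nscale_prod c p = (c \<odot> fst p, c \<odot> snd p)"
instance by standard
    (auto simp: nscale_prod_def prod_eq_iff nscale_add_right nscale_add_left nscale_nscale nscale_one)
end


section \<open>Signs and strings of morphisms\<close>

definition psgn :: "bit \<Rightarrow> 'a::ab_group_add \<Rightarrow> 'a" where
  "psgn d x = (if d = 0 then x else - x)"

text \<open>A string \<open>L\<^sub>0 \<rightarrow> L\<^sub>1 \<rightarrow> \<dots> \<rightarrow> L\<^sub>k\<close> of morphisms \<open>a\<^sub>1, \<dots>, a\<^sub>k\<close> is given by \<open>L\<^sub>0\<close> together with the list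
  \<open>[(a\<^sub>1, L\<^sub>1), \<dots>, (a\<^sub>k, L\<^sub>k)]\<close>, so that substrings are sublists. \<open>Hom A L L' d\<close> is the component
  of degree \<open>d\<close> of the \<open>\<int>/2\<close>-graded space of morphisms, and \<open>mu A L as\<close> is \<open>m\<^sub>k(a\<^sub>1, \<dots>, a\<^sub>k)\<close>
  (with \<open>m\<^sub>0\<close> of the object \<open>L\<close> for \<open>as = []\<close>).\<close>

record ('o, 'm) ainf_category =
  Ob :: "'o set"
  Hom :: "'o \<Rightarrow> 'o \<Rightarrow> bit \<Rightarrow> 'm set"
  mu :: "'o \<Rightarrow> ('m \<times> 'o) list \<Rightarrow> 'm"
  unit_of :: "'o \<Rightarrow> 'm"

fun tgt :: "'o \<Rightarrow> ('m \<times> 'o) list \<Rightarrow> 'o" where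
  "tgt L [] = L"
| "tgt L ((a, L') # as) = tgt L' as"

text \<open>The degree of a homogeneous morphism. It is only used in signs, where the value chosen
  for the zero morphism does not matter.\<close>

definition deg :: "('o, 'm) ainf_category \<Rightarrow> 'o \<Rightarrow> 'o \<Rightarrow> 'm \<Rightarrow> bit" where
  "deg A L L' a = (if a \<in> Hom A L L' 0 then 0 else 1)"

text \<open>Strings of homogeneous morphisms, and the shifted degree \<open>\<Sum>\<^sub>i (|a\<^sub>i| - 1)\<close> of such a string.\<close>

fun hpath :: "('o, 'm) ainf_category \<Rightarrow> 'o \<Rightarrow> ('m \<times> 'o) list \<Rightarrow> bool" where
  "hpath A L [] \<longleftrightarrow> L \<in> Ob A"
| "hpath A L ((a, L') # as) \<longleftrightarrow> L \<in> Ob A \<and> (\<exists>d. a \<in> Hom A L L' d) \<and> hpath A L' as"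

fun sdeg :: "('o, 'm) ainf_category \<Rightarrow> 'o \<Rightarrow> ('m \<times> 'o) list \<Rightarrow> bit" where
  "sdeg A L [] = 0"
| "sdeg A L ((a, L') # as) = (deg A L L' a - 1) + sdeg A L' as"

definition Hom_total :: "('o, 'm::ab_group_add) ainf_category \<Rightarrow> 'o \<Rightarrow> 'o \<Rightarrow> 'm set" where
  "Hom_total A L L' = {x + y | x y. x \<in> Hom A L L' 0 \<and> y \<in> Hom A L L' 1}"

fun tpath :: "('o, 'm::ab_group_add) ainf_category \<Rightarrow> 'o \<Rightarrow> ('m \<times> 'o) list \<Rightarrow> bool" where
  "tpath A L [] \<longleftrightarrow> L \<in> Ob A"
| "tpath A L ((a, L') # as) \<longleftrightarrow> L \<in> Ob A \<and> a \<in> Hom_total A L L' \<and> tpath A L' as"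

definition multilinear_on ::
  "('o \<Rightarrow> ('m \<times> 'o) list \<Rightarrow> bool) \<Rightarrow> ('o \<Rightarrow> ('m::novikov_module \<times> 'o) list \<Rightarrow> 'n::novikov_module) \<Rightarrow> bool"
where
  "multilinear_on P f \<longleftrightarrow> (\<forall>L u L' v x y c.
     P L (u @ (x, L') # v) \<and> P L (u @ (y, L') # v) \<and> P L (u @ (c \<odot> x + y, L') # v) \<longrightarrow>
     f L (u @ (c \<odot> x + y, L') # v) = c \<odot> f L (u @ (x, L') # v) + f L (u @ (y, L') # v))"

definition splits3 :: "'a list \<Rightarrow> ('a list \<times> 'a list \<times> 'a list) set" where
  "splits3 as = {(u, v, w). u @ v @ w = as}"

text \<open>The string obtained from \<open>u @ v @ w\<close> by replacing \<open>v\<close> with \<open>m(v)\<close>.\<close>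

definition contract ::
  "('o, 'm) ainf_category \<Rightarrow> 'o \<Rightarrow> ('m \<times> 'o) list \<Rightarrow> ('m \<times> 'o) list \<Rightarrow> ('m \<times> 'o) list \<Rightarrow> ('m \<times> 'o) list"
where
  "contract A L u v w = u @ (mu A (tgt L u) v, tgt L (u @ v)) # w"


section \<open>Filtered unital \<open>A\<^sub>\<infinity>\<close>-categories over the Novikov field\<close>

text \<open>\<open>Hom(L, L')\<close> is the space of \<open>\<Lambda>\<close>-valued functions on a finite set \<open>gen L L' 0 \<union> gen L L' 1\<close> of
  generators (for instance intersection points) graded by parity.\<close>

definition hvec :: "'p set \<Rightarrow> ('p \<Rightarrow> novikov) set" where
  "hvec S = {x. \<forall>p. x p \<noteq> 0 \<longrightarrow> p \<in> S}"

definition vval :: "('p \<Rightarrow> novikov) \<Rightarrow> ereal" where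
  "vval x = (INF p. nval (x p))"

definition filtered_unital_ainf ::
  "('o, 'p \<Rightarrow> novikov) ainf_category \<Rightarrow> ('o \<Rightarrow> 'o \<Rightarrow> bit \<Rightarrow> 'p set) \<Rightarrow> bool"
where
  "filtered_unital_ainf A gen \<longleftrightarrow>
     (\<forall>L\<in>Ob A. \<forall>L'\<in>Ob A. finite (gen L L' 0) \<and> finite (gen L L' 1) \<and> gen L L' 0 \<inter> gen L L' 1 = {} \<and>
        (\<forall>d. Hom A L L' d = hvec (gen L L' d))) \<and>
     (\<forall>L as. hpath A L as \<longrightarrow> mu A L as \<in> Hom A L (tgt L as) (sdeg A L as)) \<and>
     multilinear_on (tpath A) (mu A) \<and>
     (\<forall>L as. tpath A L as \<longrightarrow> (\<Sum>(a, L')\<leftarrow>as. vval a) \<le> vval (mu A L as)) \<and>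
     (\<forall>L as. hpath A L as \<longrightarrow>
        (\<Sum>(u, v, w)\<in>splits3 as. psgn (sdeg A L u) (mu A L (contract A L u v w))) = 0) \<and>
     (\<forall>L\<in>Ob A. unit_of A L \<in> Hom A L L 0) \<and>
     (\<forall>L\<in>Ob A. \<forall>L'\<in>Ob A. \<forall>d. \<forall>x\<in>Hom A L L' d.
        mu A L [(unit_of A L, L), (x, L')] = x \<and>
        psgn d (mu A L [(x, L'), (unit_of A L', L')]) = x) \<and>
     (\<forall>L u v. tpath A L (u @ (unit_of A (tgt L u), tgt L u) # v) \<and> length u + length v \<noteq> 1 \<longrightarrow>
        mu A L (u @ (unit_of A (tgt L u), tgt L u) # v) = 0)"

text \<open>The mirror functors of a reference object are defined on the objects with vanishing curvature:
  \<open>m\<^sub>1\<close> with respect to \<open>(0, b)\<close> squares to \<open>W\<close> on \<open>Hom(L, \<L>)\<close> only if \<open>m\<^sub>0\<close> of \<open>L\<close> vanishes. The reference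
  object itself may be curved.\<close>

definition uncurved :: "('o, 'm::zero) ainf_category \<Rightarrow> ('o, 'm) ainf_category" where
  "uncurved A = A\<lparr>Ob := {L \<in> Ob A. mu A L [] = 0}\<rparr>"


section \<open>\<open>A\<^sub>\<infinity>\<close>-functors and natural transformations\<close>

record ('o, 'm, 'q, 'n) ainf_functor =
  fob :: "'o \<Rightarrow> 'q"
  fmor :: "'o \<Rightarrow> ('m \<times> 'o) list \<Rightarrow> 'n"

definition blocks :: "'a list \<Rightarrow> 'a list list set" where
  "blocks as = {us. concat us = as \<and> [] \<notin> set us}"

fun fpath :: "('o, 'm, 'q, 'n) ainf_functor \<Rightarrow> 'o \<Rightarrow> ('m \<times> 'o) list list \<Rightarrow> ('n \<times> 'q) list" where
  "fpath F L [] = []"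
| "fpath F L (u # us) = (fmor F L u, fob F (tgt L u)) # fpath F (tgt L u) us"

definition is_ainf_functor ::
  "('o, 'm::novikov_module) ainf_category \<Rightarrow> ('q, 'n::novikov_module) ainf_category \<Rightarrow>
   ('o, 'm, 'q, 'n) ainf_functor \<Rightarrow> bool"
where
  "is_ainf_functor A B F \<longleftrightarrow>
     (\<forall>L\<in>Ob A. fob F L \<in> Ob B) \<and>
     (\<forall>L as. hpath A L as \<and> as \<noteq> [] \<longrightarrow>
        fmor F L as \<in> Hom B (fob F L) (fob F (tgt L as)) (sdeg A L as + 1)) \<and>
     multilinear_on (hpath A) (fmor F) \<and>
     (\<forall>L as. hpath A L as \<longrightarrow>
        (\<Sum>us\<in>blocks as. mu B (fob F L) (fpath F L us)) =
        (\<Sum>(u, v, w)\<in>splits3 as. psgn (sdeg A L u) (fmor F L (contract A L u v w))))"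

text \<open>Pre-natural transformations \<open>F \<rightarrow> G\<close> of degree \<open>n\<close>, i.e. of shifted degree \<open>n - 1\<close>. The component
  at \<open>L\<close> is \<open>T L []\<close>.\<close>

definition prenat ::
  "('o, 'm::novikov_module) ainf_category \<Rightarrow> ('q, 'n::novikov_module) ainf_category \<Rightarrow>
   ('o, 'm, 'q, 'n) ainf_functor \<Rightarrow> ('o, 'm, 'q, 'n) ainf_functor \<Rightarrow> bit \<Rightarrow>
   ('o \<Rightarrow> ('m \<times> 'o) list \<Rightarrow> 'n) \<Rightarrow> bool"
where
  "prenat A B F G n T \<longleftrightarrow>
     (\<forall>L as. hpath A L as \<longrightarrow> T L as \<in> Hom B (fob F L) (fob G (tgt L as)) (n + sdeg A L as)) \<and>
     multilinear_on (hpath A) T"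

text \<open>\<open>M\<^sub>1(T) = \<Sum> \<plusminus> m(F, \<dots>, F, T, G, \<dots>, G) - (-1)\<^bsup>n-1\<^esup> \<Sum> \<plusminus> T(\<dots>, m(\<dots>), \<dots>)\<close>, with Koszul signs from
  moving \<open>T\<close> (of shifted degree \<open>n - 1\<close>) and \<open>m\<close> (of shifted degree 1) past the inputs on their left.\<close>

definition nat_M1 ::
  "('o, 'm) ainf_category \<Rightarrow> ('q, 'n::ab_group_add) ainf_category \<Rightarrow>
   ('o, 'm, 'q, 'n) ainf_functor \<Rightarrow> ('o, 'm, 'q, 'n) ainf_functor \<Rightarrow> bit \<Rightarrow>
   ('o \<Rightarrow> ('m \<times> 'o) list \<Rightarrow> 'n) \<Rightarrow> 'o \<Rightarrow> ('m \<times> 'o) list \<Rightarrow> 'n"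
where
  "nat_M1 A B F G n T L as =
     (\<Sum>(us, v, ws)\<in>{(us, v, ws). concat us @ v @ concat ws = as \<and> [] \<notin> set us \<union> set ws}.
        let L1 = tgt L (concat us); L2 = tgt L1 v in
        psgn ((n - 1) * sdeg A L (concat us))
          (mu B (fob F L) (fpath F L us @ (T L1 v, fob G L2) # fpath G L2 ws)))
     - psgn (n - 1)
       (\<Sum>(u, v, w)\<in>splits3 as. psgn (sdeg A L u) (T L (contract A L u v w)))"

text \<open>The composition \<open>M\<^sub>2(T, T')\<close> of \<open>T : F \<rightarrow> G\<close> of degree \<open>n\<close> and \<open>T' : G \<rightarrow> K\<close> of degree \<open>n'\<close>.\<close>

definition nat_M2 ::
  "('o, 'm) ainf_category \<Rightarrow> ('q, 'n::ab_group_add) ainf_category \<Rightarrow>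
   ('o, 'm, 'q, 'n) ainf_functor \<Rightarrow> ('o, 'm, 'q, 'n) ainf_functor \<Rightarrow> ('o, 'm, 'q, 'n) ainf_functor \<Rightarrow>
   bit \<Rightarrow> bit \<Rightarrow> ('o \<Rightarrow> ('m \<times> 'o) list \<Rightarrow> 'n) \<Rightarrow> ('o \<Rightarrow> ('m \<times> 'o) list \<Rightarrow> 'n) \<Rightarrow>
   'o \<Rightarrow> ('m \<times> 'o) list \<Rightarrow> 'n"
where
  "nat_M2 A B F G K n n' T T' L as =
     (\<Sum>(us, v, ws, v', xs)\<in>{(us, v, ws, v', xs).
          concat us @ v @ concat ws @ v' @ concat xs = as \<and> [] \<notin> set us \<union> set ws \<union> set xs}.
        let L1 = tgt L (concat us); L2 = tgt L1 v; L3 = tgt L2 (concat ws); L4 = tgt L3 v' in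
        psgn ((n - 1) * sdeg A L (concat us) + (n' - 1) * sdeg A L (concat us @ v @ concat ws))
          (mu B (fob F L)
            (fpath F L us @ (T L1 v, fob G L2) # fpath G L2 ws @ (T' L3 v', fob K L4) # fpath K L4 xs)))"

definition nat_id ::
  "('q, 'n::zero) ainf_category \<Rightarrow> ('o, 'm, 'q, 'n) ainf_functor \<Rightarrow> 'o \<Rightarrow> ('m \<times> 'o) list \<Rightarrow> 'n"
where
  "nat_id B F L as = (if as = [] then unit_of B (fob F L) else 0)"

definition nat_transformation ::
  "('o, 'm::novikov_module) ainf_category \<Rightarrow> ('q, 'n::novikov_module) ainf_category \<Rightarrow>
   ('o, 'm, 'q, 'n) ainf_functor \<Rightarrow> ('o, 'm, 'q, 'n) ainf_functor \<Rightarrow>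
   ('o \<Rightarrow> ('m \<times> 'o) list \<Rightarrow> 'n) \<Rightarrow> bool"
where
  "nat_transformation A B F G T \<longleftrightarrow>
     prenat A B F G 0 T \<and> (\<forall>L as. hpath A L as \<longrightarrow> nat_M1 A B F G 0 T L as = 0)"

definition quasi_iso_via ::
  "('o, 'm::novikov_module) ainf_category \<Rightarrow> ('q, 'n::novikov_module) ainf_category \<Rightarrow>
   ('o, 'm, 'q, 'n) ainf_functor \<Rightarrow> ('o, 'm, 'q, 'n) ainf_functor \<Rightarrow>
   ('o \<Rightarrow> ('m \<times> 'o) list \<Rightarrow> 'n) \<Rightarrow> ('o \<Rightarrow> ('m \<times> 'o) list \<Rightarrow> 'n) \<Rightarrow>
   ('o \<Rightarrow> ('m \<times> 'o) list \<Rightarrow> 'n) \<Rightarrow> ('o \<Rightarrow> ('m \<times> 'o) list \<Rightarrow> 'n) \<Rightarrow> bool"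
where
  "quasi_iso_via A B F1 F2 N12 N21 H1 H2 \<longleftrightarrow>
     is_ainf_functor A B F1 \<and> is_ainf_functor A B F2 \<and>
     nat_transformation A B F1 F2 N12 \<and> nat_transformation A B F2 F1 N21 \<and>
     prenat A B F1 F1 1 H1 \<and> prenat A B F2 F2 1 H2 \<and>
     (\<forall>L as. hpath A L as \<longrightarrow>
        nat_M2 A B F1 F2 F1 0 0 N12 N21 L as - nat_id B F1 L as = nat_M1 A B F1 F1 1 H1 L as) \<and>
     (\<forall>L as. hpath A L as \<longrightarrow>
        nat_M2 A B F2 F1 F2 0 0 N21 N12 L as - nat_id B F2 L as = nat_M1 A B F2 F2 1 H2 L as)"

definition quasi_isomorphic ::
  "('o, 'm::novikov_module) ainf_category \<Rightarrow> ('q, 'n::novikov_module) ainf_category \<Rightarrow>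
   ('o, 'm, 'q, 'n) ainf_functor \<Rightarrow> ('o, 'm, 'q, 'n) ainf_functor \<Rightarrow> bool"
where
  "quasi_isomorphic A B F1 F2 \<longleftrightarrow> (\<exists>N12 N21 H1 H2. quasi_iso_via A B F1 F2 N12 N21 H1 H2)"


section \<open>dg-categories and the homotopy fiber product\<close>

text \<open>\<open>dcomp D X Y Z g f\<close> is the composition of \<open>f : X \<rightarrow> Y\<close> and \<open>g : Y \<rightarrow> Z\<close>.\<close>

record ('q, 'n) dg_category =
  dob :: "'q set"
  dhom :: "'q \<Rightarrow> 'q \<Rightarrow> bit \<Rightarrow> 'n set"
  ddiff :: "'q \<Rightarrow> 'q \<Rightarrow> 'n \<Rightarrow> 'n"
  dcomp :: "'q \<Rightarrow> 'q \<Rightarrow> 'q \<Rightarrow> 'n \<Rightarrow> 'n \<Rightarrow> 'n"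
  did :: "'q \<Rightarrow> 'n"

definition ainf_of_dg :: "('q, 'n::ab_group_add) dg_category \<Rightarrow> ('q, 'n) ainf_category" where
  "ainf_of_dg D = \<lparr>
     Ob = dob D,
     Hom = (\<lambda>E F. dhom D F E),
     mu = (\<lambda>E0 as. case as of
         [(f, E1)] \<Rightarrow> ddiff D E1 E0 f
       | [(f, E1), (g, E2)] \<Rightarrow> psgn (if f \<in> dhom D E1 E0 0 then 0 else 1) (dcomp D E2 E1 E0 f g)
       | _ \<Rightarrow> 0),
     unit_of = did D\<rparr>"

record ('q, 'n, 'r, 'l) dg_functor =
  gob :: "'q \<Rightarrow> 'r"
  gmor :: "'q \<Rightarrow> 'q \<Rightarrow> 'n \<Rightarrow> 'l"

text \<open>Composition of an \<open>A\<^sub>\<infinity>\<close>-functor into a dg-category with a dg-functor.\<close>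

definition comp_dg ::
  "('q, 'n, 'r, 'l) dg_functor \<Rightarrow> ('o, 'm, 'q, 'n) ainf_functor \<Rightarrow> ('o, 'm, 'r, 'l) ainf_functor"
where
  "comp_dg r F = \<lparr>
     fob = (\<lambda>L. gob r (fob F L)),
     fmor = (\<lambda>L as. gmor r (fob F (tgt L as)) (fob F L) (fmor F L as))\<rparr>"

definition invertible_H0 :: "('q, 'n::ab_group_add) dg_category \<Rightarrow> 'q \<Rightarrow> 'q \<Rightarrow> 'n \<Rightarrow> bool" where
  "invertible_H0 D X Y f \<longleftrightarrow>
     f \<in> dhom D X Y 0 \<and> ddiff D X Y f = 0 \<and>
     (\<exists>g\<in>dhom D Y X 0. ddiff D Y X g = 0 \<and>
        (\<exists>h\<in>dhom D X X 1. dcomp D X Y X g f - did D X = ddiff D X X h) \<and>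
        (\<exists>k\<in>dhom D Y Y 1. dcomp D Y X Y f g - did D Y = ddiff D Y Y k))"

definition hfp_hom ::
  "('b, 'mb) dg_category \<Rightarrow> ('c, 'mc) dg_category \<Rightarrow> ('d, 'md) dg_category \<Rightarrow>
   ('b, 'mb, 'd, 'md) dg_functor \<Rightarrow> ('c, 'mc, 'd, 'md) dg_functor \<Rightarrow>
   'b \<times> 'c \<times> 'md \<Rightarrow> 'b \<times> 'c \<times> 'md \<Rightarrow> bit \<Rightarrow> ('mb \<times> 'mc \<times> 'md) set"
where
  "hfp_hom B C D G L = (\<lambda>(M1, N1, \<phi>1) (M2, N2, \<phi>2) i.
     dhom B M1 M2 i \<times> dhom C N1 N2 i \<times> dhom D (gob G M1) (gob L N2) (i - 1))"

definition hfp ::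
  "('b, 'mb) dg_category \<Rightarrow> ('c, 'mc) dg_category \<Rightarrow> ('d, 'md::ab_group_add) dg_category \<Rightarrow>
   ('b, 'mb, 'd, 'md) dg_functor \<Rightarrow> ('c, 'mc, 'd, 'md) dg_functor \<Rightarrow>
   ('b \<times> 'c \<times> 'md, 'mb \<times> 'mc \<times> 'md) dg_category"
where
  "hfp B C D G L = \<lparr>
     dob = {(M, N, \<phi>). M \<in> dob B \<and> N \<in> dob C \<and> invertible_H0 D (gob G M) (gob L N) \<phi>},
     dhom = hfp_hom B C D G L,
     ddiff = (\<lambda>(M1, N1, \<phi>1) (M2, N2, \<phi>2) (\<mu>, \<nu>, \<gamma>).
       (ddiff B M1 M2 \<mu>, ddiff C N1 N2 \<nu>,
        - ddiff D (gob G M1) (gob L N2) \<gamma>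
        - dcomp D (gob G M1) (gob G M2) (gob L N2) \<phi>2 (gmor G M1 M2 \<mu>)
        + dcomp D (gob G M1) (gob L N1) (gob L N2) (gmor L N1 N2 \<nu>) \<phi>1)),
     dcomp = (\<lambda>(M1, N1, \<phi>1) (M2, N2, \<phi>2) (M3, N3, \<phi>3) (\<mu>', \<nu>', \<gamma>') (\<mu>, \<nu>, \<gamma>).
       (dcomp B M1 M2 M3 \<mu>' \<mu>, dcomp C N1 N2 N3 \<nu>' \<nu>,
        dcomp D (gob G M1) (gob G M2) (gob L N3) \<gamma>' (gmor G M1 M2 \<mu>)
        + psgn (if (\<mu>', \<nu>', \<gamma>') \<in> hfp_hom B C D G L (M2, N2, \<phi>2) (M3, N3, \<phi>3) 0 then 0 else 1)
            (dcomp D (gob G M1) (gob L N2) (gob L N3) (gmor L N2 N3 \<nu>') \<gamma>))),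
     did = (\<lambda>(M, N, \<phi>). (did B M, did C N, 0))\<rparr>"


section \<open>Matrix factorizations over rings of functions\<close>

text \<open>A ring of \<open>\<Lambda>\<close>-valued functions on a domain \<open>U\<close> (all functions, continuous functions, convergent
  power series, \<open>\<dots>\<close>). Functions on \<open>U\<close> are extended by zero, so that they agree iff they agree on \<open>U\<close>;
  in particular the unit of the ring is the indicator function of \<open>U\<close>.\<close>

definition function_ring :: "'u set \<Rightarrow> ('u \<Rightarrow> novikov) set \<Rightarrow> bool" where
  "function_ring U R \<longleftrightarrow>
     (\<forall>f\<in>R. \<forall>u. u \<notin> U \<longrightarrow> f u = 0) \<and>
     (\<forall>c. (\<lambda>u. if u \<in> U then c else 0) \<in> R) \<and>
     (\<forall>f\<in>R. \<forall>g\<in>R. f + g \<in> R \<and> f * g \<in> R)"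

definition free_module :: "('u \<Rightarrow> novikov) set \<Rightarrow> 'p set \<Rightarrow> ('p \<Rightarrow> 'u \<Rightarrow> novikov) set" where
  "free_module R S = {y. (\<forall>p. y p \<in> R) \<and> (\<forall>p. p \<notin> S \<longrightarrow> y p = 0)}"

abbreviation both :: "(bit \<Rightarrow> 'p set) \<Rightarrow> 'p set" where
  "both S \<equiv> S 0 \<union> S 1"

text \<open>\<open>R\<close>-linear maps of degree \<open>d\<close> between the free modules on the \<open>\<int>/2\<close>-graded bases \<open>S\<close>, \<open>S'\<close>,
  extended by zero outside of the source module.\<close>

definition module_maps ::
  "('u \<Rightarrow> novikov) set \<Rightarrow> (bit \<Rightarrow> 'p set) \<Rightarrow> (bit \<Rightarrow> 'p set) \<Rightarrow> bit \<Rightarrow>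
   (('p \<Rightarrow> 'u \<Rightarrow> novikov) \<Rightarrow> 'p \<Rightarrow> 'u \<Rightarrow> novikov) set"
where
  "module_maps R S S' d = {f.
     (\<forall>y\<in>free_module R (both S). f y \<in> free_module R (both S')) \<and>
     (\<forall>y\<in>free_module R (both S). \<forall>z\<in>free_module R (both S). f (y + z) = f y + f z) \<and>
     (\<forall>r\<in>R. \<forall>y\<in>free_module R (both S). f (\<lambda>p. r * y p) = (\<lambda>p. r * f y p)) \<and>
     (\<forall>e. \<forall>y\<in>free_module R (S e). f y \<in> free_module R (S' (e + d))) \<and>
     (\<forall>y. y \<notin> free_module R (both S) \<longrightarrow> f y = 0)}"

record ('p, 'u) matrix_factorization =
  gens :: "bit \<Rightarrow> 'p set"
  delta :: "('p \<Rightarrow> 'u \<Rightarrow> novikov) \<Rightarrow> 'p \<Rightarrow> 'u \<Rightarrow> novikov"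

definition MF ::
  "('u \<Rightarrow> novikov) set \<Rightarrow> ('u \<Rightarrow> novikov) \<Rightarrow>
   (('p, 'u) matrix_factorization, ('p \<Rightarrow> 'u \<Rightarrow> novikov) \<Rightarrow> 'p \<Rightarrow> 'u \<Rightarrow> novikov) dg_category"
where
  "MF R W = \<lparr>
     dob = {E. finite (both (gens E)) \<and> gens E 0 \<inter> gens E 1 = {} \<and>
       delta E \<in> module_maps R (gens E) (gens E) 1 \<and>
       (\<forall>y\<in>free_module R (both (gens E)). delta E (delta E y) = (\<lambda>p. W * y p))},
     dhom = (\<lambda>E F. module_maps R (gens E) (gens F)),
     ddiff = (\<lambda>E F f y. delta F (f y)
       - psgn (if f \<in> module_maps R (gens E) (gens F) 0 then 0 else 1) (f (delta E y))),
     dcomp = (\<lambda>E F K g f y. g (f y)),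
     did = (\<lambda>E y. if y \<in> free_module R (both (gens E)) then y else 0)\<rparr>"

text \<open>Restriction of functions along \<open>j : V \<rightarrow> U\<close>, and the induced base change of free modules and
  module maps to a ring \<open>R'\<close> of functions on \<open>V\<close>: the map \<open>f\<close> is applied to the basis of the
  module over \<open>U\<close>, and the result is restricted to \<open>V\<close>.\<close>

definition pullback :: "'v set \<Rightarrow> ('v \<Rightarrow> 'u) \<Rightarrow> ('u \<Rightarrow> novikov) \<Rightarrow> 'v \<Rightarrow> novikov" where
  "pullback V j f = (\<lambda>v. if v \<in> V then f (j v) else 0)"

definition basis_elt :: "'u set \<Rightarrow> 'p \<Rightarrow> 'p \<Rightarrow> 'u \<Rightarrow> novikov" where
  "basis_elt U s = (\<lambda>p u. if p = s \<and> u \<in> U then 1 else 0)"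

definition base_change ::
  "'u set \<Rightarrow> 'v set \<Rightarrow> ('v \<Rightarrow> 'u) \<Rightarrow> ('v \<Rightarrow> novikov) set \<Rightarrow> 'p set \<Rightarrow>
   (('p \<Rightarrow> 'u \<Rightarrow> novikov) \<Rightarrow> 'p \<Rightarrow> 'u \<Rightarrow> novikov) \<Rightarrow> ('p \<Rightarrow> 'v \<Rightarrow> novikov) \<Rightarrow> 'p \<Rightarrow> 'v \<Rightarrow> novikov"
where
  "base_change U V j R' S f = (\<lambda>y. if y \<in> free_module R' S
     then (\<lambda>p. \<Sum>s\<in>S. y s * pullback V j (f (basis_elt U s) p)) else 0)"

definition restriction ::
  "'u set \<Rightarrow> 'v set \<Rightarrow> ('v \<Rightarrow> 'u) \<Rightarrow> ('v \<Rightarrow> novikov) set \<Rightarrow>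
   (('p, 'u) matrix_factorization, ('p \<Rightarrow> 'u \<Rightarrow> novikov) \<Rightarrow> 'p \<Rightarrow> 'u \<Rightarrow> novikov,
    ('p, 'v) matrix_factorization, ('p \<Rightarrow> 'v \<Rightarrow> novikov) \<Rightarrow> 'p \<Rightarrow> 'v \<Rightarrow> novikov) dg_functor"
where
  "restriction U V j R' = \<lparr>
     gob = (\<lambda>E. \<lparr>gens = gens E, delta = base_change U V j R' (both (gens E)) (delta E)\<rparr>),
     gmor = (\<lambda>E F f. base_change U V j R' (both (gens E)) f)\<rparr>"


section \<open>Deformations by weak Maurer--Cartan elements\<close>

text \<open>The deformation space \<open>{\<Sum>\<^sub>j x\<^sub>j X\<^sub>j | x\<^sub>j \<in> P}\<close> for a set \<open>X\<close> of generators.\<close>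

definition deformation_space :: "'p set \<Rightarrow> novikov set \<Rightarrow> ('p \<Rightarrow> novikov) set" where
  "deformation_space X P = {b \<in> hvec X. \<forall>p\<in>X. b p \<in> P}"

text \<open>Strings of morphisms between pairs \<open>(L, b)\<close>; \<open>insert_b\<close> inserts \<open>n\<^sub>i\<close> copies of \<open>b\<^sub>i\<close> at the \<open>i\<close>-th
  object of the string, and \<open>dmu\<close> is the deformed operation, the sum over all numbers of insertions.
  The series is summed generator by generator in the Novikov topology.\<close>

fun insert_b ::
  "'o \<times> 'm \<Rightarrow> ('m \<times> ('o \<times> 'm)) list \<Rightarrow> nat list \<Rightarrow> ('m \<times> 'o) list"
where
  "insert_b (L, b) [] ns = replicate (hd ns) (b, L)"
| "insert_b (L, b) ((x, Z) # as) ns = replicate (hd ns) (b, L) @ (x, fst Z) # insert_b Z as (tl ns)"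

definition dmu ::
  "('o, 'p \<Rightarrow> novikov) ainf_category \<Rightarrow> 'o \<times> ('p \<Rightarrow> novikov) \<Rightarrow>
   (('p \<Rightarrow> novikov) \<times> ('o \<times> ('p \<Rightarrow> novikov))) list \<Rightarrow> 'p \<Rightarrow> novikov"
where
  "dmu A Z as = (\<lambda>p. \<Sum>\<^sub>\<infinity>ns\<in>{ns. length ns = Suc (length as)}. mu A (fst Z) (insert_b Z as ns) p)"

definition insertions_converge ::
  "('o, 'p \<Rightarrow> novikov) ainf_category \<Rightarrow> ('o \<times> ('p \<Rightarrow> novikov)) set \<Rightarrow> bool"
where
  "insertions_converge A \<D> \<longleftrightarrow> (\<forall>Z\<in>\<D>. \<forall>as. snd ` set as \<subseteq> \<D> \<and>
     tpath A (fst Z) (map (map_prod id fst) as) \<longrightarrow>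
     (\<forall>p. (\<lambda>ns. mu A (fst Z) (insert_b Z as ns) p) summable_on {ns. length ns = Suc (length as)}))"

text \<open>Families over a domain \<open>V\<close> with coefficients in a ring \<open>R\<close> of functions on \<open>V\<close>, i.e.
  elements of \<open>H \<otimes> R\<close>.\<close>

definition family ::
  "'u set \<Rightarrow> ('u \<Rightarrow> novikov) set \<Rightarrow> ('p \<Rightarrow> novikov) set \<Rightarrow> ('u \<Rightarrow> 'p \<Rightarrow> novikov) \<Rightarrow> bool"
where
  "family V R H x \<longleftrightarrow> (\<forall>u\<in>V. x u \<in> H) \<and> (\<forall>p. (\<lambda>u. if u \<in> V then x u p else 0) \<in> R)"

fun family_path ::
  "('o, 'p \<Rightarrow> novikov) ainf_category \<Rightarrow> 'u set \<Rightarrow> ('u \<Rightarrow> novikov) set \<Rightarrow>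
   ('o \<times> ('u \<Rightarrow> 'p \<Rightarrow> novikov)) set \<Rightarrow> 'o \<Rightarrow>
   (('u \<Rightarrow> 'p \<Rightarrow> novikov) \<times> ('o \<times> ('u \<Rightarrow> 'p \<Rightarrow> novikov))) list \<Rightarrow> bool"
where
  "family_path A V R \<D> L [] \<longleftrightarrow> True"
| "family_path A V R \<D> L ((x, Z) # as) \<longleftrightarrow>
     Z \<in> \<D> \<and> family V R (Hom_total A L (fst Z)) x \<and> family_path A V R \<D> (fst Z) as"

text \<open>The operations deformed by the families in \<open>\<D>\<close> are defined over the ring \<open>R\<close>. This is what makes
  the localized mirror functor take values in modules over \<open>R\<close>. It holds automatically when \<open>R\<close> is
  the ring of all functions on \<open>V\<close>.\<close>

definition defined_over ::
  "('o, 'p \<Rightarrow> novikov) ainf_category \<Rightarrow> 'u set \<Rightarrow> ('u \<Rightarrow> novikov) set \<Rightarrow>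
   ('o \<times> ('u \<Rightarrow> 'p \<Rightarrow> novikov)) set \<Rightarrow> bool"
where
  "defined_over A V R \<D> \<longleftrightarrow> (\<forall>Z\<in>\<D>. \<forall>as. family_path A V R \<D> (fst Z) as \<longrightarrow>
     (\<forall>p. (\<lambda>u. if u \<in> V
        then dmu A (fst Z, snd Z u) (map (\<lambda>(x, Y). (x u, (fst Y, snd Y u))) as) p else 0) \<in> R))"

lemma function_ring_all: "function_ring U {f. \<forall>u. u \<notin> U \<longrightarrow> f u = 0}"
  by (auto simp: function_ring_def)

lemma defined_over_all: "defined_over A V {f. \<forall>u. u \<notin> V \<longrightarrow> f u = 0} \<D>"
  by (auto simp: defined_over_def)


section \<open>Localized mirror functors\<close>

text \<open>The points of \<open>U\<close> are the elements \<open>b\<close> themselves. An element \<open>y\<close> of the free module on the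
  generators of \<open>Hom(L, \<L>)\<close> has the value \<open>\<lambda>q. y q b\<close> in \<open>Hom(L, \<L>)\<close> at \<open>b \<in> U\<close>.\<close>

definition mirror_functor ::
  "('o, 'p \<Rightarrow> novikov) ainf_category \<Rightarrow> ('o \<Rightarrow> 'o \<Rightarrow> bit \<Rightarrow> 'p set) \<Rightarrow> 'o \<Rightarrow>
   ('p \<Rightarrow> novikov) set \<Rightarrow> (('p \<Rightarrow> novikov) \<Rightarrow> novikov) set \<Rightarrow>
   ('o, 'p \<Rightarrow> novikov, ('p, 'p \<Rightarrow> novikov) matrix_factorization,
    ('p \<Rightarrow> ('p \<Rightarrow> novikov) \<Rightarrow> novikov) \<Rightarrow> 'p \<Rightarrow> ('p \<Rightarrow> novikov) \<Rightarrow> novikov) ainf_functor"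
where
  "mirror_functor A gen \<L> U R = \<lparr>
     fob = (\<lambda>L. \<lparr>
       gens = gen L \<L>,
       delta = (\<lambda>y. if y \<in> free_module R (both (gen L \<L>))
         then (\<lambda>p b. if b \<in> U then - dmu A (L, 0) [(\<lambda>q. y q b, (\<L>, b))] p else 0) else 0)\<rparr>),
     fmor = (\<lambda>L as y. if y \<in> free_module R (both (gen (tgt L as) \<L>))
       then (\<lambda>p b. if b \<in> U
         then \<Sum>\<^sub>\<infinity>j. mu A L (as @ (\<lambda>q. y q b, \<L>) # replicate j (b, \<L>)) p else 0) else 0)\<rparr>"

text \<open>The map \<open>y \<mapsto> (u \<mapsto> m(a\<^sub>1, \<dots>, a\<^sub>k, y(u), \<tau> u))\<close> for \<open>y(u) \<in> Hom(L\<^sub>k, \<L>)\<close> and a string \<open>\<tau> u\<close> starting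
  at \<open>(\<L>, b u)\<close>. The operation is deformed by \<open>0\<close> at \<open>L\<^sub>0, \<dots>, L\<^sub>k\<close>, by \<open>b u\<close> at \<open>\<L>\<close>, and by the given
  elements at the objects of \<open>\<tau> u\<close>.\<close>

definition insertion_map ::
  "('o, 'p \<Rightarrow> novikov) ainf_category \<Rightarrow> ('o \<Rightarrow> 'o \<Rightarrow> bit \<Rightarrow> 'p set) \<Rightarrow> 'u set \<Rightarrow> ('u \<Rightarrow> novikov) set \<Rightarrow>
   'o \<Rightarrow> ('u \<Rightarrow> 'p \<Rightarrow> novikov) \<Rightarrow>
   ('u \<Rightarrow> (('p \<Rightarrow> novikov) \<times> ('o \<times> ('p \<Rightarrow> novikov))) list) \<Rightarrow>
   'o \<Rightarrow> (('p \<Rightarrow> novikov) \<times> 'o) list \<Rightarrow> ('p \<Rightarrow> 'u \<Rightarrow> novikov) \<Rightarrow> 'p \<Rightarrow> 'u \<Rightarrow> novikov"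
where
  "insertion_map A gen V R \<L> b \<tau> L as = (\<lambda>y. if y \<in> free_module R (both (gen (tgt L as) \<L>))
     then (\<lambda>p u. if u \<in> V
       then dmu A (L, 0) (map (\<lambda>(a, K). (a, (K, 0))) as @ (\<lambda>q. y q u, (\<L>, b u)) # \<tau> u) p else 0) else 0)"

text \<open>The transformation \<open>y \<mapsto> (-1)\<^bsup>|a|' + |y|\<^esup> m(a\<^sub>1, \<dots>, a\<^sub>k, y, \<theta>)\<close> for a morphism \<open>\<theta>\<close> of degree 0 from
  \<open>(\<L>, b)\<close> to \<open>(\<L>', b')\<close>; the sign \<open>(-1)\<^bsup>|y|\<^esup>\<close> is applied to each homogeneous component of \<open>y\<close>.\<close>

definition comparison_map ::
  "('o, 'p \<Rightarrow> novikov) ainf_category \<Rightarrow> ('o \<Rightarrow> 'o \<Rightarrow> bit \<Rightarrow> 'p set) \<Rightarrow> 'u set \<Rightarrow> ('u \<Rightarrow> novikov) set \<Rightarrow>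
   'o \<Rightarrow> ('u \<Rightarrow> 'p \<Rightarrow> novikov) \<Rightarrow> 'o \<Rightarrow> ('u \<Rightarrow> 'p \<Rightarrow> novikov) \<Rightarrow> ('u \<Rightarrow> 'p \<Rightarrow> novikov) \<Rightarrow>
   'o \<Rightarrow> (('p \<Rightarrow> novikov) \<times> 'o) list \<Rightarrow> ('p \<Rightarrow> 'u \<Rightarrow> novikov) \<Rightarrow> 'p \<Rightarrow> 'u \<Rightarrow> novikov"
where
  "comparison_map A gen V R \<L> b \<L>' b' \<theta> L as = (\<lambda>y. psgn (sdeg A L as)
     (insertion_map A gen V R \<L> b (\<lambda>u. [(\<theta> u, (\<L>', b' u))]) L as
        (\<lambda>p. if p \<in> gen (tgt L as) \<L> 1 then - y p else y p)))"

text \<open>The homotopy \<open>y \<mapsto> m(a\<^sub>1, \<dots>, a\<^sub>k, y, \<theta>, \<theta>') - m(a\<^sub>1, \<dots>, a\<^sub>k, y, \<gamma>)\<close>, where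
  \<open>m\<^sub>2(\<theta>, \<theta>') = 1 + m\<^sub>1(\<gamma>)\<close> on \<open>(\<L>, b)\<close>.\<close>

definition homotopy_map ::
  "('o, 'p \<Rightarrow> novikov) ainf_category \<Rightarrow> ('o \<Rightarrow> 'o \<Rightarrow> bit \<Rightarrow> 'p set) \<Rightarrow> 'u set \<Rightarrow> ('u \<Rightarrow> novikov) set \<Rightarrow>
   'o \<Rightarrow> ('u \<Rightarrow> 'p \<Rightarrow> novikov) \<Rightarrow> 'o \<Rightarrow> ('u \<Rightarrow> 'p \<Rightarrow> novikov) \<Rightarrow>
   ('u \<Rightarrow> 'p \<Rightarrow> novikov) \<Rightarrow> ('u \<Rightarrow> 'p \<Rightarrow> novikov) \<Rightarrow> ('u \<Rightarrow> 'p \<Rightarrow> novikov) \<Rightarrow>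
   'o \<Rightarrow> (('p \<Rightarrow> novikov) \<times> 'o) list \<Rightarrow> ('p \<Rightarrow> 'u \<Rightarrow> novikov) \<Rightarrow> 'p \<Rightarrow> 'u \<Rightarrow> novikov"
where
  "homotopy_map A gen V R \<L> b \<L>' b' \<theta> \<theta>' \<gamma> L as =
     insertion_map A gen V R \<L> b (\<lambda>u. [(\<theta> u, (\<L>', b' u)), (\<theta>' u, (\<L>, b u))]) L as
     - insertion_map A gen V R \<L> b (\<lambda>u. [(\<gamma> u, (\<L>, b u))]) L as"

end

theory Submission
  imports Defs
begin

text \<open>Every identity between the comparison maps is the \<open>A\<^sub>\<infinity>\<close>-relation of the deformed operations
  for one string \<open>(a\<^sub>1, \<dots>, a\<^sub>k, y, \<dots>)\<close> in which \<open>y\<close> is followed by morphisms between deformed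
  reference objects: the string \<open>(a, y)\<close> gives the functor equations of \<open>\<F>\<close>, because
  \<open>m\<^sub>0\<^sup>b = W(b) 1\<close> contributes only the multiple \<open>W(b) y\<close> by unitality; \<open>(a, y, \<alpha>)\<close> shows that
  \<open>y \<mapsto> m(a, y, \<alpha>)\<close> is a natural transformation, because \<open>\<alpha>\<close> is closed and the two curvature terms
  cancel when the potentials agree; and \<open>(a, y, \<alpha>, \<beta>)\<close> minus \<open>(a, y, \<gamma>)\<close> shows that the composition
  of two such transformations is homotopic to the identity. The potentials agree because the
  relation for the string \<open>(\<alpha>)\<close> reads \<open>(W\<^sub>1 - W\<^sub>0) \<alpha> = 0\<close> up to sign. An \<open>A\<^sub>\<infinity>\<close>-functor into the
  homotopy fiber product is the same as a pair of functors with a natural transformation between their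
  restrictions whose value at every object is invertible in cohomology.\<close>

section \<open>Unconditional sums in the Novikov field\<close>

text \<open>Two obstacles shape the proof. The deformed operations are infinite sums, so their
  relations require a double sum to be regrouped and one sum to be moved inside an argument of
  another. The valuation is non-Archimedean, so a family is summable exactly when its terms tend to
  zero, and each coefficient then depends on finitely many terms; regrouping becomes an identity of
  finite sums. Moving a sum inside is possible because every Hom space has finitely many generators.
  The second obstacle is signs. A degree is read off by testing membership in degree 0, so the zero
  vector counts as even, also where it serves as an odd deformation element; sign rules are
  therefore proved with the alternative that some letter is zero, where the operation vanishes
  anyway. The sign of an inhomogeneous module element is carried by the linear operator
  \<open>parity\<close>. Identities over a ring of functions are checked at each point of the
  domain; that the results stay in the ring comes from \<open>defined_over\<close>.\<close>

lemma ereal_le_nval_iff: "ereal E \<le> nval x \<longleftrightarrow> (\<forall>r<E. ncoeff x r = 0)"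
  unfolding nval_def le_INF_iff by (auto simp: not_less[symmetric])

lemma nval_lower_bound: "\<exists>d. ereal d \<le> nval x"
  using novikov_support_bound[of "ncoeff x"] ncoeff_finite
  unfolding ereal_le_nval_iff by (meson not_less)

lemma ereal_le_nval_mult:
  assumes "ereal d \<le> nval x" "ereal e \<le> nval y"
  shows "ereal (d + e) \<le> nval (x * y)"
  using assms ncoeff_mult_below unfolding ereal_le_nval_iff by blast

lemma ereal_le_nval_add:
  "ereal E \<le> nval x \<Longrightarrow> ereal E \<le> nval y \<Longrightarrow> ereal E \<le> nval (x + y)"
  by (simp add: ereal_le_nval_iff)

lemma ereal_le_nval_diff:
  "ereal E \<le> nval x \<Longrightarrow> ereal E \<le> nval y \<Longrightarrow> ereal E \<le> nval (x - y)"
  by (simp add: ereal_le_nval_iff)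

lemma ereal_le_nval_zero [simp]: "ereal E \<le> nval 0"
  by (simp add: ereal_le_nval_iff)

text \<open>By the ultrametric inequality every point of a valuation ball is a centre of it with the
  same radius, so the balls of the neighbourhood base are themselves open.\<close>

lemma open_nval_ball: "open {y. ereal E \<le> nval (y - x)}"
  unfolding open_novikov_def ereal_le_nval_iff
  by (auto intro!: exI[of _ E])

lemma has_sum_novikov_iff:
  fixes f :: "'i \<Rightarrow> novikov"
  shows "(f has_sum x) I \<longleftrightarrow>
    (\<forall>E. \<exists>F. finite F \<and> F \<subseteq> I \<and>
       (\<forall>G. finite G \<and> F \<subseteq> G \<and> G \<subseteq> I \<longrightarrow> ereal E \<le> nval (sum f G - x)))"
  (is "_ \<longleftrightarrow> ?R")
proof
  assume "(f has_sum x) I"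
  then have *: "eventually (\<lambda>F. sum f F \<in> S) (finite_subsets_at_top I)" if "open S" "x \<in> S" for S
    using that unfolding has_sum_def tendsto_def by blast
  show ?R
    using *[OF open_nval_ball[of _ x]] unfolding eventually_finite_subsets_at_top by simp
next
  assume R: ?R
  show "(f has_sum x) I"
    unfolding has_sum_def
  proof (rule topological_tendstoI)
    fix S assume "open S" "x \<in> S"
    then obtain E where E: "\<And>y. ereal E \<le> nval (y - x) \<Longrightarrow> y \<in> S" unfolding open_novikov_def by blast
    show "eventually (\<lambda>F. sum f F \<in> S) (finite_subsets_at_top I)"
      unfolding eventually_finite_subsets_at_top using R E by metis
  qed
qed

text \<open>Terms tending to zero: the non-Archimedean criterion for unconditional summability.
  \<open>summable_on_novikov_iff\<close> identifies the two, and later convergence arguments count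
  indices of low valuation.\<close>

definition vanishing :: "('i \<Rightarrow> novikov) \<Rightarrow> 'i set \<Rightarrow> bool" where
  "vanishing f I \<longleftrightarrow> (\<forall>E. finite {i \<in> I. \<not> ereal E \<le> nval (f i)})"

lemma vanishing_coeff_finite:
  assumes "vanishing f I"
  shows "finite {i \<in> I. ncoeff (f i) r \<noteq> 0}"
proof -
  have "finite {i \<in> I. \<not> ereal (r + 1) \<le> nval (f i)}" using assms unfolding vanishing_def by blast
  moreover have "{i \<in> I. ncoeff (f i) r \<noteq> 0} \<subseteq> {i \<in> I. \<not> ereal (r + 1) \<le> nval (f i)}"
    unfolding ereal_le_nval_iff using less_add_one by blast
  ultimately show ?thesis by (rule rev_finite_subset)
qed

text \<open>Only finitely many terms reach any given exponent, so each coefficient of the candidate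
  is a finite sum. One finite set of indices works for all exponents below a bound, which gives both
  the finiteness of the support and convergence.\<close>

lemma vanishing_has_sum:
  assumes v: "vanishing f I"
  shows "\<exists>x. (f has_sum x) I \<and> (\<forall>r. ncoeff x r = (\<Sum>i | i \<in> I \<and> ncoeff (f i) r \<noteq> 0. ncoeff (f i) r))"
proof -
  define g where "g r = (\<Sum>i | i \<in> I \<and> ncoeff (f i) r \<noteq> 0. ncoeff (f i) r)" for r
  define B where "B E = {i \<in> I. \<not> ereal E \<le> nval (f i)}" for E
  have B: "finite (B E)" for E using v unfolding vanishing_def B_def by blast
  have g: "g r = (\<Sum>i\<in>G. ncoeff (f i) r)" if "r < E" "finite G" "B E \<subseteq> G" "G \<subseteq> I" for r E G
    unfolding g_def
    by (rule sum.mono_neutral_left)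
       (use that in \<open>auto simp: B_def ereal_le_nval_iff\<close>)
  have "finite {r. r \<le> C \<and> g r \<noteq> 0}" for C
  proof -
    \<comment> \<open>\<open>B E\<close> controls only exponents strictly below \<open>E\<close>;
      the shift to \<open>C + 1\<close> includes the exponent \<open>C\<close> itself.\<close>
    have "{r. r \<le> C \<and> g r \<noteq> 0} \<subseteq> (\<Union>i\<in>B (C + 1). {r. r \<le> C \<and> ncoeff (f i) r \<noteq> 0})"
    proof
      fix r assume r: "r \<in> {r. r \<le> C \<and> g r \<noteq> 0}"
      then have "g r = (\<Sum>i\<in>B (C + 1). ncoeff (f i) r)"
        by (intro g[of r "C + 1"] B) (auto simp: B_def)
      then obtain i where "i \<in> B (C + 1)" "ncoeff (f i) r \<noteq> 0"
        using r by (metis (mono_tags, lifting) mem_Collect_eq sum.neutral)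
      then show "r \<in> (\<Union>i\<in>B (C + 1). {r. r \<le> C \<and> ncoeff (f i) r \<noteq> 0})" using r by blast
    qed
    then show ?thesis using B ncoeff_finite by (rule_tac finite_subset) auto
  qed
  then have x: "ncoeff (Abs_novikov g) = g" by (simp add: Abs_novikov_inverse)
  have "(f has_sum Abs_novikov g) I"
    unfolding has_sum_novikov_iff
  proof
    fix E
    have "ereal E \<le> nval (sum f G - Abs_novikov g)" if "finite G" "B E \<subseteq> G" "G \<subseteq> I" for G
      unfolding ereal_le_nval_iff using g[of _ E G] that by (simp add: ncoeff_sum x)
    then show "\<exists>F. finite F \<and> F \<subseteq> I \<and>
        (\<forall>G. finite G \<and> F \<subseteq> G \<and> G \<subseteq> I \<longrightarrow> ereal E \<le> nval (sum f G - Abs_novikov g))"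
      using B[of E] by (intro exI[of _ "B E"]) (auto simp: B_def)
  qed
  then show ?thesis using x fun_cong[OF x] by (auto simp: g_def)
qed

text \<open>A single term is the difference of two partial sums, and past the set \<open>F\<close>
  both are close to the limit.\<close>

lemma has_sum_vanishing:
  assumes "(f has_sum x) I"
  shows "vanishing f I"
  unfolding vanishing_def
proof
  fix E
  obtain F where F: "finite F" "F \<subseteq> I"
    and G: "\<And>G. finite G \<Longrightarrow> F \<subseteq> G \<Longrightarrow> G \<subseteq> I \<Longrightarrow> ereal E \<le> nval (sum f G - x)"
    using assms unfolding has_sum_novikov_iff by metis
  have "ereal E \<le> nval (f i)" if i: "i \<in> I" "i \<notin> F" for i
  proof -
    have "ereal E \<le> nval ((sum f (insert i F) - x) - (sum f F - x))"
      by (intro ereal_le_nval_diff G) (use F i in auto)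
    then show ?thesis using F i by simp
  qed
  then have "{i \<in> I. \<not> ereal E \<le> nval (f i)} \<subseteq> F" by blast
  then show "finite {i \<in> I. \<not> ereal E \<le> nval (f i)}" using F finite_subset by blast
qed

lemma summable_on_novikov_iff: "f summable_on I \<longleftrightarrow> vanishing f I" for f :: "'i \<Rightarrow> novikov"
  using has_sum_vanishing vanishing_has_sum unfolding summable_on_def by blast

text \<open>The tool that reduces identities of infinite sums to finite ones: \<open>F\<close> may
  be any finite set that catches the indices contributing at the exponent \<open>r\<close>, so
  several sums can share one \<open>F\<close>.\<close>

lemma ncoeff_infsum:
  assumes "vanishing f I" "finite F" "F \<subseteq> I" "\<And>i. i \<in> I \<Longrightarrow> ncoeff (f i) r \<noteq> 0 \<Longrightarrow> i \<in> F"
  shows "ncoeff (infsum f I) r = (\<Sum>i\<in>F. ncoeff (f i) r)"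
proof -
  obtain x where x: "(f has_sum x) I"
    "\<And>r. ncoeff x r = (\<Sum>i | i \<in> I \<and> ncoeff (f i) r \<noteq> 0. ncoeff (f i) r)"
    using vanishing_has_sum[OF assms(1)] by blast
  have "(\<Sum>i | i \<in> I \<and> ncoeff (f i) r \<noteq> 0. ncoeff (f i) r) = (\<Sum>i\<in>F. ncoeff (f i) r)"
    by (rule sum.mono_neutral_left) (use assms in auto)
  then show ?thesis using x infsumI by metis
qed

lemma vanishing_subset: "vanishing f I \<Longrightarrow> J \<subseteq> I \<Longrightarrow> vanishing f J"
  unfolding vanishing_def by (auto intro: rev_finite_subset)

lemma vanishing_finite: "finite I \<Longrightarrow> vanishing f I"
  unfolding vanishing_def by auto

lemma vanishing_mono:
  assumes "vanishing f I" "\<And>i E. i \<in> I \<Longrightarrow> ereal E \<le> nval (f i) \<Longrightarrow> ereal E \<le> nval (g i)"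
  shows "vanishing g I"
  unfolding vanishing_def
proof
  fix E
  show "finite {i \<in> I. \<not> ereal E \<le> nval (g i)}"
    by (rule finite_subset[of _ "{i \<in> I. \<not> ereal E \<le> nval (f i)}"])
       (use assms in \<open>auto simp: vanishing_def\<close>)
qed

text \<open>Only finitely many terms fail to have valuation at least 0, and their individual bounds
  together with 0 have a minimum. Products need this, since a factor of negative valuation can
  offset a high valuation of the other.\<close>

lemma vanishing_lower_bound:
  assumes "vanishing f I"
  shows "\<exists>d. \<forall>i\<in>I. ereal d \<le> nval (f i)"
proof -
  let ?A = "{i \<in> I. \<not> ereal 0 \<le> nval (f i)}"
  have A: "finite ?A" using assms unfolding vanishing_def by blast
  define d where "d i = (SOME d. ereal d \<le> nval (f i))" for i
  have d: "ereal (d i) \<le> nval (f i)" for i unfolding d_def by (rule someI_ex[OF nval_lower_bound])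
  define m where "m = Min (insert 0 (d ` ?A))"
  have m0: "m \<le> 0" unfolding m_def using A by (intro Min_le) auto
  have "ereal m \<le> nval (f i)" if "i \<in> I" for i
  proof (cases "i \<in> ?A")
    case True
    then have "m \<le> d i" unfolding m_def using A by (intro Min_le) auto
    then show ?thesis using d[of i] by (meson dual_order.trans ereal_less_eq(3))
  next
    case False
    then show ?thesis using that m0 by (metis (mono_tags, lifting) dual_order.trans ereal_less_eq(3) mem_Collect_eq)
  qed
  then show ?thesis by blast
qed

lemma vanishing_add:
  assumes "vanishing f I" "vanishing g I"
  shows "vanishing (\<lambda>i. f i + g i) I"
  unfolding vanishing_def
proof
  fix E
  have "{i \<in> I. \<not> ereal E \<le> nval (f i + g i)} \<subseteq>
      {i \<in> I. \<not> ereal E \<le> nval (f i)} \<union> {i \<in> I. \<not> ereal E \<le> nval (g i)}"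
    using ereal_le_nval_add by blast
  then show "finite {i \<in> I. \<not> ereal E \<le> nval (f i + g i)}"
    using assms unfolding vanishing_def by (meson finite_UnI finite_subset)
qed

lemma vanishing_sum:
  assumes "finite A" "\<And>a. a \<in> A \<Longrightarrow> vanishing (f a) I"
  shows "vanishing (\<lambda>i. \<Sum>a\<in>A. f a i) I"
  using assms
proof (induction A rule: finite_induct)
  case empty
  then show ?case by (simp add: vanishing_def)
qed (auto intro: vanishing_add)

lemma infsum_novikov_add:
  fixes f g :: "'i \<Rightarrow> novikov"
  assumes "vanishing f I" "vanishing g I"
  shows "infsum (\<lambda>i. f i + g i) I = infsum f I + infsum g I"
proof (rule novikov_eqI)
  fix r
  let ?F = "{i \<in> I. ncoeff (f i) r \<noteq> 0} \<union> {i \<in> I. ncoeff (g i) r \<noteq> 0}"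
  have fin: "finite ?F" using assms vanishing_coeff_finite by blast
  have "ncoeff (infsum (\<lambda>i. f i + g i) I) r = (\<Sum>i\<in>?F. ncoeff (f i + g i) r)"
    by (rule ncoeff_infsum) (use fin assms vanishing_add in auto)
  moreover have "ncoeff (infsum f I) r = (\<Sum>i\<in>?F. ncoeff (f i) r)"
    by (rule ncoeff_infsum) (use fin assms in auto)
  moreover have "ncoeff (infsum g I) r = (\<Sum>i\<in>?F. ncoeff (g i) r)"
    by (rule ncoeff_infsum) (use fin assms in auto)
  ultimately show "ncoeff (infsum (\<lambda>i. f i + g i) I) r = ncoeff (infsum f I + infsum g I) r"
    by (simp add: sum.distrib)
qed

lemma infsum_novikov_sum:
  fixes f :: "'a \<Rightarrow> 'i \<Rightarrow> novikov"
  assumes "finite A" "\<And>a. a \<in> A \<Longrightarrow> vanishing (f a) I"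
  shows "infsum (\<lambda>i. \<Sum>a\<in>A. f a i) I = (\<Sum>a\<in>A. infsum (f a) I)"
  using assms
  by (induction A rule: finite_induct) (simp_all add: infsum_novikov_add vanishing_sum)

lemma vanishing_fibres:
  assumes v: "vanishing t K"
  shows "vanishing (\<lambda>j. infsum t {k \<in> K. h k = j}) J"
  unfolding vanishing_def
proof
  fix E
  let ?B = "{k \<in> K. \<not> ereal E \<le> nval (t k)}"
  have "{j \<in> J. \<not> ereal E \<le> nval (infsum t {k \<in> K. h k = j})} \<subseteq> h ` ?B"
  proof
    fix j assume "j \<in> {j \<in> J. \<not> ereal E \<le> nval (infsum t {k \<in> K. h k = j})}"
    then obtain r where r: "r < E" "ncoeff (infsum t {k \<in> K. h k = j}) r \<noteq> 0"
      by (auto simp: ereal_le_nval_iff)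
    let ?F = "{k \<in> {k \<in> K. h k = j}. ncoeff (t k) r \<noteq> 0}"
    have vj: "vanishing t {k \<in> K. h k = j}" using v by (rule vanishing_subset) auto
    have "ncoeff (infsum t {k \<in> K. h k = j}) r = (\<Sum>k\<in>?F. ncoeff (t k) r)"
      by (rule ncoeff_infsum[OF vj vanishing_coeff_finite[OF vj]]) auto
    then have "?F \<noteq> {}" using r by (metis sum.empty)
    then show "j \<in> h ` ?B" using r unfolding ereal_le_nval_iff by blast
  qed
  then show "finite {j \<in> J. \<not> ereal E \<le> nval (infsum t {k \<in> K. h k = j})}"
    using v unfolding vanishing_def by (meson finite_imageI finite_subset)
qed

text \<open>Regrouping along an arbitrary map \<open>h\<close>: at each exponent only the finitely
  many indices in \<open>?F\<close> matter, and both sides become the finite sum over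
  \<open>?F\<close>, sorted by the value of \<open>h\<close>.\<close>

lemma infsum_fibres:
  fixes t :: "'k \<Rightarrow> novikov"
  assumes v: "vanishing t K" and h: "h ` K \<subseteq> J"
  shows "infsum (\<lambda>j. infsum t {k \<in> K. h k = j}) J = infsum t K"
proof (rule novikov_eqI)
  fix r
  let ?F = "{k \<in> K. ncoeff (t k) r \<noteq> 0}"
  have F: "finite ?F" using v by (rule vanishing_coeff_finite)
  have inner: "ncoeff (infsum t {k \<in> K. h k = j}) r = (\<Sum>k | k \<in> ?F \<and> h k = j. ncoeff (t k) r)" for j
    by (rule ncoeff_infsum[OF vanishing_subset[OF v] finite_subset[OF _ F]]) auto
  have "ncoeff (infsum (\<lambda>j. infsum t {k \<in> K. h k = j}) J) r
      = (\<Sum>j\<in>h ` ?F. ncoeff (infsum t {k \<in> K. h k = j}) r)"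
  proof (rule ncoeff_infsum[OF vanishing_fibres[OF v]])
    show "finite (h ` ?F)" "h ` ?F \<subseteq> J" using F h by auto
    fix j assume j: "ncoeff (infsum t {k \<in> K. h k = j}) r \<noteq> 0"
    then have "{k. k \<in> ?F \<and> h k = j} \<noteq> {}" unfolding inner by (metis (no_types, lifting) sum.empty)
    then show "j \<in> h ` ?F" by auto
  qed
  also have "\<dots> = (\<Sum>k\<in>?F. ncoeff (t k) r)"
    unfolding inner using F by (rule sum.image_gen[symmetric])
  also have "\<dots> = ncoeff (infsum t K) r"
    by (rule ncoeff_infsum[symmetric]) (use F v in auto)
  finally show "ncoeff (infsum (\<lambda>j. infsum t {k \<in> K. h k = j}) J) r = ncoeff (infsum t K) r" .
qed

lemma vanishing_product:
  assumes "vanishing f I" "vanishing g J"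
  shows "vanishing (\<lambda>(i, j). f i * g j) (I \<times> J)"
proof -
  obtain d e where d: "\<And>i. i \<in> I \<Longrightarrow> ereal d \<le> nval (f i)" and e: "\<And>j. j \<in> J \<Longrightarrow> ereal e \<le> nval (g j)"
    using assms vanishing_lower_bound by metis
  show ?thesis
    unfolding vanishing_def
  proof
    fix E
    \<comment> \<open>With the uniform bounds \<open>d\<close> and \<open>e\<close>, a product below
      \<open>E\<close> forces the first factor below \<open>E - e\<close> and the second below
      \<open>E - d\<close>, so finitely many pairs remain.\<close>
    have "{x \<in> I \<times> J. \<not> ereal E \<le> nval (case x of (i, j) \<Rightarrow> f i * g j)} \<subseteq>
        {i \<in> I. \<not> ereal (E - e) \<le> nval (f i)} \<times> {j \<in> J. \<not> ereal (E - d) \<le> nval (g j)}"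
    proof
      fix x assume "x \<in> {x \<in> I \<times> J. \<not> ereal E \<le> nval (case x of (i, j) \<Rightarrow> f i * g j)}"
      then obtain i j where x: "x = (i, j)" "i \<in> I" "j \<in> J" "\<not> ereal E \<le> nval (f i * g j)" by auto
      then show "x \<in> {i \<in> I. \<not> ereal (E - e) \<le> nval (f i)} \<times> {j \<in> J. \<not> ereal (E - d) \<le> nval (g j)}"
        using ereal_le_nval_mult[of "E - e" "f i" e "g j"] ereal_le_nval_mult[of d "f i" "E - d" "g j"]
          d[of i] e[of j] by auto
    qed
    then show "finite {x \<in> I \<times> J. \<not> ereal E \<le> nval (case x of (i, j) \<Rightarrow> f i * g j)}"
      using assms unfolding vanishing_def by (meson finite_SigmaI finite_subset)
  qed
qed

lemma vanishing_cmult: "vanishing f I \<Longrightarrow> vanishing (\<lambda>i. c * f i) I"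
proof -
  assume v: "vanishing f I"
  obtain d where d: "ereal d \<le> nval c" using nval_lower_bound by blast
  show ?thesis
    unfolding vanishing_def
  proof
    fix E
    have "{i \<in> I. \<not> ereal E \<le> nval (c * f i)} \<subseteq> {i \<in> I. \<not> ereal (E - d) \<le> nval (f i)}"
      using ereal_le_nval_mult[OF d, of "E - d"] by auto
    then show "finite {i \<in> I. \<not> ereal E \<le> nval (c * f i)}"
      using v unfolding vanishing_def by (meson finite_subset)
  qed
qed

lemma infsum_novikov_cmult:
  fixes f :: "'i \<Rightarrow> novikov"
  assumes v: "vanishing f I"
  shows "infsum (\<lambda>i. c * f i) I = c * infsum f I"
proof (rule infsumI)
  obtain d where d: "ereal d \<le> nval c" using nval_lower_bound by blast
  have s: "(f has_sum infsum f I) I"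
    using v by (simp add: summable_on_novikov_iff[symmetric])
  show "((\<lambda>i. c * f i) has_sum c * infsum f I) I"
    unfolding has_sum_novikov_iff
  proof
    fix E
    obtain F where F: "finite F" "F \<subseteq> I"
      "\<And>G. finite G \<and> F \<subseteq> G \<and> G \<subseteq> I \<Longrightarrow> ereal (E - d) \<le> nval (sum f G - infsum f I)"
      using s unfolding has_sum_novikov_iff by metis
    have "ereal E \<le> nval (sum (\<lambda>i. c * f i) G - c * infsum f I)" if "finite G \<and> F \<subseteq> G \<and> G \<subseteq> I" for G
      using ereal_le_nval_mult[OF d F(3)[OF that]]
      by (simp add: algebra_simps sum_distrib_left)
    then show "\<exists>F. finite F \<and> F \<subseteq> I \<and>
        (\<forall>G. finite G \<and> F \<subseteq> G \<and> G \<subseteq> I \<longrightarrow> ereal E \<le> nval (sum (\<lambda>i. c * f i) G - c * infsum f I))"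
      using F(1,2) by blast
  qed
qed

lemma infsum_novikov_product:
  fixes f :: "'i \<Rightarrow> novikov"
  assumes f: "vanishing f I" and g: "vanishing g J"
  shows "infsum (\<lambda>(i, j). f i * g j) (I \<times> J) = infsum f I * infsum g J"
proof -
  have "infsum (\<lambda>(i, j). f i * g j) {k \<in> I \<times> J. fst k = i} = f i * infsum g J" if "i \<in> I" for i
  proof -
    have "{k \<in> I \<times> J. fst k = i} = Pair i ` J" using that by auto
    moreover have "infsum (\<lambda>(i, j). f i * g j) (Pair i ` J) = infsum (\<lambda>j. f i * g j) J"
      by (subst infsum_reindex) (auto simp: inj_on_def o_def)
    ultimately show ?thesis using infsum_novikov_cmult[OF g] by simp
  qed
  then have "infsum (\<lambda>i. f i * infsum g J) I
      = infsum (\<lambda>i. infsum (\<lambda>(i, j). f i * g j) {k \<in> I \<times> J. fst k = i}) I"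
    by (intro infsum_cong) simp
  also have "\<dots> = infsum (\<lambda>(i, j). f i * g j) (I \<times> J)"
    by (rule infsum_fibres[OF vanishing_product[OF f g]]) auto
  finally show ?thesis using infsum_novikov_cmult[OF f, of "infsum g J"] by (simp add: mult.commute)
qed

lemma vanishing_UN:
  assumes "finite J" "\<And>j. j \<in> J \<Longrightarrow> vanishing f (I j)"
  shows "vanishing f (\<Union>j\<in>J. I j)"
  unfolding vanishing_def
proof
  fix E
  have "{i \<in> \<Union>j\<in>J. I j. \<not> ereal E \<le> nval (f i)} = (\<Union>j\<in>J. {i \<in> I j. \<not> ereal E \<le> nval (f i)})" by auto
  then show "finite {i \<in> \<Union>j\<in>J. I j. \<not> ereal E \<le> nval (f i)}"
    using assms unfolding vanishing_def by simp
qed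

lemma vanishing_reindex:
  assumes "bij_betw h I J"
  shows "vanishing (\<lambda>i. f (h i)) I \<longleftrightarrow> vanishing f J"
  using summable_on_reindex_bij_betw[OF assms, of f] by (simp add: summable_on_novikov_iff)

section \<open>Pointwise evaluation and signs\<close>

lemma sum_fun_apply: "sum f A x = (\<Sum>a\<in>A. f a x)"
  by (induction A rule: infinite_finite_induct) auto

lemma psgn_zero [simp]: "psgn d 0 = 0" by (simp add: psgn_def)
lemma psgn_zero_left [simp]: "psgn 0 x = x" by (simp add: psgn_def)
lemma psgn_one [simp]: "psgn 1 x = - x" by (simp add: psgn_def)
lemma psgn_apply: "psgn d f x = psgn d (f x)" by (simp add: psgn_def)
lemma psgn_add: "psgn d (x + y) = psgn d x + psgn d y" by (simp add: psgn_def)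
lemma psgn_minus: "psgn d (- x) = - psgn d x" by (simp add: psgn_def)
lemma psgn_psgn: "psgn d (psgn e x) = psgn (d + e) x"
  by (cases d rule: bit.exhaust; cases e rule: bit.exhaust) (simp_all add: psgn_def)
lemma psgn_sum: "psgn d (sum f A) = (\<Sum>a\<in>A. psgn d (f a))" by (simp add: psgn_def sum_negf)

lemma nscale_apply: "(c \<odot> f) p = c * (f p :: novikov)"
  by (simp add: nscale_fun_def nscale_novikov_def)

section \<open>Strings with inserted letters\<close>

text \<open>A string with insertions is a list in which \<open>None\<close> stands for an inserted deformation element and
  \<open>Some x\<close> for a letter of the original string. Splitting such a list splits the original string
  and distributes the insertions, without any counting of insertion numbers.\<close>

fun unmark :: "'x option list \<Rightarrow> 'x list" where
  "unmark [] = []"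
| "unmark (None # s) = unmark s"
| "unmark (Some x # s) = x # unmark s"

fun mark :: "'x list \<Rightarrow> nat list \<Rightarrow> 'x option list" where
  "mark [] ns = replicate (hd ns) None"
| "mark (x # as) ns = replicate (hd ns) None @ Some x # mark as (tl ns)"

fun spell :: "'o \<times> 'm \<Rightarrow> ('m \<times> ('o \<times> 'm)) option list \<Rightarrow> ('m \<times> 'o) list" where
  "spell Z [] = []"
| "spell Z (None # s) = (snd Z, fst Z) # spell Z s"
| "spell Z (Some (x, Z') # s) = (x, fst Z') # spell Z' s"

abbreviation marked :: "'x list \<Rightarrow> 'x option list set" where
  "marked as \<equiv> {s. unmark s = as}"

lemma unmark_append [simp]: "unmark (s @ t) = unmark s @ unmark t"
  by (induction s rule: unmark.induct) auto

lemma unmark_replicate [simp]: "unmark (replicate n None) = []"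
  by (induction n) auto

lemma unmark_Some [simp]: "unmark (map Some as) = as"
  by (induction as) auto

lemma tgt_append [simp]: "tgt L (u @ v) = tgt (tgt L u) v"
  by (induction L u rule: tgt.induct) auto

lemma spell_append: "spell Z (s @ t) = spell Z s @ spell (tgt Z (unmark s)) t"
  by (induction Z s rule: spell.induct) auto

lemma spell_replicate: "spell Z (replicate n None) = replicate n (snd Z, fst Z)"
  by (induction n) auto

lemma length_spell [simp]: "length (spell Z s) = length s"
  by (induction Z s rule: spell.induct) auto

lemma spell_mark: "spell Z (mark as ns) = insert_b Z as ns"
proof (induction as arbitrary: Z ns)
  case Nil
  then show ?case by (cases Z) (simp add: spell_replicate)
next
  case (Cons a as)
  then show ?case by (cases Z; cases a) (simp add: spell_replicate spell_append)
qed

lemma unmark_mark [simp]: "unmark (mark as ns) = as"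
  by (induction as arbitrary: ns) auto

text \<open>The number of original letters before a marked letter fixes its position, so there is
  only one way to cut a marked string at a given original letter.\<close>

lemma marked_append_cancel:
  "s @ Some x # t = s' @ Some y # t' \<Longrightarrow> unmark s = unmark s' \<Longrightarrow> s = s' \<and> x = y \<and> t = t'"
proof (induction s arbitrary: s')
  case Nil
  then show ?case by (cases s') auto
next
  case (Cons a s)
  then show ?case by (cases s'; cases a) auto
qed

lemma mark_inj: "length ns = Suc (length as) \<Longrightarrow> length ms = Suc (length as) \<Longrightarrow>
  mark as ns = mark as ms \<Longrightarrow> ns = ms"
proof (induction as arbitrary: ns ms)
  case Nil
  then have "hd ns = hd ms" by (metis length_replicate mark.simps(1))
  then show ?case using Nil by (cases ns; cases ms) auto
next
  case (Cons a as)
  obtain n ns' m ms' where *: "ns = n # ns'" "ms = m # ms'"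
    using Cons.prems by (cases ns; cases ms) auto
  have eq: "replicate n None @ Some a # mark as ns' = replicate m None @ Some a # mark as ms'"
    using Cons.prems(3) * by simp
  have c: "replicate n None = replicate m (None :: 'a option) \<and> mark as ns' = mark as ms'"
    using marked_append_cancel[OF eq] by simp
  then have "n = m" by (metis length_replicate)
  with c have "n = m" "mark as ns' = mark as ms'" by blast+
  then show ?case using Cons.IH[of ns' ms'] Cons.prems * by simp
qed

lemma mark_surj: "\<exists>ns. length ns = Suc (length (unmark s)) \<and> mark (unmark s) ns = s"
proof (induction s rule: unmark.induct)
  case 1
  then show ?case by (intro exI[of _ "[0]"]) simp
next
  case (2 s)
  then obtain ns where ns: "length ns = Suc (length (unmark s))" "mark (unmark s) ns = s" by blast
  then obtain n ns' where n: "ns = n # ns'" by (cases ns) auto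
  have "mark (unmark s) (Suc n # ns') = None # s"
    using ns n by (cases "unmark s") auto
  then show ?case using ns n by (intro exI[of _ "Suc n # ns'"]) auto
next
  case (3 x s)
  then obtain ns where "length ns = Suc (length (unmark s))" "mark (unmark s) ns = s" by blast
  then show ?case by (intro exI[of _ "0 # ns"]) auto
qed

text \<open>The lists of insertion numbers that index \<open>dmu\<close> are traded for marked
  strings here, with \<open>spell_mark\<close> matching the terms; the algebra of deformed
  operations sums over marked strings only.\<close>

lemma bij_betw_mark: "bij_betw (mark as) {ns. length ns = Suc (length as)} (marked as)"
  unfolding bij_betw_def
proof
  show "inj_on (mark as) {ns. length ns = Suc (length as)}"
    by (rule inj_onI) (auto intro: mark_inj)
  show "mark as ` {ns. length ns = Suc (length as)} = marked as"
  proof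
    show "marked as \<subseteq> mark as ` {ns. length ns = Suc (length as)}"
    proof
      fix s assume "s \<in> marked as"
      then show "s \<in> mark as ` {ns. length ns = Suc (length as)}"
        using mark_surj[of s] by (metis (mono_tags, lifting) imageI mem_Collect_eq)
    qed
  qed auto
qed

lemma unmark_eq_append_Cons:
  "unmark s = u @ x # v \<Longrightarrow> \<exists>s1 s3. s = s1 @ Some x # s3 \<and> unmark s1 = u \<and> unmark s3 = v"
proof (induction s arbitrary: u rule: unmark.induct)
  case (2 s)
  then obtain s1 s3 where "s = s1 @ Some x # s3 \<and> unmark s1 = u \<and> unmark s3 = v" by auto
  then show ?case by (intro exI[of _ "None # s1"] exI[of _ s3]) auto
next
  case (3 y s)
  show ?case
  proof (cases u)
    case Nil
    then show ?thesis using 3 by (intro exI[of _ "[]"] exI[of _ s]) auto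
  next
    case (Cons z u')
    then obtain s1 s3 where "s = s1 @ Some x # s3 \<and> unmark s1 = u' \<and> unmark s3 = v"
      using 3 by auto
    then show ?thesis using Cons 3 by (intro exI[of _ "Some z # s1"] exI[of _ s3]) auto
  qed
qed auto

text \<open>Insertions to the left and to the right of a fixed letter are independent, so a sum over
  marked strings becomes a sum over a product.\<close>

lemma bij_betw_marked_Cons:
  "bij_betw (\<lambda>(s, t). s @ Some x # t) (marked u \<times> marked v) (marked (u @ x # v))"
  unfolding bij_betw_def
proof
  show "inj_on (\<lambda>(s, t). s @ Some x # t) (marked u \<times> marked v)"
    by (rule inj_onI) (auto dest: marked_append_cancel)
  show "(\<lambda>(s, t). s @ Some x # t) ` (marked u \<times> marked v) = marked (u @ x # v)"
  proof
    show "marked (u @ x # v) \<subseteq> (\<lambda>(s, t). s @ Some x # t) ` (marked u \<times> marked v)"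
    proof
      fix s assume "s \<in> marked (u @ x # v)"
      then obtain s1 s3 where "s = s1 @ Some x # s3 \<and> unmark s1 = u \<and> unmark s3 = v"
        using unmark_eq_append_Cons[of s u x v] by auto
      then show "s \<in> (\<lambda>(s, t). s @ Some x # t) ` (marked u \<times> marked v)"
        by (intro image_eqI[of _ _ "(s1, s3)"]) auto
    qed
  qed auto
qed

definition splits2 :: "'a list \<Rightarrow> ('a list \<times> 'a list) set" where
  "splits2 as = {(u, v). u @ v = as}"

lemma splits2_eq: "splits2 as = (\<lambda>i. (take i as, drop i as)) ` {..length as}"
proof
  show "splits2 as \<subseteq> (\<lambda>i. (take i as, drop i as)) ` {..length as}"
  proof
    fix x assume "x \<in> splits2 as"
    then obtain u v where x: "x = (u, v)" "u @ v = as" by (auto simp: splits2_def)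
    then show "x \<in> (\<lambda>i. (take i as, drop i as)) ` {..length as}"
      by (intro image_eqI[of _ _ "length u"]) auto
  qed
qed (auto simp: splits2_def)

lemma finite_splits2 [simp]: "finite (splits2 as)"
  unfolding splits2_eq by simp

lemma splits3_subset: "splits3 as \<subseteq> (\<Union>(u, r)\<in>splits2 as. (\<lambda>(v, w). (u, v, w)) ` splits2 r)"
  unfolding splits3_def splits2_def by auto

lemma finite_splits3 [simp]: "finite (splits3 as)"
  by (rule finite_subset[OF splits3_subset]) auto

text \<open>Writing out a marked string keeps its length, so a cut of the written string pulls back
  to the marked string by position.\<close>

lemma sum_splits3_spell:
  "(\<Sum>(u, v, w)\<in>splits3 (spell Z s). f u v w) =
   (\<Sum>(s1, s2, s3)\<in>splits3 s. f (spell Z s1) (spell (tgt Z (unmark s1)) s2)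
      (spell (tgt Z (unmark (s1 @ s2))) s3))"
proof -
  let ?h = "\<lambda>(s1, s2, s3). (spell Z s1, spell (tgt Z (unmark s1)) s2, spell (tgt Z (unmark (s1 @ s2))) s3)"
  have "bij_betw ?h (splits3 s) (splits3 (spell Z s))"
    unfolding bij_betw_def
  proof
    show "inj_on ?h (splits3 s)"
    proof (rule inj_onI)
      fix x y assume xy: "x \<in> splits3 s" "y \<in> splits3 s" "?h x = ?h y"
      obtain s1 s2 s3 where x: "x = (s1, s2, s3)" by (cases x)
      obtain t1 t2 t3 where y: "y = (t1, t2, t3)" by (cases y)
      have "length s1 = length t1" "length s2 = length t2"
        using xy(3) unfolding x y prod.case by (metis prod.inject length_spell)+
      then show "x = y" using xy x y by (auto simp: splits3_def)
    qed
    show "?h ` splits3 s = splits3 (spell Z s)"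
    proof
      show "splits3 (spell Z s) \<subseteq> ?h ` splits3 s"
      proof clarify
        fix u v w assume uvw: "(u, v, w) \<in> splits3 (spell Z s)"
        define s1 where "s1 = take (length u) s"
        define s2 where "s2 = take (length v) (drop (length u) s)"
        define s3 where "s3 = drop (length v) (drop (length u) s)"
        have s: "s = s1 @ s2 @ s3" unfolding s1_def s2_def s3_def by (simp only: append_take_drop_id)
        have e: "u @ v @ w = spell Z s" using uvw by (simp add: splits3_def)
        then have len: "length s = length u + length v + length w"
          by (metis add.assoc length_append length_spell)
        have l: "length s1 = length u" "length s2 = length v"
          unfolding s1_def s2_def using len by auto
        have "u @ v @ w = spell Z s1 @ spell (tgt Z (unmark s1)) s2
            @ spell (tgt Z (unmark (s1 @ s2))) s3"
          using e s by (simp add: spell_append)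
        then have "(u, v, w) = ?h (s1, s2, s3)"
          using l by (auto simp: append_eq_append_conv)
        then show "(u, v, w) \<in> ?h ` splits3 s"
          using s by (intro image_eqI[of _ _ "(s1, s2, s3)"]) (auto simp: splits3_def)
      qed
      show "?h ` splits3 s \<subseteq> splits3 (spell Z s)"
        by (auto simp: splits3_def spell_append)
    qed
  qed
  then have "(\<Sum>x\<in>splits3 (spell Z s). (\<lambda>(u, v, w). f u v w) x) = (\<Sum>x\<in>splits3 s. (\<lambda>(u, v, w). f u v w) (?h x))"
    by (rule sum.reindex_bij_betw[symmetric])
  then show ?thesis by (simp add: case_prod_beta)
qed

section \<open>Deformed operations\<close>

definition unit_vec :: "'p \<Rightarrow> 'p \<Rightarrow> novikov" where
  "unit_vec q = (\<lambda>p. if p = q then 1 else 0)"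

lemma tpath_append: "tpath A L (u @ v) \<longleftrightarrow> tpath A L u \<and> tpath A (tgt L u) v"
proof (induction u arbitrary: L)
  case Nil
  show ?case by (cases v) auto
next
  case (Cons a u)
  then show ?case by (cases a) auto
qed

lemma hpath_append: "hpath A L (u @ v) \<longleftrightarrow> hpath A L u \<and> hpath A (tgt L u) v"
proof (induction u arbitrary: L)
  case Nil
  show ?case by (cases v) auto
next
  case (Cons a u)
  then show ?case by (cases a) auto
qed

lemma sdeg_append: "sdeg A L (u @ v) = sdeg A L u + sdeg A (tgt L u) v"
  by (induction A L u rule: sdeg.induct) (auto simp: add_ac)

lemma hpath_tgt: "hpath A L u \<Longrightarrow> tgt L u \<in> Ob A"
  by (induction A L u rule: hpath.induct) auto

definition proj :: "('m \<times> 'o \<times> 'b) list \<Rightarrow> ('m \<times> 'o) list" where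
  "proj as = map (map_prod id fst) as"

lemma proj_simps [simp]:
  "proj [] = []" "proj ((x, Z) # as) = (x, fst Z) # proj as" "proj (u @ v) = proj u @ proj v"
  by (simp_all add: proj_def)

abbreviation ddeg where "ddeg A Z as \<equiv> sdeg A (fst Z) (proj as)"

section \<open>Consequences of the axioms of a filtered unital category\<close>

locale filtered_ainf =
  fixes A :: "('o, 'p \<Rightarrow> novikov) ainf_category" and gen :: "'o \<Rightarrow> 'o \<Rightarrow> bit \<Rightarrow> 'p set"
  assumes fuk: "filtered_unital_ainf A gen"
begin

lemma gen_finite: "L \<in> Ob A \<Longrightarrow> L' \<in> Ob A \<Longrightarrow> finite (gen L L' d)"
  using fuk unfolding filtered_unital_ainf_def by (metis (full_types) bit.exhaust)

lemma gen_disjoint: "L \<in> Ob A \<Longrightarrow> L' \<in> Ob A \<Longrightarrow> gen L L' 0 \<inter> gen L L' 1 = {}"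
  using fuk unfolding filtered_unital_ainf_def by blast

lemma Hom_iff: "L \<in> Ob A \<Longrightarrow> L' \<in> Ob A \<Longrightarrow> x \<in> Hom A L L' d \<longleftrightarrow> (\<forall>p. x p \<noteq> 0 \<longrightarrow> p \<in> gen L L' d)"
  using fuk unfolding filtered_unital_ainf_def hvec_def by auto

lemma mu_degree: "hpath A L as \<Longrightarrow> mu A L as \<in> Hom A L (tgt L as) (sdeg A L as)"
  using fuk unfolding filtered_unital_ainf_def by blast

lemma mu_relation: "hpath A L as \<Longrightarrow>
    (\<Sum>(u, v, w)\<in>splits3 as. psgn (sdeg A L u) (mu A L (contract A L u v w))) = 0"
  using fuk unfolding filtered_unital_ainf_def by blast

lemma mu_vval: "tpath A L as \<Longrightarrow> (\<Sum>(a, L')\<leftarrow>as. vval a) \<le> vval (mu A L as)"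
  using fuk unfolding filtered_unital_ainf_def by blast

lemma unit_Hom: "L \<in> Ob A \<Longrightarrow> unit_of A L \<in> Hom A L L 0"
  using fuk unfolding filtered_unital_ainf_def by blast

lemma mu_unit_left: "L \<in> Ob A \<Longrightarrow> L' \<in> Ob A \<Longrightarrow> x \<in> Hom A L L' d \<Longrightarrow>
    mu A L [(unit_of A L, L), (x, L')] = x"
  using fuk unfolding filtered_unital_ainf_def by blast

lemma mu_unit_right: "L \<in> Ob A \<Longrightarrow> L' \<in> Ob A \<Longrightarrow> x \<in> Hom A L L' d \<Longrightarrow>
    psgn d (mu A L [(x, L'), (unit_of A L', L')]) = x"
  using fuk unfolding filtered_unital_ainf_def by blast

lemma mu_unit_other: "tpath A L (u @ (unit_of A K, K) # v) \<Longrightarrow> K = tgt L u \<Longrightarrow>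
    length u + length v \<noteq> 1 \<Longrightarrow> mu A L (u @ (unit_of A K, K) # v) = 0"
  using fuk unfolding filtered_unital_ainf_def by blast

lemma mu_linear:
  assumes "tpath A L (u @ (x, L') # v)" "tpath A L (u @ (y, L') # v)"
    "tpath A L (u @ (c \<odot> x + y, L') # v)"
  shows "mu A L (u @ (c \<odot> x + y, L') # v) = c \<odot> mu A L (u @ (x, L') # v) + mu A L (u @ (y, L') # v)"
  using fuk assms unfolding filtered_unital_ainf_def multilinear_on_def by blast

lemma Hom_total_iff:
  assumes "L \<in> Ob A" "L' \<in> Ob A"
  shows "x \<in> Hom_total A L L' \<longleftrightarrow> (\<forall>p. x p \<noteq> 0 \<longrightarrow> p \<in> both (gen L L'))"
proof
  assume "x \<in> Hom_total A L L'"
  then obtain y z where "x = y + z" "y \<in> Hom A L L' 0" "z \<in> Hom A L L' 1"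
    unfolding Hom_total_def by blast
  moreover from this have "y p = 0" if "p \<notin> gen L L' 0" for p
    using that Hom_iff[OF assms] by blast
  moreover from calculation have "z p = 0" if "p \<notin> gen L L' 1" for p
    using that Hom_iff[OF assms] by blast
  ultimately show "\<forall>p. x p \<noteq> 0 \<longrightarrow> p \<in> both (gen L L')"
    by (metis UnI1 UnI2 add.right_neutral plus_fun_apply)
next
  assume x: "\<forall>p. x p \<noteq> 0 \<longrightarrow> p \<in> both (gen L L')"
  have "x = (\<lambda>p. if p \<in> gen L L' 0 then x p else 0) + (\<lambda>p. if p \<in> gen L L' 0 then 0 else x p)"
    by (auto simp: fun_eq_iff)
  moreover have "(\<lambda>p. if p \<in> gen L L' 0 then x p else 0) \<in> Hom A L L' 0"
    "(\<lambda>p. if p \<in> gen L L' 0 then 0 else x p) \<in> Hom A L L' 1"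
    using x by (auto simp: Hom_iff[OF assms])
  ultimately show "x \<in> Hom_total A L L'" unfolding Hom_total_def by blast
qed

lemma Hom_sub_total: "L \<in> Ob A \<Longrightarrow> L' \<in> Ob A \<Longrightarrow> x \<in> Hom A L L' d \<Longrightarrow> x \<in> Hom_total A L L'"
  by (cases d rule: bit.exhaust) (auto simp: Hom_iff Hom_total_iff)

lemma hpath_tpath: "hpath A L as \<Longrightarrow> tpath A L as"
proof (induction as arbitrary: L)
  case (Cons a as)
  obtain x L' where a: "a = (x, L')" by (cases a)
  have "L' \<in> Ob A" using Cons.prems unfolding a by (cases as) auto
  then show ?case using Cons Hom_sub_total unfolding a by auto
qed simp

text \<open>Disjoint sets of even and odd generators leave a nonzero homogeneous vector only one
  degree. The zero vector lies in both and is assigned degree 0, which is why it is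
  excluded.\<close>

lemma deg_eq: "L \<in> Ob A \<Longrightarrow> L' \<in> Ob A \<Longrightarrow> x \<in> Hom A L L' d \<Longrightarrow> x \<noteq> 0 \<Longrightarrow> deg A L L' x = d"
proof -
  assume L: "L \<in> Ob A" "L' \<in> Ob A" and x: "x \<in> Hom A L L' d" and "x \<noteq> 0"
  then obtain p where p: "x p \<noteq> 0" by (metis ext zero_fun_apply)
  show ?thesis
  proof (cases "d = 0")
    case False
    then have "d = 1" by simp
    then have "p \<notin> gen L L' 0" using x p gen_disjoint[OF L] Hom_iff[OF L] by blast
    then show ?thesis using \<open>d = 1\<close> p Hom_iff[OF L] unfolding deg_def by auto
  qed (use x in \<open>auto simp: deg_def\<close>)
qed

lemma Hom_total_add: "L \<in> Ob A \<Longrightarrow> L' \<in> Ob A \<Longrightarrow> x \<in> Hom_total A L L' \<Longrightarrow> y \<in> Hom_total A L L' \<Longrightarrow>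
    x + y \<in> Hom_total A L L'"
  unfolding Hom_total_iff by (metis add_0 plus_fun_apply)

lemma Hom_total_scale: "L \<in> Ob A \<Longrightarrow> L' \<in> Ob A \<Longrightarrow> x \<in> Hom_total A L L' \<Longrightarrow> c \<odot> x \<in> Hom_total A L L'"
  by (auto simp: Hom_total_iff nscale_apply)

lemma Hom_total_zero: "L \<in> Ob A \<Longrightarrow> L' \<in> Ob A \<Longrightarrow> 0 \<in> Hom_total A L L'"
  by (auto simp: Hom_total_iff)

lemma Hom_zero: "L \<in> Ob A \<Longrightarrow> L' \<in> Ob A \<Longrightarrow> 0 \<in> Hom A L L' d"
  by (auto simp: Hom_iff)

lemma tpath_tgt: "tpath A L u \<Longrightarrow> tgt L u \<in> Ob A \<and> L \<in> Ob A"
proof (induction u arbitrary: L)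
  case (Cons a u)
  then show ?case by (cases a) auto
qed simp

lemma tpath_insert: "tpath A L (u @ (x, L') # v) \<longleftrightarrow>
    tpath A L u \<and> x \<in> Hom_total A (tgt L u) L' \<and> tpath A L' v"
  using tpath_tgt by (auto simp: tpath_append)

lemma mu_zero: "tpath A L (u @ (0, L') # v) \<Longrightarrow> mu A L (u @ (0, L') # v) = 0"
  using mu_linear[of L u 0 L' v 0 1] by (simp add: nscale_one)

lemma mu_zero_mem: "tpath A L as \<Longrightarrow> (0, L') \<in> set as \<Longrightarrow> mu A L as = 0"
  using mu_zero by (metis split_list)

lemma mu_expand_aux:
  assumes "tpath A L u" "tpath A L' v" "finite S" "S \<subseteq> both (gen (tgt L u) L')"
  shows "mu A L (u @ ((\<lambda>p. if p \<in> S then x p else 0), L') # v)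
    = (\<Sum>q\<in>S. x q \<odot> mu A L (u @ (unit_vec q, L') # v))"
  using assms(3,4)
proof (induction S rule: finite_induct)
  case empty
  have "mu A L (u @ (0, L') # v) = 0"
    by (rule mu_zero) (use assms tpath_tgt Hom_total_zero in \<open>auto simp: tpath_insert\<close>)
  then show ?case by (simp add: zero_fun_def)
next
  case (insert q S)
  have ob: "tgt L u \<in> Ob A" "L' \<in> Ob A" using assms tpath_tgt by auto
  have e: "(\<lambda>p. if p \<in> insert q S then x p else 0) = x q \<odot> unit_vec q + (\<lambda>p. if p \<in> S then x p else 0)"
    using insert.hyps by (auto simp: fun_eq_iff nscale_apply unit_vec_def)
  have "mu A L (u @ (x q \<odot> unit_vec q + (\<lambda>p. if p \<in> S then x p else 0), L') # v)
    = x q \<odot> mu A L (u @ (unit_vec q, L') # v) + mu A L (u @ ((\<lambda>p. if p \<in> S then x p else 0), L') # v)"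
    by (rule mu_linear)
       (use assms insert.prems ob in \<open>auto simp: tpath_insert Hom_total_iff unit_vec_def nscale_apply\<close>)
  then show ?case using insert e by simp
qed

text \<open>Finitely many generators make \<open>mu\<close>, as a function of one slot, a finite
  linear combination whose coefficients are the components of \<open>x\<close>. This is what later
  allows an infinite sum in that slot to be pulled out.\<close>

lemma mu_expand:
  assumes "tpath A L u" "tpath A L' v" "x \<in> Hom_total A (tgt L u) L'"
  shows "mu A L (u @ (x, L') # v) p
    = (\<Sum>q\<in>both (gen (tgt L u) L'). x q * mu A L (u @ (unit_vec q, L') # v) p)"
proof -
  have ob: "tgt L u \<in> Ob A" "L' \<in> Ob A" using assms tpath_tgt by auto
  let ?S = "both (gen (tgt L u) L')"
  have fin: "finite ?S" using gen_finite[OF ob] by simp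
  have "x = (\<lambda>p. if p \<in> ?S then x p else 0)"
    using assms(3) Hom_total_iff[OF ob] by (auto simp: fun_eq_iff)
  then have "mu A L (u @ (x, L') # v) = (\<Sum>q\<in>?S. x q \<odot> mu A L (u @ (unit_vec q, L') # v))"
    using mu_expand_aux[OF assms(1,2) fin, of x] by simp
  then show ?thesis by (simp add: sum_fun_apply nscale_apply)
qed

end

section \<open>Strings between deformed objects\<close>

locale deformed_objects = filtered_ainf A gen
  for A :: "('o, 'p \<Rightarrow> novikov) ainf_category" and gen :: "'o \<Rightarrow> 'o \<Rightarrow> bit \<Rightarrow> 'p set" +
  fixes \<D> :: "('o \<times> ('p \<Rightarrow> novikov)) set"
  assumes obj: "Z \<in> \<D> \<Longrightarrow> fst Z \<in> Ob A"
    and odd: "Z \<in> \<D> \<Longrightarrow> snd Z \<in> Hom A (fst Z) (fst Z) 1"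
begin

text \<open>Strings running through pairs in \<open>\<D>\<close>: convergence and linearity are
  available for the arbitrary letters of \<open>dtp\<close>, while degrees and signs need the
  homogeneous letters of \<open>dhp\<close>.\<close>

definition dtp :: "'o \<times> ('p \<Rightarrow> novikov) \<Rightarrow> (('p \<Rightarrow> novikov) \<times> 'o \<times> ('p \<Rightarrow> novikov)) list \<Rightarrow> bool" where
  "dtp Z as \<longleftrightarrow> Z \<in> \<D> \<and> snd ` set as \<subseteq> \<D> \<and> tpath A (fst Z) (proj as)"

definition dhp :: "'o \<times> ('p \<Rightarrow> novikov) \<Rightarrow> (('p \<Rightarrow> novikov) \<times> 'o \<times> ('p \<Rightarrow> novikov)) list \<Rightarrow> bool" where
  "dhp Z as \<longleftrightarrow> Z \<in> \<D> \<and> snd ` set as \<subseteq> \<D> \<and> hpath A (fst Z) (proj as)"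

lemma dtp_Nil [simp]: "dtp Z [] \<longleftrightarrow> Z \<in> \<D>"
  by (auto simp: dtp_def obj)

lemma dtp_Cons [simp]: "dtp Z ((x, Z') # as) \<longleftrightarrow>
    Z \<in> \<D> \<and> x \<in> Hom_total A (fst Z) (fst Z') \<and> dtp Z' as"
  by (auto simp: dtp_def obj)

lemma dhp_Nil [simp]: "dhp Z [] \<longleftrightarrow> Z \<in> \<D>"
  by (auto simp: dhp_def obj)

lemma dhp_Cons [simp]: "dhp Z ((x, Z') # as) \<longleftrightarrow>
    Z \<in> \<D> \<and> (\<exists>d. x \<in> Hom A (fst Z) (fst Z') d) \<and> dhp Z' as"
  by (auto simp: dhp_def obj)

lemma dhp_dtp: "dhp Z as \<Longrightarrow> dtp Z as"
  using hpath_tpath by (auto simp: dhp_def dtp_def)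

lemma dtp_start: "dtp Z as \<Longrightarrow> Z \<in> \<D>" by (simp add: dtp_def)

lemma dtp_append: "dtp Z (u @ v) \<longleftrightarrow> dtp Z u \<and> dtp (tgt Z u) v"
proof (induction u arbitrary: Z)
  case Nil
  then show ?case by (auto dest: dtp_start)
next
  case (Cons a u)
  then show ?case by (cases a) auto
qed

lemma dhp_append: "dhp Z (u @ v) \<longleftrightarrow> dhp Z u \<and> dhp (tgt Z u) v"
proof (induction u arbitrary: Z)
  case Nil
  then show ?case by (auto simp: dhp_def obj)
next
  case (Cons a u)
  then show ?case by (cases a) auto
qed

lemma dtp_tgt: "dtp Z u \<Longrightarrow> tgt Z u \<in> \<D>"
proof (induction u arbitrary: Z)
  case (Cons a u)
  then show ?case by (cases a) auto
qed simp

lemma dtp_insert: "dtp Z (u @ (x, Z') # v) \<longleftrightarrow>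
    dtp Z u \<and> x \<in> Hom_total A (fst (tgt Z u)) (fst Z') \<and> dtp Z' v"
  by (auto simp: dtp_append dest: dtp_tgt)

lemma tgt_spell: "tgt (fst Z) (spell Z s) = fst (tgt Z (unmark s))"
  by (induction Z s rule: spell.induct) auto

lemma tpath_spell: "dtp Z (unmark s) \<Longrightarrow> tpath A (fst Z) (spell Z s)"
proof (induction Z s rule: spell.induct)
  case (2 Z s)
  then have "Z \<in> \<D>" using dtp_start by simp
  then show ?case using 2 obj[of Z] odd[of Z] Hom_sub_total by auto
qed (auto simp: obj)

lemma hpath_spell: "dhp Z (unmark s) \<Longrightarrow> hpath A (fst Z) (spell Z s)"
proof (induction Z s rule: spell.induct)
  case (2 Z s)
  then have "Z \<in> \<D>" by (simp add: dhp_def)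
  then show ?case using 2 obj[of Z] odd[of Z] by auto
qed (auto simp: obj)

text \<open>An odd insertion has shifted degree 0 and leaves the sign alone. The exception is a zero
  deformation element, which counts as even; but then the string contains a zero letter and its
  operation vanishes.\<close>

lemma sdeg_spell:
  "dtp Z (unmark s) \<Longrightarrow> sdeg A (fst Z) (spell Z s) = ddeg A Z (unmark s) \<or> (\<exists>K. (0, K) \<in> set (spell Z s))"
proof (induction Z s rule: spell.induct)
  case (2 Z s)
  then have Z: "Z \<in> \<D>" using dtp_start by simp
  then consider "snd Z = 0" | "deg A (fst Z) (fst Z) (snd Z) = 1"
    using deg_eq obj odd by blast
  then show ?case
  proof cases
    case 1
    then have "(0, fst Z) \<in> set (spell Z (None # s))" by simp
    then show ?thesis by blast
  next
    case 2
    show ?thesis using "2.IH" "2.prems" 2 by simp (metis insert_iff)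
  qed
qed auto

end

section \<open>Sums over insertions\<close>

locale deformed_ainf = deformed_objects A gen \<D>
  for A :: "('o, 'p \<Rightarrow> novikov) ainf_category" and gen :: "'o \<Rightarrow> 'o \<Rightarrow> bit \<Rightarrow> 'p set"
    and \<D> :: "('o \<times> ('p \<Rightarrow> novikov)) set" +
  assumes conv: "insertions_converge A \<D>"
begin

lemma vanishing_mu_spell:
  assumes "dtp Z as"
  shows "vanishing (\<lambda>s. mu A (fst Z) (spell Z s) p) (marked as)"
proof -
  have "(\<lambda>ns. mu A (fst Z) (insert_b Z as ns) p) summable_on {ns. length ns = Suc (length as)}"
    using conv assms unfolding insertions_converge_def dtp_def proj_def by blast
  then show ?thesis
    using vanishing_reindex[OF bij_betw_mark, of "\<lambda>s. mu A (fst Z) (spell Z s) p" as]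
    by (simp add: summable_on_novikov_iff spell_mark)
qed

lemma dmu_marked: "dmu A Z as p = infsum (\<lambda>s. mu A (fst Z) (spell Z s) p) (marked as)"
  unfolding dmu_def spell_mark[symmetric] by (rule infsum_reindex_bij_betw[OF bij_betw_mark])

lemma dmu_insert:
  assumes "dtp Z (u @ (x, Z') # v)"
  shows "vanishing (\<lambda>(s, t). mu A (fst Z) (spell Z s @ (x, fst Z') # spell Z' t) p) (marked u \<times> marked v)"
    (is ?V)
    and "dmu A Z (u @ (x, Z') # v) p =
      infsum (\<lambda>(s, t). mu A (fst Z) (spell Z s @ (x, fst Z') # spell Z' t) p) (marked u \<times> marked v)"
proof -
  let ?g = "\<lambda>(s, t). mu A (fst Z) (spell Z (s @ Some (x, Z') # t)) p"
  have eq: "?g y = (\<lambda>(s, t). mu A (fst Z) (spell Z s @ (x, fst Z') # spell Z' t) p) y"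
    if "y \<in> marked u \<times> marked v" for y
    using that by (auto simp: spell_append)
  have "vanishing ?g (marked u \<times> marked v)"
    using vanishing_mu_spell[OF assms, of p]
      vanishing_reindex[OF bij_betw_marked_Cons, of "\<lambda>s. mu A (fst Z) (spell Z s) p"]
    by (simp add: case_prod_beta')
  then show ?V by (rule vanishing_mono) (simp only: eq)
  have "dmu A Z (u @ (x, Z') # v) p = infsum ?g (marked u \<times> marked v)"
    unfolding dmu_marked infsum_reindex_bij_betw[OF bij_betw_marked_Cons, symmetric]
    by (simp add: case_prod_beta')
  also have "\<dots> = infsum (\<lambda>(s, t). mu A (fst Z) (spell Z s @ (x, fst Z') # spell Z' t) p) (marked u \<times> marked v)"
    by (rule infsum_cong) (rule eq)
  finally show "dmu A Z (u @ (x, Z') # v) p = \<dots>" .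
qed

text \<open>Expansion in generators holds for each pattern of insertions, and a finite sum may be
  exchanged with the sum over patterns. Linearity of \<open>dmu\<close> in every slot is a
  corollary.\<close>

lemma dmu_expand:
  assumes "dtp Z u" "x \<in> Hom_total A (fst (tgt Z u)) (fst Z')" "dtp Z' v"
  shows "dmu A Z (u @ (x, Z') # v) p =
    (\<Sum>q\<in>both (gen (fst (tgt Z u)) (fst Z')). x q * dmu A Z (u @ (unit_vec q, Z') # v) p)"
proof -
  let ?Q = "both (gen (fst (tgt Z u)) (fst Z'))"
  let ?f = "\<lambda>x (s, t). mu A (fst Z) (spell Z s @ (x, fst Z') # spell Z' t) p"
  have ob: "fst (tgt Z u) \<in> Ob A" "fst Z' \<in> Ob A" using assms dtp_tgt dtp_start obj by auto
  have fin: "finite ?Q" using gen_finite[OF ob] by simp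
  have q: "dtp Z (u @ (unit_vec q, Z') # v)" if "q \<in> ?Q" for q
    using assms that by (auto simp: dtp_insert Hom_total_iff[OF ob] unit_vec_def)
  have van: "vanishing (?f (unit_vec q)) (marked u \<times> marked v)" if "q \<in> ?Q" for q
    using dmu_insert(1)[OF q[OF that]] .
  have "dmu A Z (u @ (x, Z') # v) p = infsum (?f x) (marked u \<times> marked v)"
    by (rule dmu_insert(2)) (use assms in \<open>simp add: dtp_insert\<close>)
  also have "\<dots> = infsum (\<lambda>y. \<Sum>q\<in>?Q. x q * ?f (unit_vec q) y) (marked u \<times> marked v)"
  proof (rule infsum_cong, clarify)
    fix s t assume "u = unmark s" "v = unmark t"
    then show "mu A (fst Z) (spell Z s @ (x, fst Z') # spell Z' t) p
      = (\<Sum>q\<in>both (gen (fst (tgt Z (unmark s))) (fst Z')).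
          x q * mu A (fst Z) (spell Z s @ (unit_vec q, fst Z') # spell Z' t) p)"
      using mu_expand[of "fst Z" "spell Z s" "fst Z'" "spell Z' t" x p] assms
      by (simp add: tgt_spell tpath_spell)
  qed
  also have "\<dots> = (\<Sum>q\<in>?Q. infsum (\<lambda>y. x q * ?f (unit_vec q) y) (marked u \<times> marked v))"
    by (rule infsum_novikov_sum[OF fin]) (rule vanishing_cmult[OF van])
  also have "\<dots> = (\<Sum>q\<in>?Q. x q * dmu A Z (u @ (unit_vec q, Z') # v) p)"
    by (intro sum.cong refl) (simp add: infsum_novikov_cmult[OF van] dmu_insert(2)[OF q])
  finally show ?thesis .
qed

lemma dmu_linear:
  assumes "dtp Z u" "x \<in> Hom_total A (fst (tgt Z u)) (fst Z')" "y \<in> Hom_total A (fst (tgt Z u)) (fst Z')"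
    "dtp Z' v"
  shows "dmu A Z (u @ (c \<odot> x + y, Z') # v) = c \<odot> dmu A Z (u @ (x, Z') # v) + dmu A Z (u @ (y, Z') # v)"
proof
  fix p
  have ob: "fst (tgt Z u) \<in> Ob A" "fst Z' \<in> Ob A" using assms dtp_tgt dtp_start obj by auto
  have t: "c \<odot> x + y \<in> Hom_total A (fst (tgt Z u)) (fst Z')"
    using assms ob Hom_total_add Hom_total_scale by simp
  show "dmu A Z (u @ (c \<odot> x + y, Z') # v) p
    = (c \<odot> dmu A Z (u @ (x, Z') # v) + dmu A Z (u @ (y, Z') # v)) p"
    by (simp add: dmu_expand[OF assms(1) t assms(4)] dmu_expand[OF assms(1,2,4)]
        dmu_expand[OF assms(1,3,4)] nscale_apply ring_distribs sum.distrib sum_distrib_left mult.assoc)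
qed

lemma dmu_add:
  assumes "dtp Z u" "x \<in> Hom_total A (fst (tgt Z u)) (fst Z')" "y \<in> Hom_total A (fst (tgt Z u)) (fst Z')"
    "dtp Z' v"
  shows "dmu A Z (u @ (x + y, Z') # v) = dmu A Z (u @ (x, Z') # v) + dmu A Z (u @ (y, Z') # v)"
  using dmu_linear[OF assms, of 1] by (simp add: nscale_one)

lemma dmu_zero: "dtp Z u \<Longrightarrow> dtp Z' v \<Longrightarrow> dmu A Z (u @ (0, Z') # v) = 0"
  using dmu_linear[of Z u 0 Z' 0 v 1] Hom_total_zero dtp_tgt dtp_start obj
  by (simp add: nscale_one)

lemma dmu_zero_mem: "dtp Z as \<Longrightarrow> (0, Z') \<in> set as \<Longrightarrow> dmu A Z as = 0"
  using dmu_zero dtp_insert by (metis split_list)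

lemma dmu_scale:
  assumes "dtp Z u" "x \<in> Hom_total A (fst (tgt Z u)) (fst Z')" "dtp Z' v"
  shows "dmu A Z (u @ (c \<odot> x, Z') # v) = c \<odot> dmu A Z (u @ (x, Z') # v)"
  using dmu_linear[OF assms(1,2) _ assms(3), of 0 c] Hom_total_zero dtp_tgt dtp_start obj assms
  by (simp add: dmu_zero)

text \<open>A written-out string either has the shifted degree of the original one or contains a
  zero letter, in which case it contributes nothing to the sum.\<close>

lemma dmu_degree:
  assumes "dhp Z as"
  shows "dmu A Z as \<in> Hom A (fst Z) (fst (tgt Z as)) (ddeg A Z as)"
proof -
  have ob: "fst Z \<in> Ob A" "fst (tgt Z as) \<in> Ob A"
    using dhp_dtp[OF assms] dtp_start dtp_tgt obj by auto
  have "mu A (fst Z) (spell Z s) \<in> Hom A (fst Z) (fst (tgt Z as)) (ddeg A Z as)" if "s \<in> marked as" for s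
  proof -
    have s: "dhp Z (unmark s)" "unmark s = as" using assms that by auto
    consider "sdeg A (fst Z) (spell Z s) = ddeg A Z as" | K where "(0, K) \<in> set (spell Z s)"
      using sdeg_spell[OF dhp_dtp[OF s(1)]] s(2) by auto
    then show ?thesis
    proof cases
      case 1
      then show ?thesis using mu_degree[OF hpath_spell[OF s(1)]] s(2) by (simp add: tgt_spell)
    next
      case 2
      then have "mu A (fst Z) (spell Z s) = 0"
        using mu_zero_mem tpath_spell dhp_dtp s(1) by blast
      then show ?thesis using Hom_zero[OF ob] by simp
    qed
  qed
  then have z: "mu A (fst Z) (spell Z s) p = 0" if "s \<in> marked as" "p \<notin> gen (fst Z) (fst (tgt Z as)) (ddeg A Z as)" for s p
    using that Hom_iff[OF ob] by blast
  have "dmu A Z as p = 0" if "p \<notin> gen (fst Z) (fst (tgt Z as)) (ddeg A Z as)" for p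
    unfolding dmu_marked by (rule infsum_0) (rule z[OF _ that])
  then show ?thesis unfolding Hom_iff[OF ob] by blast
qed

text \<open>The analytic core of the deformed relation: outer and inner insertions merge into one
  summable family. After expanding the inner value in finitely many generators, the terms are a
  finite sum of products of an outer and an inner vanishing family.\<close>

lemma dmu_compose:
  fixes Z u v w p
  defines "Z1 \<equiv> tgt Z u" and "Z2 \<equiv> tgt (tgt Z u) v"
  defines "t \<equiv> \<lambda>(s1, s2, s3).
    mu A (fst Z) (spell Z s1 @ (mu A (fst Z1) (spell Z1 s2), fst Z2) # spell Z2 s3) p"
  assumes u: "dtp Z u" and v: "dhp Z1 v" and w: "dtp Z2 w"
  shows "vanishing t (marked u \<times> marked v \<times> marked w)"
    and "infsum t (marked u \<times> marked v \<times> marked w) = dmu A Z (u @ (dmu A Z1 v, Z2) # w) p"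
proof -
  have D: "Z \<in> \<D>" "Z1 \<in> \<D>" "Z2 \<in> \<D>"
    using u w dtp_start dhp_dtp[OF v] by blast+
  have Z2: "Z2 = tgt Z1 v" by (simp add: Z1_def Z2_def)
  let ?Q = "both (gen (fst Z1) (fst Z2))"
  have ob: "fst Z1 \<in> Ob A" "fst Z2 \<in> Ob A" using D obj by auto
  have fin: "finite ?Q" using gen_finite[OF ob] by simp
  let ?F = "\<lambda>q (s1, s3). mu A (fst Z) (spell Z s1 @ (unit_vec q, fst Z2) # spell Z2 s3) p"
  let ?G = "\<lambda>q s2. mu A (fst Z1) (spell Z1 s2) q"
  let ?t = "\<lambda>y. \<Sum>q\<in>?Q. (\<lambda>(x, y). ?F q x * ?G q y) y"
  \<comment> \<open>The product of the two families is indexed by the outer pair followed by the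
    inner string; \<open>?h\<close> restores the order of the string.\<close>
  let ?h = "\<lambda>((s1, s3), s2). (s1, s2, s3)"
  have q: "dtp Z (u @ (unit_vec q, Z2) # w)" if "q \<in> ?Q" for q
    using that u w by (auto simp: dtp_insert Z1_def[symmetric] Hom_total_iff[OF ob] unit_vec_def)
  have vF: "vanishing (?F q) (marked u \<times> marked w)" if "q \<in> ?Q" for q
    using dmu_insert(1)[OF q[OF that]] .
  have vG: "vanishing (?G q) (marked v)" for q
    using vanishing_mu_spell[OF dhp_dtp[OF v]] .
  have bij: "bij_betw ?h ((marked u \<times> marked w) \<times> marked v) (marked u \<times> marked v \<times> marked w)"
    by (rule bij_betwI[of _ _ _ "\<lambda>(s1, s2, s3). ((s1, s3), s2)"]) auto
  have eq: "t (?h y) = ?t y" if y: "y \<in> (marked u \<times> marked w) \<times> marked v" for y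
  proof -
    obtain s1 s2 s3 where s: "y = ((s1, s3), s2)" "u = unmark s1" "w = unmark s3" "v = unmark s2"
      using y by auto
    have "mu A (fst Z1) (spell Z1 s2) \<in> Hom_total A (fst Z1) (fst Z2)"
      using mu_degree[OF hpath_spell[of Z1 s2]] v s Hom_sub_total[OF ob] by (simp add: tgt_spell Z2)
    then have "t (s1, s2, s3) = (\<Sum>q\<in>?Q. ?G q s2 * ?F q (s1, s3))"
      using mu_expand[of "fst Z" "spell Z s1" "fst Z2" "spell Z2 s3" "mu A (fst Z1) (spell Z1 s2)" p]
        u w tpath_spell s
      by (simp add: t_def tgt_spell Z1_def)
    then show ?thesis using s(1) by (simp add: mult.commute)
  qed
  have van: "vanishing ?t ((marked u \<times> marked w) \<times> marked v)"
    by (rule vanishing_sum[OF fin]) (rule vanishing_product[OF vF vG])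
  then have "vanishing (\<lambda>y. t (?h y)) ((marked u \<times> marked w) \<times> marked v)"
    by (rule vanishing_mono) (simp only: eq)
  then show "vanishing t (marked u \<times> marked v \<times> marked w)"
    by (simp only: vanishing_reindex[OF bij])
  have "dmu A Z1 v \<in> Hom_total A (fst Z1) (fst Z2)"
    using dmu_degree[OF v] Hom_sub_total[OF ob] by (simp add: Z2)
  then have "dmu A Z (u @ (dmu A Z1 v, Z2) # w) p
    = (\<Sum>q\<in>?Q. dmu A Z1 v q * dmu A Z (u @ (unit_vec q, Z2) # w) p)"
    unfolding Z1_def by (rule dmu_expand[OF u _ w])
  also have "\<dots> = (\<Sum>q\<in>?Q. infsum (\<lambda>(x, y). ?F q x * ?G q y) ((marked u \<times> marked w) \<times> marked v))"
  proof (rule sum.cong[OF refl])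
    fix r assume r: "r \<in> ?Q"
    show "dmu A Z1 v r * dmu A Z (u @ (unit_vec r, Z2) # w) p =
        infsum (\<lambda>(x, y). ?F r x * ?G r y) ((marked u \<times> marked w) \<times> marked v)"
      unfolding infsum_novikov_product[OF vF[OF r] vG] dmu_insert(2)[OF q[OF r]] dmu_marked[of Z1]
      by (rule mult.commute)
  qed
  also have "\<dots> = infsum ?t ((marked u \<times> marked w) \<times> marked v)"
    by (rule infsum_novikov_sum[OF fin, symmetric]) (rule vanishing_product[OF vF vG])
  also have "\<dots> = infsum (\<lambda>y. t (?h y)) ((marked u \<times> marked w) \<times> marked v)"
    by (rule infsum_cong) (rule eq[symmetric])
  also have "\<dots> = infsum t (marked u \<times> marked v \<times> marked w)"
    by (rule infsum_reindex_bij_betw[OF bij])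
  finally show "infsum t (marked u \<times> marked v \<times> marked w) = dmu A Z (u @ (dmu A Z1 v, Z2) # w) p" ..
qed

end

lemma psgn_scale: "psgn d (x :: novikov) = psgn d 1 * x"
  by (simp add: psgn_def)

lemma vanishing_psgn: "vanishing f I \<Longrightarrow> vanishing (\<lambda>i. psgn d (f i)) I"
  by (subst psgn_scale) (rule vanishing_cmult)

lemma infsum_novikov_psgn: "vanishing f I \<Longrightarrow> infsum (\<lambda>i. psgn d (f i)) I = psgn d (infsum f I)"
  by (subst (1 2) psgn_scale) (rule infsum_novikov_cmult)

lemma length_unmark: "length (unmark s) \<le> length s"
  by (induction s rule: unmark.induct) auto

lemma map_Some_unmark: "None \<notin> set s \<Longrightarrow> map Some (unmark s) = s"
  by (induction s rule: unmark.induct) auto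

lemma length_unmark_less: "None \<in> set s \<Longrightarrow> length (unmark s) < length s"
  by (induction s rule: unmark.induct) (use length_unmark in \<open>auto simp: less_Suc_eq_le\<close>)

lemma unmark_eq_Nil: "unmark s = [] \<longleftrightarrow> (\<exists>j. s = replicate j None)"
proof
  show "unmark s = [] \<Longrightarrow> \<exists>j. s = replicate j None"
  proof (induction s rule: unmark.induct)
    case (2 s)
    then obtain j where "s = replicate j None" by auto
    then show ?case by (intro exI[of _ "Suc j"]) simp
  qed auto
qed auto

lemma spell_map_Some: "spell Z (map Some as) = proj as"
  by (induction as arbitrary: Z) auto

text \<open>Objects without deformation enter deformed strings with deformation element 0.\<close>

definition lift :: "('m \<times> 'o) list \<Rightarrow> ('m :: zero \<times> 'o \<times> 'm) list" where
  "lift = map (\<lambda>(a, K). (a, (K, 0)))"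

lemma lift_simps [simp]:
  "lift [] = []" "lift ((a, K) # as) = (a, (K, 0)) # lift as" "lift (u @ v) = lift u @ lift v"
  "lift as = [] \<longleftrightarrow> as = []" "length (lift as) = length as"
  by (simp_all add: lift_def)

lemma proj_lift [simp]: "proj (lift as) = as"
  by (induction as) auto

lemma tgt_lift [simp]: "tgt (L, 0) (lift as) = (tgt L as, 0)"
  by (induction L as rule: tgt.induct) auto

context deformed_ainf
begin

text \<open>One summable family \<open>T\<close>, indexed by three consecutive marked strings, is
  summed in two ways: one grouping gives the left-hand side, the other a sum of undeformed
  relations.\<close>

lemma dmu_relation:
  assumes as: "dhp Z as"
  shows "(\<Sum>(u, v, w)\<in>splits3 as. psgn (ddeg A Z u)
    (dmu A Z (u @ (dmu A (tgt Z u) v, tgt (tgt Z u) v) # w))) = 0"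
proof
  fix p
  define t where "t = (\<lambda>Z1 Z2 (s1, s2, s3).
    mu A (fst Z) (spell Z s1 @ (mu A (fst Z1) (spell Z1 s2), fst Z2) # spell Z2 s3) p)"
  define T where "T = (\<lambda>(s1, s2, s3). psgn (ddeg A Z (unmark s1))
    (t (tgt Z (unmark s1)) (tgt (tgt Z (unmark s1)) (unmark s2)) (s1, s2, s3)))"
  define K where "K = {(s1, s2, s3). unmark (s1 @ s2 @ s3) = as}"
  define block where "block = (\<lambda>(u :: (('p \<Rightarrow> novikov) \<times> 'o \<times> ('p \<Rightarrow> novikov)) list,
      v :: (('p \<Rightarrow> novikov) \<times> 'o \<times> ('p \<Rightarrow> novikov)) list,
      w :: (('p \<Rightarrow> novikov) \<times> 'o \<times> ('p \<Rightarrow> novikov)) list).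
    marked u \<times> marked v \<times> marked w)"
  define h where "h = (\<lambda>(s1 :: (('p \<Rightarrow> novikov) \<times> 'o \<times> ('p \<Rightarrow> novikov)) option list,
      s2 :: (('p \<Rightarrow> novikov) \<times> 'o \<times> ('p \<Rightarrow> novikov)) option list,
      s3 :: (('p \<Rightarrow> novikov) \<times> 'o \<times> ('p \<Rightarrow> novikov)) option list).
    (unmark s1, unmark s2, unmark s3))"
  define g where "g = (\<lambda>(s1, s2, s3). s1 @ s2 @ (s3 :: (('p \<Rightarrow> novikov) \<times> 'o \<times> ('p \<Rightarrow> novikov)) option list))"
  have path: "dtp Z u" "dhp (tgt Z u) v" "dtp (tgt (tgt Z u) v) w" if "(u, v, w) \<in> splits3 as" for u v w
    using that as by (auto simp: splits3_def dhp_append intro: dhp_dtp)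
  have T: "T y = psgn (ddeg A Z u) (t (tgt Z u) (tgt (tgt Z u) v) y)" if "y \<in> block (u, v, w)" for u v w y
    using that by (auto simp: T_def block_def)
  have van: "vanishing (\<lambda>y. psgn (ddeg A Z u) (t (tgt Z u) (tgt (tgt Z u) v) y)) (block (u, v, w))"
    if "(u, v, w) \<in> splits3 as" for u v w
    unfolding block_def t_def prod.case by (rule vanishing_psgn) (rule dmu_compose(1)[OF path[OF that]])
  have vanT: "vanishing T (block x)" if "x \<in> splits3 as" for x
  proof -
    obtain u v w where x: "x = (u, v, w)" by (cases x)
    show ?thesis
      using van[of u v w] that unfolding x by (rule_tac vanishing_mono) (auto simp only: T)
  qed
  have K: "K = (\<Union>x\<in>splits3 as. block x)"
    unfolding K_def block_def splits3_def by auto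
  have vK: "vanishing T K"
    unfolding K by (rule vanishing_UN[OF finite_splits3 vanT])
  have fibre_h: "{k \<in> K. h k = x} = block x" if "x \<in> splits3 as" for x
    using that unfolding K_def h_def block_def splits3_def by auto
  have fibre_g: "{k \<in> K. g k = s} = splits3 s" if "s \<in> marked as" for s
    using that unfolding K_def g_def splits3_def by auto
  \<comment> \<open>Grouping by the underlying split of \<open>as\<close>: each fibre is a product
    of sets of marked strings, to which \<open>dmu_compose\<close> applies.\<close>
  have "infsum T K = infsum (\<lambda>x. infsum T {k \<in> K. h k = x}) (splits3 as)"
    by (rule infsum_fibres[OF vK, symmetric]) (auto simp: K_def h_def splits3_def)
  also have "\<dots> = (\<Sum>x\<in>splits3 as. infsum T {k \<in> K. h k = x})"
    by (simp only: infsum_finite finite_splits3)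
  also have "\<dots> = (\<Sum>(u, v, w)\<in>splits3 as. psgn (ddeg A Z u)
      (dmu A Z (u @ (dmu A (tgt Z u) v, tgt (tgt Z u) v) # w) p))"
  proof (rule sum.cong[OF refl])
    fix x assume x: "x \<in> splits3 as"
    obtain u v w where uvw: "x = (u, v, w)" by (cases x)
    have "infsum T {k \<in> K. h k = x} = infsum T (block (u, v, w))"
      using fibre_h[OF x] uvw by simp
    also have "\<dots> = infsum (\<lambda>y. psgn (ddeg A Z u) (t (tgt Z u) (tgt (tgt Z u) v) y)) (block (u, v, w))"
      by (rule infsum_cong) (rule T)
    also have "\<dots> = psgn (ddeg A Z u) (infsum (t (tgt Z u) (tgt (tgt Z u) v)) (block (u, v, w)))"
      unfolding block_def t_def prod.case
      by (rule infsum_novikov_psgn) (rule dmu_compose(1)[OF path[OF x[unfolded uvw]]])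
    also have "infsum (t (tgt Z u) (tgt (tgt Z u) v)) (block (u, v, w)) =
        dmu A Z (u @ (dmu A (tgt Z u) v, tgt (tgt Z u) v) # w) p"
      unfolding block_def t_def prod.case by (rule dmu_compose(2)[OF path[OF x[unfolded uvw]]])
    finally show "infsum T {k \<in> K. h k = x} = (case x of (u, v, w) \<Rightarrow> psgn (ddeg A Z u)
      (dmu A Z (u @ (dmu A (tgt Z u) v, tgt (tgt Z u) v) # w) p))"
      by (simp add: uvw)
  qed
  finally have 1: "infsum T K = \<dots>" .
  \<comment> \<open>Grouping by the concatenated string instead: the fibre over \<open>s\<close> is
    the finite set of its splits, and its sum is the undeformed relation for
    \<open>spell Z s\<close>.\<close>
  have "infsum T K = infsum (\<lambda>s. infsum T {k \<in> K. g k = s}) (marked as)"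
    by (rule infsum_fibres[OF vK, symmetric]) (auto simp: K_def g_def)
  also have "\<dots> = 0"
  proof (rule infsum_0)
    fix s assume s: "s \<in> marked as"
    have us: "unmark s = as" using s by simp
    have "infsum T {k \<in> K. g k = s} = (\<Sum>k\<in>splits3 s. T k)"
      unfolding fibre_g[OF s] by (simp only: infsum_finite finite_splits3)
    also have "\<dots> = (\<Sum>(s1, s2, s3)\<in>splits3 s. psgn (sdeg A (fst Z) (spell Z s1))
       (mu A (fst Z) (contract A (fst Z) (spell Z s1) (spell (tgt Z (unmark s1)) s2)
          (spell (tgt Z (unmark (s1 @ s2))) s3)) p))"
    proof (rule sum.cong[OF refl])
      fix x assume x: "x \<in> splits3 s"
      obtain s1 s2 s3 where sss: "x = (s1, s2, s3)" by (cases x)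
      have s3: "s = s1 @ s2 @ s3" using x sss by (auto simp: splits3_def)
      define Z1 where "Z1 = tgt Z (unmark s1)"
      define Z2 where "Z2 = tgt Z1 (unmark s2)"
      have paths: "dhp Z (unmark s1)" "dhp Z1 (unmark s2)" "dhp Z2 (unmark s3)"
        using as us s3 by (auto simp: dhp_append Z1_def Z2_def)
      have ob: "fst Z1 \<in> Ob A" "fst Z2 \<in> Ob A"
        using paths(2,3) obj by (auto simp: dhp_def)
      have tp: "tpath A (fst Z) (spell Z s1 @ (mu A (fst Z1) (spell Z1 s2), fst Z2) # spell Z2 s3)"
        unfolding tpath_insert
        using paths tpath_spell dhp_dtp mu_degree[OF hpath_spell[OF paths(2)]] Hom_sub_total[OF ob]
        by (auto simp: tgt_spell Z1_def[symmetric] Z2_def[symmetric])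
      \<comment> \<open>The undeformed relation uses the degree of the written-out string. It can
        differ from that of the original string only after insertion of a zero letter, and then the
        term is zero.\<close>
      consider "sdeg A (fst Z) (spell Z s1) = ddeg A Z (unmark s1)"
        | L where "(0, L) \<in> set (spell Z s1)"
        using sdeg_spell[OF dhp_dtp[OF paths(1)]] by blast
      then have "psgn (ddeg A Z (unmark s1)) (t Z1 Z2 (s1, s2, s3)) = psgn (sdeg A (fst Z) (spell Z s1)) (t Z1 Z2 (s1, s2, s3))"
      proof cases
        case 2
        then have "t Z1 Z2 (s1, s2, s3) = 0" using mu_zero_mem[OF tp, of L] by (simp add: t_def)
        then show ?thesis by simp
      qed simp
      then show "T x = (case x of (s1, s2, s3) \<Rightarrow> psgn (sdeg A (fst Z) (spell Z s1))
       (mu A (fst Z) (contract A (fst Z) (spell Z s1) (spell (tgt Z (unmark s1)) s2)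
          (spell (tgt Z (unmark (s1 @ s2))) s3)) p))"
        unfolding sss T_def prod.case contract_def t_def Z1_def Z2_def
        by (simp add: tgt_spell)
    qed
    also have "\<dots> = (\<Sum>(u, v, w)\<in>splits3 (spell Z s). psgn (sdeg A (fst Z) u)
       (mu A (fst Z) (contract A (fst Z) u v w) p))"
      by (rule sum_splits3_spell[symmetric])
    also have "\<dots> = (\<Sum>(u, v, w)\<in>splits3 (spell Z s). psgn (sdeg A (fst Z) u)
       (mu A (fst Z) (contract A (fst Z) u v w))) p"
      by (simp add: sum_fun_apply case_prod_beta' psgn_apply)
    also have "\<dots> = 0"
      using mu_relation[OF hpath_spell[of Z s]] as us by simp
    finally show "infsum T {k \<in> K. g k = s} = 0" .
  qed
  finally show "(\<Sum>(u, v, w)\<in>splits3 as. psgn (ddeg A Z u)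
    (dmu A Z (u @ (dmu A (tgt Z u) v, tgt (tgt Z u) v) # w))) p = 0 p"
    using 1 by (simp add: sum_fun_apply case_prod_beta' psgn_apply)
qed

lemma dmu_single:
  assumes "\<And>s. s \<in> marked as \<Longrightarrow> None \<in> set s \<Longrightarrow> mu A (fst Z) (spell Z s) = 0"
  shows "dmu A Z as = mu A (fst Z) (proj as)"
proof
  fix p
  have "dmu A Z as p = infsum (\<lambda>s. mu A (fst Z) (spell Z s) p) {map Some as}"
    unfolding dmu_marked
  proof (rule infsum_cong_neutral)
    fix s assume "s \<in> marked as - {map Some as}"
    then have "s \<in> marked as" "s \<noteq> map Some (unmark s)" by auto
    moreover from this have "None \<in> set s" using map_Some_unmark[of s] by metis
    ultimately show "mu A (fst Z) (spell Z s) p = 0" using assms by simp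
  qed auto
  then show "dmu A Z as p = mu A (fst Z) (proj as) p" by (simp add: spell_map_Some)
qed

text \<open>The unit axiom spares only operations with exactly two inputs, so the length of the
  written-out string decides. Consequently two letters besides the unit kill every term of
  \<open>dmu\<close>, and one letter leaves only the term without insertions.\<close>

lemma spell_unit_zero:
  assumes "dtp Z (u @ (unit_of A (fst Z'), Z') # v)" "fst Z' = fst (tgt Z u)"
    "s \<in> marked (u @ (unit_of A (fst Z'), Z') # v)" "length s \<noteq> 2"
  shows "mu A (fst Z) (spell Z s) = 0"
proof -
  obtain s1 s3 where s: "s = s1 @ Some (unit_of A (fst Z'), Z') # s3" "unmark s1 = u" "unmark s3 = v"
    using unmark_eq_append_Cons[of s u "(unit_of A (fst Z'), Z')" v] assms(3) by auto
  have sp: "spell Z s = spell Z s1 @ (unit_of A (fst Z'), fst Z') # spell Z' s3"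
    using s by (simp add: spell_append)
  show ?thesis
    unfolding sp
  proof (rule mu_unit_other)
    show "tpath A (fst Z) (spell Z s1 @ (unit_of A (fst Z'), fst Z') # spell Z' s3)"
      using tpath_spell[of Z s] assms(1,3) unfolding sp by simp
    show "fst Z' = tgt (fst Z) (spell Z s1)" by (simp add: tgt_spell assms(2) s(2))
    show "length (spell Z s1) + length (spell Z' s3) \<noteq> 1" using assms(4) s(1) by simp
  qed
qed

lemma dmu_unit_zero:
  assumes "dtp Z (u @ (unit_of A (fst Z'), Z') # v)" "fst Z' = fst (tgt Z u)"
    "length u + length v \<ge> 2"
  shows "dmu A Z (u @ (unit_of A (fst Z'), Z') # v) = 0"
proof
  fix p
  show "dmu A Z (u @ (unit_of A (fst Z'), Z') # v) p = 0 p"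
    unfolding dmu_marked zero_fun_apply
  proof (rule infsum_0)
    fix s assume s: "s \<in> marked (u @ (unit_of A (fst Z'), Z') # v)"
    have "length s \<noteq> 2" using length_unmark[of s] s assms(3) by auto
    then show "mu A (fst Z) (spell Z s) p = 0" using spell_unit_zero[OF assms(1,2) s] by simp
  qed
qed

lemma dmu_unit_single:
  assumes "dtp Z (u @ (unit_of A (fst Z'), Z') # v)" "fst Z' = fst (tgt Z u)"
    "length u + length v = 1"
  shows "dmu A Z (u @ (unit_of A (fst Z'), Z') # v) = mu A (fst Z) (proj (u @ (unit_of A (fst Z'), Z') # v))"
proof (rule dmu_single)
  fix s :: "(('p \<Rightarrow> novikov) \<times> 'o \<times> ('p \<Rightarrow> novikov)) option list"
  assume s: "s \<in> marked (u @ (unit_of A (fst Z'), Z') # v)" "None \<in> set s"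
  then have "length s \<noteq> 2" using length_unmark_less[OF s(2)] assms(3) by auto
  then show "mu A (fst Z) (spell Z s) = 0" using spell_unit_zero[OF assms(1,2) s(1)] by simp
qed

lemma dmu_unit_right:
  assumes "Z \<in> \<D>" "Z' \<in> \<D>" "x \<in> Hom A (fst Z) (fst Z') d"
  shows "dmu A Z [(x, Z'), (unit_of A (fst Z'), Z')] = psgn d x"
proof -
  have ob: "fst Z \<in> Ob A" "fst Z' \<in> Ob A" using assms obj by auto
  have "dmu A Z ([(x, Z')] @ (unit_of A (fst Z'), Z') # []) = mu A (fst Z) [(x, fst Z'), (unit_of A (fst Z'), fst Z')]"
    by (subst dmu_unit_single)
       (simp_all add: assms(1,2) Hom_sub_total[OF ob assms(3)] Hom_sub_total[OF ob(2,2) unit_Hom[OF ob(2)]])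
  also have "\<dots> = psgn d (psgn d (mu A (fst Z) [(x, fst Z'), (unit_of A (fst Z'), fst Z')]))"
    by (simp add: psgn_def)
  also have "\<dots> = psgn d x" using mu_unit_right[OF ob assms(3)] by simp
  finally show ?thesis by simp
qed

lemma dmu_unit_left:
  assumes "Z \<in> \<D>" "Z' \<in> \<D>" "x \<in> Hom A (fst Z) (fst Z') d"
  shows "dmu A Z [(unit_of A (fst Z), Z), (x, Z')] = x"
proof -
  have ob: "fst Z \<in> Ob A" "fst Z' \<in> Ob A" using assms obj by auto
  have "dmu A Z ([] @ (unit_of A (fst Z), Z) # [(x, Z')]) = mu A (fst Z) [(unit_of A (fst Z), fst Z), (x, fst Z')]"
    by (subst dmu_unit_single)
       (simp_all add: assms(1,2) Hom_sub_total[OF ob assms(3)] Hom_sub_total[OF ob(1,1) unit_Hom[OF ob(1)]])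
  then show ?thesis by (simp only: append_Nil mu_unit_left[OF ob assms(3)])
qed

text \<open>The deformation element of an undeformed object is 0, so an insertion there puts a zero
  letter into the string.\<close>

lemma spell_lift_zero: "s \<in> marked (lift as) \<Longrightarrow> None \<in> set s \<Longrightarrow> \<exists>K. (0, K) \<in> set (spell (L, 0) s)"
proof (induction s arbitrary: as L)
  case (Cons x s)
  show ?case
  proof (cases x)
    case None
    then show ?thesis by auto
  next
    case (Some y)
    then obtain a as' where as: "as = a # as'" using Cons.prems by (cases as) auto
    obtain b K where b: "a = (b, K)" by (cases a)
    have y: "y = (b, (K, 0))" and "s \<in> marked (lift as')" "None \<in> set s"
      using Cons.prems Some as b by simp_all
    then obtain M where "(0, M) \<in> set (spell (K, 0) s)" using Cons.IH[of as' K] by blast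
    then have "(0, M) \<in> set (spell (L, 0) (x # s))" using Some y by simp
    then show ?thesis by blast
  qed
qed simp

lemma dmu_lift:
  assumes "dtp (L, 0) (lift as)"
  shows "dmu A (L, 0) (lift as) = mu A L as"
proof -
  have "dmu A (L, 0) (lift as) = mu A (fst (L, 0 :: 'p \<Rightarrow> novikov)) (proj (lift as))"
  proof (rule dmu_single)
    fix s assume s: "s \<in> marked (lift as)" "None \<in> set s"
    then have "tpath A L (spell (L, 0) s)" using tpath_spell[of "(L, 0)" s] assms by simp
    moreover obtain K where "(0, K) \<in> set (spell (L, 0) s)" using spell_lift_zero[OF s] by blast
    ultimately show "mu A (fst (L, 0 :: 'p \<Rightarrow> novikov)) (spell (L, 0) s) = 0"
      unfolding fst_conv by (rule mu_zero_mem)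
  qed
  then show ?thesis by simp
qed

text \<open>Insertions survive only at the last object, the one object whose deformation element may
  be nonzero; this recovers the series in \<open>mirror_functor\<close>.\<close>

lemma dmu_lift_snoc:
  assumes "dtp (L, 0) (lift as @ [(y, Z)])"
  shows "dmu A (L, 0) (lift as @ [(y, Z)]) p =
    infsum (\<lambda>j. mu A L (as @ (y, fst Z) # replicate j (snd Z, fst Z)) p) UNIV"
proof -
  let ?g = "\<lambda>(s, t). mu A L (spell (L, 0) s @ (y, fst Z) # spell Z t) p"
  let ?h = "\<lambda>j. (map Some (lift as), replicate j None :: (('p \<Rightarrow> novikov) \<times> 'o \<times> ('p \<Rightarrow> novikov)) option list)"
  have inj: "inj_on ?h (UNIV :: nat set)" by (rule inj_onI) (auto dest: arg_cong[of _ _ length])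
  have "dmu A (L, 0) (lift as @ [(y, Z)]) p = infsum ?g (marked (lift as) \<times> marked [])"
    using dmu_insert(2)[OF assms, of p] by simp
  also have "\<dots> = infsum ?g (range ?h)"
  proof (rule infsum_cong_neutral)
    fix x assume x: "x \<in> marked (lift as) \<times> marked [] - range ?h"
    obtain s t where st: "x = (s, t)" by (cases x)
    have s: "unmark s = lift as" "unmark t = []" using x st by auto
    then obtain j where "t = replicate j None" using unmark_eq_Nil by blast
    then have "s \<noteq> map Some (lift as)" using x st by auto
    then have "None \<in> set s" using s(1) map_Some_unmark[of s] by metis
    then obtain K where "(0, K) \<in> set (spell (L, 0) s)" using spell_lift_zero[of s as L] s(1) by auto
    moreover have "tpath A L (spell (L, 0) s @ (y, fst Z) # spell Z t)"
      using tpath_spell[of "(L, 0)" "s @ Some (y, Z) # t"] assms s by (simp add: spell_append)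
    ultimately show "?g x = 0" using mu_zero_mem[of L _ K] st by simp
  qed auto
  also have "\<dots> = infsum (\<lambda>j. mu A L (as @ (y, fst Z) # replicate j (snd Z, fst Z)) p) UNIV"
    by (simp only: infsum_reindex[OF inj] o_def prod.case spell_map_Some spell_replicate proj_lift)
  finally show ?thesis .
qed

end

section \<open>Convergence for positive valuation\<close>

lemma ereal_le_vval_iff: "ereal E \<le> vval x \<longleftrightarrow> (\<forall>p. ereal E \<le> nval (x p))"
  by (simp add: vval_def le_INF_iff)

lemma ereal_sum_list_replicate:
  "ereal e \<le> c \<Longrightarrow> ereal (real n * e) \<le> sum_list (replicate n c)"
proof (induction n)
  case (Suc n)
  then have "ereal e + ereal (real n * e) \<le> c + sum_list (replicate n c)"
    by (intro add_mono) auto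
  then show ?case by (simp add: algebra_simps)
qed simp

text \<open>Lower bounds add along the string: every inserted copy contributes at least
  \<open>e\<close>, every original letter a fixed and possibly negative amount
  \<open>c\<close>.\<close>

lemma insert_b_vval:
  assumes "length ns = Suc (length as)" "\<And>W. W \<in> insert Z (snd ` set as) \<Longrightarrow> ereal e \<le> vval (snd W)"
    "\<And>x. x \<in> set as \<Longrightarrow> ereal (c (fst x)) \<le> vval (fst x)"
  shows "ereal (real (sum_list ns) * e + (\<Sum>x\<leftarrow>as. c (fst x))) \<le> (\<Sum>(a, L)\<leftarrow>insert_b Z as ns. vval a)"
  using assms
proof (induction as arbitrary: Z ns)
  case Nil
  obtain L b where Z: "Z = (L, b)" by (cases Z)
  obtain n where n: "ns = [n]" using Nil(1) by (cases ns) auto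
  show ?case using ereal_sum_list_replicate[of e "vval b" n] Nil(2)[of Z] by (simp add: Z n)
next
  case (Cons x as)
  obtain L b where Z: "Z = (L, b)" by (cases Z)
  obtain a Z' where x: "x = (a, Z')" by (cases x)
  obtain n ns' where n: "ns = n # ns'" using Cons.prems(1) by (cases ns) auto
  have 1: "ereal (real (sum_list ns') * e + (\<Sum>x\<leftarrow>as. c (fst x))) \<le> (\<Sum>(a, L)\<leftarrow>insert_b Z' as ns'. vval a)"
    by (rule Cons.IH) (use Cons.prems x n in auto)
  have 2: "ereal (real n * e) \<le> sum_list (replicate n (vval b))"
    using ereal_sum_list_replicate[of e "vval b" n] Cons.prems(2)[of Z] by (simp add: Z)
  have 3: "ereal (c a) \<le> vval a" using Cons.prems(3)[of x] x by simp
  have "ereal (real n * e) + (ereal (c a) + ereal (real (sum_list ns') * e + (\<Sum>x\<leftarrow>as. c (fst x))))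
    \<le> sum_list (replicate n (vval b)) + (vval a + (\<Sum>(a, L)\<leftarrow>insert_b Z' as ns'. vval a))"
    by (intro add_mono 1 2 3)
  then show ?case by (simp add: Z x n algebra_simps)
qed

lemma finite_sum_list_bounded: "finite {ns :: nat list. length ns = n \<and> sum_list ns \<le> N}"
proof (rule finite_subset)
  show "{ns :: nat list. length ns = n \<and> sum_list ns \<le> N} \<subseteq> {ns. set ns \<subseteq> {..N} \<and> length ns = n}"
    using member_le_sum_list by fastforce
  show "finite {ns :: nat list. set ns \<subseteq> {..N} \<and> length ns = n}"
    by (rule finite_lists_length_eq) simp
qed

context filtered_ainf
begin

lemma Hom_total_vval_bound:
  assumes "L \<in> Ob A" "L' \<in> Ob A" "x \<in> Hom_total A L L'"
  shows "\<exists>d. ereal d \<le> vval x"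
proof -
  let ?S = "both (gen L L')"
  have "finite ?S" using gen_finite[OF assms(1,2)] by simp
  then obtain d where d: "\<And>p. p \<in> ?S \<Longrightarrow> ereal d \<le> nval (x p)"
    using vanishing_lower_bound[OF vanishing_finite, of ?S x] by blast
  have "x p = 0" if "p \<notin> ?S" for p using that assms(3) Hom_total_iff[OF assms(1,2)] by blast
  then have "ereal d \<le> nval (x p)" for p using d[of p] by (cases "p \<in> ?S") auto
  then show ?thesis by (auto simp: ereal_le_vval_iff)
qed

end

context deformed_objects
begin

text \<open>Each inserted element raises the valuation by a fixed positive amount.\<close>

lemma insertions_converge_positive:
  assumes pos: "\<And>Z. Z \<in> \<D> \<Longrightarrow> 0 < vval (snd Z)"
  shows "insertions_converge A \<D>"
  unfolding insertions_converge_def summable_on_novikov_iff proj_def[symmetric]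
proof (intro ballI allI impI)
  fix Z as p assume Z: "Z \<in> \<D>" and as: "snd ` set as \<subseteq> \<D> \<and> tpath A (fst Z) (proj as)"
  then have path: "dtp Z as" by (simp add: dtp_def)
  let ?B = "insert Z (snd ` set as)"
  define e' where "e' W = (SOME e :: real. 0 < e \<and> ereal e \<le> vval (snd W))" for W :: "'o \<times> ('p \<Rightarrow> novikov)"
  have e': "0 < e' W \<and> ereal (e' W) \<le> vval (snd W)" if "W \<in> ?B" for W
    unfolding e'_def
  proof (rule someI_ex)
    have "W \<in> \<D>" using that Z as by blast
    from ereal_dense2[OF pos[OF this]] obtain r where "0 < ereal r" "ereal r < vval (snd W)"
      by auto
    then show "\<exists>e>0. ereal e \<le> vval (snd W)" by (auto intro: less_imp_le)
  qed
  \<comment> \<open>Only the objects of the given string receive insertions, so a minimum over a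
    finite set suffices even if \<open>\<D>\<close> is infinite.\<close>
  define e where "e = Min (e' ` ?B)"
  have fin: "finite (e' ` ?B)" by simp
  have e0: "e > 0" unfolding e_def using fin e' by (subst Min_gr_iff) auto
  have e: "ereal e \<le> vval (snd W)" if "W \<in> ?B" for W
  proof -
    have "e \<le> e' W" unfolding e_def by (rule Min_le[OF fin]) (use that in blast)
    then show ?thesis using e'[OF that] by (meson dual_order.trans ereal_less_eq(3))
  qed
  define c where "c a = (SOME d :: real. ereal d \<le> vval a)" for a :: "'p \<Rightarrow> novikov"
  have c: "ereal (c (fst x)) \<le> vval (fst x)" if mem: "x \<in> set as" for x
  proof -
    obtain u v where uv: "as = u @ x # v" using split_list[OF mem] by blast
    have x: "fst x \<in> Hom_total A (fst (tgt Z u)) (fst (snd x))" "dtp Z u" "dtp (snd x) v"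
      using path uv dtp_insert[of Z u "fst x" "snd x" v] by simp_all
    have "\<exists>d. ereal d \<le> vval (fst x)"
      by (rule Hom_total_vval_bound[OF obj[OF dtp_tgt[OF x(2)]] obj[OF dtp_start[OF x(3)]] x(1)])
    then show ?thesis unfolding c_def by (rule someI_ex)
  qed
  let ?C = "\<Sum>x\<leftarrow>as. c (fst x)"
  have lower: "ereal (real (sum_list ns) * e + ?C) \<le> nval (mu A (fst Z) (insert_b Z as ns) p)"
    if "length ns = Suc (length as)" for ns
  proof -
    have "tpath A (fst Z) (insert_b Z as ns)"
      using tpath_spell[of Z "mark as ns"] path by (simp add: spell_mark)
    then have "(\<Sum>(a, L)\<leftarrow>insert_b Z as ns. vval a) \<le> vval (mu A (fst Z) (insert_b Z as ns))"
      by (rule mu_vval)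
    with insert_b_vval[of ns as Z e c, OF that e c]
    have "ereal (real (sum_list ns) * e + ?C) \<le> vval (mu A (fst Z) (insert_b Z as ns))"
      by (meson order_trans)
    then show ?thesis by (simp add: ereal_le_vval_iff)
  qed
  show "vanishing (\<lambda>ns. mu A (fst Z) (insert_b Z as ns) p) {ns. length ns = Suc (length as)}"
    unfolding vanishing_def
  proof
    fix E
    \<comment> \<open>By \<open>lower\<close>, a term of valuation below \<open>E\<close> has fewer
      than \<open>(E - ?C) / e\<close> insertions, and finitely many lists of the right length have
      such a bounded total.\<close>
    let ?N = "nat \<lceil>(E - ?C) / e\<rceil>"
    have "sum_list ns \<le> ?N"
      if "length ns = Suc (length as)" "\<not> ereal E \<le> nval (mu A (fst Z) (insert_b Z as ns) p)" for ns
    proof -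
      have "\<not> ereal E \<le> ereal (real (sum_list ns) * e + ?C)"
        using lower[OF that(1)] that(2) by (meson order_trans)
      then have "real (sum_list ns) * e < E - ?C" by simp
      then have "real (sum_list ns) < (E - ?C) / e" using e0 by (simp add: field_simps)
      then show ?thesis by linarith
    qed
    then show "finite {ns \<in> {ns. length ns = Suc (length as)}.
        \<not> ereal E \<le> nval (mu A (fst Z) (insert_b Z as ns) p)}"
      by (intro finite_subset[OF _ finite_sum_list_bounded[of "Suc (length as)" ?N]]) auto
  qed
qed

end

section \<open>Cutting a string at a distinguished letter\<close>

lemma splits3_append_Cons:
  "splits3 (as @ x # \<tau>) =
     (\<lambda>(u, v, w). (u, v, w @ x # \<tau>)) ` splits3 as \<union>
     (\<lambda>((u, v), (t1, t2)). (u, v @ x # t1, t2)) ` (splits2 as \<times> splits2 \<tau>) \<union>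
     (\<lambda>(t1, t2, t3). (as @ x # t1, t2, t3)) ` splits3 \<tau>" (is "_ = ?A \<union> ?B \<union> ?C")
proof
  show "splits3 (as @ x # \<tau>) \<subseteq> ?A \<union> ?B \<union> ?C"
  proof
    fix y assume "y \<in> splits3 (as @ x # \<tau>)"
    then obtain u v w where y: "y = (u, v, w)" and e: "u @ (v @ w) = as @ (x # \<tau>)"
      by (auto simp: splits3_def)
    from e consider r where "u = as @ r" "r @ v @ w = x # \<tau>" "r \<noteq> []"
      | r where "as = u @ r" "v @ w = r @ x # \<tau>"
      by (fastforce simp: append_eq_append_conv2)
    then show "y \<in> ?A \<union> ?B \<union> ?C"
    proof cases
      case 1
      then obtain r' where r: "r = x # r'" "r' @ v @ w = \<tau>" by (cases r) auto
      then have "y = (\<lambda>(t1, t2, t3). (as @ x # t1, t2, t3)) (r', v, w)" "(r', v, w) \<in> splits3 \<tau>"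
        using y 1 by (auto simp: splits3_def)
      then have "y \<in> ?C" by blast
      then show ?thesis by blast
    next
      case 2
      from 2(2) consider q where "v = r @ q" "q @ w = x # \<tau>" "q \<noteq> []" | q where "r = v @ q" "w = q @ x # \<tau>"
        by (fastforce simp: append_eq_append_conv2)
      then show ?thesis
      proof cases
        case 1
        then obtain q' where "q = x # q'" "q' @ w = \<tau>" by (cases q) auto
        then have "y = (\<lambda>((u, v), (t1, t2)). (u, v @ x # t1, t2)) ((u, r), (q', w))"
          "((u, r), (q', w)) \<in> splits2 as \<times> splits2 \<tau>"
          using y 1 2 by (auto simp: splits2_def)
        then have "y \<in> ?B" by blast
        then show ?thesis by blast
      next
        case q: 2
        then have "y = (\<lambda>(u, v, w). (u, v, w @ x # \<tau>)) (u, v, q)" "(u, v, q) \<in> splits3 as"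
          using y 2 by (auto simp: splits3_def)
        then have "y \<in> ?A" by blast
        then show ?thesis by blast
      qed
    qed
  qed
  show "?A \<union> ?B \<union> ?C \<subseteq> splits3 (as @ x # \<tau>)"
    by (auto simp: splits3_def splits2_def)
qed

text \<open>The inner block lies before \<open>x\<close>, contains \<open>x\<close>, or lies after
  \<open>x\<close>. For the module variable these groups become \<open>rel_in\<close>,
  \<open>rel_mid\<close> and \<open>rel_end\<close>.\<close>

lemma sum_splits3_append_Cons:
  fixes f :: "'a list \<Rightarrow> 'a list \<Rightarrow> 'a list \<Rightarrow> 'b :: ab_group_add"
  shows "(\<Sum>(u, v, w)\<in>splits3 (as @ x # \<tau>). f u v w) =
     (\<Sum>(u, v, w)\<in>splits3 as. f u v (w @ x # \<tau>)) +
     (\<Sum>(u, v)\<in>splits2 as. \<Sum>(t1, t2)\<in>splits2 \<tau>. f u (v @ x # t1) t2) +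
     (\<Sum>(t1, t2, t3)\<in>splits3 \<tau>. f (as @ x # t1) t2 t3)"
proof -
  let ?f = "\<lambda>(u, v, w). f u v w"
  let ?a = "\<lambda>(u, v, w). (u, v, w @ x # \<tau>)"
  let ?b = "\<lambda>((u, v), (t1, t2)). (u, v @ x # t1, t2)"
  let ?c = "\<lambda>(t1, t2, t3). (as @ x # t1, t2, t3)"
  let ?A = "?a ` splits3 as" and ?B = "?b ` (splits2 as \<times> splits2 \<tau>)" and ?C = "?c ` splits3 \<tau>"
  have fin: "finite ?A" "finite ?B" "finite ?C" by auto
  \<comment> \<open>The three kinds of splits are told apart by the lengths of their first and last
    parts.\<close>
  have A: "?A \<subseteq> {y. length (snd (snd y)) > length \<tau>}" by auto
  have B: "?B \<subseteq> {y. length (snd (snd y)) \<le> length \<tau> \<and> length (fst y) \<le> length as}"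
    by (auto simp: splits2_def)
  have C: "?C \<subseteq> {y. length (snd (snd y)) \<le> length \<tau> \<and> length (fst y) > length as}"
    by (auto simp: splits3_def)
  have "False" if "y \<in> ?A" "y \<in> ?B" for y
    using subsetD[OF A that(1)] subsetD[OF B that(2)] by simp
  moreover have "False" if "y \<in> ?A" "y \<in> ?C" for y
    using subsetD[OF A that(1)] subsetD[OF C that(2)] by simp
  moreover have "False" if "y \<in> ?B" "y \<in> ?C" for y
    using subsetD[OF B that(1)] subsetD[OF C that(2)] by simp
  ultimately have disj: "?A \<inter> ?B = {}" "(?A \<union> ?B) \<inter> ?C = {}" by blast+
  have "sum ?f (splits3 (as @ x # \<tau>)) = sum ?f ?A + sum ?f ?B + sum ?f ?C"
    unfolding splits3_append_Cons using fin disj by (simp add: sum.union_disjoint)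
  also have "sum ?f ?A = (\<Sum>(u, v, w)\<in>splits3 as. f u v (w @ x # \<tau>))"
    by (subst sum.reindex) (auto simp: inj_on_def case_prod_beta' o_def)
  also have "sum ?f ?B = (\<Sum>((u, v), (t1, t2))\<in>splits2 as \<times> splits2 \<tau>. f u (v @ x # t1) t2)"
    by (subst sum.reindex) (auto simp: inj_on_def case_prod_beta' o_def splits2_def)
  also have "\<dots> = (\<Sum>(u, v)\<in>splits2 as. \<Sum>(t1, t2)\<in>splits2 \<tau>. f u (v @ x # t1) t2)"
    by (simp add: sum.cartesian_product case_prod_beta')
  also have "sum ?f ?C = (\<Sum>(t1, t2, t3)\<in>splits3 \<tau>. f (as @ x # t1) t2 t3)"
    by (subst sum.reindex) (auto simp: inj_on_def case_prod_beta' o_def)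
  finally show ?thesis by simp
qed

lemma sum_splits3_map:
  "(\<Sum>(u, v, w)\<in>splits3 (map g as). f u v w) = (\<Sum>(u, v, w)\<in>splits3 as. f (map g u) (map g v) (map g w))"
proof -
  let ?h = "\<lambda>(u, v, w). (map g u, map g v, map g w)"
  have "bij_betw ?h (splits3 as) (splits3 (map g as))"
    unfolding bij_betw_def
  proof
    show "inj_on ?h (splits3 as)"
    proof (rule inj_onI)
      fix x y assume xy: "x \<in> splits3 as" "y \<in> splits3 as" "?h x = ?h y"
      obtain s1 s2 s3 where x: "x = (s1, s2, s3)" by (cases x)
      obtain t1 t2 t3 where y: "y = (t1, t2, t3)" by (cases y)
      have "length s1 = length t1" "length s2 = length t2"
        using xy(3) unfolding x y prod.case by (metis prod.inject length_map)+
      then show "x = y" using xy x y by (auto simp: splits3_def)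
    qed
    show "?h ` splits3 as = splits3 (map g as)"
    proof
      show "splits3 (map g as) \<subseteq> ?h ` splits3 as"
      proof
        fix y assume "y \<in> splits3 (map g as)"
        then obtain u v w where "y = (u, v, w)" "map g as = u @ v @ w"
          unfolding splits3_def by force
        moreover from this obtain u' v' w' where "as = u' @ v' @ w'" "u = map g u'" "v = map g v'" "w = map g w'"
          by (metis map_eq_append_conv)
        ultimately have "y = ?h (u', v', w')" "as = u' @ v' @ w'" by simp_all
        then show "y \<in> ?h ` splits3 as" by (intro image_eqI[of _ _ "(u', v', w')"]) (auto simp: splits3_def)
      qed
    qed (auto simp: splits3_def)
  qed
  then have "(\<Sum>x\<in>splits3 (map g as). (\<lambda>(u, v, w). f u v w) x) = (\<Sum>x\<in>splits3 as. (\<lambda>(u, v, w). f u v w) (?h x))"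
    by (rule sum.reindex_bij_betw[symmetric])
  then show ?thesis by (simp add: case_prod_beta')
qed

lemma sum_splits2_map:
  "(\<Sum>(u, v)\<in>splits2 (map g as). f u v) = (\<Sum>(u, v)\<in>splits2 as. f (map g u) (map g v))"
proof -
  have inj: "inj_on (\<lambda>i. (take i xs, drop i xs)) {..length xs}" for xs :: "'x list"
  proof (rule inj_onI)
    fix i j assume "i \<in> {..length xs}" "j \<in> {..length xs}" "(take i xs, drop i xs) = (take j xs, drop j xs)"
    then show "i = j" by (metis atMost_iff length_take min.absorb2 prod.inject)
  qed
  show ?thesis
    unfolding splits2_eq sum.reindex[OF inj] by (simp add: take_map drop_map o_def)
qed

section \<open>The \<open>A\<^sub>\<infinity>\<close>-relations with a module variable\<close>

lemma sum_splits3_lift: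
  "(\<Sum>(u, v, w)\<in>splits3 (lift as). f u v w) = (\<Sum>(u, v, w)\<in>splits3 as. f (lift u) (lift v) (lift w))"
  unfolding lift_def by (rule sum_splits3_map)

lemma sum_splits2_lift:
  "(\<Sum>(u, v)\<in>splits2 (lift as). f u v) = (\<Sum>(u, v)\<in>splits2 as. f (lift u) (lift v))"
  unfolding lift_def by (rule sum_splits2_map)

lemma lift_contract:
  "lift (contract A L u v w) = lift u @ (mu A (tgt L u) v, (tgt L (u @ v), 0)) # lift w"
  by (simp add: contract_def)

lemma tgt_contract: "tgt L (contract A L u v w) = tgt L (u @ v @ w)"
  by (simp add: contract_def)

lemma Ob_uncurved: "K \<in> Ob (uncurved A) \<longleftrightarrow> K \<in> Ob A \<and> mu A K [] = 0"
  by (simp add: uncurved_def)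

lemma uncurved_simps [simp]:
  "Hom (uncurved A) = Hom A" "mu (uncurved A) = mu A" "unit_of (uncurved A) = unit_of A"
  by (simp_all add: uncurved_def fun_eq_iff)

lemma deg_uncurved [simp]: "deg (uncurved A) L L' a = deg A L L' a"
  by (simp add: deg_def)

lemma sdeg_uncurved [simp]: "sdeg (uncurved A) L as = sdeg A L as"
  by (induction A L as rule: sdeg.induct) auto

lemma contract_uncurved [simp]: "contract (uncurved A) L u v w = contract A L u v w"
  by (simp add: contract_def)

lemma hpath_uncurved: "hpath (uncurved A) L as \<Longrightarrow> hpath A L as"
  by (induction A L as rule: hpath.induct) (auto simp: Ob_uncurved)

text \<open>The sign \<open>(-1)^|y|\<close> as a linear operator, so that relations in which it
  occurs can be stated for inhomogeneous \<open>y\<close>.\<close>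

definition parity :: "('o \<Rightarrow> 'o \<Rightarrow> bit \<Rightarrow> 'p set) \<Rightarrow> 'o \<Rightarrow> 'o \<Rightarrow> ('p \<Rightarrow> 'v :: ab_group_add) \<Rightarrow> 'p \<Rightarrow> 'v" where
  "parity gen K L y = (\<lambda>p. if p \<in> gen K L 1 then - y p else y p)"

lemma parity_add: "parity gen K L (x + y) = parity gen K L x + parity gen K L y"
  by (auto simp: parity_def fun_eq_iff)

text \<open>Admitting all pairs \<open>(L, 0)\<close> lets test objects and deformed reference
  objects occur in one string, so a single deformed relation covers functors, transformations and
  homotopies.\<close>

locale mirror_ainf = deformed_ainf A gen \<D>
  for A :: "('o, 'p \<Rightarrow> novikov) ainf_category" and gen :: "'o \<Rightarrow> 'o \<Rightarrow> bit \<Rightarrow> 'p set"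
    and \<D> :: "('o \<times> ('p \<Rightarrow> novikov)) set" +
  assumes zero_obj: "L \<in> Ob A \<Longrightarrow> (L, 0) \<in> \<D>"
begin

text \<open>The operation on \<open>(as, y, \<tau>)\<close> with \<open>y\<close> as module
  variable: the objects before \<open>y\<close> carry deformation 0, those from \<open>Z\<close> on
  carry their own.\<close>

definition M where
  "M L as y Z \<tau> = dmu A (L, 0) (lift as @ (y, Z) # \<tau>)"

lemma parity_Hom:
  assumes "K \<in> Ob A" "L \<in> Ob A" "y \<in> Hom A K L e"
  shows "parity gen K L y = psgn e y"
proof (cases "e = 0")
  case True
  have "p \<notin> gen K L 1" if "y p \<noteq> 0" for p
    using that assms gen_disjoint[OF assms(1,2)] Hom_iff[OF assms(1,2)] True by blast
  then show ?thesis using True by (auto simp: parity_def fun_eq_iff)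
next
  case False
  then have "e = 1" by simp
  moreover from this have "p \<in> gen K L 1" if "y p \<noteq> 0" for p
    using that assms Hom_iff[OF assms(1,2)] by blast
  ultimately show ?thesis by (auto simp: parity_def fun_eq_iff)
qed

lemma parity_total:
  assumes "K \<in> Ob A" "L \<in> Ob A" "y \<in> Hom_total A K L"
  shows "parity gen K L y \<in> Hom_total A K L"
  using assms(3) unfolding Hom_total_iff[OF assms(1,2)] by (auto simp: parity_def)

lemma dhp_lift: "hpath A L as \<Longrightarrow> dhp (L, 0) (lift as)"
proof (induction as arbitrary: L)
  case (Cons x as)
  obtain a K where x: "x = (a, K)" by (cases x)
  have "dhp (K, 0) (lift as)" by (rule Cons.IH) (use Cons.prems x in simp)
  then show ?case
    using Cons.prems zero_obj[of L] unfolding x hpath.simps by (simp only: lift_simps dhp_Cons fst_conv)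
qed (simp add: zero_obj)

lemma dtp_lift: "hpath A L as \<Longrightarrow> dtp (L, 0) (lift as)"
  using dhp_lift dhp_dtp by blast

lemma hpath_mu_Hom:
  assumes "hpath A L as" "(u, v, w) \<in> splits3 as"
  shows "mu A (tgt L u) v \<in> Hom A (tgt L u) (tgt L (u @ v)) (sdeg A (tgt L u) v)"
  using assms mu_degree[of "tgt L u" v] by (auto simp: splits3_def hpath_append)

lemma hpath_contract:
  assumes "hpath A L as" "(u, v, w) \<in> splits3 as"
  shows "hpath A L (contract A L u v w)"
  using assms hpath_mu_Hom[OF assms] unfolding contract_def
  by (auto simp: splits3_def hpath_append dest: hpath_tgt)

lemma hpath_start: "hpath A L as \<Longrightarrow> L \<in> Ob A"
  by (cases as) auto

lemma start_Ob: "dhp Z \<tau> \<Longrightarrow> fst Z \<in> Ob A"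
  by (rule obj) (simp add: dhp_def)

lemma tgt_Ob: "dhp Z \<tau> \<Longrightarrow> fst (tgt Z \<tau>) \<in> Ob A"
  by (rule obj[OF dtp_tgt[OF dhp_dtp]])

lemma M_add:
  assumes "hpath A L as" "x \<in> Hom_total A (tgt L as) (fst Z)" "y \<in> Hom_total A (tgt L as) (fst Z)" "dtp Z \<tau>"
  shows "M L as (x + y) Z \<tau> = M L as x Z \<tau> + M L as y Z \<tau>"
  unfolding M_def by (rule dmu_add) (use assms dtp_lift in auto)

lemma M_scale:
  assumes "hpath A L as" "y \<in> Hom_total A (tgt L as) (fst Z)" "dtp Z \<tau>"
  shows "M L as (c \<odot> y) Z \<tau> = c \<odot> M L as y Z \<tau>"
  unfolding M_def by (rule dmu_scale) (use assms dtp_lift in auto)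

lemma M_zero: "hpath A L as \<Longrightarrow> dtp Z \<tau> \<Longrightarrow> M L as 0 Z \<tau> = 0"
  unfolding M_def by (rule dmu_zero) (auto intro: dtp_lift)

lemma psgn_eq_nscale: "psgn d (y :: 'p \<Rightarrow> novikov) = psgn d 1 \<odot> y"
  by (auto simp: psgn_def fun_eq_iff nscale_apply)

lemma M_psgn:
  assumes "hpath A L as" "y \<in> Hom_total A (tgt L as) (fst Z)" "dtp Z \<tau>"
  shows "M L as (psgn d y) Z \<tau> = psgn d (M L as y Z \<tau>)"
  unfolding psgn_eq_nscale[of d] by (rule M_scale[OF assms])

lemma M_degree:
  assumes "hpath A L as" "y \<in> Hom A (tgt L as) (fst Z) e" "dhp Z \<tau>"
  shows "M L as y Z \<tau> \<in> Hom A L (fst (tgt Z \<tau>)) (sdeg A L as + e + 1 + ddeg A Z \<tau>)"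
proof (cases "y = 0")
  case True
  have "M L as 0 Z \<tau> = 0" using M_zero assms dhp_dtp by blast
  moreover have "L \<in> Ob A" "fst (tgt Z \<tau>) \<in> Ob A"
    using hpath_start[OF assms(1)] tgt_Ob[OF assms(3)] by simp_all
  ultimately show ?thesis using Hom_zero True by simp
next
  case False
  have ob: "tgt L as \<in> Ob A" "fst Z \<in> Ob A"
    using hpath_tgt[OF assms(1)] start_Ob[OF assms(3)] by simp_all
  have "dhp (L, 0) (lift as @ (y, Z) # \<tau>)"
    using assms dhp_lift[OF assms(1)] ob zero_obj by (auto simp: dhp_append)
  moreover have "ddeg A (L, 0 :: 'p \<Rightarrow> novikov) (lift as @ (y, Z) # \<tau>) = sdeg A L as + e + 1 + ddeg A Z \<tau>"
    using deg_eq[OF ob assms(2) False]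
    by (simp add: sdeg_append add.assoc del: add_bit_eq_xor)
  ultimately show ?thesis
    using dmu_degree[of "(L, 0)" "lift as @ (y, Z) # \<tau>"] by (simp add: M_def del: add_bit_eq_xor)
qed

lemma M_total:
  assumes "hpath A L as" "y \<in> Hom_total A (tgt L as) (fst Z)" "dhp Z \<tau>"
  shows "M L as y Z \<tau> \<in> Hom_total A L (fst (tgt Z \<tau>))"
proof -
  have ob: "L \<in> Ob A" "fst (tgt Z \<tau>) \<in> Ob A" "tgt L as \<in> Ob A" "fst Z \<in> Ob A"
    using hpath_start[OF assms(1)] tgt_Ob[OF assms(3)] hpath_tgt[OF assms(1)] start_Ob[OF assms(3)]
    by simp_all
  obtain y0 y1 where y: "y = y0 + y1" "y0 \<in> Hom A (tgt L as) (fst Z) 0" "y1 \<in> Hom A (tgt L as) (fst Z) 1"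
    using assms(2) unfolding Hom_total_def by blast
  have "M L as y Z \<tau> = M L as y0 Z \<tau> + M L as y1 Z \<tau>"
    unfolding y(1)
    by (rule M_add[OF assms(1) Hom_sub_total[OF ob(3,4) y(2)] Hom_sub_total[OF ob(3,4) y(3)] dhp_dtp[OF assms(3)]])
  moreover have "M L as y0 Z \<tau> \<in> Hom_total A L (fst (tgt Z \<tau>))" "M L as y1 Z \<tau> \<in> Hom_total A L (fst (tgt Z \<tau>))"
    using M_degree[OF assms(1) y(2) assms(3)] M_degree[OF assms(1) y(3) assms(3)] Hom_sub_total[OF ob(1,2)]
    by blast+
  ultimately show ?thesis using Hom_total_add[OF ob(1,2)] by simp
qed

text \<open>This is \<open>dmu_relation\<close> sorted by the position of the inner block relative
  to \<open>y\<close>; the summand \<open>e + 1\<close> in the last sign is the shifted degree of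
  \<open>y\<close>.\<close>

lemma M_relation_homogeneous:
  assumes as: "hpath A L as" and y: "y \<in> Hom A (tgt L as) (fst Z) e" and \<tau>: "dhp Z \<tau>"
  shows "(\<Sum>(u, v, w)\<in>splits3 as. psgn (sdeg A L u) (M L (contract A L u v w) y Z \<tau>)) +
    (\<Sum>(u, v)\<in>splits2 as. \<Sum>(t1, t2)\<in>splits2 \<tau>.
       psgn (sdeg A L u) (M L u (M (tgt L u) v y Z t1) (tgt Z t1) t2)) +
    (\<Sum>(t1, t2, t3)\<in>splits3 \<tau>. psgn (sdeg A L as + e + 1 + ddeg A Z t1)
       (M L as y Z (t1 @ (dmu A (tgt Z t1) t2, tgt (tgt Z t1) t2) # t3))) = 0"
proof -
  have ob: "tgt L as \<in> Ob A" "fst Z \<in> Ob A"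
    using hpath_tgt[OF as] start_Ob[OF \<tau>] by simp_all
  let ?f = "\<lambda>u v w. psgn (ddeg A (L, 0 :: 'p \<Rightarrow> novikov) u) (dmu A (L, 0) (u @ (dmu A (tgt (L, 0) u) v, tgt (tgt (L, 0) u) v) # w))"
  have "dhp (L, 0) (lift as @ (y, Z) # \<tau>)"
    using as y \<tau> dhp_lift[OF as] zero_obj ob by (auto simp: dhp_append)
  from dmu_relation[OF this] have "(\<Sum>(u, v, w)\<in>splits3 (lift as @ (y, Z) # \<tau>). ?f u v w) = 0" .
  then have "(\<Sum>(u, v, w)\<in>splits3 as. ?f (lift u) (lift v) (lift w @ (y, Z) # \<tau>)) +
     (\<Sum>(u, v)\<in>splits2 as. \<Sum>(t1, t2)\<in>splits2 \<tau>. ?f (lift u) (lift v @ (y, Z) # t1) t2) +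
     (\<Sum>(t1, t2, t3)\<in>splits3 \<tau>. ?f (lift as @ (y, Z) # t1) t2 t3) = 0"
    unfolding sum_splits3_append_Cons sum_splits3_lift sum_splits2_lift .
  moreover have "(\<Sum>(u, v, w)\<in>splits3 as. ?f (lift u) (lift v) (lift w @ (y, Z) # \<tau>)) =
    (\<Sum>(u, v, w)\<in>splits3 as. psgn (sdeg A L u) (M L (contract A L u v w) y Z \<tau>))"
  proof (rule sum.cong[OF refl], clarify)
    fix u v w assume uvw: "(u, v, w) \<in> splits3 as"
    then have "hpath A (tgt L u) v" using as by (auto simp: splits3_def hpath_append)
    then have "dmu A (tgt L u, 0) (lift v) = mu A (tgt L u) v" by (intro dmu_lift dtp_lift)
    then show "?f (lift u) (lift v) (lift w @ (y, Z) # \<tau>) = psgn (sdeg A L u) (M L (contract A L u v w) y Z \<tau>)"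
      by (simp add: M_def lift_contract)
  qed
  moreover have "(\<Sum>(u, v)\<in>splits2 as. \<Sum>(t1, t2)\<in>splits2 \<tau>. ?f (lift u) (lift v @ (y, Z) # t1) t2) =
    (\<Sum>(u, v)\<in>splits2 as. \<Sum>(t1, t2)\<in>splits2 \<tau>.
       psgn (sdeg A L u) (M L u (M (tgt L u) v y Z t1) (tgt Z t1) t2))"
    by (simp add: M_def)
  moreover have "(\<Sum>(t1, t2, t3)\<in>splits3 \<tau>. ?f (lift as @ (y, Z) # t1) t2 t3) =
    (\<Sum>(t1, t2, t3)\<in>splits3 \<tau>. psgn (sdeg A L as + e + 1 + ddeg A Z t1)
       (M L as y Z (t1 @ (dmu A (tgt Z t1) t2, tgt (tgt Z t1) t2) # t3)))"
  proof (rule sum.cong[OF refl], clarify)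
    fix t1 t2 t3 assume t: "(t1, t2, t3) \<in> splits3 \<tau>"
    let ?r = "t1 @ (dmu A (tgt Z t1) t2, tgt (tgt Z t1) t2) # t3"
    have ps: "dhp Z t1" "dhp (tgt Z t1) t2" "dhp (tgt (tgt Z t1) t2) t3"
      using \<tau> t by (auto simp: splits3_def dhp_append)
    show "?f (lift as @ (y, Z) # t1) t2 t3 = psgn (sdeg A L as + e + 1 + ddeg A Z t1) (M L as y Z ?r)"
    \<comment> \<open>For \<open>y = 0\<close> the degree that \<open>deg\<close> assigns need not
      be \<open>e\<close>, but both sides vanish.\<close>
    proof (cases "y = 0")
      case True
      have "dtp Z ?r"
        unfolding dtp_insert
        using dhp_dtp[OF ps(1)] dhp_dtp[OF ps(3)]
          Hom_sub_total[OF start_Ob[OF ps(2)] tgt_Ob[OF ps(2)] dmu_degree[OF ps(2)]]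
        by simp
      then have "M L as y Z ?r = 0" using M_zero[OF as] True by simp
      then show ?thesis by (simp add: M_def)
    next
      case False
      show ?thesis
        using deg_eq[OF ob y False]
        by (simp add: M_def sdeg_append add.assoc del: add_bit_eq_xor)
    qed
  qed
  ultimately show ?thesis by simp
qed

end

lemma minus_psgn: "- psgn d x = psgn (d + 1) x"
  by (cases "d = 0") (simp_all add: psgn_def)

lemma parity_psgn: "parity gen K L (psgn d y) = psgn d (parity gen K L y)"
  by (auto simp: parity_def psgn_def fun_eq_iff)

lemma parity_parity [simp]: "parity gen K L (parity gen K L y) = y"
  by (auto simp: parity_def fun_eq_iff)

lemma splits3_Nil: "splits3 [] = {([], [], [])}"
  by (auto simp: splits3_def)

lemma splits3_single: "splits3 [x] = {([], [], [x]), ([], [x], []), ([x], [], [])}"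
  by (auto simp: splits3_def append_eq_Cons_conv)

lemma splits3_pair: "splits3 [x, y] = {([], [], [x, y]), ([], [x], [y]), ([], [x, y], []),
    ([x], [], [y]), ([x], [y], []), ([x, y], [], [])}"
  by (auto simp: splits3_def append_eq_Cons_conv)

lemma splits2_Nil: "splits2 [] = {([], [])}"
  by (auto simp: splits2_def)

lemma splits2_single: "splits2 [x] = {([], [x]), ([x], [])}"
  by (auto simp: splits2_def append_eq_Cons_conv)

lemma splits2_pair: "splits2 [x, y] = {([], [x, y]), ([x], [y]), ([x, y], [])}"
  by (auto simp: splits2_def append_eq_Cons_conv)

section \<open>The relation for inhomogeneous module elements, and the role of units\<close>

context mirror_ainf
begin

definition rel_in where
  "rel_in L as y Z \<tau> = (\<Sum>(u, v, w)\<in>splits3 as. psgn (sdeg A L u) (M L (contract A L u v w) y Z \<tau>))"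

definition rel_mid where
  "rel_mid L as y Z \<tau> = (\<Sum>(u, v)\<in>splits2 as. \<Sum>(t1, t2)\<in>splits2 \<tau>.
     psgn (sdeg A L u) (M L u (M (tgt L u) v y Z t1) (tgt Z t1) t2))"

text \<open>The shifted degree of \<open>y\<close> is missing from the sign;
  \<open>M_relation\<close> accounts for it by \<open>parity\<close> and by placing this group on
  the other side.\<close>

definition rel_end where
  "rel_end L as y Z \<tau> = (\<Sum>(t1, t2, t3)\<in>splits3 \<tau>. psgn (sdeg A L as + ddeg A Z t1)
     (M L as y Z (t1 @ (dmu A (tgt Z t1) t2, tgt (tgt Z t1) t2) # t3)))"

lemma dtp_contract:
  assumes "dhp Z \<tau>" "(t1, t2, t3) \<in> splits3 \<tau>"
  shows "dtp Z (t1 @ (dmu A (tgt Z t1) t2, tgt (tgt Z t1) t2) # t3)"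
proof -
  have ps: "dhp Z t1" "dhp (tgt Z t1) t2" "dhp (tgt (tgt Z t1) t2) t3"
    using assms by (auto simp: splits3_def dhp_append)
  show ?thesis
    unfolding dtp_insert
    using dhp_dtp[OF ps(1)] dhp_dtp[OF ps(3)]
      Hom_sub_total[OF start_Ob[OF ps(2)] tgt_Ob[OF ps(2)] dmu_degree[OF ps(2)]]
    by simp
qed

lemma tgt_contract': "(u, v, w) \<in> splits3 as \<Longrightarrow> tgt L (contract A L u v w) = tgt L as"
  by (auto simp: tgt_contract splits3_def)

lemma rel_in_add:
  assumes "hpath A L as" "x \<in> Hom_total A (tgt L as) (fst Z)" "y \<in> Hom_total A (tgt L as) (fst Z)" "dtp Z \<tau>"
  shows "rel_in L as (x + y) Z \<tau> = rel_in L as x Z \<tau> + rel_in L as y Z \<tau>"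
  unfolding rel_in_def sum.distrib[symmetric]
proof (rule sum.cong[OF refl], clarify)
  fix u v w assume s: "(u, v, w) \<in> splits3 as"
  show "psgn (sdeg A L u) (M L (contract A L u v w) (x + y) Z \<tau>) =
    psgn (sdeg A L u) (M L (contract A L u v w) x Z \<tau>) + psgn (sdeg A L u) (M L (contract A L u v w) y Z \<tau>)"
    unfolding psgn_add[symmetric]
    by (subst M_add[OF hpath_contract[OF assms(1) s]])
       (use assms s in \<open>simp_all add: tgt_contract'\<close>)
qed

lemma rel_mid_add:
  assumes "hpath A L as" "x \<in> Hom_total A (tgt L as) (fst Z)" "y \<in> Hom_total A (tgt L as) (fst Z)" "dhp Z \<tau>"
  shows "rel_mid L as (x + y) Z \<tau> = rel_mid L as x Z \<tau> + rel_mid L as y Z \<tau>"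
  unfolding rel_mid_def sum.distrib[symmetric]
proof (rule sum.cong[OF refl], clarify)
  fix u v assume s: "(u, v) \<in> splits2 as"
  then have uv: "hpath A L u" "hpath A (tgt L u) v" "tgt (tgt L u) v = tgt L as"
    using assms(1) by (auto simp: splits2_def hpath_append)
  show "(\<Sum>(t1, t2)\<in>splits2 \<tau>. psgn (sdeg A L u) (M L u (M (tgt L u) v (x + y) Z t1) (tgt Z t1) t2)) =
    (\<Sum>(t1, t2)\<in>splits2 \<tau>. psgn (sdeg A L u) (M L u (M (tgt L u) v x Z t1) (tgt Z t1) t2)) +
    (\<Sum>(t1, t2)\<in>splits2 \<tau>. psgn (sdeg A L u) (M L u (M (tgt L u) v y Z t1) (tgt Z t1) t2))"
    unfolding sum.distrib[symmetric]
  proof (rule sum.cong[OF refl], clarify)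
    fix t1 t2 assume "(t1, t2) \<in> splits2 \<tau>"
    then have t: "dhp Z t1" "dhp (tgt Z t1) t2" using assms(4) by (auto simp: splits2_def dhp_append)
    have 1: "M (tgt L u) v (x + y) Z t1 = M (tgt L u) v x Z t1 + M (tgt L u) v y Z t1"
      by (rule M_add[OF uv(2)]) (use uv assms t dhp_dtp in auto)
    have 2: "M (tgt L u) v x Z t1 \<in> Hom_total A (tgt L u) (fst (tgt Z t1))"
      "M (tgt L u) v y Z t1 \<in> Hom_total A (tgt L u) (fst (tgt Z t1))"
      by (rule M_total[OF uv(2) _ t(1)]; use uv assms in simp)+
    show "psgn (sdeg A L u) (M L u (M (tgt L u) v (x + y) Z t1) (tgt Z t1) t2) =
      psgn (sdeg A L u) (M L u (M (tgt L u) v x Z t1) (tgt Z t1) t2) +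
      psgn (sdeg A L u) (M L u (M (tgt L u) v y Z t1) (tgt Z t1) t2)"
      unfolding 1 psgn_add[symmetric] M_add[OF uv(1) 2 dhp_dtp[OF t(2)]] ..
  qed
qed

lemma rel_end_add:
  assumes "hpath A L as" "x \<in> Hom_total A (tgt L as) (fst Z)" "y \<in> Hom_total A (tgt L as) (fst Z)" "dhp Z \<tau>"
  shows "rel_end L as (x + y) Z \<tau> = rel_end L as x Z \<tau> + rel_end L as y Z \<tau>"
  unfolding rel_end_def sum.distrib[symmetric]
  by (rule sum.cong[OF refl], clarify)
     (simp only: M_add[OF assms(1-3) dtp_contract[OF assms(4)]] psgn_add)

text \<open>For homogeneous \<open>y\<close> the shifted degree splits into a minus sign, which
  moves the last group to the right, and \<open>(-1)^|y|\<close>, which is \<open>parity\<close>.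
  Everything is then additive in \<open>y\<close>, so the even and the odd component may be
  added.\<close>

lemma M_relation:
  assumes as: "hpath A L as" and y: "y \<in> Hom_total A (tgt L as) (fst Z)" and \<tau>: "dhp Z \<tau>"
  shows "rel_in L as y Z \<tau> + rel_mid L as y Z \<tau> = rel_end L as (parity gen (tgt L as) (fst Z) y) Z \<tau>"
proof -
  have ob: "tgt L as \<in> Ob A" "fst Z \<in> Ob A"
    using hpath_tgt[OF as] start_Ob[OF \<tau>] by simp_all
  have hom: "rel_in L as x Z \<tau> + rel_mid L as x Z \<tau> = rel_end L as (parity gen (tgt L as) (fst Z) x) Z \<tau>"
    if x: "x \<in> Hom A (tgt L as) (fst Z) e" for x e
  proof -
    have "(\<Sum>(t1, t2, t3)\<in>splits3 \<tau>. psgn (sdeg A L as + e + 1 + ddeg A Z t1)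
       (M L as x Z (t1 @ (dmu A (tgt Z t1) t2, tgt (tgt Z t1) t2) # t3))) =
       (\<Sum>(t1, t2, t3)\<in>splits3 \<tau>. - psgn (sdeg A L as + ddeg A Z t1)
     (M L as (parity gen (tgt L as) (fst Z) x) Z (t1 @ (dmu A (tgt Z t1) t2, tgt (tgt Z t1) t2) # t3)))"
    proof (rule sum.cong[OF refl], clarify)
      fix t1 t2 t3 assume t: "(t1, t2, t3) \<in> splits3 \<tau>"
      show "psgn (sdeg A L as + e + 1 + ddeg A Z t1)
         (M L as x Z (t1 @ (dmu A (tgt Z t1) t2, tgt (tgt Z t1) t2) # t3)) =
         - psgn (sdeg A L as + ddeg A Z t1)
           (M L as (parity gen (tgt L as) (fst Z) x) Z (t1 @ (dmu A (tgt Z t1) t2, tgt (tgt Z t1) t2) # t3))"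
        unfolding parity_Hom[OF ob x] M_psgn[OF as Hom_sub_total[OF ob x] dtp_contract[OF \<tau> t]]
          minus_psgn psgn_psgn
        by (simp add: add_ac del: add_bit_eq_xor)
    qed
    also have "\<dots> = - rel_end L as (parity gen (tgt L as) (fst Z) x) Z \<tau>"
      unfolding rel_end_def sum_negf[symmetric] by (simp add: case_prod_beta')
    finally have "rel_in L as x Z \<tau> + rel_mid L as x Z \<tau> + - rel_end L as (parity gen (tgt L as) (fst Z) x) Z \<tau> = 0"
      using M_relation_homogeneous[OF as x \<tau>] unfolding rel_in_def[symmetric] rel_mid_def[symmetric]
      by (simp only:)
    then show ?thesis by (simp only: add_uminus_conv_diff right_minus_eq)
  qed
  obtain y0 y1 where y01: "y = y0 + y1" "y0 \<in> Hom A (tgt L as) (fst Z) 0" "y1 \<in> Hom A (tgt L as) (fst Z) 1"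
    using y unfolding Hom_total_def by blast
  note t = Hom_sub_total[OF ob y01(2)] Hom_sub_total[OF ob y01(3)]
  have "rel_in L as y Z \<tau> + rel_mid L as y Z \<tau> =
    (rel_in L as y0 Z \<tau> + rel_mid L as y0 Z \<tau>) + (rel_in L as y1 Z \<tau> + rel_mid L as y1 Z \<tau>)"
    unfolding y01(1) rel_in_add[OF as t dhp_dtp[OF \<tau>]] rel_mid_add[OF as t \<tau>] by (simp add: add_ac)
  also have "\<dots> = rel_end L as (parity gen (tgt L as) (fst Z) y) Z \<tau>"
    unfolding hom[OF y01(2)] hom[OF y01(3)] y01(1) parity_add
    by (rule rel_end_add[symmetric]) (use as \<tau> t parity_total[OF ob] in auto)
  finally show ?thesis .
qed

definition weak_mc where
  "weak_mc Z W \<longleftrightarrow> Z \<in> \<D> \<and> dmu A Z [] = W \<odot> unit_of A (fst Z)"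

lemma M_insert_scale:
  assumes "hpath A L as" "y \<in> Hom_total A (tgt L as) (fst Z)" "dtp Z t1"
    "x \<in> Hom_total A (fst (tgt Z t1)) (fst Z')" "dtp Z' t3"
  shows "M L as y Z (t1 @ (c \<odot> x, Z') # t3) = c \<odot> M L as y Z (t1 @ (x, Z') # t3)"
  using dmu_scale[of "(L, 0)" "lift as @ (y, Z) # t1" x Z' t3 c] assms dtp_lift[OF assms(1)] zero_obj
    hpath_tgt[OF assms(1)]
  by (simp add: M_def dtp_append)

lemma M_insert_add:
  assumes "hpath A L as" "y \<in> Hom_total A (tgt L as) (fst Z)" "dtp Z t1"
    "x \<in> Hom_total A (fst (tgt Z t1)) (fst Z')" "x' \<in> Hom_total A (fst (tgt Z t1)) (fst Z')" "dtp Z' t3"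
  shows "M L as y Z (t1 @ (x + x', Z') # t3) = M L as y Z (t1 @ (x, Z') # t3) + M L as y Z (t1 @ (x', Z') # t3)"
  using dmu_add[of "(L, 0)" "lift as @ (y, Z) # t1" x Z' x' t3] assms dtp_lift[OF assms(1)] zero_obj
    hpath_tgt[OF assms(1)]
  by (simp add: M_def dtp_append)

lemma M_insert_zero:
  assumes "hpath A L as" "y \<in> Hom_total A (tgt L as) (fst Z)" "dtp Z t1" "dtp Z' t3"
  shows "M L as y Z (t1 @ (0, Z') # t3) = 0"
  using dmu_zero[of "(L, 0)" "lift as @ (y, Z) # t1" Z' t3] assms dtp_lift[OF assms(1)] zero_obj
    hpath_tgt[OF assms(1)]
  by (simp add: M_def dtp_append)

lemma unit_total: "Z \<in> \<D> \<Longrightarrow> unit_of A (fst Z) \<in> Hom_total A (fst Z) (fst Z)"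
  using Hom_sub_total[OF obj obj unit_Hom[OF obj]] by blast

text \<open>The variable \<open>y\<close> and the unit are already two inputs; any further letter
  makes at least three, and such operations vanish on units.\<close>

lemma M_unit_zero:
  assumes "hpath A L as" "y \<in> Hom_total A (tgt L as) (fst Z)" "dtp Z t1" "dtp (tgt Z t1) t3"
    "as \<noteq> [] \<or> t1 \<noteq> [] \<or> t3 \<noteq> []"
  shows "M L as y Z (t1 @ (unit_of A (fst (tgt Z t1)), tgt Z t1) # t3) = 0"
proof -
  have "dmu A (L, 0) ((lift as @ (y, Z) # t1) @ (unit_of A (fst (tgt Z t1)), tgt Z t1) # t3) = 0"
  proof (rule dmu_unit_zero)
    show "dtp (L, 0) ((lift as @ (y, Z) # t1) @ (unit_of A (fst (tgt Z t1)), tgt Z t1) # t3)"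
      using assms dtp_lift[OF assms(1)] zero_obj hpath_tgt[OF assms(1)] unit_total[OF dtp_tgt[OF assms(3)]]
      by (simp add: dtp_append dtp_tgt)
    show "fst (tgt Z t1) = fst (tgt (L, 0) (lift as @ (y, Z) # t1))" by simp
    show "2 \<le> length (lift as @ (y, Z) # t1) + length t3"
      using assms(5) by (cases as; cases t1; cases t3) auto
  qed
  then show ?thesis by (simp add: M_def)
qed

text \<open>The weak Maurer--Cartan equation makes the curvature a multiple of the unit, so it is
  invisible as soon as a letter other than \<open>y\<close> is present.\<close>

lemma M_curvature_zero:
  assumes "hpath A L as" "y \<in> Hom_total A (tgt L as) (fst Z)" "dtp Z t1" "dtp (tgt Z t1) t3"
    "as \<noteq> [] \<or> t1 \<noteq> [] \<or> t3 \<noteq> []" "weak_mc (tgt Z t1) W"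
  shows "M L as y Z (t1 @ (dmu A (tgt Z t1) [], tgt Z t1) # t3) = 0"
proof -
  have d: "tgt Z t1 \<in> \<D>" "dmu A (tgt Z t1) [] = W \<odot> unit_of A (fst (tgt Z t1))"
    using assms(6) by (auto simp: weak_mc_def)
  show ?thesis
    unfolding d(2) M_insert_scale[OF assms(1,2,3) unit_total[OF d(1)] assms(4)] M_unit_zero[OF assms(1-5)]
    by (simp add: fun_eq_iff nscale_apply)
qed

text \<open>The right unit axiom carries the sign \<open>(-1)^|x|\<close>, which
  \<open>parity\<close> undoes. With letters before \<open>y\<close> there are at least three inputs
  and the unit gives zero.\<close>

lemma M_end_unit:
  assumes "hpath A L as" "y \<in> Hom_total A (tgt L as) (fst Z)" "Z \<in> \<D>"
  shows "psgn (sdeg A L as) (M L as (parity gen (tgt L as) (fst Z) y) Z [(unit_of A (fst Z), Z)])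
    = (if as = [] then y else 0)"
proof (cases "as = []")
  case False
  have ob: "tgt L as \<in> Ob A" "fst Z \<in> Ob A" using hpath_tgt[OF assms(1)] obj[OF assms(3)] by auto
  show ?thesis
    using M_unit_zero[of L as "parity gen (tgt L as) (fst Z) y" Z "[]" "[]"] assms False parity_total[OF ob assms(2)]
    by simp
next
  case True
  have ob: "L \<in> Ob A" "fst Z \<in> Ob A" using hpath_start[OF assms(1)] obj[OF assms(3)] by auto
  have e: "M L [] (parity gen L (fst Z) x) Z [(unit_of A (fst Z), Z)] = x" if x: "x \<in> Hom A L (fst Z) e" for x e
  proof -
    have "M L [] (psgn e x) Z [(unit_of A (fst Z), Z)] = psgn e (M L [] x Z [(unit_of A (fst Z), Z)])"
      by (rule M_psgn) (use ob assms Hom_sub_total[OF ob x] unit_total[OF assms(3)] in auto)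
    also have "M L [] x Z [(unit_of A (fst Z), Z)] = psgn e x"
      using dmu_unit_right[OF zero_obj[OF ob(1)] assms(3), of x e] x by (simp add: M_def)
    finally show ?thesis using parity_Hom[OF ob x] by (simp add: psgn_def)
  qed
  obtain y0 y1 where y: "y = y0 + y1" "y0 \<in> Hom A L (fst Z) 0" "y1 \<in> Hom A L (fst Z) 1"
    using assms(2) True unfolding Hom_total_def by auto
  have "M L [] (parity gen L (fst Z) y0 + parity gen L (fst Z) y1) Z [(unit_of A (fst Z), Z)] =
    M L [] (parity gen L (fst Z) y0) Z [(unit_of A (fst Z), Z)] + M L [] (parity gen L (fst Z) y1) Z [(unit_of A (fst Z), Z)]"
    by (rule M_add)
       (use ob assms parity_total[OF ob Hom_sub_total[OF ob y(2)]] parity_total[OF ob Hom_sub_total[OF ob y(3)]]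
          unit_total[OF assms(3)] in auto)
  then show ?thesis
    using True e[OF y(2)] e[OF y(3)] by (simp add: y(1) parity_add)
qed

text \<open>With nothing after \<open>y\<close> the only end term is the curvature of
  \<open>Z\<close>, which survives for empty \<open>as\<close> alone. The empty case is the source
  of the matrix factorization equation, the other case of the functor equation.\<close>

lemma functor_relation:
  assumes as: "hpath A L as" and y: "y \<in> Hom_total A (tgt L as) (fst Z)" and W: "weak_mc Z W"
  shows "rel_in L as y Z [] + (\<Sum>(u, v)\<in>splits2 as. psgn (sdeg A L u) (M L u (M (tgt L u) v y Z []) Z []))
    = (if as = [] then W \<odot> y else 0)"
proof -
  have d: "Z \<in> \<D>" "dmu A Z [] = W \<odot> unit_of A (fst Z)" using W by (auto simp: weak_mc_def)
  have ob: "tgt L as \<in> Ob A" "fst Z \<in> Ob A" using hpath_tgt[OF as] obj[OF d(1)] by auto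
  let ?y = "parity gen (tgt L as) (fst Z) y"
  have "rel_end L as ?y Z [] = psgn (sdeg A L as) (M L as ?y Z [(W \<odot> unit_of A (fst Z), Z)])"
    by (simp add: rel_end_def splits3_Nil d(2))
  also have "M L as ?y Z [(W \<odot> unit_of A (fst Z), Z)] = W \<odot> M L as ?y Z [(unit_of A (fst Z), Z)]"
    using M_insert_scale[OF as parity_total[OF ob y], of "[]" "unit_of A (fst Z)" Z "[]" W] d(1) unit_total[OF d(1)]
    by simp
  also have "psgn (sdeg A L as) (W \<odot> M L as ?y Z [(unit_of A (fst Z), Z)]) =
      W \<odot> psgn (sdeg A L as) (M L as ?y Z [(unit_of A (fst Z), Z)])"
    by (auto simp: psgn_def fun_eq_iff nscale_apply)
  also have "\<dots> = (if as = [] then W \<odot> y else 0)"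
    unfolding M_end_unit[OF as y d(1)] by (auto simp: fun_eq_iff nscale_apply)
  finally have "rel_end L as ?y Z [] = (if as = [] then W \<odot> y else 0)" .
  moreover have "rel_mid L as y Z [] = (\<Sum>(u, v)\<in>splits2 as. psgn (sdeg A L u) (M L u (M (tgt L u) v y Z []) Z []))"
    by (simp add: rel_mid_def splits2_Nil)
  ultimately show ?thesis using M_relation[OF as y, of "[]"] d(1) by simp
qed

lemma rel_end_single:
  assumes as: "hpath A L as" and y: "y \<in> Hom_total A (tgt L as) (fst Z)"
    and W: "weak_mc Z W" "weak_mc Z' W'" and x: "x \<in> Hom_total A (fst Z) (fst Z')"
  shows "rel_end L as y Z [(x, Z')] = psgn (sdeg A L as) (M L as y Z [(dmu A Z [(x, Z')], Z')])"
proof -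
  have d: "Z \<in> \<D>" "Z' \<in> \<D>" using W by (auto simp: weak_mc_def)
  have "M L as y Z [(dmu A Z [], Z), (x, Z')] = 0"
    using M_curvature_zero[OF as y, of "[]" "[(x, Z')]" W] d x W by simp
  moreover have "M L as y Z [(x, Z'), (dmu A Z' [], Z')] = 0"
    using M_curvature_zero[OF as y, of "[(x, Z')]" "[]" W'] d x W by simp
  ultimately show ?thesis by (simp add: rel_end_def splits3_single)
qed

text \<open>Of the six splits of the pair, three insert curvature beside other letters and two
  insert the differential of a closed morphism; only the product remains.\<close>

lemma rel_end_pair:
  assumes as: "hpath A L as" and y: "y \<in> Hom_total A (tgt L as) (fst Z)"
    and W: "weak_mc Z W" "weak_mc Z' W'" "weak_mc Z'' W''"
    and x: "x \<in> Hom_total A (fst Z) (fst Z')" "x' \<in> Hom_total A (fst Z') (fst Z'')"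
    and closed: "dmu A Z [(x, Z')] = 0" "dmu A Z' [(x', Z'')] = 0"
  shows "rel_end L as y Z [(x, Z'), (x', Z'')] =
    psgn (sdeg A L as) (M L as y Z [(dmu A Z [(x, Z'), (x', Z'')], Z'')])"
proof -
  have d: "Z \<in> \<D>" "Z' \<in> \<D>" "Z'' \<in> \<D>" using W by (auto simp: weak_mc_def)
  have "M L as y Z [(dmu A Z [], Z), (x, Z'), (x', Z'')] = 0"
    using M_curvature_zero[OF as y, of "[]" "[(x, Z'), (x', Z'')]" W] d x W by simp
  moreover have "M L as y Z [(x, Z'), (dmu A Z' [], Z'), (x', Z'')] = 0"
    using M_curvature_zero[OF as y, of "[(x, Z')]" "[(x', Z'')]" W'] d x W by simp
  moreover have "M L as y Z [(x, Z'), (x', Z''), (dmu A Z'' [], Z'')] = 0"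
    using M_curvature_zero[OF as y, of "[(x, Z'), (x', Z'')]" "[]" W''] d x W by simp
  moreover have "M L as y Z [(0, Z'), (x', Z'')] = 0"
    using M_insert_zero[OF as y, of "[]" Z' "[(x', Z'')]"] d x by simp
  moreover have "M L as y Z [(x, Z'), (0, Z'')] = 0"
    using M_insert_zero[OF as y, of "[(x, Z')]" Z'' "[]"] d x by simp
  ultimately show ?thesis by (simp add: rel_end_def splits3_pair closed)
qed

end

lemma bit_cancel: "a + a = (0 :: bit)" "a + (a + b) = (b :: bit)"
  by (cases "a = 0"; cases "b = 0"; simp)+

section \<open>Naturality, homotopy and equality of potentials at one point\<close>

context mirror_ainf
begin

text \<open>A string of shifted degree \<open>d\<close>, with the exception for zero letters built
  in, since \<open>ddeg\<close> misjudges an odd letter that happens to be zero.\<close>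

definition graded where
  "graded Z \<tau> d \<longleftrightarrow> dhp Z \<tau> \<and> (ddeg A Z \<tau> = d \<or> (\<exists>K. (0, K) \<in> set \<tau>))"

lemma graded_Nil: "Z \<in> \<D> \<Longrightarrow> graded Z [] 0"
  by (simp add: graded_def)

lemma graded_Cons:
  assumes "Z \<in> \<D>" "x \<in> Hom A (fst Z) (fst Z') e" "graded Z' \<tau> d"
  shows "graded Z ((x, Z') # \<tau>) (e + 1 + d)"
proof -
  have "dhp Z' \<tau>" using assms(3) by (simp add: graded_def)
  then have ob: "fst Z \<in> Ob A" "fst Z' \<in> Ob A" using obj[OF assms(1)] start_Ob by auto
  show ?thesis
  proof (cases "x = 0")
    case True
    then have "(0, Z') \<in> set ((x, Z') # \<tau>)" by simp
    moreover have "dhp Z ((x, Z') # \<tau>)" using assms \<open>dhp Z' \<tau>\<close> by auto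
    ultimately show ?thesis unfolding graded_def by blast
  next
    case False
    then show ?thesis
      using assms deg_eq[OF ob assms(2) False] unfolding graded_def
      by (auto simp del: add_bit_eq_xor)
  qed
qed

lemma M_graded:
  assumes "hpath A L as" "y \<in> Hom A (tgt L as) (fst Z) e" "graded Z \<tau> d"
  shows "M L as y Z \<tau> \<in> Hom A L (fst (tgt Z \<tau>)) (sdeg A L as + e + 1 + d)"
proof -
  have \<tau>: "dhp Z \<tau>" using assms(3) by (simp add: graded_def)
  consider "ddeg A Z \<tau> = d" | K where "(0, K) \<in> set \<tau>" using assms(3) unfolding graded_def by blast
  then show ?thesis
  proof cases
    case 1
    then show ?thesis using M_degree[OF assms(1,2) \<tau>] by simp
  next
    case 2
    have "dtp (L, 0) (lift as @ (y, Z) # \<tau>)"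
      unfolding dtp_insert
      using dtp_lift[OF assms(1)] dhp_dtp[OF \<tau>] Hom_sub_total[OF hpath_tgt[OF assms(1)] start_Ob[OF \<tau>] assms(2)]
      by simp
    then have "M L as y Z \<tau> = 0" unfolding M_def by (rule dmu_zero_mem) (use 2 in auto)
    then show ?thesis using Hom_zero[OF hpath_start[OF assms(1)] tgt_Ob[OF \<tau>]] by simp
  qed
qed

text \<open>The degree of the output is that of \<open>y\<close> plus
  \<open>sdeg as + 1 + d\<close>, so twisting the output instead of the input costs exactly this
  sign.\<close>

lemma M_parity:
  assumes as: "hpath A L as" and y: "y \<in> Hom_total A (tgt L as) (fst Z)" and \<tau>: "graded Z \<tau> d"
  shows "parity gen L (fst (tgt Z \<tau>)) (M L as y Z \<tau>) =
    psgn (sdeg A L as + 1 + d) (M L as (parity gen (tgt L as) (fst Z) y) Z \<tau>)"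
proof -
  have \<tau>': "dhp Z \<tau>" using \<tau> by (simp add: graded_def)
  note ob = hpath_tgt[OF as] start_Ob[OF \<tau>']
  have hom: "parity gen L (fst (tgt Z \<tau>)) (M L as x Z \<tau>) =
    psgn (sdeg A L as + 1 + d) (M L as (parity gen (tgt L as) (fst Z) x) Z \<tau>)"
    if x: "x \<in> Hom A (tgt L as) (fst Z) e" for x e
    unfolding parity_Hom[OF ob x] M_psgn[OF as Hom_sub_total[OF ob x] dhp_dtp[OF \<tau>']] psgn_psgn
      parity_Hom[OF hpath_start[OF as] tgt_Ob[OF \<tau>'] M_graded[OF as x \<tau>]]
    by (simp add: add_ac del: add_bit_eq_xor)
  obtain y0 y1 where y01: "y = y0 + y1" "y0 \<in> Hom A (tgt L as) (fst Z) 0" "y1 \<in> Hom A (tgt L as) (fst Z) 1"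
    using y unfolding Hom_total_def by blast
  note t = Hom_sub_total[OF ob y01(2)] Hom_sub_total[OF ob y01(3)]
  show ?thesis
    unfolding y01(1) M_add[OF as t dhp_dtp[OF \<tau>']] parity_add hom[OF y01(2)] hom[OF y01(3)]
      M_add[OF as parity_total[OF ob t(1)] parity_total[OF ob t(2)] dhp_dtp[OF \<tau>']] psgn_add ..
qed

text \<open>An operation has shifted degree 1, so contraction changes the shifted degree of a string
  by one. If the contracted value is zero its assigned degree may be wrong, but then both sides
  vanish.\<close>

lemma M_contract_sign:
  assumes as: "hpath A L as" and s: "(u, v, w) \<in> splits3 as" and \<tau>: "dtp Z \<tau>"
    and y: "y \<in> Hom_total A (tgt L as) (fst Z)"
  shows "psgn (sdeg A L (contract A L u v w)) (M L (contract A L u v w) y Z \<tau>) =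
    psgn (sdeg A L as + 1) (M L (contract A L u v w) y Z \<tau>)"
proof (cases "mu A (tgt L u) v = 0")
  case True
  have "dtp (L, 0) (lift (contract A L u v w) @ (y, Z) # \<tau>)"
    unfolding dtp_insert
    using dtp_lift[OF hpath_contract[OF as s]] \<tau> y tgt_contract'[OF s] by simp
  moreover have "(0, (tgt L (u @ v), 0)) \<in> set (lift (contract A L u v w) @ (y, Z) # \<tau>)"
    unfolding lift_contract True by simp
  ultimately have "M L (contract A L u v w) y Z \<tau> = 0" unfolding M_def by (rule dmu_zero_mem)
  then show ?thesis by simp
next
  case False
  have ob: "tgt L u \<in> Ob A" "tgt L (u @ v) \<in> Ob A"
    using as s by (auto simp: splits3_def hpath_append dest: hpath_tgt)
  have a: "as = u @ v @ w" using s by (simp add: splits3_def)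
  have "sdeg A L (contract A L u v w) = sdeg A L as + 1"
    using deg_eq[OF ob hpath_mu_Hom[OF as s] False]
    by (simp add: contract_def sdeg_append a add_ac del: add_bit_eq_xor)
  then show ?thesis by simp
qed

text \<open>The value of \<open>comparison_map\<close> at one point of the domain.\<close>

definition T where
  "T L as y Z \<theta> Z' = psgn (sdeg A L as) (M L as (parity gen (tgt L as) (fst Z) y) Z [(\<theta>, Z')])"

lemma rel_mid_single:
  "rel_mid L as y Z [(x, Z')] = (\<Sum>(u, v)\<in>splits2 as. psgn (sdeg A L u)
     (M L u (M (tgt L u) v y Z []) Z [(x, Z')] + M L u (M (tgt L u) v y Z [(x, Z')]) Z' []))"
  by (simp add: rel_mid_def splits2_single psgn_add)

lemma rel_mid_pair:
  "rel_mid L as y Z [(x, Z'), (x', Z'')] = (\<Sum>(u, v)\<in>splits2 as. psgn (sdeg A L u)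
     (M L u (M (tgt L u) v y Z []) Z [(x, Z'), (x', Z'')]
      + M L u (M (tgt L u) v y Z [(x, Z')]) Z' [(x', Z'')]
      + M L u (M (tgt L u) v y Z [(x, Z'), (x', Z'')]) Z'' []))"
  by (simp add: rel_mid_def splits2_pair psgn_add add_ac)

text \<open>Up to the common sign \<open>?s\<close> these are the terms of the relation for
  \<open>\<theta>\<close> placed after the twisted \<open>y\<close>. Its end side is zero: each
  curvature term has a unit among at least three inputs, and \<open>\<theta>\<close> is
  closed.\<close>

lemma natural_relation:
  assumes as: "hpath A L as" and y: "y \<in> Hom_total A (tgt L as) (fst Z)"
    and W: "weak_mc Z W" "weak_mc Z' W'" and \<theta>: "\<theta> \<in> Hom A (fst Z) (fst Z') 0"
    and closed: "dmu A Z [(\<theta>, Z')] = 0"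
  shows "(\<Sum>(u, v, w)\<in>splits3 as. psgn (sdeg A L u) (T L (contract A L u v w) y Z \<theta> Z'))
    + (\<Sum>(u, v)\<in>splits2 as. psgn (sdeg A L u) (T L u (M (tgt L u) v y Z []) Z \<theta> Z'))
    = (\<Sum>(u, v)\<in>splits2 as. M L u (T (tgt L u) v y Z \<theta> Z') Z' [])"
proof -
  have d: "Z \<in> \<D>" "Z' \<in> \<D>" using W by (auto simp: weak_mc_def)
  note obZ = obj[OF d(1)] obj[OF d(2)]
  note ob = hpath_tgt[OF as] obZ(1)
  have \<theta>t: "\<theta> \<in> Hom_total A (fst Z) (fst Z')" using \<theta> Hom_sub_total obZ by blast
  have \<theta>p: "dhp Z [(\<theta>, Z')]" using d \<theta> by auto
  let ?y = "parity gen (tgt L as) (fst Z) y"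
  have y': "?y \<in> Hom_total A (tgt L as) (fst Z)" by (rule parity_total[OF ob y])
  let ?s = "sdeg A L as + 1"
  have "rel_in L as ?y Z [(\<theta>, Z')] + rel_mid L as ?y Z [(\<theta>, Z')] = rel_end L as y Z [(\<theta>, Z')]"
    using M_relation[OF as y' \<theta>p] by simp
  also have "\<dots> = psgn (sdeg A L as) (M L as y Z [(0, Z')])"
    unfolding rel_end_single[OF as y W \<theta>t] closed ..
  also have "\<dots> = 0"
    using M_insert_zero[OF as y, of "[]" Z' "[]"] d by simp
  finally have rel: "rel_in L as ?y Z [(\<theta>, Z')] + rel_mid L as ?y Z [(\<theta>, Z')] = 0" .
  have 1: "(\<Sum>(u, v, w)\<in>splits3 as. psgn (sdeg A L u) (T L (contract A L u v w) y Z \<theta> Z'))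
    = psgn ?s (rel_in L as ?y Z [(\<theta>, Z')])"
    unfolding rel_in_def psgn_sum
  proof (rule sum.cong[OF refl], clarify)
    fix u v w assume s: "(u, v, w) \<in> splits3 as"
    show "psgn (sdeg A L u) (T L (contract A L u v w) y Z \<theta> Z') =
      psgn ?s (psgn (sdeg A L u) (M L (contract A L u v w) ?y Z [(\<theta>, Z')]))"
      unfolding T_def tgt_contract'[OF s] M_contract_sign[OF as s dhp_dtp[OF \<theta>p] y'] psgn_psgn
      by (simp add: add_ac del: add_bit_eq_xor)
  qed
  \<comment> \<open>With \<open>\<theta>\<close> outside, \<open>parity\<close> has to pass the
    inner operation, which costs the sign \<open>sdeg v + 1\<close>; with \<open>\<theta>\<close>
    inside it does not. This is the relative minus between the two sums.\<close>
  have 2: "(\<Sum>(u, v)\<in>splits2 as. psgn (sdeg A L u) (T L u (M (tgt L u) v y Z []) Z \<theta> Z'))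
      - (\<Sum>(u, v)\<in>splits2 as. M L u (T (tgt L u) v y Z \<theta> Z') Z' [])
    = psgn ?s (rel_mid L as ?y Z [(\<theta>, Z')])"
    unfolding rel_mid_single psgn_sum sum_subtractf[symmetric]
  proof (rule sum.cong[OF refl], clarify)
    fix u v assume s: "(u, v) \<in> splits2 as"
    then have uv: "hpath A L u" "hpath A (tgt L u) v" "tgt (tgt L u) v = tgt L as"
      and sd: "sdeg A L as = sdeg A L u + sdeg A (tgt L u) v"
      using as by (auto simp: splits2_def hpath_append sdeg_append)
    have yv: "y \<in> Hom_total A (tgt (tgt L u) v) (fst Z)" and y'v: "?y \<in> Hom_total A (tgt (tgt L u) v) (fst Z)"
      using y y' uv by simp_all
    have My: "M (tgt L u) v ?y Z [] \<in> Hom_total A (tgt L u) (fst Z)"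
      using M_total[OF uv(2) y'v, of "[]"] d by simp
    have MT: "M (tgt L u) v ?y Z [(\<theta>, Z')] \<in> Hom_total A (tgt L u) (fst Z')"
      using M_total[OF uv(2) y'v \<theta>p] by simp
    have "parity gen (tgt L u) (fst Z) (M (tgt L u) v y Z []) =
      psgn (sdeg A (tgt L u) v + 1) (M (tgt L u) v ?y Z [])"
      using M_parity[OF uv(2) yv graded_Nil[OF d(1)]] uv(3) by simp
    then have a: "psgn (sdeg A L u) (T L u (M (tgt L u) v y Z []) Z \<theta> Z') =
        psgn ?s (psgn (sdeg A L u) (M L u (M (tgt L u) v ?y Z []) Z [(\<theta>, Z')]))"
      unfolding T_def by (simp only: M_psgn[OF uv(1) My dhp_dtp[OF \<theta>p]] psgn_psgn sd add_ac)
    have Nil: "dtp Z' []" using d by simp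
    have b: "M L u (T (tgt L u) v y Z \<theta> Z') Z' [] =
        - psgn ?s (psgn (sdeg A L u) (M L u (M (tgt L u) v ?y Z [(\<theta>, Z')]) Z' []))"
      unfolding T_def uv(3) minus_psgn psgn_psgn sd
      by (simp add: M_psgn[OF uv(1) MT Nil] add_ac bit_cancel del: add_bit_eq_xor)
    show "psgn (sdeg A L u) (T L u (M (tgt L u) v y Z []) Z \<theta> Z') - M L u (T (tgt L u) v y Z \<theta> Z') Z' [] =
      psgn ?s (psgn (sdeg A L u) (M L u (M (tgt L u) v ?y Z []) Z [(\<theta>, Z')] +
         M L u (M (tgt L u) v ?y Z [(\<theta>, Z')]) Z' []))"
      unfolding a b psgn_add by simp
  qed
  have "(\<Sum>(u, v, w)\<in>splits3 as. psgn (sdeg A L u) (T L (contract A L u v w) y Z \<theta> Z'))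
    + ((\<Sum>(u, v)\<in>splits2 as. psgn (sdeg A L u) (T L u (M (tgt L u) v y Z []) Z \<theta> Z'))
      - (\<Sum>(u, v)\<in>splits2 as. M L u (T (tgt L u) v y Z \<theta> Z') Z' [])) = 0"
    unfolding 1 2 psgn_add[symmetric] rel by simp
  then show ?thesis by (simp only: add_diff_eq right_minus_eq)
qed

text \<open>The outer transformation twists the output of the inner one; as \<open>\<theta>\<close>
  has degree 0, this cancels the inner twist and sign, and only the sign of \<open>u\<close>
  remains.\<close>

lemma T_T:
  assumes as: "hpath A L u" "hpath A (tgt L u) v" and y: "y \<in> Hom_total A (tgt (tgt L u) v) (fst Z)"
    and d: "Z \<in> \<D>" "Z' \<in> \<D>" "Z'' \<in> \<D>"
    and \<theta>: "\<theta> \<in> Hom A (fst Z) (fst Z') 0" "\<theta>' \<in> Hom A (fst Z') (fst Z'') 0"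
  shows "T L u (T (tgt L u) v y Z \<theta> Z') Z' \<theta>' Z'' =
    psgn (sdeg A L u) (M L u (M (tgt L u) v y Z [(\<theta>, Z')]) Z' [(\<theta>', Z'')])"
proof -
  have g: "graded Z [(\<theta>, Z')] 1" using graded_Cons[OF d(1) \<theta>(1) graded_Nil[OF d(2)]] by simp
  let ?y = "parity gen (tgt (tgt L u) v) (fst Z) y"
  have y': "?y \<in> Hom_total A (tgt (tgt L u) v) (fst Z)"
    using parity_total[OF hpath_tgt[OF as(2)] obj[OF d(1)] y] .
  have "parity gen (tgt L u) (fst Z') (T (tgt L u) v y Z \<theta> Z') = M (tgt L u) v y Z [(\<theta>, Z')]"
    using M_parity[OF as(2) y' g] unfolding T_def parity_psgn by (simp add: psgn_def)
  then show ?thesis unfolding T_def[of L u] by simp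
qed

lemma Hom_total_diff:
  assumes "K \<in> Ob A" "L \<in> Ob A" "x \<in> Hom_total A K L" "y \<in> Hom_total A K L"
  shows "x - y \<in> Hom_total A K L"
  unfolding Hom_total_iff[OF assms(1,2)]
proof (intro allI impI)
  fix p assume "(x - y) p \<noteq> 0"
  then have "x p \<noteq> 0 \<or> y p \<noteq> 0" by auto
  then show "p \<in> both (gen K L)" using assms(3,4) unfolding Hom_total_iff[OF assms(1,2)] by blast
qed

text \<open>On the end side the difference of the two relations inserts
  \<open>m_2(\<theta>, \<theta>') - m_1(\<gamma>)\<close> after the twisted \<open>y\<close>; this
  is the unit, so \<open>M_end_unit\<close> gives \<open>y\<close> or zero. The middle terms with
  \<open>\<theta>\<close> inside and \<open>\<theta>'\<close> outside are the composite computed in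
  \<open>T_T\<close>.\<close>

lemma homotopy_relation:
  assumes as: "hpath A L as" and y: "y \<in> Hom_total A (tgt L as) (fst Z)"
    and W: "weak_mc Z W" "weak_mc Z' W'"
    and \<theta>: "\<theta> \<in> Hom A (fst Z) (fst Z') 0" "\<theta>' \<in> Hom A (fst Z') (fst Z) 0" "\<gamma> \<in> Hom A (fst Z) (fst Z) 1"
    and closed: "dmu A Z [(\<theta>, Z')] = 0" "dmu A Z' [(\<theta>', Z)] = 0"
    and inv: "dmu A Z [(\<theta>, Z'), (\<theta>', Z)] = unit_of A (fst Z) + dmu A Z [(\<gamma>, Z)]"
  defines "H \<equiv> \<lambda>L as y. M L as y Z [(\<theta>, Z'), (\<theta>', Z)] - M L as y Z [(\<gamma>, Z)]"
  shows "(\<Sum>(u, v, w)\<in>splits3 as. psgn (sdeg A L u) (H L (contract A L u v w) y))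
    + (\<Sum>(u, v)\<in>splits2 as. psgn (sdeg A L u) (H L u (M (tgt L u) v y Z [])))
    + (\<Sum>(u, v)\<in>splits2 as. psgn (sdeg A L u) (M L u (H (tgt L u) v y) Z []))
    + (\<Sum>(u, v)\<in>splits2 as. T L u (T (tgt L u) v y Z \<theta> Z') Z' \<theta>' Z)
    = (if as = [] then y else 0)"
proof -
  have d: "Z \<in> \<D>" "Z' \<in> \<D>" using W by (auto simp: weak_mc_def)
  note obZ = obj[OF d(1)] obj[OF d(2)]
  note ob = hpath_tgt[OF as] obZ(1)
  have t: "\<theta> \<in> Hom_total A (fst Z) (fst Z')" "\<theta>' \<in> Hom_total A (fst Z') (fst Z)" "\<gamma> \<in> Hom_total A (fst Z) (fst Z)"
    using \<theta> Hom_sub_total obZ by blast+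
  have p: "dhp Z [(\<theta>, Z'), (\<theta>', Z)]" "dhp Z [(\<gamma>, Z)]" using d \<theta> by auto
  let ?y = "parity gen (tgt L as) (fst Z) y"
  have y': "?y \<in> Hom_total A (tgt L as) (fst Z)" by (rule parity_total[OF ob y])
  have m1: "dmu A Z [(\<gamma>, Z)] \<in> Hom_total A (fst Z) (fst Z)"
    using Hom_sub_total[OF start_Ob[OF p(2)] tgt_Ob[OF p(2)] dmu_degree[OF p(2)]] by simp
  have "M L as ?y Z [(unit_of A (fst Z) + dmu A Z [(\<gamma>, Z)], Z)] =
    M L as ?y Z [(unit_of A (fst Z), Z)] + M L as ?y Z [(dmu A Z [(\<gamma>, Z)], Z)]"
    using M_insert_add[OF as y', of "[]" _ Z _ "[]"] d unit_total[OF d(1)] m1 by simp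
  then have "rel_end L as ?y Z [(\<theta>, Z'), (\<theta>', Z)] = (if as = [] then y else 0) + rel_end L as ?y Z [(\<gamma>, Z)]"
    unfolding rel_end_pair[OF as y' W W(1) t(1,2) closed] rel_end_single[OF as y' W(1,1) t(3)] inv
    by (simp add: psgn_add M_end_unit[OF as y d(1)])
  then have "(rel_in L as y Z [(\<theta>, Z'), (\<theta>', Z)] - rel_in L as y Z [(\<gamma>, Z)])
      + (rel_mid L as y Z [(\<theta>, Z'), (\<theta>', Z)] - rel_mid L as y Z [(\<gamma>, Z)]) = (if as = [] then y else 0)"
    using M_relation[OF as y p(1)] M_relation[OF as y p(2)] by (simp add: algebra_simps)
  moreover have "rel_in L as y Z [(\<theta>, Z'), (\<theta>', Z)] - rel_in L as y Z [(\<gamma>, Z)] =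
    (\<Sum>(u, v, w)\<in>splits3 as. psgn (sdeg A L u) (H L (contract A L u v w) y))"
    unfolding rel_in_def sum_subtractf[symmetric] H_def
    by (rule sum.cong[OF refl]) (auto simp: psgn_def)
  moreover have "rel_mid L as y Z [(\<theta>, Z'), (\<theta>', Z)] - rel_mid L as y Z [(\<gamma>, Z)] =
    (\<Sum>(u, v)\<in>splits2 as. psgn (sdeg A L u) (H L u (M (tgt L u) v y Z [])))
    + (\<Sum>(u, v)\<in>splits2 as. psgn (sdeg A L u) (M L u (H (tgt L u) v y) Z []))
    + (\<Sum>(u, v)\<in>splits2 as. T L u (T (tgt L u) v y Z \<theta> Z') Z' \<theta>' Z)"
    unfolding rel_mid_pair rel_mid_single sum_subtractf[symmetric] sum.distrib[symmetric]
  proof (rule sum.cong[OF refl], clarify)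
    fix u v assume s: "(u, v) \<in> splits2 as"
    then have uv: "hpath A L u" "hpath A (tgt L u) v" "tgt (tgt L u) v = tgt L as"
      using as by (auto simp: splits2_def hpath_append)
    have yv: "y \<in> Hom_total A (tgt (tgt L u) v) (fst Z)" using y uv by simp
    have My: "M (tgt L u) v y Z [(\<theta>, Z'), (\<theta>', Z)] \<in> Hom_total A (tgt L u) (fst Z)"
      "M (tgt L u) v y Z [(\<gamma>, Z)] \<in> Hom_total A (tgt L u) (fst Z)"
      using M_total[OF uv(2) yv p(1)] M_total[OF uv(2) yv p(2)] by simp_all
    have Nil: "dtp Z []" using d by simp
    \<comment> \<open>Linearity of the outer operation is available for sums, so the difference
      \<open>H\<close> is moved through it by adding the subtracted term back.\<close>
    have "M L u (H (tgt L u) v y) Z [] + M L u (M (tgt L u) v y Z [(\<gamma>, Z)]) Z [] =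
        M L u (M (tgt L u) v y Z [(\<theta>, Z'), (\<theta>', Z)]) Z []"
    proof -
      have "H (tgt L u) v y \<in> Hom_total A (tgt L u) (fst Z)"
        using Hom_total_diff[OF hpath_tgt[OF uv(1)] obZ(1) My] unfolding H_def .
      from M_add[OF uv(1) this My(2) Nil] show ?thesis by (simp add: H_def)
    qed
    then have H: "M L u (H (tgt L u) v y) Z [] = M L u (M (tgt L u) v y Z [(\<theta>, Z'), (\<theta>', Z)]) Z []
        - M L u (M (tgt L u) v y Z [(\<gamma>, Z)]) Z []" by (simp add: eq_diff_eq)
    show "psgn (sdeg A L u)
        (M L u (M (tgt L u) v y Z []) Z [(\<theta>, Z'), (\<theta>', Z)] +
         M L u (M (tgt L u) v y Z [(\<theta>, Z')]) Z' [(\<theta>', Z)] +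
         M L u (M (tgt L u) v y Z [(\<theta>, Z'), (\<theta>', Z)]) Z []) -
       psgn (sdeg A L u)
        (M L u (M (tgt L u) v y Z []) Z [(\<gamma>, Z)] + M L u (M (tgt L u) v y Z [(\<gamma>, Z)]) Z []) =
       psgn (sdeg A L u) (H L u (M (tgt L u) v y Z [])) + psgn (sdeg A L u) (M L u (H (tgt L u) v y) Z []) +
       T L u (T (tgt L u) v y Z \<theta> Z') Z' \<theta>' Z"
      unfolding T_T[OF uv(1,2) yv d(1,2,1) \<theta>(1,2)] H unfolding H_def
      by (simp add: psgn_def algebra_simps)
  qed
  ultimately show ?thesis by (simp add: add.assoc)
qed

lemma potentials_agree:
  assumes W: "weak_mc Z W" "weak_mc Z' W'" and \<theta>: "\<theta> \<in> Hom A (fst Z) (fst Z') 0" "\<theta> \<noteq> 0"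
    and closed: "dmu A Z [(\<theta>, Z')] = 0"
  shows "W = W'"
proof -
  have d: "Z \<in> \<D>" "Z' \<in> \<D>" and m0: "dmu A Z [] = W \<odot> unit_of A (fst Z)" "dmu A Z' [] = W' \<odot> unit_of A (fst Z')"
    using W by (auto simp: weak_mc_def)
  note ob = obj[OF d(1)] obj[OF d(2)]
  have t: "\<theta> \<in> Hom_total A (fst Z) (fst Z')" using Hom_sub_total[OF ob \<theta>(1)] .
  have p: "dhp Z [(\<theta>, Z')]" using d \<theta> by auto
  have "dmu A Z [(W \<odot> unit_of A (fst Z), Z), (\<theta>, Z')] = W \<odot> \<theta>"
    using dmu_scale[of Z "[]" "unit_of A (fst Z)" Z "[(\<theta>, Z')]" W] dmu_unit_left[OF d \<theta>(1)] d t
      unit_total[OF d(1)] by simp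
  moreover have "dmu A Z [(\<theta>, Z'), (W' \<odot> unit_of A (fst Z'), Z')] = W' \<odot> \<theta>"
    using dmu_scale[of Z "[(\<theta>, Z')]" "unit_of A (fst Z')" Z' "[]" W'] dmu_unit_right[OF d \<theta>(1)] d t
      unit_total[OF d(2)] by simp
  moreover have "dmu A Z [(0, Z')] = 0"
    using dmu_zero[of Z "[]" Z' "[]"] d by simp
  moreover have "deg A (fst Z) (fst Z') \<theta> = 0" using \<theta>(1) by (simp add: deg_def)
  ultimately have "W \<odot> \<theta> - W' \<odot> \<theta> = 0"
    using dmu_relation[OF p] by (simp add: splits3_single m0 closed)
  \<comment> \<open>A nonzero component of \<open>\<theta>\<close> can be divided out because the
    Novikov coefficients form a field.\<close>
  moreover obtain q where "\<theta> q \<noteq> 0" using \<theta>(2) by (metis ext zero_fun_apply)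
  moreover have "(W \<odot> \<theta> - W' \<odot> \<theta>) q = (W - W') * \<theta> q"
    by (simp add: nscale_apply algebra_simps)
  ultimately have "(W - W') * \<theta> q = 0" by simp
  then show ?thesis using \<open>\<theta> q \<noteq> 0\<close> by simp
qed

end

section \<open>\<open>A\<^sub>\<infinity>\<close>-functors into dg-categories\<close>

lemma mu_dg_Nil: "mu (ainf_of_dg D) E [] = 0"
  by (simp add: ainf_of_dg_def)

lemma mu_dg_single: "mu (ainf_of_dg D) E [(f, E1)] = ddiff D E1 E f"
  by (simp add: ainf_of_dg_def)

lemma mu_dg_pair: "mu (ainf_of_dg D) E [(f, E1), (g, E2)] =
    psgn (if f \<in> dhom D E1 E 0 then 0 else 1) (dcomp D E2 E1 E f g)"
  by (simp add: ainf_of_dg_def)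

lemma mu_dg_long: "length as > 2 \<Longrightarrow> mu (ainf_of_dg D) E as = 0"
  by (auto simp: ainf_of_dg_def split: list.splits)

lemma length_fpath [simp]: "length (fpath F L us) = length us"
  by (induction F L us rule: fpath.induct) auto

lemma length_concat_ge: "[] \<notin> set us \<Longrightarrow> length us \<le> length (concat us)"
proof (induction us)
  case (Cons u us)
  then have "1 \<le> length u" by (cases u) auto
  moreover have "length us \<le> length (concat us)" using Cons by simp
  ultimately show ?case by simp
qed simp

lemma finite_sublists: "finite {u :: 'a list. length u \<le> n \<and> set u \<subseteq> set as}"
  by (rule finite_subset[OF _ finite_lists_length_le[of "set as" n]]) auto

lemma finite_block_lists:
  "finite {us. set us \<subseteq> {u :: 'a list. length u \<le> length as \<and> set u \<subseteq> set as} \<and> length us \<le> length as}"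
  by (rule finite_lists_length_le[OF finite_sublists])

text \<open>Forbidding empty blocks bounds their number by the length of the string, which makes the
  index sets of the functor and transformation equations finite.\<close>

lemma block_bounds:
  assumes "[] \<notin> set us" "length (concat us) \<le> n" "set (concat us) \<subseteq> S"
  shows "set us \<subseteq> {u. length u \<le> n \<and> set u \<subseteq> S} \<and> length us \<le> n"
proof -
  have "u \<in> {u. length u \<le> n \<and> set u \<subseteq> S}" if mem: "u \<in> set us" for u
  proof -
    obtain xs ys where "us = xs @ u # ys" using split_list[OF mem] by blast
    then show ?thesis using assms(2,3) by auto
  qed
  moreover have "length us \<le> n" using length_concat_ge[OF assms(1)] assms(2) by simp
  ultimately show ?thesis by blast
qed

lemma finite_blocks: "finite (blocks as)"
proof (rule finite_subset[OF _ finite_block_lists[of as]], rule subsetI)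
  fix us assume "us \<in> blocks as"
  then have "[] \<notin> set us" "concat us = as" by (auto simp: blocks_def)
  then show "us \<in> {us. set us \<subseteq> {u. length u \<le> length as \<and> set u \<subseteq> set as} \<and> length us \<le> length as}"
    using block_bounds[of us "length as" "set as"] by auto
qed

lemma finite_nat_blocks:
  "finite {(us, v, ws). concat us @ v @ concat ws = as \<and> [] \<notin> set us \<union> set ws}"
proof -
  let ?B = "{us. set us \<subseteq> {u. length u \<le> length as \<and> set u \<subseteq> set as} \<and> length us \<le> length as}"
  let ?S = "{u. length u \<le> length as \<and> set u \<subseteq> set as}"
  have "{(us, v, ws). concat us @ v @ concat ws = as \<and> [] \<notin> set us \<union> set ws} \<subseteq> ?B \<times> ?S \<times> ?B"
  proof (rule subsetI)
    fix x assume "x \<in> {(us, v, ws). concat us @ v @ concat ws = as \<and> [] \<notin> set us \<union> set ws}"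
    then obtain us v ws where x: "x = (us, v, ws)" and *: "concat us @ v @ concat ws = as" "[] \<notin> set us \<union> set ws"
      by auto
    have "length (concat us) \<le> length as" "set (concat us) \<subseteq> set as"
      "length (concat ws) \<le> length as" "set (concat ws) \<subseteq> set as"
      unfolding *(1)[symmetric] by auto
    then have "us \<in> ?B" "ws \<in> ?B" using block_bounds[of us] block_bounds[of ws] *(2) by simp_all
    moreover have "v \<in> ?S" using * by auto
    ultimately show "x \<in> ?B \<times> ?S \<times> ?B" unfolding x by (intro SigmaI)
  qed
  then show ?thesis
    by (rule finite_subset) (intro finite_cartesian_product finite_block_lists finite_sublists)
qed

lemma finite_nat_blocks2:
  "finite {(us, v, ws, v', xs). concat us @ v @ concat ws @ v' @ concat xs = as \<and>
     [] \<notin> set us \<union> set ws \<union> set xs}"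
proof -
  let ?P = "\<lambda>as. {(us, v, ws). concat us @ v @ concat ws = as \<and> [] \<notin> set us \<union> set ws}"
  have "{(us, v, ws, v', xs). concat us @ v @ concat ws @ v' @ concat xs = as \<and>
     [] \<notin> set us \<union> set ws \<union> set xs} \<subseteq>
    (\<Union>(a, b)\<in>splits2 as. (\<lambda>((us, v, ws), (v', xs)). (us, v, ws, v', xs)) ` (?P a \<times> (\<lambda>(us, v, ws). (v, ws)) ` ?P b))"
  proof (rule subsetI)
    fix x assume "x \<in> {(us, v, ws, v', xs). concat us @ v @ concat ws @ v' @ concat xs = as \<and>
      [] \<notin> set us \<union> set ws \<union> set xs}"
    then obtain us v ws v' xs where x: "x = (us, v, ws, v', xs)"
      and *: "concat us @ v @ concat ws @ v' @ concat xs = as" "[] \<notin> set us \<union> set ws \<union> set xs"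
      by auto
    let ?a = "concat us @ v @ concat ws" and ?b = "v' @ concat xs"
    have 1: "(us, v, ws) \<in> ?P ?a" using * by auto
    have 2: "(v', xs) \<in> (\<lambda>(us, v, ws). (v, ws)) ` ?P ?b"
      using * by (intro image_eqI[of _ _ "([], v', xs)"]) auto
    have "x \<in> (\<lambda>((us, v, ws), (v', xs)). (us, v, ws, v', xs)) ` (?P ?a \<times> (\<lambda>(us, v, ws). (v, ws)) ` ?P ?b)"
      unfolding x
    proof (rule image_eqI[of _ _ "((us, v, ws), (v', xs))"])
      show "((us, v, ws), (v', xs)) \<in> ?P ?a \<times> (\<lambda>(us, v, ws). (v, ws)) ` ?P ?b"
        using 1 2 by (rule SigmaI)
    qed simp
    moreover have "(?a, ?b) \<in> splits2 as"
      using * by (simp add: splits2_def)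
    ultimately show "x \<in> (\<Union>(a, b)\<in>splits2 as.
        (\<lambda>((us, v, ws), (v', xs)). (us, v, ws, v', xs)) ` (?P a \<times> (\<lambda>(us, v, ws). (v, ws)) ` ?P b))"
      by (intro UN_I[of "(?a, ?b)"]) simp_all
  qed
  moreover have "finite (\<Union>(a, b)\<in>splits2 as. (\<lambda>((us, v, ws), (v', xs)). (us, v, ws, v', xs)) ` (?P a \<times> (\<lambda>(us, v, ws). (v, ws)) ` ?P b))"
  proof (intro finite_UN_I finite_splits2)
    fix x :: "'a list \<times> 'a list"
    obtain a b where x: "x = (a, b)" by (cases x)
    show "finite (case x of (a, b) \<Rightarrow>
        (\<lambda>((us, v, ws), (v', xs)). (us, v, ws, v', xs)) ` (?P a \<times> (\<lambda>(us, v, ws). (v, ws)) ` ?P b))"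
      unfolding x prod.case by (intro finite_imageI finite_cartesian_product finite_nat_blocks)
  qed
  ultimately show ?thesis by (rule finite_subset)
qed

lemma sum_splits2_left:
  fixes f :: "'a list \<Rightarrow> 'a list \<Rightarrow> 'b :: comm_monoid_add"
  shows "(\<Sum>(u, v)\<in>splits2 as. f u v) = f [] as + (\<Sum>(u, v)\<in>{(u, v) \<in> splits2 as. u \<noteq> []}. f u v)"
proof -
  have e: "splits2 as = insert ([], as) {(u, v) \<in> splits2 as. u \<noteq> []}" by (auto simp: splits2_def)
  have fin: "finite {(u, v) \<in> splits2 as. u \<noteq> []}" by (rule finite_subset[OF _ finite_splits2[of as]]) auto
  show ?thesis by (subst e, subst sum.insert[OF fin]) auto
qed

lemma sum_splits2_right:
  fixes f :: "'a list \<Rightarrow> 'a list \<Rightarrow> 'b :: comm_monoid_add"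
  shows "(\<Sum>(u, v)\<in>splits2 as. f u v) = f as [] + (\<Sum>(u, v)\<in>{(u, v) \<in> splits2 as. v \<noteq> []}. f u v)"
proof -
  have e: "splits2 as = insert (as, []) {(u, v) \<in> splits2 as. v \<noteq> []}" by (auto simp: splits2_def)
  have fin: "finite {(u, v) \<in> splits2 as. v \<noteq> []}" by (rule finite_subset[OF _ finite_splits2[of as]]) auto
  show ?thesis by (subst e, subst sum.insert[OF fin]) auto
qed

lemma sum_splits2_ends:
  fixes f :: "'a list \<Rightarrow> 'a list \<Rightarrow> 'b :: comm_monoid_add"
  assumes "as \<noteq> []"
  shows "(\<Sum>(u, v)\<in>splits2 as. f u v) =
    f [] as + f as [] + (\<Sum>(u, v)\<in>{(u, v) \<in> splits2 as. u \<noteq> [] \<and> v \<noteq> []}. f u v)"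
proof -
  have e: "{(u, v) \<in> splits2 as. u \<noteq> []} = insert (as, []) {(u, v) \<in> splits2 as. u \<noteq> [] \<and> v \<noteq> []}"
    using assms by (auto simp: splits2_def)
  have "finite {(u, v) \<in> splits2 as. u \<noteq> [] \<and> v \<noteq> []}" by (rule finite_subset[OF _ finite_splits2[of as]]) auto
  then have "(\<Sum>(u, v)\<in>{(u, v) \<in> splits2 as. u \<noteq> []}. f u v) =
      f as [] + (\<Sum>(u, v)\<in>{(u, v) \<in> splits2 as. u \<noteq> [] \<and> v \<noteq> []}. f u v)"
    unfolding e by (subst sum.insert) auto
  then show ?thesis unfolding sum_splits2_left[of f] by (simp add: add.assoc)
qed

text \<open>The degree as \<open>ainf_of_dg\<close> reads it; a morphism lying in both degrees
  counts as even.\<close>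

definition dg_sign where
  "dg_sign D E0 E1 f = (if f \<in> dhom D E1 E0 0 then 0 else (1 :: bit))"

text \<open>The target has no operations beyond \<open>m_2\<close>, so only partitions into one or
  two blocks contribute: a differential and the compositions over proper splits.\<close>

lemma sum_blocks_dg:
  assumes "as \<noteq> []"
  shows "(\<Sum>us\<in>blocks as. mu (ainf_of_dg D) (fob F L) (fpath F L us)) =
    ddiff D (fob F (tgt L as)) (fob F L) (fmor F L as) +
    (\<Sum>(u, v)\<in>{(u, v) \<in> splits2 as. u \<noteq> [] \<and> v \<noteq> []}.
       psgn (dg_sign D (fob F L) (fob F (tgt L u)) (fmor F L u))
         (dcomp D (fob F (tgt L as)) (fob F (tgt L u)) (fob F L) (fmor F L u) (fmor F (tgt L u) v)))"
proof -
  let ?m = "\<lambda>us. mu (ainf_of_dg D) (fob F L) (fpath F L us)"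
  let ?P = "{(u, v) \<in> splits2 as. u \<noteq> [] \<and> v \<noteq> []}"
  let ?h = "\<lambda>(u, v). [u, v]"
  have fin: "finite ?P" by (rule finite_subset[OF _ finite_splits2[of as]]) auto
  have sub: "insert [as] (?h ` ?P) \<subseteq> blocks as" using assms by (auto simp: blocks_def splits2_def)
  have "sum ?m (blocks as) = sum ?m (insert [as] (?h ` ?P))"
  proof (rule sum.mono_neutral_right[OF finite_blocks sub], rule ballI)
    fix us assume us: "us \<in> blocks as - insert [as] (?h ` ?P)"
    have "length us > 2"
    proof (rule ccontr)
      assume "\<not> ?thesis"
      then consider "us = []" | u where "us = [u]" | u v where "us = [u, v]"
        by (cases us; cases "tl us"; cases "tl (tl us)") auto
      then show False
      proof cases
        case (3 u v)
        then have "(u, v) \<in> ?P" using us by (auto simp: blocks_def splits2_def)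
        then show False using us 3 by (auto intro: rev_image_eqI)
      qed (use us assms in \<open>auto simp: blocks_def\<close>)
    qed
    then show "?m us = 0" by (intro mu_dg_long) simp
  qed
  also have "\<dots> = ?m [as] + sum ?m (?h ` ?P)" using fin by (subst sum.insert) auto
  also have "sum ?m (?h ` ?P) = (\<Sum>x\<in>?P. ?m (?h x))" by (subst sum.reindex) (auto simp: inj_on_def)
  also have "\<dots> = (\<Sum>(u, v)\<in>?P. psgn (dg_sign D (fob F L) (fob F (tgt L u)) (fmor F L u))
         (dcomp D (fob F (tgt L as)) (fob F (tgt L u)) (fob F L) (fmor F L u) (fmor F (tgt L u) v)))"
    by (rule sum.cong[OF refl]) (auto simp: mu_dg_pair dg_sign_def splits2_def)
  finally show ?thesis by (simp add: mu_dg_single)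
qed

lemma sum_blocks_dg_Nil:
  fixes F :: "('a, 'b, 'c, 'd :: ab_group_add) ainf_functor"
  shows "(\<Sum>us\<in>blocks []. mu (ainf_of_dg D) E (fpath F L us)) = 0"
proof -
  have "blocks [] = {[] :: ('b \<times> 'a) list list}"
  proof
    show "blocks [] \<subseteq> {[] :: ('b \<times> 'a) list list}"
    proof
      fix us :: "('b \<times> 'a) list list" assume "us \<in> blocks []"
      then show "us \<in> {[]}" by (cases us) (auto simp: blocks_def)
    qed
  qed (auto simp: blocks_def)
  then show ?thesis by (simp add: mu_dg_Nil)
qed

text \<open>Each term of \<open>M_1\<close> uses \<open>T\<close> once, so with at most binary
  operations at most one functor block stands beside it. The block given to \<open>T\<close> may be
  empty, hence only the functor block is required to be nonempty.\<close>

lemma nat_M1_dg: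
  "nat_M1 A (ainf_of_dg D) F G n T L as =
     ddiff D (fob G (tgt L as)) (fob F L) (T L as)
     + (\<Sum>(u, v)\<in>{(u, v) \<in> splits2 as. u \<noteq> []}. psgn ((n - 1) * sdeg A L u)
          (psgn (dg_sign D (fob F L) (fob F (tgt L u)) (fmor F L u))
            (dcomp D (fob G (tgt L as)) (fob F (tgt L u)) (fob F L) (fmor F L u) (T (tgt L u) v))))
     + (\<Sum>(u, v)\<in>{(u, v) \<in> splits2 as. v \<noteq> []}.
          psgn (dg_sign D (fob F L) (fob G (tgt L u)) (T L u))
            (dcomp D (fob G (tgt L as)) (fob G (tgt L u)) (fob F L) (T L u) (fmor G (tgt L u) v)))
     - psgn (n - 1) (\<Sum>(u, v, w)\<in>splits3 as. psgn (sdeg A L u) (T L (contract A L u v w)))"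
proof -
  let ?I = "{(us, v, ws). concat us @ v @ concat ws = as \<and> [] \<notin> set us \<union> set ws}"
  let ?m = "\<lambda>(us, v, ws). let L1 = tgt L (concat us); L2 = tgt L1 v in
        psgn ((n - 1) * sdeg A L (concat us))
          (mu (ainf_of_dg D) (fob F L) (fpath F L us @ (T L1 v, fob G L2) # fpath G L2 ws))"
  let ?P = "{(u, v) \<in> splits2 as. u \<noteq> []}" and ?Q = "{(u, v) \<in> splits2 as. v \<noteq> []}"
  let ?p = "\<lambda>(u, v). ([u], v, [])" and ?q = "\<lambda>(u, v). ([], u, [v])"
  have fin: "finite ?P" "finite ?Q" by (rule finite_subset[OF _ finite_splits2[of as]]; auto)+
  have sub: "insert ([], as, []) (?p ` ?P \<union> ?q ` ?Q) \<subseteq> ?I" by (auto simp: splits2_def)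
  have "sum ?m ?I = sum ?m (insert ([], as, []) (?p ` ?P \<union> ?q ` ?Q))"
  proof (rule sum.mono_neutral_right[OF finite_nat_blocks sub], rule ballI)
    fix x assume x: "x \<in> ?I - insert ([], as, []) (?p ` ?P \<union> ?q ` ?Q)"
    obtain us v ws where uvw: "x = (us, v, ws)" by (cases x)
    have "length us + length ws > 1"
    proof (rule ccontr)
      assume "\<not> ?thesis"
      then consider "us = []" "ws = []" | u where "us = [u]" "ws = []" | w where "us = []" "ws = [w]"
        by (cases us; cases ws; cases "tl us"; cases "tl ws") auto
      then show False
      proof cases
        case (2 u)
        then have "(u, v) \<in> ?P" using x uvw by (auto simp: splits2_def)
        then have "x \<in> ?p ` ?P" using 2 uvw by (auto intro: rev_image_eqI)
        then show False using x by blast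
      next
        case (3 w)
        then have "(v, w) \<in> ?Q" using x uvw by (auto simp: splits2_def)
        then have "x \<in> ?q ` ?Q" using 3 uvw by (auto intro: rev_image_eqI)
        then show False using x by blast
      qed (use x uvw in auto)
    qed
    then have "length (fpath F L us @ (T (tgt L (concat us)) v, fob G (tgt (tgt L (concat us)) v)) #
        fpath G (tgt (tgt L (concat us)) v) ws) > 2" by simp
    from mu_dg_long[OF this] show "?m x = 0" by (simp add: uvw Let_def)
  qed
  also have "\<dots> = ?m ([], as, []) + sum ?m (?p ` ?P \<union> ?q ` ?Q)"
    using fin by (subst sum.insert) auto
  also have "sum ?m (?p ` ?P \<union> ?q ` ?Q) = sum ?m (?p ` ?P) + sum ?m (?q ` ?Q)"
    using fin by (intro sum.union_disjoint) auto
  finally have "sum ?m ?I = ?m ([], as, []) + (sum ?m (?p ` ?P) + sum ?m (?q ` ?Q))" .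
  moreover have "sum ?m (?p ` ?P) = (\<Sum>(u, v)\<in>?P. psgn ((n - 1) * sdeg A L u)
          (psgn (dg_sign D (fob F L) (fob F (tgt L u)) (fmor F L u))
            (dcomp D (fob G (tgt L as)) (fob F (tgt L u)) (fob F L) (fmor F L u) (T (tgt L u) v))))"
    by (subst sum.reindex) (auto simp: inj_on_def mu_dg_pair dg_sign_def splits2_def Let_def intro!: sum.cong)
  moreover have "sum ?m (?q ` ?Q) = (\<Sum>(u, v)\<in>?Q. psgn (dg_sign D (fob F L) (fob G (tgt L u)) (T L u))
            (dcomp D (fob G (tgt L as)) (fob G (tgt L u)) (fob F L) (T L u) (fmor G (tgt L u) v)))"
    by (subst sum.reindex) (auto simp: inj_on_def mu_dg_pair dg_sign_def splits2_def Let_def intro!: sum.cong)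
  ultimately show ?thesis
    unfolding nat_M1_def by (simp add: mu_dg_single add.assoc)
qed

text \<open>The two transformations already fill both inputs of \<open>m_2\<close>, so no functor
  block can occur, and either of the two parts may be empty.\<close>

lemma nat_M2_dg:
  "nat_M2 A (ainf_of_dg D) F G K n n' T T' L as =
     (\<Sum>(u, v)\<in>splits2 as. psgn ((n' - 1) * sdeg A L u)
        (psgn (dg_sign D (fob F L) (fob G (tgt L u)) (T L u))
          (dcomp D (fob K (tgt L as)) (fob G (tgt L u)) (fob F L) (T L u) (T' (tgt L u) v))))"
proof -
  let ?I = "{(us, v, ws, v', xs). concat us @ v @ concat ws @ v' @ concat xs = as \<and>
     [] \<notin> set us \<union> set ws \<union> set xs}"
  let ?m = "\<lambda>(us, v, ws, v', xs). let L1 = tgt L (concat us); L2 = tgt L1 v; L3 = tgt L2 (concat ws); L4 = tgt L3 v' in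
        psgn ((n - 1) * sdeg A L (concat us) + (n' - 1) * sdeg A L (concat us @ v @ concat ws))
          (mu (ainf_of_dg D) (fob F L)
            (fpath F L us @ (T L1 v, fob G L2) # fpath G L2 ws @ (T' L3 v', fob K L4) # fpath K L4 xs))"
  let ?p = "\<lambda>(u, v). ([], u, [], v, [])"
  have sub: "?p ` splits2 as \<subseteq> ?I" by (auto simp: splits2_def)
  have "sum ?m ?I = sum ?m (?p ` splits2 as)"
  proof (rule sum.mono_neutral_right[OF finite_nat_blocks2 sub], rule ballI)
    fix x assume x: "x \<in> ?I - ?p ` splits2 as"
    obtain us v ws v' xs where uvw: "x = (us, v, ws, v', xs)" by (cases x)
    have "length us + length ws + length xs > 0"
    proof (rule ccontr)
      assume "\<not> ?thesis"
      then have e: "us = []" "ws = []" "xs = []" by auto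
      then have "(v, v') \<in> splits2 as" using x uvw by (auto simp: splits2_def)
      then have "x \<in> ?p ` splits2 as" using e uvw by (auto intro: rev_image_eqI)
      then show False using x by blast
    qed
    then have "length (fpath F L us @ (T (tgt L (concat us)) v, fob G (tgt (tgt L (concat us)) v)) #
        fpath G (tgt (tgt L (concat us)) v) ws @
        (T' (tgt (tgt (tgt L (concat us)) v) (concat ws)) v', fob K (tgt (tgt (tgt (tgt L (concat us)) v) (concat ws)) v')) #
        fpath K (tgt (tgt (tgt (tgt L (concat us)) v) (concat ws)) v') xs) > 2" by auto
    from mu_dg_long[OF this] show "?m x = 0" by (simp add: uvw Let_def)
  qed
  also have "\<dots> = (\<Sum>(u, v)\<in>splits2 as. psgn ((n' - 1) * sdeg A L u)
        (psgn (dg_sign D (fob F L) (fob G (tgt L u)) (T L u))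
          (dcomp D (fob K (tgt L as)) (fob G (tgt L u)) (fob F L) (T L u) (T' (tgt L u) v))))"
    by (subst sum.reindex) (auto simp: inj_on_def mu_dg_pair dg_sign_def splits2_def Let_def intro!: sum.cong)
  finally show ?thesis unfolding nat_M2_def .
qed

section \<open>Module maps\<close>

context
  fixes V :: "'u set" and R :: "('u \<Rightarrow> novikov) set"
  assumes ring: "function_ring V R"
begin

lemma ring_off: "f \<in> R \<Longrightarrow> u \<notin> V \<Longrightarrow> f u = 0"
  using ring by (auto simp: function_ring_def)

lemma ring_const: "(\<lambda>u. if u \<in> V then c else 0) \<in> R"
  using ring by (auto simp: function_ring_def)

lemma ring_add: "f \<in> R \<Longrightarrow> g \<in> R \<Longrightarrow> f + g \<in> R"
  using ring by (auto simp: function_ring_def)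

lemma ring_mult: "f \<in> R \<Longrightarrow> g \<in> R \<Longrightarrow> f * g \<in> R"
  using ring by (auto simp: function_ring_def)

lemma ring_zero: "0 \<in> R"
  using ring_const[of 0] by (simp add: zero_fun_def)

lemma ring_uminus: "f \<in> R \<Longrightarrow> - f \<in> R"
proof -
  assume f: "f \<in> R"
  have "- f = (\<lambda>u. if u \<in> V then - 1 else 0) * f"
    using ring_off[OF f] by (auto simp: fun_eq_iff)
  then show ?thesis using ring_mult[OF ring_const f] by simp
qed

lemma free_zero: "0 \<in> free_module R S"
  using ring_zero by (simp add: free_module_def)

lemma free_add: "x \<in> free_module R S \<Longrightarrow> y \<in> free_module R S \<Longrightarrow> x + y \<in> free_module R S"
  using ring_add by (simp add: free_module_def)

lemma free_uminus: "x \<in> free_module R S \<Longrightarrow> - x \<in> free_module R S"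
  using ring_uminus by (simp add: free_module_def)

lemma free_scale: "r \<in> R \<Longrightarrow> y \<in> free_module R S \<Longrightarrow> (\<lambda>p. r * y p) \<in> free_module R S"
  using ring_mult by (simp add: free_module_def)

lemma free_mono: "S \<subseteq> S' \<Longrightarrow> free_module R S \<subseteq> free_module R S'"
  by (auto simp: free_module_def)

lemma free_decompose:
  assumes "y \<in> free_module R (both S)"
  shows "\<exists>y0\<in>free_module R (S 0). \<exists>y1\<in>free_module R (S 1). y = y0 + y1"
proof (intro bexI)
  show "y = (\<lambda>p. if p \<in> S 0 then y p else 0) + (\<lambda>p. if p \<in> S 0 then 0 else y p)"
    by (auto simp: fun_eq_iff)
  show "(\<lambda>p. if p \<in> S 0 then y p else 0) \<in> free_module R (S 0)"
    "(\<lambda>p. if p \<in> S 0 then 0 else y p) \<in> free_module R (S 1)"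
    using assms ring_zero by (auto simp: free_module_def)
qed

lemma maps_zero_arg:
  assumes "f \<in> module_maps R S S' d"
  shows "f 0 = 0"
proof -
  have "f (0 + 0) = f 0 + f 0" using assms free_zero unfolding module_maps_def by blast
  then show ?thesis by simp
qed

lemma maps_uminus_arg:
  assumes "f \<in> module_maps R S S' d" "y \<in> free_module R (both S)"
  shows "f (- y) = - f y"
proof -
  have "f (y + - y) = f y + f (- y)" using assms free_uminus unfolding module_maps_def by blast
  then have "f y + f (- y) = 0" using maps_zero_arg[OF assms(1)] by simp
  then show ?thesis by (simp add: minus_unique)
qed

lemma maps_uminus:
  assumes "f \<in> module_maps R S S' d"
  shows "(\<lambda>y. - f y) \<in> module_maps R S S' d"
  using assms unfolding module_maps_def by (auto intro: free_uminus simp del: add_bit_eq_xor)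

lemma maps_add:
  assumes "f \<in> module_maps R S S' d" "g \<in> module_maps R S S' d"
  shows "f + g \<in> module_maps R S S' d"
  using assms unfolding module_maps_def
  by (auto intro: free_add simp: fun_eq_iff algebra_simps simp del: add_bit_eq_xor)

lemma maps_diff:
  assumes "f \<in> module_maps R S S' d" "g \<in> module_maps R S S' d"
  shows "f - g \<in> module_maps R S S' d"
  using maps_add[OF assms(1) maps_uminus[OF assms(2)]] by (simp add: fun_diff_def plus_fun_def)

text \<open>Each homogeneous part is sent into two components with disjoint bases, hence to zero. So
  the sign test in the dg-category can misread the degree of the zero map only, which is
  \<open>maps_sign\<close>.\<close>

lemma maps_both_degrees:
  assumes "f \<in> module_maps R S S' 0" "f \<in> module_maps R S S' 1" "S' 0 \<inter> S' 1 = {}"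
  shows "f = 0"
proof
  fix y
  have hom: "f z = 0" if "z \<in> free_module R (S e)" for z e
  proof -
    have "f z \<in> free_module R (S' e)" "f z \<in> free_module R (S' (e + 1))"
      using assms(1,2) that unfolding module_maps_def by (auto simp del: add_bit_eq_xor)
    moreover have "S' e \<inter> S' (e + 1) = {}" using assms(3) by (cases "e = 0") auto
    ultimately have "f z p = 0" for p by (auto simp: free_module_def)
    then show ?thesis by (simp add: fun_eq_iff)
  qed
  show "f y = 0 y"
  proof (cases "y \<in> free_module R (both S)")
    case True
    then obtain y0 y1 where y: "y0 \<in> free_module R (S 0)" "y1 \<in> free_module R (S 1)" "y = y0 + y1"
      using free_decompose by blast
    then have "y0 \<in> free_module R (both S)" "y1 \<in> free_module R (both S)"
      using free_mono[of "S 0" "both S"] free_mono[of "S 1" "both S"] by auto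
    then have "f (y0 + y1) = f y0 + f y1" using assms(1) unfolding module_maps_def by blast
    then show ?thesis using hom[OF y(1)] hom[OF y(2)] y(3) by simp
  next
    case False
    then show ?thesis using assms(1) unfolding module_maps_def by simp
  qed
qed

lemma maps_sign:
  assumes "f \<in> module_maps R S S' d" "S' 0 \<inter> S' 1 = {}"
  shows "(if f \<in> module_maps R S S' 0 then 0 else 1) = d \<or> f = 0"
proof (cases "d = 0")
  case False
  then have "d = 1" by simp
  then show ?thesis using maps_both_degrees[OF _ _ assms(2), of f S] assms(1) by auto
qed (use assms in simp)

end

text \<open>Specialization of a module element at a point; by \<open>val_at_ext\<close> identities
  over the ring of functions reduce to identities in the Hom spaces.\<close>

definition val_at :: "'u \<Rightarrow> ('p \<Rightarrow> 'u \<Rightarrow> novikov) \<Rightarrow> 'p \<Rightarrow> novikov" where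
  "val_at u y = (\<lambda>q. y q u)"

lemma val_at_ext: "(\<And>u. val_at u f = val_at u g) \<Longrightarrow> f = g"
  by (auto simp: val_at_def fun_eq_iff)

lemma val_at_add: "val_at u (f + g) = val_at u f + val_at u g" by (simp add: val_at_def fun_eq_iff)
lemma val_at_diff: "val_at u (f - g) = val_at u f - val_at u g" by (simp add: val_at_def fun_eq_iff)
lemma val_at_zero: "val_at u 0 = 0" by (simp add: val_at_def fun_eq_iff)
lemma val_at_psgn: "val_at u (psgn d f) = psgn d (val_at u f)" by (simp add: val_at_def psgn_def fun_eq_iff)
lemma val_at_sum: "val_at u (sum f A) = (\<Sum>a\<in>A. val_at u (f a))" by (simp add: val_at_def sum_fun_apply fun_eq_iff)
lemma val_at_scale: "val_at u (\<lambda>p. r * y p) = r u \<odot> val_at u y" by (simp add: val_at_def fun_eq_iff nscale_apply)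
lemma val_at_nscale: "val_at u (c \<odot> y) = c \<odot> val_at u y" by (simp add: val_at_def fun_eq_iff nscale_fun_def)
lemma val_at_parity: "val_at u (parity gen K L y) = parity gen K L (val_at u y)"
  by (simp add: val_at_def parity_def fun_eq_iff)

section \<open>Localized mirror functors and comparison maps as module maps\<close>

text \<open>Here \<open>Z\<close> pairs an object with a whole family of deformation elements, and
  \<open>ev Z u\<close> is the deformed object at the parameter \<open>u\<close>.\<close>

definition ev :: "'o \<times> ('u \<Rightarrow> 'm) \<Rightarrow> 'u \<Rightarrow> 'o \<times> 'm" where
  "ev Z u = (fst Z, snd Z u)"

definition evs :: "(('u \<Rightarrow> 'm) \<times> 'o \<times> ('u \<Rightarrow> 'm)) list \<Rightarrow> 'u \<Rightarrow> ('m \<times> 'o \<times> 'm) list" where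
  "evs \<tau> u = map (\<lambda>(x, Y). (x u, ev Y u)) \<tau>"

lemma fst_ev [simp]: "fst (ev Z u) = fst Z" by (simp add: ev_def)

lemma evs_simps [simp]: "evs [] u = []" "evs ((x, Y) # \<tau>) u = (x u, ev Y u) # evs \<tau> u"
  by (simp_all add: evs_def)

lemma tgt_evs: "tgt (ev Z u) (evs \<tau> u) = ev (tgt Z \<tau>) u"
  by (induction Z \<tau> rule: tgt.induct) auto

text \<open>One setting for three domains: each reference object over its own deformation space, and
  both together over the overlap. The set \<open>\<G>\<close> holds families of deformed objects,
  whose specializations lie in the common set \<open>\<D>\<close>.\<close>

locale mirror_family = mirror_ainf A gen \<D>
  for A :: "('o, 'p \<Rightarrow> novikov) ainf_category" and gen :: "'o \<Rightarrow> 'o \<Rightarrow> bit \<Rightarrow> 'p set"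
    and \<D> :: "('o \<times> ('p \<Rightarrow> novikov)) set" +
  fixes V :: "'u set" and R :: "('u \<Rightarrow> novikov) set" and \<G> :: "('o \<times> ('u \<Rightarrow> 'p \<Rightarrow> novikov)) set"
  assumes ring: "function_ring V R"
    and over: "defined_over A V R \<G>"
    and points: "Z \<in> \<G> \<Longrightarrow> u \<in> V \<Longrightarrow> ev Z u \<in> \<D>"
    and obG: "Z \<in> \<G> \<Longrightarrow> fst Z \<in> Ob A"
    and zero_family: "L \<in> Ob A \<Longrightarrow> (L, \<lambda>_. 0) \<in> \<G>"
begin

text \<open>A string of families with one degree over all of \<open>V\<close>. A letter may vanish
  at some points, which \<open>graded\<close> tolerates.\<close>

definition gstr :: "'o \<times> ('u \<Rightarrow> 'p \<Rightarrow> novikov) \<Rightarrow>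
    (('u \<Rightarrow> 'p \<Rightarrow> novikov) \<times> 'o \<times> ('u \<Rightarrow> 'p \<Rightarrow> novikov)) list \<Rightarrow> bit \<Rightarrow> bool" where
  "gstr Z \<tau> d \<longleftrightarrow> Z \<in> \<G> \<and> family_path A V R \<G> (fst Z) \<tau> \<and> tgt Z \<tau> \<in> \<G> \<and>
     (\<forall>u\<in>V. graded (ev Z u) (evs \<tau> u) d)"

lemma gstr_Nil: "Z \<in> \<G> \<Longrightarrow> gstr Z [] 0"
  by (simp add: gstr_def graded_Nil points)

lemma gstr_Cons:
  assumes "Z \<in> \<G>" "family V R (Hom A (fst Z) (fst Z') e) x" "gstr Z' \<tau> d"
  shows "gstr Z ((x, Z') # \<tau>) (e + 1 + d)"
proof -
  have Z': "Z' \<in> \<G>" using assms(3) by (simp add: gstr_def)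
  have "family V R (Hom_total A (fst Z) (fst Z')) x"
    using assms(2) Hom_sub_total[OF obG[OF assms(1)] obG[OF Z']] unfolding family_def by blast
  moreover have "graded (ev Z u) (evs ((x, Z') # \<tau>) u) (e + 1 + d)" if u: "u \<in> V" for u
    unfolding evs_simps
    by (rule graded_Cons[OF points[OF assms(1) u]])
       (use assms u in \<open>auto simp: family_def gstr_def\<close>)
  ultimately show ?thesis using assms Z' by (simp add: gstr_def)
qed

definition IM where
  "IM Z \<tau> = insertion_map A gen V R (fst Z) (snd Z) (evs \<tau>)"

lemma IM_nonfree: "y \<notin> free_module R (both (gen (tgt L as) (fst Z))) \<Longrightarrow> IM Z \<tau> L as y = 0"
  by (simp add: IM_def insertion_map_def)

lemma IM_at:
  "y \<in> free_module R (both (gen (tgt L as) (fst Z))) \<Longrightarrow>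
    val_at u (IM Z \<tau> L as y) = (if u \<in> V then M L as (val_at u y) (ev Z u) (evs \<tau> u) else 0)"
  by (auto simp: IM_def insertion_map_def M_def val_at_def lift_def ev_def fun_eq_iff)

lemma free_at_total:
  assumes "y \<in> free_module R (both (gen K L))" "K \<in> Ob A" "L \<in> Ob A"
  shows "val_at u y \<in> Hom_total A K L"
  using assms(1) unfolding Hom_total_iff[OF assms(2,3)] by (auto simp: free_module_def val_at_def)

lemma free_at_Hom:
  assumes "y \<in> free_module R (gen K L e)" "K \<in> Ob A" "L \<in> Ob A"
  shows "val_at u y \<in> Hom A K L e"
  using assms(1) unfolding Hom_iff[OF assms(2,3)] by (auto simp: free_module_def val_at_def)

lemma val_at_off: "y \<in> free_module R S \<Longrightarrow> u \<notin> V \<Longrightarrow> val_at u y = 0"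
  using ring_off[OF ring] by (auto simp: free_module_def val_at_def fun_eq_iff)

lemma family_path_append:
  "hpath A L as \<Longrightarrow> family_path A V R \<G> L (map (\<lambda>(a, K). (\<lambda>_. a, K, \<lambda>_. 0)) as @ \<tau>) \<longleftrightarrow>
     family_path A V R \<G> (tgt L as) \<tau>"
proof (induction as arbitrary: L)
  case (Cons x as)
  obtain a K where x: "x = (a, K)" by (cases x)
  have h: "L \<in> Ob A" "hpath A K as" using Cons.prems x by auto
  then have K: "K \<in> Ob A" using hpath_start by blast
  have "family V R (Hom_total A L K) (\<lambda>_. a)"
    using Cons.prems x h K Hom_sub_total ring_const[OF ring] by (auto simp: family_def)
  then show ?case
    using Cons.IH[OF h(2)] zero_family[OF K]
    unfolding x list.map append_Cons prod.case family_path.simps fst_conv tgt.simps by blast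
qed simp

text \<open>The letters of \<open>as\<close> become constant families, so the component is one of
  the functions that \<open>defined_over\<close> places in \<open>R\<close>.\<close>

lemma IM_component:
  assumes as: "hpath A L as" and \<tau>: "gstr Z \<tau> d" and y: "y \<in> free_module R (both (gen (tgt L as) (fst Z)))"
  shows "IM Z \<tau> L as y p \<in> R"
proof -
  have Z: "Z \<in> \<G>" "family_path A V R \<G> (fst Z) \<tau>" using \<tau> by (auto simp: gstr_def)
  note ob = hpath_tgt[OF as] obG[OF Z(1)]
  let ?\<sigma> = "map (\<lambda>(a, K). (\<lambda>_. a, K, \<lambda>_. 0)) as @ (\<lambda>u. val_at u y, Z) # \<tau>"
  have "(\<lambda>u. if u \<in> V then val_at u y q else 0) = y q" for q
    using ring_off[OF ring] y by (auto simp: free_module_def val_at_def fun_eq_iff)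
  then have "family V R (Hom_total A (tgt L as) (fst Z)) (\<lambda>u. val_at u y)"
    using free_at_total[OF y ob] y by (simp add: family_def free_module_def)
  then have "family_path A V R \<G> (fst (L, \<lambda>_ :: 'u. 0 :: 'p \<Rightarrow> novikov)) ?\<sigma>"
    using Z by (simp add: family_path_append[OF as])
  then have r: "(\<lambda>u. if u \<in> V then dmu A (fst (L, \<lambda>_ :: 'u. 0 :: 'p \<Rightarrow> novikov), snd (L, \<lambda>_ :: 'u. 0 :: 'p \<Rightarrow> novikov) u)
      (map (\<lambda>(x, Y). (x u, (fst Y, snd Y u))) ?\<sigma>) p else 0) \<in> R"
    using over zero_family[OF hpath_start[OF as]] unfolding defined_over_def by blast
  have e: "map (\<lambda>(x, Y). (x u, (fst Y, snd Y u))) ?\<sigma> = lift as @ (val_at u y, ev Z u) # evs \<tau> u" for u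
    by (auto simp: evs_def lift_def ev_def case_prod_beta')
  have "(\<lambda>u. if u \<in> V then dmu A (L, 0) (lift as @ (val_at u y, ev Z u) # evs \<tau> u) p else 0) \<in> R"
    using r unfolding e fst_conv snd_conv .
  then show ?thesis
    using y unfolding lift_def val_at_def ev_def by (simp add: IM_def insertion_map_def)
qed

lemma graded_dhp: "graded Z \<tau> d \<Longrightarrow> dhp Z \<tau>" by (simp add: graded_def)

text \<open>Additivity, linearity over the ring and degree are checked at each point through
  \<open>IM_at\<close>. Membership of the components in \<open>R\<close> is the one condition that
  is not pointwise.\<close>

lemma IM_maps:
  assumes as: "hpath A L as" and \<tau>: "gstr Z \<tau> d"
  shows "IM Z \<tau> L as \<in> module_maps R (gen (tgt L as) (fst Z)) (gen L (fst (tgt Z \<tau>))) (sdeg A L as + 1 + d)"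
proof -
  have Z: "Z \<in> \<G>" "tgt Z \<tau> \<in> \<G>" using \<tau> by (auto simp: gstr_def)
  have g: "graded (ev Z u) (evs \<tau> u) d" if "u \<in> V" for u using \<tau> that by (auto simp: gstr_def)
  note ob = hpath_tgt[OF as] obG[OF Z(1)] and ob' = hpath_start[OF as] obG[OF Z(2)]
  let ?F = "free_module R (both (gen (tgt L as) (fst Z)))"
  have h: "dhp (ev Z u) (evs \<tau> u)" if "u \<in> V" for u using graded_dhp[OF g[OF that]] .
  have t: "val_at u y \<in> Hom_total A (tgt L as) (fst (ev Z u))" if "y \<in> ?F" for u y
    using free_at_total[OF that ob] by simp
  have total: "M L as (val_at u y) (ev Z u) (evs \<tau> u) \<in> Hom_total A L (fst (tgt Z \<tau>))"
    if "y \<in> ?F" "u \<in> V" for u y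
    using M_total[OF as t[OF that(1)] h[OF that(2)]] by (simp add: tgt_evs)
  have z: "IM Z \<tau> L as y p u = val_at u (IM Z \<tau> L as y) p" for y p u by (simp add: val_at_def)
  have 1: "IM Z \<tau> L as y \<in> free_module R (both (gen L (fst (tgt Z \<tau>))))" if y: "y \<in> ?F" for y
  proof -
    have "IM Z \<tau> L as y p u = 0" if p: "p \<notin> both (gen L (fst (tgt Z \<tau>)))" for p u
      unfolding z IM_at[OF y] using total[OF y, of u] p Hom_total_iff[OF ob'] by (cases "u \<in> V") auto
    then show ?thesis using IM_component[OF as \<tau> y] by (auto simp: free_module_def fun_eq_iff)
  qed
  have 2: "IM Z \<tau> L as (x + y) = IM Z \<tau> L as x + IM Z \<tau> L as y" if xy: "x \<in> ?F" "y \<in> ?F" for x y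
  proof (rule val_at_ext)
    fix u
    show "val_at u (IM Z \<tau> L as (x + y)) = val_at u (IM Z \<tau> L as x + IM Z \<tau> L as y)"
      unfolding val_at_add IM_at[OF xy(1)] IM_at[OF xy(2)] IM_at[OF free_add[OF ring xy]]
      using M_add[OF as t[OF xy(1)] t[OF xy(2)] dhp_dtp[OF h]] by simp
  qed
  have 3: "IM Z \<tau> L as (\<lambda>p. r * y p) = (\<lambda>p. r * IM Z \<tau> L as y p)" if y: "y \<in> ?F" and r: "r \<in> R" for y r
  proof (rule val_at_ext)
    fix u
    show "val_at u (IM Z \<tau> L as (\<lambda>p. r * y p)) = val_at u (\<lambda>p. r * IM Z \<tau> L as y p)"
      unfolding val_at_scale IM_at[OF y] IM_at[OF free_scale[OF ring r y]]
      using M_scale[OF as t[OF y] dhp_dtp[OF h]] by (auto simp: fun_eq_iff nscale_apply)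
  qed
  have 4: "IM Z \<tau> L as y \<in> free_module R (gen L (fst (tgt Z \<tau>)) (e + (sdeg A L as + 1 + d)))"
    if y: "y \<in> free_module R (gen (tgt L as) (fst Z) e)" for y e
  proof -
    have yF: "y \<in> ?F" using y by (cases "e = 0") (auto simp: free_module_def)
    have "M L as (val_at u y) (ev Z u) (evs \<tau> u) \<in> Hom A L (fst (tgt Z \<tau>)) (e + (sdeg A L as + 1 + d))"
      if "u \<in> V" for u
      using M_graded[OF as _ g[OF that], of "val_at u y" e] free_at_Hom[OF y ob]
      by (simp add: tgt_evs add_ac del: add_bit_eq_xor)
    then have "IM Z \<tau> L as y p u = 0"
      if p: "p \<notin> gen L (fst (tgt Z \<tau>)) (e + (sdeg A L as + 1 + d))" for p u
      unfolding z IM_at[OF yF] using p Hom_iff[OF ob'] by (cases "u \<in> V") auto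
    then show ?thesis using IM_component[OF as \<tau> yF] by (auto simp: free_module_def fun_eq_iff)
  qed
  show ?thesis
    unfolding module_maps_def mem_Collect_eq
    using 1 2 3 4 IM_nonfree by blast
qed

end

lemma parity_zero: "parity gen K L 0 = 0"
  by (auto simp: parity_def fun_eq_iff)

lemma nscale_diff_right: "c \<odot> (x - y) = c \<odot> x - c \<odot> (y :: 'a :: novikov_module)"
  using nscale_add_right[of c "x - y" y] by (simp add: eq_diff_eq)

section \<open>Linearity in the string, comparison maps and homotopies over a domain\<close>

context mirror_family
begin

lemma free_parity:
  "y \<in> free_module R S \<Longrightarrow> parity gen K L y \<in> free_module R S"
  using ring_uminus[OF ring] by (auto simp: parity_def free_module_def)

lemma free_parity_iff: "parity gen K L y \<in> free_module R S \<longleftrightarrow> y \<in> free_module R S"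
  using free_parity by (metis parity_parity)

lemma M_linear_string:
  assumes x: "hpath A L (u @ (x, K) # v)" and y: "hpath A L (u @ (y, K) # v)"
    and z: "z \<in> Hom_total A (tgt K v) (fst Z)" and \<tau>: "dhp Z \<tau>"
  shows "M L (u @ (c \<odot> x + y, K) # v) z Z \<tau> = c \<odot> M L (u @ (x, K) # v) z Z \<tau> + M L (u @ (y, K) # v) z Z \<tau>"
proof -
  have h: "hpath A L u" "hpath A K v" "\<exists>d. x \<in> Hom A (tgt L u) K d" "\<exists>d. y \<in> Hom A (tgt L u) K d"
    using x y by (auto simp: hpath_append)
  then have xy: "x \<in> Hom_total A (tgt L u) K" "y \<in> Hom_total A (tgt L u) K"
    using Hom_sub_total[OF hpath_tgt[OF h(1)] hpath_start[OF h(2)]] by blast+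
  have "dtp (K, 0) (lift v @ (z, Z) # \<tau>)"
    unfolding dtp_insert using dtp_lift[OF h(2)] z dhp_dtp[OF \<tau>] by simp
  from dmu_linear[of "(L, 0)" "lift u" x "(K, 0)" y "lift v @ (z, Z) # \<tau>" c, OF dtp_lift[OF h(1)] _ _ this]
  show ?thesis using xy by (simp add: M_def)
qed

lemma IM_linear_string:
  assumes \<tau>: "gstr Z \<tau> d"
    and x: "hpath A L (u @ (x, K) # v)" and y: "hpath A L (u @ (y, K) # v)"
  shows "IM Z \<tau> L (u @ (c \<odot> x + y, K) # v) = c \<odot> IM Z \<tau> L (u @ (x, K) # v) + IM Z \<tau> L (u @ (y, K) # v)"
proof (rule ext)
  fix z
  have Z: "Z \<in> \<G>" using \<tau> by (simp add: gstr_def)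
  have h: "hpath A K v" using x by (auto simp: hpath_append)
  show "IM Z \<tau> L (u @ (c \<odot> x + y, K) # v) z = (c \<odot> IM Z \<tau> L (u @ (x, K) # v) + IM Z \<tau> L (u @ (y, K) # v)) z"
  proof (cases "z \<in> free_module R (both (gen (tgt K v) (fst Z)))")
    case True
    have z: "val_at w z \<in> Hom_total A (tgt K v) (fst (ev Z w))" for w
      using free_at_total[OF True hpath_tgt[OF h] obG[OF Z]] by simp
    have IM: "val_at w (IM Z \<tau> L (u @ (a, K) # v) z) = (if w \<in> V then M L (u @ (a, K) # v) (val_at w z) (ev Z w) (evs \<tau> w) else 0)"
      for a w by (rule IM_at) (use True in simp)
    show ?thesis
    proof (rule val_at_ext)
      fix w
      have "dhp (ev Z w) (evs \<tau> w)" if "w \<in> V" using \<tau> that by (auto simp: gstr_def graded_def)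
      then show "val_at w (IM Z \<tau> L (u @ (c \<odot> x + y, K) # v) z) =
          val_at w ((c \<odot> IM Z \<tau> L (u @ (x, K) # v) + IM Z \<tau> L (u @ (y, K) # v)) z)"
        using M_linear_string[OF x y z]
        by (simp add: IM val_at_add nscale_fun_def[of c "IM Z \<tau> L (u @ (x, K) # v)"] val_at_nscale)
           (auto simp: fun_eq_iff nscale_apply)
    qed
  next
    case False
    then show ?thesis by (simp add: IM_nonfree nscale_fun_def fun_eq_iff nscale_novikov_def)
  qed
qed

lemma IM_multilinear: "gstr Z \<tau> d \<Longrightarrow> multilinear_on (hpath (uncurved A)) (IM Z \<tau>)"
  unfolding multilinear_on_def
  by (intro allI impI, elim conjE) (rule IM_linear_string[OF _ hpath_uncurved hpath_uncurved])

definition CM where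
  "CM Z \<theta> Z' = comparison_map A gen V R (fst Z) (snd Z) (fst Z') (snd Z') \<theta>"

lemma CM_eq: "CM Z \<theta> Z' L as y =
    psgn (sdeg A L as) (IM Z [(\<theta>, Z')] L as (parity gen (tgt L as) (fst Z) y))"
proof -
  have "evs [(\<theta>, Z')] = (\<lambda>u. [(\<theta> u, fst Z', snd Z' u)])" by (simp add: fun_eq_iff ev_def)
  then show ?thesis by (simp add: CM_def comparison_map_def IM_def parity_def)
qed

lemma CM_nonfree: "y \<notin> free_module R (both (gen (tgt L as) (fst Z))) \<Longrightarrow> CM Z \<theta> Z' L as y = 0"
  by (simp add: CM_eq IM_nonfree free_parity_iff)

lemma CM_at:
  assumes "y \<in> free_module R (both (gen (tgt L as) (fst Z)))"
  shows "val_at u (CM Z \<theta> Z' L as y) = (if u \<in> V then T L as (val_at u y) (ev Z u) (\<theta> u) (ev Z' u) else 0)"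
  using free_parity[OF assms] by (simp add: CM_eq val_at_psgn IM_at val_at_parity T_def)

lemma gstr_single:
  assumes "Z \<in> \<G>" "Z' \<in> \<G>" "family V R (Hom A (fst Z) (fst Z') e) x"
  shows "gstr Z [(x, Z')] (e + 1)"
  using gstr_Cons[OF assms(1,3) gstr_Nil[OF assms(2)]] by simp

text \<open>Since \<open>\<theta>\<close> has degree 0, the sign of the string and the twist of the
  input combine into a twist of the output. This removes the sign depending on the string, so
  linearity in its letters is inherited from \<open>IM\<close>.\<close>

lemma CM_parity:
  assumes as: "hpath A L as" and Z: "Z \<in> \<G>" "Z' \<in> \<G>" and \<theta>: "family V R (Hom A (fst Z) (fst Z') 0) \<theta>"
  shows "CM Z \<theta> Z' L as y = parity gen L (fst Z') (IM Z [(\<theta>, Z')] L as y)"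
proof (cases "y \<in> free_module R (both (gen (tgt L as) (fst Z)))")
  case True
  show ?thesis
  proof (rule val_at_ext)
    fix u
    show "val_at u (CM Z \<theta> Z' L as y) = val_at u (parity gen L (fst Z') (IM Z [(\<theta>, Z')] L as y))"
    proof (cases "u \<in> V")
      case u: True
      have "graded (ev Z u) [(\<theta> u, ev Z' u)] 1"
        using gstr_single[OF Z \<theta>] u by (auto simp: gstr_def)
      from M_parity[OF as _ this, of "val_at u y"]
      have "parity gen L (fst Z') (M L as (val_at u y) (ev Z u) [(\<theta> u, ev Z' u)]) =
          psgn (sdeg A L as) (M L as (parity gen (tgt L as) (fst Z) (val_at u y)) (ev Z u) [(\<theta> u, ev Z' u)])"
        using free_at_total[OF True hpath_tgt[OF as] obG[OF Z(1)]] by (simp add: psgn_def)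
      then show ?thesis using u by (simp add: CM_at[OF True] val_at_parity IM_at[OF True] T_def)
    qed (simp add: CM_at[OF True] val_at_parity IM_at[OF True] parity_zero)
  qed
qed (simp add: CM_nonfree IM_nonfree parity_zero)

lemma maps_parity:
  assumes f: "f \<in> module_maps R S (gen K L) d"
  shows "(\<lambda>y. parity gen K L (f y)) \<in> module_maps R S (gen K L) d"
proof -
  have s: "parity gen K L (\<lambda>p. r * w p) = (\<lambda>p. r * parity gen K L w p)"
    for r :: "'u \<Rightarrow> novikov" and w :: "'p \<Rightarrow> 'u \<Rightarrow> novikov"
    by (auto simp: parity_def fun_eq_iff)
  show ?thesis
    using f unfolding module_maps_def
    by (simp add: free_parity_iff parity_add parity_zero s del: add_bit_eq_xor)
qed

lemma CM_maps:
  assumes as: "hpath A L as" and Z: "Z \<in> \<G>" "Z' \<in> \<G>" and \<theta>: "family V R (Hom A (fst Z) (fst Z') 0) \<theta>"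
  shows "CM Z \<theta> Z' L as \<in> module_maps R (gen (tgt L as) (fst Z)) (gen L (fst Z')) (sdeg A L as)"
proof -
  have "IM Z [(\<theta>, Z')] L as \<in> module_maps R (gen (tgt L as) (fst Z)) (gen L (fst Z')) (sdeg A L as)"
    using IM_maps[OF as gstr_single[OF Z \<theta>]] by (simp add: add.assoc bit_cancel del: add_bit_eq_xor)
  from maps_parity[OF this] show ?thesis unfolding CM_parity[OF as Z \<theta>, symmetric] .
qed

lemma CM_multilinear:
  assumes Z: "Z \<in> \<G>" "Z' \<in> \<G>" and \<theta>: "family V R (Hom A (fst Z) (fst Z') 0) \<theta>"
  shows "multilinear_on (hpath (uncurved A)) (CM Z \<theta> Z')"
  unfolding multilinear_on_def
proof (intro allI impI, elim conjE)
  fix L u K v x y c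
  assume "hpath (uncurved A) L (u @ (x, K) # v)" "hpath (uncurved A) L (u @ (y, K) # v)"
    "hpath (uncurved A) L (u @ (c \<odot> x + y, K) # v)"
  note h = this[THEN hpath_uncurved]
  show "CM Z \<theta> Z' L (u @ (c \<odot> x + y, K) # v) = c \<odot> CM Z \<theta> Z' L (u @ (x, K) # v) + CM Z \<theta> Z' L (u @ (y, K) # v)"
  proof
    fix z
    have p: "parity gen L (fst Z') (c \<odot> a + b) = c \<odot> parity gen L (fst Z') a + parity gen L (fst Z') b"
      for a b :: "'p \<Rightarrow> 'u \<Rightarrow> novikov"
      by (auto simp: parity_def fun_eq_iff nscale_fun_def nscale_novikov_def)
    have "(c \<odot> CM Z \<theta> Z' L (u @ (x, K) # v) + CM Z \<theta> Z' L (u @ (y, K) # v)) z =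
        c \<odot> CM Z \<theta> Z' L (u @ (x, K) # v) z + CM Z \<theta> Z' L (u @ (y, K) # v) z"
      by (simp add: nscale_fun_def)
    moreover have "(c \<odot> IM Z [(\<theta>, Z')] L (u @ (x, K) # v) + IM Z [(\<theta>, Z')] L (u @ (y, K) # v)) z =
        c \<odot> IM Z [(\<theta>, Z')] L (u @ (x, K) # v) z + IM Z [(\<theta>, Z')] L (u @ (y, K) # v) z"
      by (simp add: nscale_fun_def)
    ultimately show "CM Z \<theta> Z' L (u @ (c \<odot> x + y, K) # v) z =
        (c \<odot> CM Z \<theta> Z' L (u @ (x, K) # v) + CM Z \<theta> Z' L (u @ (y, K) # v)) z"
      unfolding CM_parity[OF h(1) Z \<theta>] CM_parity[OF h(2) Z \<theta>] CM_parity[OF h(3) Z \<theta>]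
        IM_linear_string[OF gstr_single[OF Z \<theta>] h(1,2)] by (simp only: p)
  qed
qed

definition HM where
  "HM Z \<theta> Z' \<theta>' \<gamma> = homotopy_map A gen V R (fst Z) (snd Z) (fst Z') (snd Z') \<theta> \<theta>' \<gamma>"

lemma HM_eq: "HM Z \<theta> Z' \<theta>' \<gamma> L as = IM Z [(\<theta>, Z'), (\<theta>', Z)] L as - IM Z [(\<gamma>, Z)] L as"
proof -
  have "evs [(\<theta>, Z'), (\<theta>', Z)] = (\<lambda>u. [(\<theta> u, fst Z', snd Z' u), (\<theta>' u, fst Z, snd Z u)])"
    "evs [(\<gamma>, Z)] = (\<lambda>u. [(\<gamma> u, fst Z, snd Z u)])"
    by (simp_all add: fun_eq_iff ev_def)
  then show ?thesis by (simp add: HM_def homotopy_map_def IM_def)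
qed

lemma HM_nonfree: "y \<notin> free_module R (both (gen (tgt L as) (fst Z))) \<Longrightarrow> HM Z \<theta> Z' \<theta>' \<gamma> L as y = 0"
  by (simp add: HM_eq IM_nonfree)

lemma HM_at:
  assumes "y \<in> free_module R (both (gen (tgt L as) (fst Z)))"
  shows "val_at u (HM Z \<theta> Z' \<theta>' \<gamma> L as y) = (if u \<in> V then
     M L as (val_at u y) (ev Z u) [(\<theta> u, ev Z' u), (\<theta>' u, ev Z u)] -
     M L as (val_at u y) (ev Z u) [(\<gamma> u, ev Z u)] else 0)"
  by (simp add: HM_eq val_at_diff IM_at[OF assms])

lemma gstr_pair:
  assumes "Z \<in> \<G>" "Z' \<in> \<G>" "Z'' \<in> \<G>"
    "family V R (Hom A (fst Z) (fst Z') 0) \<theta>" "family V R (Hom A (fst Z') (fst Z'') 0) \<theta>'"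
  shows "gstr Z [(\<theta>, Z'), (\<theta>', Z'')] 0"
  using gstr_Cons[OF assms(1,4) gstr_single[OF assms(2,3,5)]] by simp

lemma HM_maps:
  assumes as: "hpath A L as" and Z: "Z \<in> \<G>" "Z' \<in> \<G>"
    and \<theta>: "family V R (Hom A (fst Z) (fst Z') 0) \<theta>" "family V R (Hom A (fst Z') (fst Z) 0) \<theta>'"
      "family V R (Hom A (fst Z) (fst Z) 1) \<gamma>"
  shows "HM Z \<theta> Z' \<theta>' \<gamma> L as \<in> module_maps R (gen (tgt L as) (fst Z)) (gen L (fst Z)) (sdeg A L as + 1)"
  unfolding HM_eq
  using maps_diff[OF ring] IM_maps[OF as gstr_pair[OF Z Z(1) \<theta>(1,2)]]
    IM_maps[OF as gstr_single[OF Z(1,1) \<theta>(3)]] by (simp del: add_bit_eq_xor)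

lemma HM_multilinear:
  assumes Z: "Z \<in> \<G>" "Z' \<in> \<G>"
    and \<theta>: "family V R (Hom A (fst Z) (fst Z') 0) \<theta>" "family V R (Hom A (fst Z') (fst Z) 0) \<theta>'"
      "family V R (Hom A (fst Z) (fst Z) 1) \<gamma>"
  shows "multilinear_on (hpath (uncurved A)) (HM Z \<theta> Z' \<theta>' \<gamma>)"
  unfolding multilinear_on_def
proof (intro allI impI, elim conjE)
  fix L u K v x y c
  assume "hpath (uncurved A) L (u @ (x, K) # v)" "hpath (uncurved A) L (u @ (y, K) # v)"
  note h = this[THEN hpath_uncurved]
  show "HM Z \<theta> Z' \<theta>' \<gamma> L (u @ (c \<odot> x + y, K) # v) =
      c \<odot> HM Z \<theta> Z' \<theta>' \<gamma> L (u @ (x, K) # v) + HM Z \<theta> Z' \<theta>' \<gamma> L (u @ (y, K) # v)"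
    unfolding HM_eq IM_linear_string[OF gstr_pair[OF Z Z(1) \<theta>(1,2)] h]
      IM_linear_string[OF gstr_single[OF Z(1,1) \<theta>(3)] h]
    by (simp only: nscale_diff_right add_diff_add)
qed

definition weak_family where
  "weak_family Z W \<longleftrightarrow> Z \<in> \<G> \<and> (\<forall>u\<in>V. weak_mc (ev Z u) (W u))"

lemma splits2_hpath:
  assumes "hpath A L as" "(u, v) \<in> splits2 as"
  shows "hpath A L u" "hpath A (tgt L u) v" "tgt (tgt L u) v = tgt L as"
  using assms by (auto simp: splits2_def hpath_append)

lemma IM_free:
  assumes "hpath A L as" "gstr Z \<tau> d" "y \<in> free_module R (both (gen (tgt L as) (fst Z)))"
  shows "IM Z \<tau> L as y \<in> free_module R (both (gen L (fst (tgt Z \<tau>))))"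
  using IM_maps[OF assms(1,2)] assms(3) unfolding module_maps_def by blast

lemma CM_free:
  assumes "hpath A L as" "Z \<in> \<G>" "Z' \<in> \<G>" "family V R (Hom A (fst Z) (fst Z') 0) \<theta>"
    "y \<in> free_module R (both (gen (tgt L as) (fst Z)))"
  shows "CM Z \<theta> Z' L as y \<in> free_module R (both (gen L (fst Z')))"
  using CM_maps[OF assms(1-4)] assms(5) unfolding module_maps_def by blast

lemma HM_free:
  assumes "hpath A L as" "Z \<in> \<G>" "Z' \<in> \<G>"
    "family V R (Hom A (fst Z) (fst Z') 0) \<theta>" "family V R (Hom A (fst Z') (fst Z) 0) \<theta>'"
    "family V R (Hom A (fst Z) (fst Z) 1) \<gamma>"
    "y \<in> free_module R (both (gen (tgt L as) (fst Z)))"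
  shows "HM Z \<theta> Z' \<theta>' \<gamma> L as y \<in> free_module R (both (gen L (fst Z)))"
  using HM_maps[OF assms(1-6)] assms(7) unfolding module_maps_def by blast

text \<open>At points of \<open>V\<close> this is \<open>functor_relation\<close>; elsewhere both
  sides are zero because functions are extended by zero. The relations for \<open>CM\<close> and
  \<open>HM\<close> are lifted from their pointwise versions in the same way.\<close>

lemma IM_functor_relation:
  assumes as: "hpath A L as" and W: "weak_family Z W"
    and y: "y \<in> free_module R (both (gen (tgt L as) (fst Z)))"
  shows "(\<Sum>(u, v, w)\<in>splits3 as. psgn (sdeg A L u) (IM Z [] L (contract A L u v w) y)) +
    (\<Sum>(u, v)\<in>splits2 as. psgn (sdeg A L u) (IM Z [] L u (IM Z [] (tgt L u) v y))) =
    (if as = [] then (\<lambda>p. W * y p) else 0)"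
proof (rule val_at_ext)
  fix x
  have Z: "Z \<in> \<G>" using W by (simp add: weak_family_def)
  note n = gstr_Nil[OF Z]
  have 1: "val_at x (IM Z [] L (contract A L u v w) y) = (if x \<in> V then M L (contract A L u v w) (val_at x y) (ev Z x) [] else 0)"
    if "(u, v, w) \<in> splits3 as" for u v w
    using IM_at[of y L "contract A L u v w" Z x "[]"] y tgt_contract'[OF that] by simp
  have 2: "val_at x (IM Z [] L u (IM Z [] (tgt L u) v y)) =
      (if x \<in> V then M L u (M (tgt L u) v (val_at x y) (ev Z x) []) (ev Z x) [] else 0)"
    if s: "(u, v) \<in> splits2 as" for u v
  proof -
    note uv = splits2_hpath[OF as s]
    have y': "y \<in> free_module R (both (gen (tgt (tgt L u) v) (fst Z)))" using y uv(3) by simp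
    show ?thesis
      using IM_at[of "IM Z [] (tgt L u) v y" L u Z x "[]"] IM_free[OF uv(2) n y'] IM_at[OF y', of x "[]"] by simp
  qed
  show "val_at x ((\<Sum>(u, v, w)\<in>splits3 as. psgn (sdeg A L u) (IM Z [] L (contract A L u v w) y)) +
    (\<Sum>(u, v)\<in>splits2 as. psgn (sdeg A L u) (IM Z [] L u (IM Z [] (tgt L u) v y)))) =
    val_at x (if as = [] then (\<lambda>p. W * y p) else 0)"
  proof (cases "x \<in> V")
    case True
    have "val_at x y \<in> Hom_total A (tgt L as) (fst (ev Z x))"
      using free_at_total[OF y hpath_tgt[OF as] obG[OF Z]] by simp
    from functor_relation[OF as this, of "W x"] W True
    have "rel_in L as (val_at x y) (ev Z x) [] + (\<Sum>(u, v)\<in>splits2 as. psgn (sdeg A L u)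
       (M L u (M (tgt L u) v (val_at x y) (ev Z x) []) (ev Z x) [])) = (if as = [] then W x \<odot> val_at x y else 0)"
      by (simp add: weak_family_def)
    moreover have "val_at x (\<Sum>(u, v, w)\<in>splits3 as. psgn (sdeg A L u) (IM Z [] L (contract A L u v w) y)) =
        rel_in L as (val_at x y) (ev Z x) []"
      unfolding val_at_sum rel_in_def by (rule sum.cong[OF refl]) (auto simp: val_at_psgn 1 True)
    moreover have "val_at x (\<Sum>(u, v)\<in>splits2 as. psgn (sdeg A L u) (IM Z [] L u (IM Z [] (tgt L u) v y))) =
        (\<Sum>(u, v)\<in>splits2 as. psgn (sdeg A L u) (M L u (M (tgt L u) v (val_at x y) (ev Z x) []) (ev Z x) []))"
      unfolding val_at_sum by (rule sum.cong[OF refl]) (auto simp: val_at_psgn 2 True)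
    ultimately show ?thesis by (simp add: val_at_add val_at_scale val_at_zero)
  next
    case False
    have "val_at x (\<Sum>(u, v, w)\<in>splits3 as. psgn (sdeg A L u) (IM Z [] L (contract A L u v w) y)) = 0"
      unfolding val_at_sum by (rule sum.neutral) (auto simp: val_at_psgn 1 False)
    moreover have "val_at x (\<Sum>(u, v)\<in>splits2 as. psgn (sdeg A L u) (IM Z [] L u (IM Z [] (tgt L u) v y))) = 0"
      unfolding val_at_sum by (rule sum.neutral) (auto simp: val_at_psgn 2 False)
    moreover have "W x \<odot> val_at x y = 0"
      using val_at_off[OF y False] by (auto simp: fun_eq_iff nscale_apply)
    ultimately show ?thesis by (simp add: val_at_add val_at_scale val_at_zero)
  qed
qed

lemma CM_natural_relation:
  assumes as: "hpath A L as" and W: "weak_family Z W" "weak_family Z' W'"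
    and \<theta>: "family V R (Hom A (fst Z) (fst Z') 0) \<theta>"
    and closed: "\<And>u. u \<in> V \<Longrightarrow> dmu A (ev Z u) [(\<theta> u, ev Z' u)] = 0"
    and y: "y \<in> free_module R (both (gen (tgt L as) (fst Z)))"
  shows "(\<Sum>(u, v, w)\<in>splits3 as. psgn (sdeg A L u) (CM Z \<theta> Z' L (contract A L u v w) y)) +
    (\<Sum>(u, v)\<in>splits2 as. psgn (sdeg A L u) (CM Z \<theta> Z' L u (IM Z [] (tgt L u) v y))) =
    (\<Sum>(u, v)\<in>splits2 as. IM Z' [] L u (CM Z \<theta> Z' (tgt L u) v y))"
proof (rule val_at_ext)
  fix x
  have Z: "Z \<in> \<G>" "Z' \<in> \<G>" using W by (auto simp: weak_family_def)
  note n = gstr_Nil[OF Z(1)]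
  let ?T = "\<lambda>L as y. T L as y (ev Z x) (\<theta> x) (ev Z' x)"
  have 1: "val_at x (CM Z \<theta> Z' L (contract A L u v w) y) = (if x \<in> V then ?T L (contract A L u v w) (val_at x y) else 0)"
    if "(u, v, w) \<in> splits3 as" for u v w
    using CM_at[of y L "contract A L u v w" Z x \<theta> Z'] y tgt_contract'[OF that] by simp
  have 2: "val_at x (CM Z \<theta> Z' L u (IM Z [] (tgt L u) v y)) =
      (if x \<in> V then ?T L u (M (tgt L u) v (val_at x y) (ev Z x) []) else 0)"
    and 3: "val_at x (IM Z' [] L u (CM Z \<theta> Z' (tgt L u) v y)) =
      (if x \<in> V then M L u (?T (tgt L u) v (val_at x y)) (ev Z' x) [] else 0)"
    if s: "(u, v) \<in> splits2 as" for u v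
  proof -
    note uv = splits2_hpath[OF as s]
    have y': "y \<in> free_module R (both (gen (tgt (tgt L u) v) (fst Z)))" using y uv(3) by simp
    show "val_at x (CM Z \<theta> Z' L u (IM Z [] (tgt L u) v y)) =
      (if x \<in> V then ?T L u (M (tgt L u) v (val_at x y) (ev Z x) []) else 0)"
      using CM_at[of "IM Z [] (tgt L u) v y" L u Z x \<theta> Z'] IM_free[OF uv(2) n y'] IM_at[OF y', of x "[]"] by simp
    show "val_at x (IM Z' [] L u (CM Z \<theta> Z' (tgt L u) v y)) =
      (if x \<in> V then M L u (?T (tgt L u) v (val_at x y)) (ev Z' x) [] else 0)"
      using IM_at[of "CM Z \<theta> Z' (tgt L u) v y" L u Z' x "[]"] CM_free[OF uv(2) Z \<theta> y'] CM_at[OF y', of x \<theta> Z'] by simp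
  qed
  show "val_at x ((\<Sum>(u, v, w)\<in>splits3 as. psgn (sdeg A L u) (CM Z \<theta> Z' L (contract A L u v w) y)) +
    (\<Sum>(u, v)\<in>splits2 as. psgn (sdeg A L u) (CM Z \<theta> Z' L u (IM Z [] (tgt L u) v y)))) =
    val_at x (\<Sum>(u, v)\<in>splits2 as. IM Z' [] L u (CM Z \<theta> Z' (tgt L u) v y))"
  proof (cases "x \<in> V")
    case True
    have t: "val_at x y \<in> Hom_total A (tgt L as) (fst (ev Z x))"
      using free_at_total[OF y hpath_tgt[OF as] obG[OF Z(1)]] by simp
    have w: "weak_mc (ev Z x) (W x)" "weak_mc (ev Z' x) (W' x)" "\<theta> x \<in> Hom A (fst (ev Z x)) (fst (ev Z' x)) 0"
      using W \<theta> True by (auto simp: weak_family_def family_def)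
    have "val_at x (\<Sum>(u, v, w)\<in>splits3 as. psgn (sdeg A L u) (CM Z \<theta> Z' L (contract A L u v w) y)) =
        (\<Sum>(u, v, w)\<in>splits3 as. psgn (sdeg A L u) (?T L (contract A L u v w) (val_at x y)))"
      unfolding val_at_sum by (rule sum.cong[OF refl]) (auto simp: val_at_psgn 1 True)
    moreover have "val_at x (\<Sum>(u, v)\<in>splits2 as. psgn (sdeg A L u) (CM Z \<theta> Z' L u (IM Z [] (tgt L u) v y))) =
        (\<Sum>(u, v)\<in>splits2 as. psgn (sdeg A L u) (?T L u (M (tgt L u) v (val_at x y) (ev Z x) [])))"
      unfolding val_at_sum by (rule sum.cong[OF refl]) (auto simp: val_at_psgn 2 True)
    moreover have "val_at x (\<Sum>(u, v)\<in>splits2 as. IM Z' [] L u (CM Z \<theta> Z' (tgt L u) v y)) =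
        (\<Sum>(u, v)\<in>splits2 as. M L u (?T (tgt L u) v (val_at x y)) (ev Z' x) [])"
      unfolding val_at_sum by (rule sum.cong[OF refl]) (auto simp: 3 True)
    ultimately show ?thesis
      using natural_relation[OF as t w closed[OF True]] by (simp add: val_at_add)
  next
    case False
    have "val_at x (\<Sum>(u, v, w)\<in>splits3 as. psgn (sdeg A L u) (CM Z \<theta> Z' L (contract A L u v w) y)) = 0"
      unfolding val_at_sum by (rule sum.neutral) (auto simp: val_at_psgn 1 False)
    moreover have "val_at x (\<Sum>(u, v)\<in>splits2 as. psgn (sdeg A L u) (CM Z \<theta> Z' L u (IM Z [] (tgt L u) v y))) = 0"
      unfolding val_at_sum by (rule sum.neutral) (auto simp: val_at_psgn 2 False)
    moreover have "val_at x (\<Sum>(u, v)\<in>splits2 as. IM Z' [] L u (CM Z \<theta> Z' (tgt L u) v y)) = 0"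
      unfolding val_at_sum by (rule sum.neutral) (auto simp: 3 False)
    ultimately show ?thesis by (simp add: val_at_add)
  qed
qed

lemma HM_homotopy_relation:
  assumes as: "hpath A L as" and W: "weak_family Z W" "weak_family Z' W'"
    and \<theta>: "family V R (Hom A (fst Z) (fst Z') 0) \<theta>" "family V R (Hom A (fst Z') (fst Z) 0) \<theta>'"
      "family V R (Hom A (fst Z) (fst Z) 1) \<gamma>"
    and closed: "\<And>u. u \<in> V \<Longrightarrow> dmu A (ev Z u) [(\<theta> u, ev Z' u)] = 0"
      "\<And>u. u \<in> V \<Longrightarrow> dmu A (ev Z' u) [(\<theta>' u, ev Z u)] = 0"
    and inv: "\<And>u. u \<in> V \<Longrightarrow> dmu A (ev Z u) [(\<theta> u, ev Z' u), (\<theta>' u, ev Z u)] =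
      unit_of A (fst Z) + dmu A (ev Z u) [(\<gamma> u, ev Z u)]"
    and y: "y \<in> free_module R (both (gen (tgt L as) (fst Z)))"
  defines "H \<equiv> HM Z \<theta> Z' \<theta>' \<gamma>"
  shows "(\<Sum>(u, v, w)\<in>splits3 as. psgn (sdeg A L u) (H L (contract A L u v w) y)) +
    (\<Sum>(u, v)\<in>splits2 as. psgn (sdeg A L u) (H L u (IM Z [] (tgt L u) v y))) +
    (\<Sum>(u, v)\<in>splits2 as. psgn (sdeg A L u) (IM Z [] L u (H (tgt L u) v y))) +
    (\<Sum>(u, v)\<in>splits2 as. CM Z' \<theta>' Z L u (CM Z \<theta> Z' (tgt L u) v y)) = (if as = [] then y else 0)"
proof (rule val_at_ext)
  fix x
  have Z: "Z \<in> \<G>" "Z' \<in> \<G>" using W by (auto simp: weak_family_def)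
  note n = gstr_Nil[OF Z(1)]
  let ?T = "\<lambda>L as y. T L as y (ev Z x) (\<theta> x) (ev Z' x)"
  let ?T' = "\<lambda>L as y. T L as y (ev Z' x) (\<theta>' x) (ev Z x)"
  let ?H = "\<lambda>L as y. M L as y (ev Z x) [(\<theta> x, ev Z' x), (\<theta>' x, ev Z x)] - M L as y (ev Z x) [(\<gamma> x, ev Z x)]"
  have 1: "val_at x (H L (contract A L u v w) y) = (if x \<in> V then ?H L (contract A L u v w) (val_at x y) else 0)"
    if "(u, v, w) \<in> splits3 as" for u v w
    using HM_at[of y L "contract A L u v w" Z x] y tgt_contract'[OF that] by (simp add: H_def)
  have 2: "val_at x (H L u (IM Z [] (tgt L u) v y)) =
      (if x \<in> V then ?H L u (M (tgt L u) v (val_at x y) (ev Z x) []) else 0)"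
    and 3: "val_at x (IM Z [] L u (H (tgt L u) v y)) =
      (if x \<in> V then M L u (?H (tgt L u) v (val_at x y)) (ev Z x) [] else 0)"
    and 4: "val_at x (CM Z' \<theta>' Z L u (CM Z \<theta> Z' (tgt L u) v y)) =
      (if x \<in> V then ?T' L u (?T (tgt L u) v (val_at x y)) else 0)"
    if s: "(u, v) \<in> splits2 as" for u v
  proof -
    note uv = splits2_hpath[OF as s]
    have y': "y \<in> free_module R (both (gen (tgt (tgt L u) v) (fst Z)))" using y uv(3) by simp
    show "val_at x (H L u (IM Z [] (tgt L u) v y)) =
      (if x \<in> V then ?H L u (M (tgt L u) v (val_at x y) (ev Z x) []) else 0)"
      using HM_at[of "IM Z [] (tgt L u) v y" L u Z x] IM_free[OF uv(2) n y'] IM_at[OF y', of x "[]"] by (simp add: H_def)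
    show "val_at x (IM Z [] L u (H (tgt L u) v y)) =
      (if x \<in> V then M L u (?H (tgt L u) v (val_at x y)) (ev Z x) [] else 0)"
      using IM_at[of "H (tgt L u) v y" L u Z x "[]"] HM_free[OF uv(2) Z \<theta> y'] HM_at[OF y', of x] by (simp add: H_def)
    show "val_at x (CM Z' \<theta>' Z L u (CM Z \<theta> Z' (tgt L u) v y)) =
      (if x \<in> V then ?T' L u (?T (tgt L u) v (val_at x y)) else 0)"
      using CM_at[of "CM Z \<theta> Z' (tgt L u) v y" L u Z' x \<theta>' Z] CM_free[OF uv(2) Z \<theta>(1) y'] CM_at[OF y', of x \<theta> Z']
      by simp
  qed
  show "val_at x ((\<Sum>(u, v, w)\<in>splits3 as. psgn (sdeg A L u) (H L (contract A L u v w) y)) +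
    (\<Sum>(u, v)\<in>splits2 as. psgn (sdeg A L u) (H L u (IM Z [] (tgt L u) v y))) +
    (\<Sum>(u, v)\<in>splits2 as. psgn (sdeg A L u) (IM Z [] L u (H (tgt L u) v y))) +
    (\<Sum>(u, v)\<in>splits2 as. CM Z' \<theta>' Z L u (CM Z \<theta> Z' (tgt L u) v y))) = val_at x (if as = [] then y else 0)"
  proof (cases "x \<in> V")
    case True
    have t: "val_at x y \<in> Hom_total A (tgt L as) (fst (ev Z x))"
      using free_at_total[OF y hpath_tgt[OF as] obG[OF Z(1)]] by simp
    have w: "weak_mc (ev Z x) (W x)" "weak_mc (ev Z' x) (W' x)"
      "\<theta> x \<in> Hom A (fst (ev Z x)) (fst (ev Z' x)) 0" "\<theta>' x \<in> Hom A (fst (ev Z' x)) (fst (ev Z x)) 0"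
      "\<gamma> x \<in> Hom A (fst (ev Z x)) (fst (ev Z x)) 1"
      using W \<theta> True by (auto simp: weak_family_def family_def)
    have "val_at x (\<Sum>(u, v, w)\<in>splits3 as. psgn (sdeg A L u) (H L (contract A L u v w) y)) =
        (\<Sum>(u, v, w)\<in>splits3 as. psgn (sdeg A L u) (?H L (contract A L u v w) (val_at x y)))"
      unfolding val_at_sum by (rule sum.cong[OF refl]) (auto simp: val_at_psgn 1 True)
    moreover have "val_at x (\<Sum>(u, v)\<in>splits2 as. psgn (sdeg A L u) (H L u (IM Z [] (tgt L u) v y))) =
        (\<Sum>(u, v)\<in>splits2 as. psgn (sdeg A L u) (?H L u (M (tgt L u) v (val_at x y) (ev Z x) [])))"
      unfolding val_at_sum by (rule sum.cong[OF refl]) (auto simp: val_at_psgn 2 True)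
    moreover have "val_at x (\<Sum>(u, v)\<in>splits2 as. psgn (sdeg A L u) (IM Z [] L u (H (tgt L u) v y))) =
        (\<Sum>(u, v)\<in>splits2 as. psgn (sdeg A L u) (M L u (?H (tgt L u) v (val_at x y)) (ev Z x) []))"
      unfolding val_at_sum by (rule sum.cong[OF refl]) (auto simp: val_at_psgn 3 True)
    moreover have "val_at x (\<Sum>(u, v)\<in>splits2 as. CM Z' \<theta>' Z L u (CM Z \<theta> Z' (tgt L u) v y)) =
        (\<Sum>(u, v)\<in>splits2 as. ?T' L u (?T (tgt L u) v (val_at x y)))"
      unfolding val_at_sum by (rule sum.cong[OF refl]) (auto simp: 4 True)
    moreover have "val_at x (if as = [] then y else 0) = (if as = [] then val_at x y else 0)"
      by (simp add: val_at_zero)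
    ultimately show ?thesis
      using homotopy_relation[OF as t w closed[OF True] inv[OF True, folded fst_ev[of Z x]]]
      by (simp only: val_at_add)
  next
    case False
    have "val_at x (\<Sum>(u, v, w)\<in>splits3 as. psgn (sdeg A L u) (H L (contract A L u v w) y)) = 0"
      unfolding val_at_sum by (rule sum.neutral) (auto simp: val_at_psgn 1 False)
    moreover have "val_at x (\<Sum>(u, v)\<in>splits2 as. psgn (sdeg A L u) (H L u (IM Z [] (tgt L u) v y))) = 0"
      unfolding val_at_sum by (rule sum.neutral) (auto simp: val_at_psgn 2 False)
    moreover have "val_at x (\<Sum>(u, v)\<in>splits2 as. psgn (sdeg A L u) (IM Z [] L u (H (tgt L u) v y))) = 0"
      unfolding val_at_sum by (rule sum.neutral) (auto simp: val_at_psgn 3 False)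
    moreover have "val_at x (\<Sum>(u, v)\<in>splits2 as. CM Z' \<theta>' Z L u (CM Z \<theta> Z' (tgt L u) v y)) = 0"
      unfolding val_at_sum by (rule sum.neutral) (auto simp: 4 False)
    ultimately show ?thesis using val_at_off[OF y False] by (simp add: val_at_add val_at_zero)
  qed
qed

end

section \<open>Functor, transformation and homotopy equations in matrix factorizations\<close>

context mirror_family
begin

definition mf where
  "mf Z L = \<lparr>gens = gen L (fst Z), delta = (\<lambda>y. - IM Z [] L [] y)\<rparr>"

text \<open>Covers both a mirror functor on its full domain and its restriction to the overlap, so
  the equations are proved once. The value of \<open>fmor\<close> on the empty string is left free,
  as it is not part of the data of a functor.\<close>

definition represents where
  "represents F Z \<longleftrightarrow> Z \<in> \<G> \<and> (\<forall>L\<in>Ob (uncurved A). fob F L = mf Z L) \<and>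
     (\<forall>L as. hpath (uncurved A) L as \<and> as \<noteq> [] \<longrightarrow> fmor F L as = IM Z [] L as)"

lemma representsD:
  assumes "represents F Z"
  shows "Z \<in> \<G>" "L \<in> Ob (uncurved A) \<Longrightarrow> fob F L = mf Z L"
    "hpath (uncurved A) L as \<Longrightarrow> as \<noteq> [] \<Longrightarrow> fmor F L as = IM Z [] L as"
  using assms by (auto simp: represents_def)

lemma dhom_mf: "dhom (MF R W) (mf Z K) (mf Z' L) = module_maps R (gen K (fst Z)) (gen L (fst Z'))"
  by (simp add: MF_def mf_def)

lemma dcomp_MF: "dcomp (MF R W) E2 E1 E0 f g = (\<lambda>y. f (g y))"
  by (simp add: MF_def)

text \<open>The sign test may misread the degree of the zero map, but composing with that map on the
  left gives zero.\<close>

lemma psgn_dcomp_mf: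
  assumes "f \<in> module_maps R (gen K (fst Z)) (gen L (fst Z')) d" "L \<in> Ob A" "fst Z' \<in> Ob A"
  shows "psgn (dg_sign (MF R W) (mf Z' L) (mf Z K) f) (dcomp (MF R W) E (mf Z K) (mf Z' L) f g) y = psgn d (f (g y))"
proof -
  have "dg_sign (MF R W) (mf Z' L) (mf Z K) f = d \<or> f = 0"
    unfolding dg_sign_def dhom_mf using maps_sign[OF ring assms(1) gen_disjoint[OF assms(2,3)]] .
  then show ?thesis by (auto simp: dcomp_MF psgn_apply)
qed

lemma IM_Nil_maps:
  assumes "hpath A L as" "Z \<in> \<G>"
  shows "IM Z [] L as \<in> module_maps R (gen (tgt L as) (fst Z)) (gen L (fst Z)) (sdeg A L as + 1)"
  using IM_maps[OF assms(1) gstr_Nil[OF assms(2)]] by simp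

lemma IM_zero_arg: "hpath A L as \<Longrightarrow> Z \<in> \<G> \<Longrightarrow> IM Z [] L as 0 = 0"
  using maps_zero_arg[OF ring IM_Nil_maps] by blast

lemma ddiff_mf:
  assumes f: "f \<in> module_maps R (gen K (fst Z)) (gen L (fst Z')) d" and ob: "K \<in> Ob A" "L \<in> Ob A"
    and Z: "Z \<in> \<G>" "Z' \<in> \<G>"
  shows "ddiff (MF R W) (mf Z K) (mf Z' L) f y = - IM Z' [] L [] (f y) + psgn d (f (IM Z [] K [] y))"
proof -
  have K: "hpath A K []" using ob by simp
  have "f (- IM Z [] K [] y) = - f (IM Z [] K [] y)"
  proof (cases "y \<in> free_module R (both (gen K (fst Z)))")
    case True
    then have "IM Z [] K [] y \<in> free_module R (both (gen K (fst Z)))"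
      using IM_free[OF K gstr_Nil[OF Z(1)]] by simp
    then show ?thesis by (rule maps_uminus_arg[OF ring f])
  next
    case False
    then show ?thesis using IM_nonfree[of y K "[]" Z] maps_zero_arg[OF ring f] by simp
  qed
  moreover have "(if f \<in> module_maps R (gen K (fst Z)) (gen L (fst Z')) 0 then 0 else 1) = d \<or> f = 0"
    using maps_sign[OF ring f gen_disjoint[OF ob(2) obG[OF Z(2)]]] .
  ultimately show ?thesis
    by (auto simp: MF_def mf_def psgn_minus)
qed

lemma hpath_uncurved_tgt: "hpath (uncurved A) L as \<Longrightarrow> tgt L as \<in> Ob (uncurved A)"
  by (rule hpath_tgt)

lemma hpath_uncurved_start: "hpath (uncurved A) L as \<Longrightarrow> L \<in> Ob (uncurved A)"
  by (cases as) auto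

lemma hpath_uncurved_contract:
  assumes "hpath (uncurved A) L as" "(u, v, w) \<in> splits3 as"
  shows "hpath (uncurved A) L (contract A L u v w)"
  using assms hpath_mu_Hom[OF hpath_uncurved[OF assms(1)] assms(2)] unfolding contract_def
  by (auto simp: splits3_def hpath_append dest: hpath_uncurved_tgt)

lemma splits2_uncurved:
  assumes "hpath (uncurved A) L as" "(u, v) \<in> splits2 as"
  shows "hpath (uncurved A) L u" "hpath (uncurved A) (tgt L u) v" "tgt (tgt L u) v = tgt L as"
  using assms by (auto simp: splits2_def hpath_append)

lemma contract_nonempty: "contract A L u v w \<noteq> []"
  by (simp add: contract_def)

lemma IM_zero_string:
  assumes "hpath A L (u @ (0, K) # v)" "gstr Z \<tau> d"
  shows "IM Z \<tau> L (u @ (0, K) # v) = 0"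
  using IM_linear_string[OF assms(2,1,1), of 1] by (simp add: nscale_one)

text \<open>Contracting the empty string inserts the curvature of \<open>L\<close>, which is zero on
  \<open>uncurved A\<close>, and a zero letter makes the map vanish.\<close>

lemma IM_contract_Nil:
  assumes "L \<in> Ob (uncurved A)" "Z \<in> \<G>"
  shows "IM Z [] L (contract A L [] [] []) = 0"
proof -
  have ob: "L \<in> Ob A" "mu A L [] = 0" using assms by (auto simp: Ob_uncurved)
  have "hpath A L ([] @ (0, L) # [])" using ob Hom_zero by auto
  from IM_zero_string[OF this gstr_Nil[OF assms(2)]] show ?thesis by (simp add: contract_def ob)
qed

text \<open>The functor relation for the empty string says that the operation squares to
  \<open>W\<close>; the minus sign in \<open>delta\<close> occurs twice and drops out.\<close>

lemma mf_object:
  assumes "L \<in> Ob (uncurved A)" and W: "weak_family Z W"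
  shows "mf Z L \<in> dob (MF R W)"
proof -
  have Z: "Z \<in> \<G>" using W by (simp add: weak_family_def)
  have ob: "L \<in> Ob A" using assms(1) by (simp add: Ob_uncurved)
  have h: "hpath A L []" using ob by simp
  have maps: "IM Z [] L [] \<in> module_maps R (gen L (fst Z)) (gen L (fst Z)) 1"
    using IM_Nil_maps[OF h Z] by simp
  have "- IM Z [] L [] (- IM Z [] L [] y) = (\<lambda>p. W * y p)"
    if y: "y \<in> free_module R (both (gen L (fst Z)))" for y
  proof -
    have f: "IM Z [] L [] y \<in> free_module R (both (gen L (fst Z)))"
      using IM_free[OF h gstr_Nil[OF Z]] y by simp
    have "IM Z [] L [] (IM Z [] L [] y) = (\<lambda>p. W * y p)"
      using IM_functor_relation[OF h W, of y] y IM_contract_Nil[OF assms(1) Z]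
      by (simp add: splits3_Nil splits2_Nil)
    then show ?thesis using maps_uminus_arg[OF ring maps f] by simp
  qed
  then show ?thesis
    using gen_finite[OF ob obG[OF Z]] gen_disjoint[OF ob obG[OF Z]] maps_uminus[OF ring maps]
    by (simp add: MF_def mf_def)
qed

text \<open>Module maps are compared as functions on all arguments, so arguments outside the free
  module, where every term vanishes, have to be included.\<close>

lemma IM_functor_relation_all:
  assumes as: "hpath A L as" "as \<noteq> []" and W: "weak_family Z W"
  shows "(\<Sum>(u, v, w)\<in>splits3 as. psgn (sdeg A L u) (IM Z [] L (contract A L u v w) y)) +
    (\<Sum>(u, v)\<in>splits2 as. psgn (sdeg A L u) (IM Z [] L u (IM Z [] (tgt L u) v y))) = 0"
proof (cases "y \<in> free_module R (both (gen (tgt L as) (fst Z)))")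
  case True
  then show ?thesis using IM_functor_relation[OF as(1) W True] as(2) by simp
next
  case False
  have Z: "Z \<in> \<G>" using W by (simp add: weak_family_def)
  have "IM Z [] L (contract A L u v w) y = 0" if "(u, v, w) \<in> splits3 as" for u v w
    by (rule IM_nonfree) (use False tgt_contract'[OF that] in simp)
  moreover have "IM Z [] L u (IM Z [] (tgt L u) v y) = 0" if "(u, v) \<in> splits2 as" for u v
  proof -
    note uv = splits2_hpath[OF as(1) that]
    have "IM Z [] (tgt L u) v y = 0" by (rule IM_nonfree) (use False uv in simp)
    then show ?thesis using IM_zero_arg[OF uv(1) Z] by simp
  qed
  ultimately show ?thesis by (auto intro!: sum.neutral simp: case_prod_beta' sum.neutral)
qed

theorem mirror_functor_is_functor:
  assumes F: "represents F Z" and W: "weak_family Z W"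
  shows "is_ainf_functor (uncurved A) (ainf_of_dg (MF R W)) F"
  unfolding is_ainf_functor_def
proof (intro conjI ballI allI impI)
  have Z: "Z \<in> \<G>" using W by (simp add: weak_family_def)
  note F' = representsD[OF F]
  show "fob F L \<in> Ob (ainf_of_dg (MF R W))" if "L \<in> Ob (uncurved A)" for L
    using mf_object[OF that W] F'(2)[OF that] by (simp add: ainf_of_dg_def)
  show "fmor F L as \<in> Hom (ainf_of_dg (MF R W)) (fob F L) (fob F (tgt L as)) (sdeg (uncurved A) L as + 1)"
    if h: "hpath (uncurved A) L as \<and> as \<noteq> []" for L as
  proof -
    have h': "hpath (uncurved A) L as" "as \<noteq> []" using h by auto
    show ?thesis
      using IM_Nil_maps[OF hpath_uncurved[OF h'(1)] Z]
        F'(2)[OF hpath_uncurved_start[OF h'(1)]] F'(2)[OF hpath_uncurved_tgt[OF h'(1)]]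
      by (simp add: F'(3)[OF h'] ainf_of_dg_def dhom_mf del: add_bit_eq_xor)
  qed
  show "multilinear_on (hpath (uncurved A)) (fmor F)"
    using IM_multilinear[OF gstr_Nil[OF Z]] unfolding multilinear_on_def by (simp add: F'(3))
  fix L as assume h: "hpath (uncurved A) L as"
  note hA = hpath_uncurved[OF h]
  have c: "fmor F L (contract A L u v w) = IM Z [] L (contract A L u v w)" if "(u, v, w) \<in> splits3 as" for u v w
    using F'(3)[OF hpath_uncurved_contract[OF h that] contract_nonempty] .
  have c3: "(\<Sum>(u, v, w)\<in>splits3 as. psgn (sdeg (uncurved A) L u) (fmor F L (contract (uncurved A) L u v w))) =
     (\<Sum>(u, v, w)\<in>splits3 as. psgn (sdeg A L u) (IM Z [] L (contract A L u v w)))"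
    by (rule sum.cong[OF refl]) (auto simp: c)
  show "(\<Sum>us\<in>blocks as. mu (ainf_of_dg (MF R W)) (fob F L) (fpath F L us)) =
     (\<Sum>(u, v, w)\<in>splits3 as. psgn (sdeg (uncurved A) L u) (fmor F L (contract (uncurved A) L u v w)))"
  proof (cases "as = []")
    case True
    then show ?thesis
      unfolding c3 using h IM_contract_Nil[OF _ Z] by (simp add: sum_blocks_dg_Nil splits3_Nil)
  next
    case False
    let ?P = "{(u, v) \<in> splits2 as. u \<noteq> [] \<and> v \<noteq> []}"
    have "(\<Sum>us\<in>blocks as. mu (ainf_of_dg (MF R W)) (fob F L) (fpath F L us)) y =
        (\<Sum>(u, v, w)\<in>splits3 as. psgn (sdeg A L u) (IM Z [] L (contract A L u v w))) y" for y
    proof -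
      \<comment> \<open>The map \<open>IM\<close> on \<open>u\<close> has degree
        \<open>sdeg u + 1\<close>, which is the sign in \<open>m_2\<close>. The differential yields
        the two extreme splits with the same sign, so all splits merge into one sum.\<close>
      let ?g = "\<lambda>u v. psgn (sdeg A L u + 1) (IM Z [] L u (IM Z [] (tgt L u) v y))"
      have obs: "L \<in> Ob A" "tgt L as \<in> Ob A" using hpath_start[OF hA] hpath_tgt[OF hA] by auto
      have "ddiff (MF R W) (fob F (tgt L as)) (fob F L) (fmor F L as) y = ?g [] as + ?g as []"
        using ddiff_mf[OF IM_Nil_maps[OF hA Z] obs(2,1) Z Z, of W y] h False
          F'(2)[OF hpath_uncurved_start[OF h]] F'(2)[OF hpath_uncurved_tgt[OF h]]
        by (simp add: F'(3) del: add_bit_eq_xor)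
      moreover have "(\<Sum>(u, v)\<in>?P. psgn (dg_sign (MF R W) (fob F L) (fob F (tgt L u)) (fmor F L u))
         (dcomp (MF R W) (fob F (tgt L as)) (fob F (tgt L u)) (fob F L) (fmor F L u) (fmor F (tgt L u) v))) y =
         (\<Sum>(u, v)\<in>?P. ?g u v)"
        unfolding sum_fun_apply[of _ _ y]
      proof (rule sum.cong[OF refl])
        fix x assume x: "x \<in> ?P"
        obtain u v where uv: "x = (u, v)" by (cases x)
        have s: "(u, v) \<in> splits2 as" "u \<noteq> []" "v \<noteq> []" using x uv by auto
        note p = splits2_uncurved[OF h s(1)]
        note pA = hpath_uncurved[OF p(1)]
        have o: "fob F L = mf Z L" "fob F (tgt L u) = mf Z (tgt L u)"
          using F'(2) hpath_uncurved_start[OF h] hpath_uncurved_tgt[OF p(1)] by auto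
        show "(case x of (u, v) \<Rightarrow> psgn (dg_sign (MF R W) (fob F L) (fob F (tgt L u)) (fmor F L u))
         (dcomp (MF R W) (fob F (tgt L as)) (fob F (tgt L u)) (fob F L) (fmor F L u) (fmor F (tgt L u) v))) y =
         (case x of (u, v) \<Rightarrow> ?g u v)"
          unfolding uv prod.case o F'(3)[OF p(1) s(2)] F'(3)[OF p(2) s(3)]
          by (rule psgn_dcomp_mf[OF IM_Nil_maps[OF pA Z] hpath_start[OF pA] obG[OF Z]])
      qed
      ultimately have "(\<Sum>us\<in>blocks as. mu (ainf_of_dg (MF R W)) (fob F L) (fpath F L us)) y =
          (\<Sum>(u, v)\<in>splits2 as. ?g u v)"
        unfolding sum_blocks_dg[OF False] sum_splits2_ends[OF False] by simp
      also have "\<dots> = - (\<Sum>(u, v)\<in>splits2 as. psgn (sdeg A L u) (IM Z [] L u (IM Z [] (tgt L u) v y)))"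
        unfolding minus_psgn[symmetric] by (simp add: case_prod_beta' sum_negf)
      also have "\<dots> = (\<Sum>(u, v, w)\<in>splits3 as. psgn (sdeg A L u) (IM Z [] L (contract A L u v w) y))"
        using IM_functor_relation_all[OF hA False W, of y] by (simp only: eq_neg_iff_add_eq_0[symmetric])
      finally show ?thesis by (simp add: sum_fun_apply case_prod_beta' psgn_apply)
    qed
    then show ?thesis unfolding c3 by (rule ext)
  qed
qed

lemma CM_natural_relation_all:
  assumes as: "hpath A L as" and W: "weak_family Z W" "weak_family Z' W'"
    and \<theta>: "family V R (Hom A (fst Z) (fst Z') 0) \<theta>"
    and closed: "\<And>u. u \<in> V \<Longrightarrow> dmu A (ev Z u) [(\<theta> u, ev Z' u)] = 0"
  shows "(\<Sum>(u, v, w)\<in>splits3 as. psgn (sdeg A L u) (CM Z \<theta> Z' L (contract A L u v w) y)) +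
    (\<Sum>(u, v)\<in>splits2 as. psgn (sdeg A L u) (CM Z \<theta> Z' L u (IM Z [] (tgt L u) v y))) =
    (\<Sum>(u, v)\<in>splits2 as. IM Z' [] L u (CM Z \<theta> Z' (tgt L u) v y))"
proof (cases "y \<in> free_module R (both (gen (tgt L as) (fst Z)))")
  case True
  then show ?thesis using CM_natural_relation[OF as W \<theta> closed True] by simp
next
  case False
  have Z: "Z \<in> \<G>" "Z' \<in> \<G>" using W by (auto simp: weak_family_def)
  have "CM Z \<theta> Z' L (contract A L u v w) y = 0" if "(u, v, w) \<in> splits3 as" for u v w
    by (rule CM_nonfree) (use False tgt_contract'[OF that] in simp)
  moreover have "CM Z \<theta> Z' L u (IM Z [] (tgt L u) v y) = 0" "IM Z' [] L u (CM Z \<theta> Z' (tgt L u) v y) = 0"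
    if "(u, v) \<in> splits2 as" for u v
  proof -
    note uv = splits2_hpath[OF as that]
    have "IM Z [] (tgt L u) v y = 0" by (rule IM_nonfree) (use False uv in simp)
    then show "CM Z \<theta> Z' L u (IM Z [] (tgt L u) v y) = 0"
      using maps_zero_arg[OF ring CM_maps[OF uv(1) Z \<theta>]] by simp
    have "CM Z \<theta> Z' (tgt L u) v y = 0" by (rule CM_nonfree) (use False uv in simp)
    then show "IM Z' [] L u (CM Z \<theta> Z' (tgt L u) v y) = 0" using IM_zero_arg[OF uv(1) Z(2)] by simp
  qed
  ultimately show ?thesis by (auto intro!: sum.neutral simp: case_prod_beta' sum.neutral)
qed

text \<open>\<open>\<theta> : Z \<rightarrow> Z'\<close> induces a transformation out of the functor of \<open>Z'\<close>, because morphisms of the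
  dg-category are reversed.\<close>

theorem comparison_is_natural:
  assumes F: "represents F Z'" and G: "represents G Z"
    and W: "weak_family Z W" "weak_family Z' W"
    and \<theta>: "family V R (Hom A (fst Z) (fst Z') 0) \<theta>"
    and closed: "\<And>u. u \<in> V \<Longrightarrow> dmu A (ev Z u) [(\<theta> u, ev Z' u)] = 0"
  shows "nat_transformation (uncurved A) (ainf_of_dg (MF R W)) F G (CM Z \<theta> Z')"
  unfolding nat_transformation_def prenat_def
proof (intro conjI allI impI)
  have Z: "Z \<in> \<G>" "Z' \<in> \<G>" using W by (auto simp: weak_family_def)
  note F' = representsD[OF F] and G' = representsD[OF G]
  show "multilinear_on (hpath (uncurved A)) (CM Z \<theta> Z')" by (rule CM_multilinear[OF Z \<theta>])
  fix L as assume h: "hpath (uncurved A) L as"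
  note hA = hpath_uncurved[OF h]
  have fo: "fob F L = mf Z' L" "fob G (tgt L as) = mf Z (tgt L as)"
    using F'(2) G'(2) hpath_uncurved_start[OF h] hpath_uncurved_tgt[OF h] by auto
  show "CM Z \<theta> Z' L as \<in> Hom (ainf_of_dg (MF R W)) (fob F L) (fob G (tgt L as)) (0 + sdeg (uncurved A) L as)"
    using CM_maps[OF hA Z \<theta>] by (simp add: ainf_of_dg_def fo dhom_mf del: add_bit_eq_xor)
  let ?P = "{(u, v) \<in> splits2 as. u \<noteq> []}" and ?Q = "{(u, v) \<in> splits2 as. v \<noteq> []}"
  have "nat_M1 (uncurved A) (ainf_of_dg (MF R W)) F G 0 (CM Z \<theta> Z') L as y = 0" for y
  proof -
    let ?f = "\<lambda>u v. IM Z' [] L u (CM Z \<theta> Z' (tgt L u) v y)"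
    let ?g = "\<lambda>u v. psgn (sdeg A L u) (CM Z \<theta> Z' L u (IM Z [] (tgt L u) v y))"
    have obs: "L \<in> Ob A" "tgt L as \<in> Ob A" using hpath_start[OF hA] hpath_tgt[OF hA] by auto
    have 1: "ddiff (MF R W) (fob G (tgt L as)) (fob F L) (CM Z \<theta> Z' L as) y = - ?f [] as + ?g as []"
      unfolding fo ddiff_mf[OF CM_maps[OF hA Z \<theta>] obs(2,1) Z] by simp
    \<comment> \<open>Moving the transformation past \<open>u\<close> costs \<open>sdeg u\<close>,
      and the functor term has degree \<open>sdeg u + 1\<close>; together they leave a constant
      minus sign.\<close>
    have 2: "(\<Sum>(u, v)\<in>?P. psgn ((0 - 1) * sdeg (uncurved A) L u)
          (psgn (dg_sign (MF R W) (fob F L) (fob F (tgt L u)) (fmor F L u))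
            (dcomp (MF R W) (fob G (tgt L as)) (fob F (tgt L u)) (fob F L) (fmor F L u) (CM Z \<theta> Z' (tgt L u) v)))) y
        = - (\<Sum>(u, v)\<in>?P. ?f u v)"
      unfolding sum_fun_apply[of _ _ y] sum_negf[symmetric]
    proof (rule sum.cong[OF refl])
      fix x assume x: "x \<in> ?P"
      obtain u v where uv: "x = (u, v)" by (cases x)
      have s: "(u, v) \<in> splits2 as" "u \<noteq> []" using x uv by auto
      note p = splits2_uncurved[OF h s(1)]
      note pA = hpath_uncurved[OF p(1)]
      have o: "fob F (tgt L u) = mf Z' (tgt L u)" using F'(2) hpath_uncurved_tgt[OF p(1)] by auto
      show "(case x of (u, v) \<Rightarrow> psgn ((0 - 1) * sdeg (uncurved A) L u)
          (psgn (dg_sign (MF R W) (fob F L) (fob F (tgt L u)) (fmor F L u))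
            (dcomp (MF R W) (fob G (tgt L as)) (fob F (tgt L u)) (fob F L) (fmor F L u) (CM Z \<theta> Z' (tgt L u) v)))) y
        = - (case x of (u, v) \<Rightarrow> ?f u v)"
        unfolding uv prod.case o fo F'(3)[OF p(1) s(2)] psgn_apply[of "(0 - 1) * sdeg (uncurved A) L u" _ y]
          psgn_dcomp_mf[OF IM_Nil_maps[OF pA Z(2)] hpath_start[OF pA] obG[OF Z(2)]]
        by (simp add: psgn_def)
    qed
    have 3: "(\<Sum>(u, v)\<in>?Q. psgn (dg_sign (MF R W) (fob F L) (fob G (tgt L u)) (CM Z \<theta> Z' L u))
            (dcomp (MF R W) (fob G (tgt L as)) (fob G (tgt L u)) (fob F L) (CM Z \<theta> Z' L u) (fmor G (tgt L u) v))) y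
        = (\<Sum>(u, v)\<in>?Q. ?g u v)"
      unfolding sum_fun_apply[of _ _ y]
    proof (rule sum.cong[OF refl])
      fix x assume x: "x \<in> ?Q"
      obtain u v where uv: "x = (u, v)" by (cases x)
      have s: "(u, v) \<in> splits2 as" "v \<noteq> []" using x uv by auto
      note p = splits2_uncurved[OF h s(1)]
      note pA = hpath_uncurved[OF p(1)]
      have o: "fob G (tgt L u) = mf Z (tgt L u)" using G'(2) hpath_uncurved_tgt[OF p(1)] by auto
      show "(case x of (u, v) \<Rightarrow> psgn (dg_sign (MF R W) (fob F L) (fob G (tgt L u)) (CM Z \<theta> Z' L u))
            (dcomp (MF R W) (fob G (tgt L as)) (fob G (tgt L u)) (fob F L) (CM Z \<theta> Z' L u) (fmor G (tgt L u) v))) y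
        = (case x of (u, v) \<Rightarrow> ?g u v)"
        unfolding uv prod.case o fo G'(3)[OF p(2) s(2)]
        by (rule psgn_dcomp_mf[OF CM_maps[OF pA Z \<theta>] hpath_start[OF pA] obG[OF Z(2)]])
    qed
    have 4: "(\<Sum>(u, v, w)\<in>splits3 as. psgn (sdeg (uncurved A) L u) (CM Z \<theta> Z' L (contract (uncurved A) L u v w))) y =
        (\<Sum>(u, v, w)\<in>splits3 as. psgn (sdeg A L u) (CM Z \<theta> Z' L (contract A L u v w) y))"
      by (simp add: sum_fun_apply case_prod_beta' psgn_apply)
    have "nat_M1 (uncurved A) (ainf_of_dg (MF R W)) F G 0 (CM Z \<theta> Z') L as y =
        - (?f [] as + (\<Sum>(u, v)\<in>?P. ?f u v)) + (?g as [] + (\<Sum>(u, v)\<in>?Q. ?g u v)) +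
        (\<Sum>(u, v, w)\<in>splits3 as. psgn (sdeg A L u) (CM Z \<theta> Z' L (contract A L u v w) y))"
      unfolding nat_M1_dg plus_fun_apply[of _ _ y] minus_apply[of _ _ y] 1 2 3 psgn_apply[of _ _ y] 4 by (simp add: algebra_simps)
    also have "\<dots> = 0"
      unfolding sum_splits2_left[where f = ?f and as = as, symmetric]
        sum_splits2_right[where f = ?g and as = as, symmetric]
      using CM_natural_relation_all[OF hA W \<theta> closed, of y] by (simp add: algebra_simps)
    finally show ?thesis .
  qed
  then show "nat_M1 (uncurved A) (ainf_of_dg (MF R W)) F G 0 (CM Z \<theta> Z') L as = 0"
    by (intro ext) simp
qed

lemma HM_homotopy_relation_all:
  assumes as: "hpath A L as" and W: "weak_family Z W" "weak_family Z' W'"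
    and \<theta>: "family V R (Hom A (fst Z) (fst Z') 0) \<theta>" "family V R (Hom A (fst Z') (fst Z) 0) \<theta>'"
      "family V R (Hom A (fst Z) (fst Z) 1) \<gamma>"
    and closed: "\<And>u. u \<in> V \<Longrightarrow> dmu A (ev Z u) [(\<theta> u, ev Z' u)] = 0"
      "\<And>u. u \<in> V \<Longrightarrow> dmu A (ev Z' u) [(\<theta>' u, ev Z u)] = 0"
    and inv: "\<And>u. u \<in> V \<Longrightarrow> dmu A (ev Z u) [(\<theta> u, ev Z' u), (\<theta>' u, ev Z u)] =
      unit_of A (fst Z) + dmu A (ev Z u) [(\<gamma> u, ev Z u)]"
  defines "H \<equiv> HM Z \<theta> Z' \<theta>' \<gamma>"
  shows "(\<Sum>(u, v, w)\<in>splits3 as. psgn (sdeg A L u) (H L (contract A L u v w) y)) +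
    (\<Sum>(u, v)\<in>splits2 as. psgn (sdeg A L u) (H L u (IM Z [] (tgt L u) v y))) +
    (\<Sum>(u, v)\<in>splits2 as. psgn (sdeg A L u) (IM Z [] L u (H (tgt L u) v y))) +
    (\<Sum>(u, v)\<in>splits2 as. CM Z' \<theta>' Z L u (CM Z \<theta> Z' (tgt L u) v y)) =
    (if as = [] then did (MF R W) (mf Z L) y else 0)"
proof (cases "y \<in> free_module R (both (gen (tgt L as) (fst Z)))")
  case True
  then show ?thesis
    using HM_homotopy_relation[OF as W \<theta> closed inv True] by (auto simp: H_def MF_def mf_def)
next
  case False
  have Z: "Z \<in> \<G>" "Z' \<in> \<G>" using W by (auto simp: weak_family_def)
  have "H L (contract A L u v w) y = 0" if "(u, v, w) \<in> splits3 as" for u v w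
    unfolding H_def by (rule HM_nonfree) (use False tgt_contract'[OF that] in simp)
  then have 1: "(\<Sum>(u, v, w)\<in>splits3 as. psgn (sdeg A L u) (H L (contract A L u v w) y)) = 0"
    by (intro sum.neutral) auto
  have z: "H L u (IM Z [] (tgt L u) v y) = 0" "IM Z [] L u (H (tgt L u) v y) = 0"
    "CM Z' \<theta>' Z L u (CM Z \<theta> Z' (tgt L u) v y) = 0"
    if "(u, v) \<in> splits2 as" for u v
  proof -
    note uv = splits2_hpath[OF as that]
    have "IM Z [] (tgt L u) v y = 0" by (rule IM_nonfree) (use False uv in simp)
    then show "H L u (IM Z [] (tgt L u) v y) = 0"
      using maps_zero_arg[OF ring HM_maps[OF uv(1) Z \<theta>]] by (simp add: H_def)
    have "H (tgt L u) v y = 0" unfolding H_def by (rule HM_nonfree) (use False uv in simp)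
    then show "IM Z [] L u (H (tgt L u) v y) = 0" using IM_zero_arg[OF uv(1) Z(1)] by simp
    have "CM Z \<theta> Z' (tgt L u) v y = 0" by (rule CM_nonfree) (use False uv in simp)
    then show "CM Z' \<theta>' Z L u (CM Z \<theta> Z' (tgt L u) v y) = 0"
      using maps_zero_arg[OF ring CM_maps[OF uv(1) Z(2,1) \<theta>(2)]] by simp
  qed
  have 2: "(\<Sum>(u, v)\<in>splits2 as. psgn (sdeg A L u) (H L u (IM Z [] (tgt L u) v y))) = 0"
    by (intro sum.neutral) (auto simp: z)
  have 3: "(\<Sum>(u, v)\<in>splits2 as. psgn (sdeg A L u) (IM Z [] L u (H (tgt L u) v y))) = 0"
    by (intro sum.neutral) (auto simp: z)
  have 4: "(\<Sum>(u, v)\<in>splits2 as. CM Z' \<theta>' Z L u (CM Z \<theta> Z' (tgt L u) v y)) = 0"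
    by (intro sum.neutral) (auto simp: z)
  show ?thesis unfolding 1 2 3 4 using False by (auto simp: MF_def mf_def)
qed

text \<open>Reversal of morphisms: the composite applies \<open>CM Z \<theta> Z'\<close> first and
  \<open>CM Z' \<theta>' Z\<close> second, so it is an endomorphism of the functor of
  \<open>Z\<close>, and the relevant product is \<open>m_2(\<theta>, \<theta>')\<close> on
  \<open>Z\<close>.\<close>

theorem homotopy_of_composition:
  assumes F: "represents F Z" and G: "represents G Z'"
    and W: "weak_family Z W" "weak_family Z' W"
    and \<theta>: "family V R (Hom A (fst Z) (fst Z') 0) \<theta>" "family V R (Hom A (fst Z') (fst Z) 0) \<theta>'"
      "family V R (Hom A (fst Z) (fst Z) 1) \<gamma>"
    and closed: "\<And>u. u \<in> V \<Longrightarrow> dmu A (ev Z u) [(\<theta> u, ev Z' u)] = 0"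
      "\<And>u. u \<in> V \<Longrightarrow> dmu A (ev Z' u) [(\<theta>' u, ev Z u)] = 0"
    and inv: "\<And>u. u \<in> V \<Longrightarrow> dmu A (ev Z u) [(\<theta> u, ev Z' u), (\<theta>' u, ev Z u)] =
      unit_of A (fst Z) + dmu A (ev Z u) [(\<gamma> u, ev Z u)]"
  defines "H \<equiv> HM Z \<theta> Z' \<theta>' \<gamma>" and "B \<equiv> ainf_of_dg (MF R W)"
  shows "prenat (uncurved A) B F F 1 H"
    and "hpath (uncurved A) L as \<Longrightarrow>
      nat_M2 (uncurved A) B F G F 0 0 (CM Z' \<theta>' Z) (CM Z \<theta> Z') L as - nat_id B F L as =
      nat_M1 (uncurved A) B F F 1 H L as"
proof -
  have Z: "Z \<in> \<G>" "Z' \<in> \<G>" using W by (auto simp: weak_family_def)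
  note F' = representsD[OF F] and G' = representsD[OF G]
  have fo: "fob F L = mf Z L" "fob F (tgt L as) = mf Z (tgt L as)" if "hpath (uncurved A) L as" for L as
    using F'(2) hpath_uncurved_start[OF that] hpath_uncurved_tgt[OF that] by auto
  show "prenat (uncurved A) B F F 1 H"
    unfolding prenat_def
  proof (intro conjI allI impI)
    show "multilinear_on (hpath (uncurved A)) H" unfolding H_def by (rule HM_multilinear[OF Z \<theta>])
    show "H L as \<in> Hom B (fob F L) (fob F (tgt L as)) (1 + sdeg (uncurved A) L as)"
      if h: "hpath (uncurved A) L as" for L as
      using HM_maps[OF hpath_uncurved[OF h] Z \<theta>]
      by (simp add: H_def B_def ainf_of_dg_def fo[OF h] dhom_mf add.commute del: add_bit_eq_xor)
  qed
  assume h: "hpath (uncurved A) L as"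
  note hA = hpath_uncurved[OF h]
  note fo = fo[OF h]
  let ?P = "{(u, v) \<in> splits2 as. u \<noteq> []}" and ?Q = "{(u, v) \<in> splits2 as. v \<noteq> []}"
  show "nat_M2 (uncurved A) B F G F 0 0 (CM Z' \<theta>' Z) (CM Z \<theta> Z') L as - nat_id B F L as =
      nat_M1 (uncurved A) B F F 1 H L as"
  proof
    fix y
    let ?f = "\<lambda>u v. psgn (sdeg A L u + 1) (IM Z [] L u (H (tgt L u) v y))"
    let ?g = "\<lambda>u v. psgn (sdeg A L u + 1) (H L u (IM Z [] (tgt L u) v y))"
    have obs: "L \<in> Ob A" "tgt L as \<in> Ob A" using hpath_start[OF hA] hpath_tgt[OF hA] by auto
    have Hm: "H L u \<in> module_maps R (gen (tgt L u) (fst Z)) (gen L (fst Z)) (sdeg A L u + 1)"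
      if "hpath A L u" for u
      unfolding H_def by (rule HM_maps[OF that Z \<theta>])
    have 1: "ddiff (MF R W) (fob F (tgt L as)) (fob F L) (H L as) y = ?f [] as + ?g as []"
      unfolding fo ddiff_mf[OF Hm[OF hA] obs(2,1) Z(1,1)] by (simp del: add_bit_eq_xor)
    have 2: "(\<Sum>(u, v)\<in>?P. psgn ((1 - 1) * sdeg (uncurved A) L u)
          (psgn (dg_sign (MF R W) (fob F L) (fob F (tgt L u)) (fmor F L u))
            (dcomp (MF R W) (fob F (tgt L as)) (fob F (tgt L u)) (fob F L) (fmor F L u) (H (tgt L u) v)))) y
        = (\<Sum>(u, v)\<in>?P. ?f u v)"
      unfolding sum_fun_apply[of _ _ y]
    proof (rule sum.cong[OF refl])
      fix x assume x: "x \<in> ?P"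
      obtain u v where uv: "x = (u, v)" by (cases x)
      have s: "(u, v) \<in> splits2 as" "u \<noteq> []" using x uv by auto
      note p = splits2_uncurved[OF h s(1)]
      note pA = hpath_uncurved[OF p(1)]
      have o: "fob F (tgt L u) = mf Z (tgt L u)" using F'(2) hpath_uncurved_tgt[OF p(1)] by auto
      show "(case x of (u, v) \<Rightarrow> psgn ((1 - 1) * sdeg (uncurved A) L u)
          (psgn (dg_sign (MF R W) (fob F L) (fob F (tgt L u)) (fmor F L u))
            (dcomp (MF R W) (fob F (tgt L as)) (fob F (tgt L u)) (fob F L) (fmor F L u) (H (tgt L u) v)))) y
        = (case x of (u, v) \<Rightarrow> ?f u v)"
        unfolding uv prod.case o fo F'(3)[OF p(1) s(2)] psgn_apply[of "(1 - 1) * sdeg (uncurved A) L u" _ y]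
          psgn_dcomp_mf[OF IM_Nil_maps[OF pA Z(1)] hpath_start[OF pA] obG[OF Z(1)]]
        by (simp del: add_bit_eq_xor)
    qed
    have 3: "(\<Sum>(u, v)\<in>?Q. psgn (dg_sign (MF R W) (fob F L) (fob F (tgt L u)) (H L u))
            (dcomp (MF R W) (fob F (tgt L as)) (fob F (tgt L u)) (fob F L) (H L u) (fmor F (tgt L u) v))) y
        = (\<Sum>(u, v)\<in>?Q. ?g u v)"
      unfolding sum_fun_apply[of _ _ y]
    proof (rule sum.cong[OF refl])
      fix x assume x: "x \<in> ?Q"
      obtain u v where uv: "x = (u, v)" by (cases x)
      have s: "(u, v) \<in> splits2 as" "v \<noteq> []" using x uv by auto
      note p = splits2_uncurved[OF h s(1)]
      note pA = hpath_uncurved[OF p(1)]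
      have o: "fob F (tgt L u) = mf Z (tgt L u)" using F'(2) hpath_uncurved_tgt[OF p(1)] by auto
      show "(case x of (u, v) \<Rightarrow> psgn (dg_sign (MF R W) (fob F L) (fob F (tgt L u)) (H L u))
            (dcomp (MF R W) (fob F (tgt L as)) (fob F (tgt L u)) (fob F L) (H L u) (fmor F (tgt L u) v))) y
        = (case x of (u, v) \<Rightarrow> ?g u v)"
        unfolding uv prod.case o fo F'(3)[OF p(2) s(2)]
        by (rule psgn_dcomp_mf[OF Hm[OF pA] hpath_start[OF pA] obG[OF Z(1)]])
    qed
    have 4: "(\<Sum>(u, v, w)\<in>splits3 as. psgn (sdeg (uncurved A) L u) (H L (contract (uncurved A) L u v w))) y =
        (\<Sum>(u, v, w)\<in>splits3 as. psgn (sdeg A L u) (H L (contract A L u v w) y))"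
      by (simp add: sum_fun_apply case_prod_beta' psgn_apply)
    have M1: "nat_M1 (uncurved A) B F F 1 H L as y =
        (?f [] as + (\<Sum>(u, v)\<in>?P. ?f u v)) + (?g as [] + (\<Sum>(u, v)\<in>?Q. ?g u v)) -
        (\<Sum>(u, v, w)\<in>splits3 as. psgn (sdeg A L u) (H L (contract A L u v w) y))"
      unfolding B_def nat_M1_dg plus_fun_apply[of _ _ y] minus_apply[of _ _ y] 1 2 3 psgn_apply[of _ _ y] 4 by (simp add: add_ac del: add_bit_eq_xor)
    \<comment> \<open>The sign of moving the second transformation past \<open>u\<close> and the
      sign of composing with a map of degree \<open>sdeg u\<close> cancel.\<close>
    have M2: "nat_M2 (uncurved A) B F G F 0 0 (CM Z' \<theta>' Z) (CM Z \<theta> Z') L as y =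
        (\<Sum>(u, v)\<in>splits2 as. CM Z' \<theta>' Z L u (CM Z \<theta> Z' (tgt L u) v y))"
      unfolding B_def nat_M2_dg sum_fun_apply[of _ _ y]
    proof (rule sum.cong[OF refl])
      fix x assume x: "x \<in> splits2 as"
      obtain u v where uv: "x = (u, v)" by (cases x)
      have s: "(u, v) \<in> splits2 as" using x uv by auto
      note p = splits2_uncurved[OF h s]
      note pA = hpath_uncurved[OF p(1)]
      have o: "fob G (tgt L u) = mf Z' (tgt L u)" using G'(2) hpath_uncurved_tgt[OF p(1)] by auto
      show "(case x of (u, v) \<Rightarrow> psgn ((0 - 1) * sdeg (uncurved A) L u)
          (psgn (dg_sign (MF R W) (fob F L) (fob G (tgt L u)) (CM Z' \<theta>' Z L u))
            (dcomp (MF R W) (fob F (tgt L as)) (fob G (tgt L u)) (fob F L) (CM Z' \<theta>' Z L u) (CM Z \<theta> Z' (tgt L u) v)))) y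
        = (case x of (u, v) \<Rightarrow> CM Z' \<theta>' Z L u (CM Z \<theta> Z' (tgt L u) v y))"
        unfolding uv prod.case o fo psgn_apply[of "(0 - 1) * sdeg (uncurved A) L u" _ y]
          psgn_dcomp_mf[OF CM_maps[OF pA Z(2,1) \<theta>(2)] hpath_start[OF pA] obG[OF Z(1)]]
        by (simp add: psgn_def)
    qed
    have id: "nat_id B F L as y = (if as = [] then did (MF R W) (mf Z L) y else 0)"
      by (simp add: nat_id_def B_def ainf_of_dg_def fo)
    have rel: "(\<Sum>(u, v, w)\<in>splits3 as. psgn (sdeg A L u) (H L (contract A L u v w) y)) +
      (\<Sum>(u, v)\<in>splits2 as. psgn (sdeg A L u) (H L u (IM Z [] (tgt L u) v y))) +
      (\<Sum>(u, v)\<in>splits2 as. psgn (sdeg A L u) (IM Z [] L u (H (tgt L u) v y))) +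
      (\<Sum>(u, v)\<in>splits2 as. CM Z' \<theta>' Z L u (CM Z \<theta> Z' (tgt L u) v y)) = nat_id B F L as y"
      unfolding id H_def by (rule HM_homotopy_relation_all[OF hA W \<theta> closed inv])
    have "(\<Sum>(u, v)\<in>splits2 as. ?f u v) = - (\<Sum>(u, v)\<in>splits2 as. psgn (sdeg A L u) (IM Z [] L u (H (tgt L u) v y)))"
      "(\<Sum>(u, v)\<in>splits2 as. ?g u v) = - (\<Sum>(u, v)\<in>splits2 as. psgn (sdeg A L u) (H L u (IM Z [] (tgt L u) v y)))"
      unfolding minus_psgn[symmetric] by (simp_all add: case_prod_beta' sum_negf)
    then show "(nat_M2 (uncurved A) B F G F 0 0 (CM Z' \<theta>' Z) (CM Z \<theta> Z') L as - nat_id B F L as) y =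
      nat_M1 (uncurved A) B F F 1 H L as y"
      unfolding minus_apply[of _ _ y] M1 M2 sum_splits2_left[where f = ?f and as = as, symmetric]
        sum_splits2_right[where f = ?g and as = as, symmetric] rel[symmetric]
      by (simp add: algebra_simps del: add_bit_eq_xor)
  qed
qed

end

section \<open>Functors into the homotopy fiber product\<close>

text \<open>The sign in \<open>ainf_of_dg\<close> comes from a membership test. The first clause
  makes the test reliable for nonzero morphisms, the second makes the sign of a zero left factor
  harmless.\<close>

definition determined_degrees :: "('q, 'n::zero) dg_category \<Rightarrow> bool" where
  "determined_degrees D \<longleftrightarrow>
     (\<forall>X\<in>dob D. \<forall>Y\<in>dob D. dhom D X Y 0 \<inter> dhom D X Y 1 \<subseteq> {0}) \<and>
     (\<forall>X Y Z g. dcomp D X Y Z 0 g = 0)"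

lemma psgn_dcomp:
  fixes D :: "('q, 'n::ab_group_add) dg_category"
  assumes "determined_degrees D" "X \<in> dob D" "Y \<in> dob D" "f \<in> dhom D X Y d" "s = d \<or> f = 0"
  shows "psgn s (dcomp D Z X Y f g) = psgn d (dcomp D Z X Y f g)"
  using assms by (auto simp: determined_degrees_def)

lemma both_degrees_zero:
  "determined_degrees D \<Longrightarrow> X \<in> dob D \<Longrightarrow> Y \<in> dob D \<Longrightarrow> f \<in> dhom D X Y 0 \<Longrightarrow> f \<in> dhom D X Y 1 \<Longrightarrow> f = 0"
  unfolding determined_degrees_def by blast

lemma dg_sign_degree:
  assumes "determined_degrees D" "X \<in> dob D" "Y \<in> dob D" "f \<in> dhom D X Y d"
  shows "dg_sign D Y X f = d \<or> f = 0"
proof (cases "d = 0")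
  case False
  then have "d = 1" by simp
  then show ?thesis using assms unfolding dg_sign_def determined_degrees_def by auto
qed (use assms in \<open>simp add: dg_sign_def\<close>)

lemma sum_splits2_left_ends:
  fixes f :: "'a list \<Rightarrow> 'a list \<Rightarrow> 'b :: ab_group_add"
  assumes "as \<noteq> []"
  shows "(\<Sum>(u, v)\<in>{(u, v) \<in> splits2 as. u \<noteq> []}. f u v) =
      f as [] + (\<Sum>(u, v)\<in>{(u, v) \<in> splits2 as. u \<noteq> [] \<and> v \<noteq> []}. f u v)"
  using sum_splits2_left[of f as] sum_splits2_ends[OF assms, of f] by (simp add: add.assoc)

lemma sum_splits2_right_ends:
  fixes f :: "'a list \<Rightarrow> 'a list \<Rightarrow> 'b :: ab_group_add"
  assumes "as \<noteq> []"
  shows "(\<Sum>(u, v)\<in>{(u, v) \<in> splits2 as. v \<noteq> []}. f u v) =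
      f [] as + (\<Sum>(u, v)\<in>{(u, v) \<in> splits2 as. u \<noteq> [] \<and> v \<noteq> []}. f u v)"
  using sum_splits2_right[of f as] sum_splits2_ends[OF assms, of f] by (simp add: algebra_simps)

lemma fst_psgn: "fst (psgn d x) = psgn d (fst x)" by (simp add: psgn_def)
lemma snd_psgn: "snd (psgn d x) = psgn d (snd x)" by (simp add: psgn_def)

lemma hpath_splits2:
  assumes "hpath A L as" "(u, v) \<in> splits2 as"
  shows "hpath A L u" "hpath A (tgt L u) v" "tgt (tgt L u) v = tgt L as"
  using assms by (auto simp: splits2_def hpath_append)

lemma hpath_start_Ob: "hpath A L as \<Longrightarrow> L \<in> Ob A"
  by (cases as) auto

text \<open>The component in \<open>D\<close> has one degree less than the functor components, as
  the fiber product requires. Its part of the functor equation is \<open>M_1(N) = 0\<close> solved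
  for the contraction terms: the extreme splits, which contain \<open>N\<close> on an empty string,
  are the comparison terms in the differential of the fiber product, and the inner splits come from
  its composition.\<close>

theorem hfp_functor:
  fixes A :: "('o, 'm :: novikov_module) ainf_category"
    and B :: "('b, 'mb :: novikov_module) dg_category" and C :: "('c, 'mc :: novikov_module) dg_category"
    and D :: "('d, 'md :: novikov_module) dg_category"
  assumes det: "determined_degrees B" "determined_degrees C" "determined_degrees D"
    and FB: "is_ainf_functor A (ainf_of_dg B) FB" and FC: "is_ainf_functor A (ainf_of_dg C) FC"
    and FG: "is_ainf_functor A (ainf_of_dg D) (comp_dg G FB)"
    and FS: "is_ainf_functor A (ainf_of_dg D) (comp_dg S FC)"
    and N: "nat_transformation A (ainf_of_dg D) (comp_dg S FC) (comp_dg G FB) N"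
    and inv: "\<And>K. K \<in> Ob A \<Longrightarrow> invertible_H0 D (gob G (fob FB K)) (gob S (fob FC K)) (N K [])"
  defines "FF \<equiv> \<lparr>fob = \<lambda>K. (fob FB K, fob FC K, N K []), fmor = \<lambda>K as. (fmor FB K as, fmor FC K as, N K as)\<rparr>"
  shows "is_ainf_functor A (ainf_of_dg (hfp B C D G S)) FF"
  unfolding is_ainf_functor_def
proof (intro conjI ballI allI impI)
  let ?H = "hfp B C D G S"
  have dob: "fob FB K \<in> dob B" "fob FC K \<in> dob C" "gob G (fob FB K) \<in> dob D" "gob S (fob FC K) \<in> dob D"
    if "K \<in> Ob A" for K
    using that FB FC FG FS unfolding is_ainf_functor_def by (auto simp: ainf_of_dg_def comp_dg_def)
  have hB: "fmor FB K as \<in> dhom B (fob FB (tgt K as)) (fob FB K) (sdeg A K as + 1)"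
    and hC: "fmor FC K as \<in> dhom C (fob FC (tgt K as)) (fob FC K) (sdeg A K as + 1)"
    and hS: "fmor (comp_dg S FC) K as \<in> dhom D (gob S (fob FC (tgt K as))) (gob S (fob FC K)) (sdeg A K as + 1)"
    if "hpath A K as" "as \<noteq> []" for K as
    using that FB FC FS unfolding is_ainf_functor_def by (auto simp: ainf_of_dg_def comp_dg_def simp del: add_bit_eq_xor)
  have hN: "N K as \<in> dhom D (gob G (fob FB (tgt K as))) (gob S (fob FC K)) (sdeg A K as)"
    if "hpath A K as" for K as
    using that N unfolding nat_transformation_def prenat_def
    by (auto simp: ainf_of_dg_def comp_dg_def simp del: add_bit_eq_xor)
  have FFo: "fob FF K = (fob FB K, fob FC K, N K [])" and FFm: "fmor FF K as = (fmor FB K as, fmor FC K as, N K as)" for K as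
    by (simp_all add: FF_def)
  show "fob FF K \<in> Ob (ainf_of_dg ?H)" if "K \<in> Ob A" for K
    using dob[OF that] inv[OF that] by (simp add: ainf_of_dg_def hfp_def FFo)
  have hH: "fmor FF K as \<in> dhom ?H (fob FF (tgt K as)) (fob FF K) (sdeg A K as + 1)"
    if "hpath A K as" "as \<noteq> []" for K as
    using hB[OF that] hC[OF that] hN[OF that(1)]
    by (simp add: hfp_def hfp_hom_def FFo FFm add.assoc bit_cancel del: add_bit_eq_xor)
  then show "fmor FF K as \<in> Hom (ainf_of_dg ?H) (fob FF K) (fob FF (tgt K as)) (sdeg A K as + 1)"
    if "hpath A K as \<and> as \<noteq> []" for K as
    using that by (simp add: ainf_of_dg_def del: add_bit_eq_xor)
  show "multilinear_on (hpath A) (fmor FF)"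
    using FB FC N unfolding is_ainf_functor_def nat_transformation_def prenat_def multilinear_on_def
    by (simp add: FFm nscale_prod_def)
  fix K as assume h: "hpath A K as"
  have rB: "(\<Sum>us\<in>blocks as. mu (ainf_of_dg B) (fob FB K) (fpath FB K us)) =
      (\<Sum>(u, v, w)\<in>splits3 as. psgn (sdeg A K u) (fmor FB K (contract A K u v w)))"
    and rC: "(\<Sum>us\<in>blocks as. mu (ainf_of_dg C) (fob FC K) (fpath FC K us)) =
      (\<Sum>(u, v, w)\<in>splits3 as. psgn (sdeg A K u) (fmor FC K (contract A K u v w)))"
    using FB FC h unfolding is_ainf_functor_def by blast+
  have rN: "nat_M1 A (ainf_of_dg D) (comp_dg S FC) (comp_dg G FB) 0 N K as = 0"
    using N h unfolding nat_transformation_def by blast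
  let ?E = "\<lambda>T. (\<Sum>(u, v, w)\<in>splits3 as. psgn (sdeg A K u) (T K (contract A K u v w)))"
  have E: "(\<Sum>(u, v, w)\<in>splits3 as. psgn (sdeg A K u) (fmor FF K (contract A K u v w))) =
      (?E (fmor FB), ?E (fmor FC), ?E N)"
    by (simp add: prod_eq_iff fst_sum snd_sum case_prod_beta' fst_psgn snd_psgn FFm)
  show "(\<Sum>us\<in>blocks as. mu (ainf_of_dg ?H) (fob FF K) (fpath FF K us)) =
      (\<Sum>(u, v, w)\<in>splits3 as. psgn (sdeg A K u) (fmor FF K (contract A K u v w)))"
  proof (cases "as = []")
    case True
    have "K \<in> Ob A" using h by (rule hpath_start_Ob)
    then have "ddiff D (gob G (fob FB K)) (gob S (fob FC K)) (N K []) = 0"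
      using inv by (simp add: invertible_H0_def)
    moreover have e: "{(u, v) \<in> splits2 as. u \<noteq> []} = {}" "{(u, v) \<in> splits2 as. v \<noteq> []} = {}"
      using True by (auto simp: splits2_def)
    ultimately have "?E N = 0"
      using rN unfolding nat_M1_dg e by (simp add: comp_dg_def True)
    moreover have "?E (fmor FB) = 0" "?E (fmor FC) = 0"
      using rB rC True sum_blocks_dg_Nil[of B _ FB] sum_blocks_dg_Nil[of C _ FC] by simp_all
    ultimately show ?thesis
      unfolding E using True sum_blocks_dg_Nil[of ?H _ FF] by (simp add: zero_prod_def)
  next
    case False
    let ?P = "{(u, v) \<in> splits2 as. u \<noteq> [] \<and> v \<noteq> []}"
    let ?K = "tgt K as"
    let ?c = "\<lambda>u v. dcomp D (gob G (fob FB ?K)) (gob S (fob FC (tgt K u))) (gob S (fob FC K))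
      (fmor (comp_dg S FC) K u) (N (tgt K u) v)"
    let ?n = "\<lambda>u v. psgn (sdeg A K u) (dcomp D (gob G (fob FB ?K)) (gob G (fob FB (tgt K u))) (gob S (fob FC K))
      (N K u) (fmor (comp_dg G FB) (tgt K u) v))"
    have H: "(\<Sum>us\<in>blocks as. mu (ainf_of_dg ?H) (fob FF K) (fpath FF K us)) =
      ddiff ?H (fob FF ?K) (fob FF K) (fmor FF K as) +
      (\<Sum>(u, v)\<in>?P. psgn (dg_sign ?H (fob FF K) (fob FF (tgt K u)) (fmor FF K u))
         (dcomp ?H (fob FF ?K) (fob FF (tgt K u)) (fob FF K) (fmor FF K u) (fmor FF (tgt K u) v)))"
      by (rule sum_blocks_dg[OF False])
    let ?tb = "\<lambda>u v. psgn (dg_sign B (fob FB K) (fob FB (tgt K u)) (fmor FB K u))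
         (dcomp B (fob FB ?K) (fob FB (tgt K u)) (fob FB K) (fmor FB K u) (fmor FB (tgt K u) v))"
    let ?tc = "\<lambda>u v. psgn (dg_sign C (fob FC K) (fob FC (tgt K u)) (fmor FC K u))
         (dcomp C (fob FC ?K) (fob FC (tgt K u)) (fob FC K) (fmor FC K u) (fmor FC (tgt K u) v))"
    have tm: "psgn (dg_sign ?H (fob FF K) (fob FF (tgt K u)) (fmor FF K u))
         (dcomp ?H (fob FF ?K) (fob FF (tgt K u)) (fob FF K) (fmor FF K u) (fmor FF (tgt K u) v)) =
         (?tb u v, ?tc u v, - ?n u v + ?c u v)"
      if s: "(u, v) \<in> splits2 as" "u \<noteq> []" "v \<noteq> []" for u v
    proof -
      note uv = hpath_splits2[OF h s(1)]
      note o = dob[OF hpath_start_Ob[OF h]] and o' = dob[OF hpath_tgt[OF uv(1)]]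
      let ?s = "dg_sign ?H (fob FF K) (fob FF (tgt K u)) (fmor FF K u)"
      let ?d = "sdeg A K u + 1"
      \<comment> \<open>The degree test in the fiber product returns something other than
        \<open>?d\<close> only if all three components lie in both degrees, and then all of them are
        zero.\<close>
      have sg: "?s = ?d \<or> (fmor FB K u = 0 \<and> fmor FC K u = 0 \<and> N K u = 0)"
      proof (cases "?s = ?d")
        case False
        have d1: "?d = 1"
        proof (rule ccontr)
          assume "?d \<noteq> 1"
          then have d0: "?d = 0" by simp
          then have "?s = 0" using hH[OF uv(1) s(2)] by (simp add: dg_sign_def del: add_bit_eq_xor)
          then show False using False d0 by simp
        qed
        have "fmor FF K u \<in> dhom ?H (fob FF (tgt K u)) (fob FF K) 0"
          using False d1 by (auto simp: dg_sign_def split: if_splits)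
        then have m: "fmor FB K u \<in> dhom B (fob FB (tgt K u)) (fob FB K) 0"
          "fmor FC K u \<in> dhom C (fob FC (tgt K u)) (fob FC K) 0"
          "N K u \<in> dhom D (gob G (fob FB (tgt K u))) (gob S (fob FC K)) 1"
          by (simp_all add: hfp_def hfp_hom_def FFo FFm)
        have s0: "sdeg A K u = 0" using d1 by (cases "sdeg A K u = 0") auto
        have "fmor FB K u = 0"
          by (rule both_degrees_zero[OF det(1) o'(1) o(1) m(1) hB[OF uv(1) s(2), unfolded d1]])
        moreover have "fmor FC K u = 0"
          by (rule both_degrees_zero[OF det(2) o'(2) o(2) m(2) hC[OF uv(1) s(2), unfolded d1]])
        moreover have "N K u = 0"
          by (rule both_degrees_zero[OF det(3) o'(3) o(4) hN[OF uv(1), unfolded s0] m(3)])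
        ultimately show ?thesis by blast
      qed simp
      have b: "psgn ?s (dcomp B (fob FB ?K) (fob FB (tgt K u)) (fob FB K) (fmor FB K u) (fmor FB (tgt K u) v)) = ?tb u v"
        using psgn_dcomp[OF det(1) o'(1) o(1) hB[OF uv(1) s(2)]] sg dg_sign_degree[OF det(1) o'(1) o(1) hB[OF uv(1) s(2)]]
        by metis
      have c: "psgn ?s (dcomp C (fob FC ?K) (fob FC (tgt K u)) (fob FC K) (fmor FC K u) (fmor FC (tgt K u) v)) = ?tc u v"
        using psgn_dcomp[OF det(2) o'(2) o(2) hC[OF uv(1) s(2)]] sg dg_sign_degree[OF det(2) o'(2) o(2) hC[OF uv(1) s(2)]]
        by metis
      have n: "psgn ?s (dcomp D (gob G (fob FB ?K)) (gob G (fob FB (tgt K u))) (gob S (fob FC K))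
          (N K u) (fmor (comp_dg G FB) (tgt K u) v)) = - ?n u v"
        unfolding minus_psgn using sg det(3) by (auto simp: determined_degrees_def simp del: add_bit_eq_xor)
      have eq: "dcomp ?H (fob FF ?K) (fob FF (tgt K u)) (fob FF K) (fmor FF K u) (fmor FF (tgt K u) v) =
        (dcomp B (fob FB ?K) (fob FB (tgt K u)) (fob FB K) (fmor FB K u) (fmor FB (tgt K u) v),
         dcomp C (fob FC ?K) (fob FC (tgt K u)) (fob FC K) (fmor FC K u) (fmor FC (tgt K u) v),
         dcomp D (gob G (fob FB ?K)) (gob G (fob FB (tgt K u))) (gob S (fob FC K))
          (N K u) (fmor (comp_dg G FB) (tgt K u) v) + psgn ?s (?c u v))"
        by (simp add: hfp_def FFo FFm comp_dg_def dg_sign_def uv(3))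
      \<comment> \<open>The sign inside the composition of the fiber product and the sign of
        \<open>m_2\<close> are equal and cancel.\<close>
      have "psgn ?s (psgn ?s (?c u v)) = ?c u v" by (simp add: psgn_def)
      then show ?thesis
        unfolding eq using b c n by (simp add: prod_eq_iff fst_psgn snd_psgn psgn_add)
    qed
    have S: "(\<Sum>(u, v)\<in>?P. psgn (dg_sign ?H (fob FF K) (fob FF (tgt K u)) (fmor FF K u))
         (dcomp ?H (fob FF ?K) (fob FF (tgt K u)) (fob FF K) (fmor FF K u) (fmor FF (tgt K u) v))) =
       ((\<Sum>(u, v)\<in>?P. ?tb u v), (\<Sum>(u, v)\<in>?P. ?tc u v), - (\<Sum>(u, v)\<in>?P. ?n u v) + (\<Sum>(u, v)\<in>?P. ?c u v))"
    proof -
      have "(\<Sum>(u, v)\<in>?P. psgn (dg_sign ?H (fob FF K) (fob FF (tgt K u)) (fmor FF K u))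
         (dcomp ?H (fob FF ?K) (fob FF (tgt K u)) (fob FF K) (fmor FF K u) (fmor FF (tgt K u) v))) =
         (\<Sum>(u, v)\<in>?P. (?tb u v, ?tc u v, - ?n u v + ?c u v))"
        by (rule sum.cong[OF refl]) (use tm in auto)
      then show ?thesis
        by (simp add: prod_eq_iff fst_sum snd_sum case_prod_beta' sum_subtractf)
    qed
    have D0: "ddiff ?H (fob FF ?K) (fob FF K) (fmor FF K as) =
       (ddiff B (fob FB ?K) (fob FB K) (fmor FB K as), ddiff C (fob FC ?K) (fob FC K) (fmor FC K as),
        - ddiff D (gob G (fob FB ?K)) (gob S (fob FC K)) (N K as) - ?n [] as + ?c as [])"
      by (simp add: hfp_def FFo FFm comp_dg_def)
    have 1: "(\<Sum>(u, v)\<in>{(u, v) \<in> splits2 as. u \<noteq> []}. psgn ((0 - 1) * sdeg A K u)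
        (psgn (dg_sign D (fob (comp_dg S FC) K) (fob (comp_dg S FC) (tgt K u)) (fmor (comp_dg S FC) K u))
          (dcomp D (fob (comp_dg G FB) (tgt K as)) (fob (comp_dg S FC) (tgt K u)) (fob (comp_dg S FC) K)
            (fmor (comp_dg S FC) K u) (N (tgt K u) v)))) =
        - (\<Sum>(u, v)\<in>{(u, v) \<in> splits2 as. u \<noteq> []}. ?c u v)"
      unfolding sum_negf[symmetric]
    proof (rule sum.cong[OF refl])
      fix x assume x: "x \<in> {(u, v) \<in> splits2 as. u \<noteq> []}"
      obtain u v where ux: "x = (u, v)" by (cases x)
      have s: "(u, v) \<in> splits2 as" "u \<noteq> []" using x ux by auto
      note uv = hpath_splits2[OF h s(1)]
      note o = dob[OF hpath_start_Ob[OF h]] and o' = dob[OF hpath_tgt[OF uv(1)]]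
      have "psgn (dg_sign D (gob S (fob FC K)) (gob S (fob FC (tgt K u))) (fmor (comp_dg S FC) K u)) (?c u v) =
          psgn (sdeg A K u + 1) (?c u v)"
        by (rule psgn_dcomp[OF det(3) o'(4) o(4) hS[OF uv(1) s(2)] dg_sign_degree[OF det(3) o'(4) o(4) hS[OF uv(1) s(2)]]])
      moreover have "fob (comp_dg S FC) X = gob S (fob FC X)" "fob (comp_dg G FB) X = gob G (fob FB X)" for X
        by (simp_all add: comp_dg_def)
      ultimately show "(case x of (u, v) \<Rightarrow> psgn ((0 - 1) * sdeg A K u)
        (psgn (dg_sign D (fob (comp_dg S FC) K) (fob (comp_dg S FC) (tgt K u)) (fmor (comp_dg S FC) K u))
          (dcomp D (fob (comp_dg G FB) (tgt K as)) (fob (comp_dg S FC) (tgt K u)) (fob (comp_dg S FC) K)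
            (fmor (comp_dg S FC) K u) (N (tgt K u) v)))) = - (case x of (u, v) \<Rightarrow> ?c u v)"
        unfolding ux prod.case by (simp only:) (simp add: psgn_def)
    qed
    have 2: "(\<Sum>(u, v)\<in>{(u, v) \<in> splits2 as. v \<noteq> []}.
        psgn (dg_sign D (fob (comp_dg S FC) K) (fob (comp_dg G FB) (tgt K u)) (N K u))
          (dcomp D (fob (comp_dg G FB) (tgt K as)) (fob (comp_dg G FB) (tgt K u)) (fob (comp_dg S FC) K)
            (N K u) (fmor (comp_dg G FB) (tgt K u) v))) =
        (\<Sum>(u, v)\<in>{(u, v) \<in> splits2 as. v \<noteq> []}. ?n u v)"
    proof (rule sum.cong[OF refl])
      fix x assume x: "x \<in> {(u, v) \<in> splits2 as. v \<noteq> []}"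
      obtain u v where ux: "x = (u, v)" by (cases x)
      have s: "(u, v) \<in> splits2 as" "v \<noteq> []" using x ux by auto
      note uv = hpath_splits2[OF h s(1)]
      note o = dob[OF hpath_start_Ob[OF h]] and o' = dob[OF hpath_tgt[OF uv(1)]]
      have e: "fob (comp_dg S FC) X = gob S (fob FC X)" "fob (comp_dg G FB) X = gob G (fob FB X)" for X
        by (simp_all add: comp_dg_def)
      show "(case x of (u, v) \<Rightarrow> psgn (dg_sign D (fob (comp_dg S FC) K) (fob (comp_dg G FB) (tgt K u)) (N K u))
          (dcomp D (fob (comp_dg G FB) (tgt K as)) (fob (comp_dg G FB) (tgt K u)) (fob (comp_dg S FC) K)
            (N K u) (fmor (comp_dg G FB) (tgt K u) v))) = (case x of (u, v) \<Rightarrow> ?n u v)"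
        unfolding ux prod.case e
        by (rule psgn_dcomp[OF det(3) o'(3) o(4) hN[OF uv(1)] dg_sign_degree[OF det(3) o'(3) o(4) hN[OF uv(1)]]])
    qed
    have "ddiff D (gob G (fob FB ?K)) (gob S (fob FC K)) (N K as)
        - (\<Sum>(u, v)\<in>{(u, v) \<in> splits2 as. u \<noteq> []}. ?c u v)
        + (\<Sum>(u, v)\<in>{(u, v) \<in> splits2 as. v \<noteq> []}. ?n u v) + ?E N = 0"
      using rN unfolding nat_M1_dg 1 2 by (simp add: comp_dg_def)
    \<comment> \<open>The splits with an empty part are separated because they belong to the
      differential, the remaining ones to the composition.\<close>
    then have "?E N = - ddiff D (gob G (fob FB ?K)) (gob S (fob FC K)) (N K as)
        + (?c as [] + (\<Sum>(u, v)\<in>?P. ?c u v)) - (?n [] as + (\<Sum>(u, v)\<in>?P. ?n u v))"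
      unfolding sum_splits2_left_ends[OF False, where f = ?c] sum_splits2_right_ends[OF False, where f = ?n]
      by (simp only: add_eq_0_iff2) (simp add: algebra_simps)
    then have n: "?E N = - ddiff D (gob G (fob FB ?K)) (gob S (fob FC K)) (N K as) - ?n [] as + ?c as []
        + (- (\<Sum>(u, v)\<in>?P. ?n u v) + (\<Sum>(u, v)\<in>?P. ?c u v))"
      by (simp only: diff_conv_add_uminus minus_add_distrib add_ac)
    have b: "?E (fmor FB) = ddiff B (fob FB ?K) (fob FB K) (fmor FB K as) + (\<Sum>(u, v)\<in>?P. ?tb u v)"
      unfolding rB[symmetric] by (rule sum_blocks_dg[OF False])
    have c: "?E (fmor FC) = ddiff C (fob FC ?K) (fob FC K) (fmor FC K as) + (\<Sum>(u, v)\<in>?P. ?tc u v)"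
      unfolding rC[symmetric] by (rule sum_blocks_dg[OF False])
    show ?thesis unfolding H D0 S E n b c by (simp only: plus_prod_def fst_conv snd_conv)
  qed
qed

section \<open>Localized mirror functors and their restrictions\<close>

lemma determined_degrees_MF:
  assumes "function_ring V R"
  shows "determined_degrees (MF R W)"
  using maps_both_degrees[OF assms] unfolding determined_degrees_def
  by (auto simp: MF_def zero_fun_def)

lemma base_change_uminus:
  "base_change U V j R S (\<lambda>y. - f y) = (\<lambda>y. - base_change U V j R S f y)"
proof -
  have p: "pullback V j (- g) = - pullback V j g" for g
    by (auto simp: pullback_def fun_eq_iff)
  show ?thesis
  proof (intro ext)
    fix y q v
    show "base_change U V j R S (\<lambda>y. - f y) y q v = (- base_change U V j R S f y) q v"
      by (simp add: base_change_def p sum_negf)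
  qed
qed

context mirror_ainf
begin

text \<open>Base change looks at the map on the basis only. At a point the basis becomes
  \<open>unit_vec\<close>, so expansion in generators recovers the value on any \<open>y\<close>,
  and an insertion map restricts to an insertion map.\<close>

lemma base_change_insertion:
  assumes as: "hpath A L as" and K: "K \<in> Ob A" and ringU: "function_ring U RU"
    and j: "\<And>v. v \<in> V \<Longrightarrow> j v \<in> U \<and> b v = bU (j v) \<and> (K, b v) \<in> \<D>"
  shows "base_change U V j R (both (gen (tgt L as) K)) (insertion_map A gen U RU K bU (\<lambda>_. []) L as) =
    insertion_map A gen V R K b (\<lambda>_. []) L as"
proof
  fix y
  let ?S = "both (gen (tgt L as) K)"
  note ob = hpath_tgt[OF as] K
  have basis: "basis_elt U s \<in> free_module RU ?S" if "s \<in> ?S" for s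
  proof -
    have e: "basis_elt U s p = (\<lambda>u. if u \<in> U then if p = s then 1 else 0 else 0)" for p
      by (auto simp: basis_elt_def fun_eq_iff)
    show ?thesis
      unfolding free_module_def
    proof (intro CollectI conjI allI impI)
      show "basis_elt U s p \<in> RU" for p unfolding e by (rule ring_const[OF ringU])
      show "basis_elt U s p = 0" if "p \<notin> ?S" for p
      proof -
        have "p \<noteq> s" using that \<open>s \<in> ?S\<close> by blast
        then show ?thesis by (simp add: basis_elt_def fun_eq_iff)
      qed
    qed
  qed
  show "base_change U V j R ?S (insertion_map A gen U RU K bU (\<lambda>_. []) L as) y =
    insertion_map A gen V R K b (\<lambda>_. []) L as y"
  proof (cases "y \<in> free_module R ?S")
    case True
    have "(\<Sum>s\<in>?S. y s v * pullback V j (insertion_map A gen U RU K bU (\<lambda>_. []) L as (basis_elt U s) p) v) =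
        insertion_map A gen V R K b (\<lambda>_. []) L as y p v" for p v
    proof (cases "v \<in> V")
      case v: True
      have bD: "(K, b v) \<in> \<D>" using j[OF v] by blast
      have "(\<lambda>q. y q v) \<in> Hom_total A (tgt L as) K"
        using True unfolding Hom_total_iff[OF ob] by (auto simp: free_module_def)
      then have "dmu A (L, 0) (lift as @ [(\<lambda>q. y q v, (K, b v))]) p =
          (\<Sum>s\<in>?S. y s v * dmu A (L, 0) (lift as @ [(unit_vec s, (K, b v))]) p)"
        using dmu_expand[OF dtp_lift[OF as], of "\<lambda>q. y q v" "(K, b v)" "[]" p] bD by simp
      moreover have "pullback V j (insertion_map A gen U RU K bU (\<lambda>_. []) L as (basis_elt U s) p) v =
          dmu A (L, 0) (lift as @ [(unit_vec s, (K, b v))]) p" if "s \<in> ?S" for s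
      proof -
        have "(\<lambda>q. basis_elt U s q (j v)) = unit_vec s"
          using j[OF v] by (auto simp: basis_elt_def unit_vec_def fun_eq_iff)
        then show ?thesis
          using j[OF v] v basis[OF that] unfolding pullback_def insertion_map_def lift_def by simp
      qed
      ultimately show ?thesis
        using v True unfolding insertion_map_def lift_def by simp
    qed (simp add: pullback_def insertion_map_def)
    then show ?thesis
      using True by (simp add: base_change_def fun_eq_iff sum_fun_apply)
  next
    case False
    then show ?thesis unfolding base_change_def insertion_map_def by simp
  qed
qed

lemma mirror_functor_object:
  "fob (mirror_functor A gen K U RU) L =
    \<lparr>gens = gen L K, delta = (\<lambda>y. - insertion_map A gen U RU K (\<lambda>b. b) (\<lambda>_. []) L [] y)\<rparr>"
  by (auto simp: mirror_functor_def insertion_map_def fun_eq_iff)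

text \<open>The definition inserts \<open>b\<close> only after \<open>y\<close>; by
  \<open>dmu_lift_snoc\<close> nothing else survives in the deformed operation.\<close>

lemma mirror_functor_morphism:
  assumes as: "hpath A L as" and K: "K \<in> Ob A" and U: "\<And>b. b \<in> U \<Longrightarrow> (K, b) \<in> \<D>"
  shows "fmor (mirror_functor A gen K U RU) L as = insertion_map A gen U RU K (\<lambda>b. b) (\<lambda>_. []) L as"
proof
  fix y
  note ob = hpath_tgt[OF as] K
  show "fmor (mirror_functor A gen K U RU) L as y = insertion_map A gen U RU K (\<lambda>b. b) (\<lambda>_. []) L as y"
  proof (cases "y \<in> free_module RU (both (gen (tgt L as) K))")
    case True
    have "(\<Sum>\<^sub>\<infinity>j. mu A L (as @ (\<lambda>q. y q b, K) # replicate j (b, K)) p) =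
        dmu A (L, 0) (lift as @ [(\<lambda>q. y q b, (K, b))]) p" if b: "b \<in> U" for b p
    proof -
      have "(\<lambda>q. y q b) \<in> Hom_total A (tgt L as) K"
        using True unfolding Hom_total_iff[OF ob] by (auto simp: free_module_def)
      then have "dtp (L, 0) (lift as @ [(\<lambda>q. y q b, (K, b))])"
        unfolding dtp_insert using dtp_lift[OF as] U[OF b] by simp
      from dmu_lift_snoc[OF this] show ?thesis by simp
    qed
    then show ?thesis
      using True unfolding insertion_map_def lift_def by (simp add: mirror_functor_def fun_eq_iff)
  next
    case False
    then show ?thesis unfolding insertion_map_def by (simp add: mirror_functor_def)
  qed
qed

end

context mirror_family
begin

lemma IM_Nil: "IM (K, b) [] = insertion_map A gen V R K b (\<lambda>_. [])"
proof -
  have "evs [] = (\<lambda>_. [])" by (simp add: fun_eq_iff)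
  then show ?thesis unfolding IM_def fst_conv snd_conv by (rule arg_cong)
qed

lemma represents_restriction:
  assumes Z: "(K, b) \<in> \<G>" and ringU: "function_ring U RU" and U: "\<And>b. b \<in> U \<Longrightarrow> (K, b) \<in> \<D>"
    and j: "\<And>v. v \<in> V \<Longrightarrow> j v \<in> U \<and> b v = j v"
  shows "represents (comp_dg (restriction U V j R) (mirror_functor A gen K U RU)) (K, b)"
proof -
  have K: "K \<in> Ob A" using obG[OF Z] by simp
  have bc: "base_change U V j R (both (gen (tgt L as) K)) (insertion_map A gen U RU K (\<lambda>b. b) (\<lambda>_. []) L as) =
      IM (K, b) [] L as" if "hpath A L as" for L as
    unfolding IM_Nil by (rule base_change_insertion[OF that K ringU]) (use j U in auto)
  have "fob (comp_dg (restriction U V j R) (mirror_functor A gen K U RU)) L = mf (K, b) L"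
    if "L \<in> Ob (uncurved A)" for L
    using bc[of L "[]"] that
    by (simp add: comp_dg_def restriction_def mf_def mirror_functor_object base_change_uminus Ob_uncurved)
  moreover have "fmor (comp_dg (restriction U V j R) (mirror_functor A gen K U RU)) L as = IM (K, b) [] L as"
    if "hpath (uncurved A) L as" for L as
    using bc[OF hpath_uncurved[OF that]] mirror_functor_morphism[OF hpath_uncurved[OF that] K U, of U RU]
    by (simp add: comp_dg_def restriction_def mirror_functor_object)
  ultimately show ?thesis unfolding represents_def using Z by blast
qed

end

lemma deformation_space_positive:
  assumes "finite X" "b \<in> deformation_space X \<Lambda>plus"
  shows "0 < vval b"
proof -
  define e where "e p = (SOME r :: real. 0 < r \<and> ereal r \<le> nval (b p))" for p
  have e: "0 < e p \<and> ereal (e p) \<le> nval (b p)" if "p \<in> X" for p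
    unfolding e_def
  proof (rule someI_ex)
    have "0 < nval (b p)" using assms(2) that by (auto simp: deformation_space_def \<Lambda>plus_def)
    then obtain r where "0 < ereal r" "ereal r < nval (b p)" using ereal_dense2 by blast
    then show "\<exists>r>0. ereal r \<le> nval (b p)" by (auto intro: less_imp_le)
  qed
  \<comment> \<open>The entry \<open>1\<close> keeps the minimum defined when \<open>X\<close> is
    empty.\<close>
  let ?m = "Min (insert 1 (e ` X))"
  have m: "0 < ?m" using e assms(1) by simp
  have "ereal ?m \<le> nval (b p)" for p
  proof (cases "p \<in> X")
    case True
    then have "?m \<le> e p" using assms(1) by (intro Min_le) auto
    then show ?thesis using e[OF True] by (meson dual_order.trans ereal_less_eq(3))
  next
    case False
    then have "b p = 0" using assms(2) by (auto simp: deformation_space_def hvec_def)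
    then show ?thesis by simp
  qed
  then have "ereal ?m \<le> vval b" by (simp add: ereal_le_vval_iff)
  moreover have "(0 :: ereal) < ereal ?m" using m by (simp only: zero_ereal_def ereal_less(1) less_ereal.simps)
  ultimately show ?thesis by (rule less_le_trans[rotated])
qed

lemma vval_zero_positive: "0 < vval 0"
proof -
  have "ereal 1 \<le> vval 0" by (simp add: ereal_le_vval_iff)
  then show ?thesis by (rule less_le_trans[rotated]) simp
qed

lemma (in mirror_ainf) mirror_familyI:
  assumes "function_ring V R" "defined_over A V R ((\<lambda>L. (L, \<lambda>_. 0)) ` Ob A \<union> S)"
    and "\<And>Z u. Z \<in> S \<Longrightarrow> u \<in> V \<Longrightarrow> ev Z u \<in> \<D>" "\<And>Z. Z \<in> S \<Longrightarrow> fst Z \<in> Ob A"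
  shows "mirror_family A gen \<D> V R ((\<lambda>L. (L, \<lambda>_. 0)) ` Ob A \<union> S)"
proof unfold_locales
  fix Z assume Z: "Z \<in> (\<lambda>L. (L, \<lambda>_. 0)) ` Ob A \<union> S"
  then consider L where "L \<in> Ob A" "Z = (L, \<lambda>_. 0)" | "Z \<in> S" by blast
  note cases = this
  show "ev Z u \<in> \<D>" if "u \<in> V" for u
    using cases by cases (simp_all only: ev_def fst_conv snd_conv zero_obj assms(3)[unfolded ev_def] that)
  show "fst Z \<in> Ob A" using cases by cases (simp_all only: fst_conv assms(4))
qed (use assms(1,2) in blast)+

section \<open>Quasi-isomorphism of two represented functors\<close>

context mirror_family
begin

lemma represents_insertion_map:
  assumes "(K, b) \<in> \<G>"
    and "\<And>L. fob F L = \<lparr>gens = gen L K, delta = (\<lambda>y. - insertion_map A gen V R K b (\<lambda>_. []) L [] y)\<rparr>"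
    and "\<And>L as. hpath A L as \<Longrightarrow> fmor F L as = insertion_map A gen V R K b (\<lambda>_. []) L as"
  shows "represents F (K, b)"
  unfolding represents_def mf_def IM_Nil using assms(1) by (auto simp: assms(2) assms(3)[OF hpath_uncurved])

lemma CM_contract_Nil:
  assumes K: "K \<in> Ob (uncurved A)" and Z: "Z \<in> \<G>" "Z' \<in> \<G>" and \<theta>: "family V R (Hom A (fst Z) (fst Z') 0) \<theta>"
  shows "CM Z \<theta> Z' K (contract A K [] [] []) = 0"
proof -
  have ob: "K \<in> Ob A" "mu A K [] = 0" using K by (auto simp: Ob_uncurved)
  have "hpath A K ([] @ (0, K) # [])" using ob Hom_zero by auto
  from IM_zero_string[OF this gstr_single[OF Z \<theta>]] show ?thesis
    by (intro ext) (simp add: CM_eq contract_def ob)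
qed

lemma HM_contract_Nil:
  assumes K: "K \<in> Ob (uncurved A)" and Z: "Z \<in> \<G>" "Z' \<in> \<G>"
    and \<theta>: "family V R (Hom A (fst Z) (fst Z') 0) \<theta>" "family V R (Hom A (fst Z') (fst Z) 0) \<theta>'"
      "family V R (Hom A (fst Z) (fst Z) 1) \<gamma>"
  shows "HM Z \<theta> Z' \<theta>' \<gamma> K (contract A K [] [] []) = 0"
proof -
  have ob: "K \<in> Ob A" "mu A K [] = 0" using K by (auto simp: Ob_uncurved)
  have h: "hpath A K ([] @ (0, K) # [])" using ob Hom_zero by auto
  show ?thesis
    using IM_zero_string[OF h gstr_pair[OF Z Z(1) \<theta>(1,2)]] IM_zero_string[OF h gstr_single[OF Z(1,1) \<theta>(3)]]
    by (simp add: HM_eq contract_def ob)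
qed

text \<open>One half of an isomorphism, with the homotopy \<open>\<gamma>\<close> on the side of
  \<open>Z\<close>. Exchanging the roles of \<open>Z\<close> and \<open>Z'\<close> gives the other
  half, so each consequence is proved once and used twice.\<close>

definition isomorphism where
  "isomorphism Z Z' \<theta> \<theta>' \<gamma> \<longleftrightarrow>
     family V R (Hom A (fst Z) (fst Z') 0) \<theta> \<and> family V R (Hom A (fst Z') (fst Z) 0) \<theta>' \<and>
     family V R (Hom A (fst Z) (fst Z) 1) \<gamma> \<and>
     (\<forall>u\<in>V. dmu A (ev Z u) [(\<theta> u, ev Z' u)] = 0 \<and> dmu A (ev Z' u) [(\<theta>' u, ev Z u)] = 0 \<and>
       dmu A (ev Z u) [(\<theta> u, ev Z' u), (\<theta>' u, ev Z u)] = unit_of A (fst Z) + dmu A (ev Z u) [(\<gamma> u, ev Z u)])"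

lemma isomorphismD:
  assumes "isomorphism Z Z' \<theta> \<theta>' \<gamma>"
  shows "family V R (Hom A (fst Z) (fst Z') 0) \<theta>" "family V R (Hom A (fst Z') (fst Z) 0) \<theta>'"
    "family V R (Hom A (fst Z) (fst Z) 1) \<gamma>"
    "u \<in> V \<Longrightarrow> dmu A (ev Z u) [(\<theta> u, ev Z' u)] = 0"
    "u \<in> V \<Longrightarrow> dmu A (ev Z' u) [(\<theta>' u, ev Z u)] = 0"
    "u \<in> V \<Longrightarrow> dmu A (ev Z u) [(\<theta> u, ev Z' u), (\<theta>' u, ev Z u)] =
       unit_of A (fst Z) + dmu A (ev Z u) [(\<gamma> u, ev Z u)]"
  using assms by (auto simp: isomorphism_def)

theorem comparison_quasi_iso:
  assumes F: "represents F0 Z0" "represents F1 Z1"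
    and W: "weak_family Z0 W" "weak_family Z1 W"
    and iso: "isomorphism Z0 Z1 \<alpha> \<beta> \<gamma>0" "isomorphism Z1 Z0 \<beta> \<alpha> \<gamma>1"
  shows "quasi_iso_via (uncurved A) (ainf_of_dg (MF R W)) F0 F1 (CM Z1 \<beta> Z0) (CM Z0 \<alpha> Z1)
    (HM Z0 \<alpha> Z1 \<beta> \<gamma>0) (HM Z1 \<beta> Z0 \<alpha> \<gamma>1)"
  unfolding quasi_iso_via_def
  using mirror_functor_is_functor[OF F(1) W(1)] mirror_functor_is_functor[OF F(2) W(2)]
    comparison_is_natural[OF F W(2,1) isomorphismD(1,4)[OF iso(2)]]
    comparison_is_natural[OF F(2,1) W isomorphismD(1,4)[OF iso(1)]]
    homotopy_of_composition[OF F W isomorphismD[OF iso(1)]]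
    homotopy_of_composition[OF F(2,1) W(2,1) isomorphismD[OF iso(2)]]
  by blast

text \<open>The conditions in \<open>invertible_H0\<close> are the transformation and homotopy
  equations for the empty string: no terms with a nonempty functor block exist there, and the
  contraction term inserts the curvature of \<open>K\<close>, which is zero.\<close>

theorem comparison_invertible:
  fixes F0 F1 :: "('o, 'p \<Rightarrow> novikov, ('p, 'u) matrix_factorization,
    ('p \<Rightarrow> 'u \<Rightarrow> novikov) \<Rightarrow> 'p \<Rightarrow> 'u \<Rightarrow> novikov) ainf_functor"
  assumes F: "represents F0 Z0" "represents F1 Z1"
    and W: "weak_family Z0 W" "weak_family Z1 W"
    and iso: "isomorphism Z0 Z1 \<alpha> \<beta> \<gamma>0" "isomorphism Z1 Z0 \<beta> \<alpha> \<gamma>1"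
    and K: "K \<in> Ob (uncurved A)"
  shows "invertible_H0 (MF R W) (fob F1 K) (fob F0 K) (CM Z1 \<beta> Z0 K [])"
proof -
  have Z: "Z0 \<in> \<G>" "Z1 \<in> \<G>" using W by (auto simp: weak_family_def)
  have ob: "K \<in> Ob A" using K by (simp add: Ob_uncurved)
  have h: "hpath A K []" "hpath (uncurved A) K []" using ob K by simp_all
  note f0 = representsD(2)[OF F(1) K] and f1 = representsD(2)[OF F(2) K]
  note i0 = isomorphismD[OF iso(1)] and i1 = isomorphismD[OF iso(2)]
  have e: "{(u, v) \<in> splits2 ([] :: (('p \<Rightarrow> novikov) \<times> 'o) list). u \<noteq> []} = {}"
    "{(u, v) \<in> splits2 ([] :: (('p \<Rightarrow> novikov) \<times> 'o) list). v \<noteq> []} = {}"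
    by (auto simp: splits2_def)
  have closed: "ddiff (MF R W) (fob G K) (fob F K) (CM Z \<theta> Z' K []) = 0"
    if "represents F Z'" "represents G Z" "weak_family Z W" "weak_family Z' W"
      "isomorphism Z Z' \<theta> \<theta>' \<gamma>"
    for F G :: "('o, 'p \<Rightarrow> novikov, ('p, 'u) matrix_factorization,
        ('p \<Rightarrow> 'u \<Rightarrow> novikov) \<Rightarrow> 'p \<Rightarrow> 'u \<Rightarrow> novikov) ainf_functor" and Z Z' \<theta> \<theta>' \<gamma>
  proof -
    note i = isomorphismD[OF that(5)]
    have "nat_M1 (uncurved A) (ainf_of_dg (MF R W)) F G 0 (CM Z \<theta> Z') K [] = 0"
      using comparison_is_natural[OF that(1-4) i(1,4)] h(2) unfolding nat_transformation_def by blast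
    moreover have "Z \<in> \<G>" "Z' \<in> \<G>" using that by (auto simp: weak_family_def)
    ultimately show ?thesis
      unfolding nat_M1_dg e splits3_Nil using CM_contract_Nil[OF K _ _ i(1)] by simp
  qed
  have homotopy: "dcomp (MF R W) (fob F K) (fob G K) (fob F K) (CM Z' \<theta>' Z K []) (CM Z \<theta> Z' K [])
      - did (MF R W) (fob F K) = ddiff (MF R W) (fob F K) (fob F K) (HM Z \<theta> Z' \<theta>' \<gamma> K [])"
    if "represents F Z" "represents G Z'" "weak_family Z W" "weak_family Z' W"
      "isomorphism Z Z' \<theta> \<theta>' \<gamma>"
    for F G :: "('o, 'p \<Rightarrow> novikov, ('p, 'u) matrix_factorization,
        ('p \<Rightarrow> 'u \<Rightarrow> novikov) \<Rightarrow> 'p \<Rightarrow> 'u \<Rightarrow> novikov) ainf_functor" and Z Z' \<theta> \<theta>' \<gamma>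
  proof -
    note i = isomorphismD[OF that(5)]
    have Z: "Z \<in> \<G>" "Z' \<in> \<G>" using that by (auto simp: weak_family_def)
    have "CM Z' \<theta>' Z K [] \<in> dhom (MF R W) (fob G K) (fob F K) 0"
      unfolding representsD(2)[OF that(1) K] representsD(2)[OF that(2) K] dhom_mf
      using CM_maps[OF h(1) Z(2,1) i(2)] by simp
    then have "dg_sign (MF R W) (fob F K) (fob G K) (CM Z' \<theta>' Z K []) = 0"
      by (simp add: dg_sign_def)
    then show ?thesis
      using homotopy_of_composition(2)[OF that(1-4) i h(2)]
      unfolding nat_M1_dg nat_M2_dg e unfolding splits3_Nil splits2_Nil
      using HM_contract_Nil[OF K Z i(1-3)] by (simp add: nat_id_def ainf_of_dg_def)
  qed
  have maps: "CM Z1 \<beta> Z0 K [] \<in> dhom (MF R W) (fob F1 K) (fob F0 K) 0"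
    "CM Z0 \<alpha> Z1 K [] \<in> dhom (MF R W) (fob F0 K) (fob F1 K) 0"
    "HM Z0 \<alpha> Z1 \<beta> \<gamma>0 K [] \<in> dhom (MF R W) (fob F0 K) (fob F0 K) 1"
    "HM Z1 \<beta> Z0 \<alpha> \<gamma>1 K [] \<in> dhom (MF R W) (fob F1 K) (fob F1 K) 1"
    unfolding f0 f1 dhom_mf
    using CM_maps[OF h(1) Z(2,1) i1(1)] CM_maps[OF h(1) Z i0(1)] HM_maps[OF h(1) Z i0(1-3)] HM_maps[OF h(1) Z(2,1) i1(1-3)]
    by simp_all
  show ?thesis
    unfolding invertible_H0_def
    using maps closed[OF F W(2,1) iso(2)] closed[OF F(2,1) W iso(1)]
      homotopy[OF F W iso(1)] homotopy[OF F(2,1) W(2,1) iso(2)] by blast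
qed

end

text \<open>Under the reversal of morphisms a transformation is a family of dg-morphisms in the
  opposite direction. Hence \<open>N01\<close>, built from \<open>\<beta>\<close>, leads to the
  fiber product with \<open>MF1\<close> first, and \<open>N10\<close>, built from
  \<open>\<alpha>\<close>, to the one with \<open>MF0\<close> first. If \<open>\<alpha> b\<close>
  and \<open>\<beta> b\<close> were both zero, the units would be exact and closedness would say
  nothing about the potentials; \<open>nonzero\<close> excludes this.\<close>

theorem theorem1p1:
  fixes A :: "('o, 'p \<Rightarrow> novikov) ainf_category"
    and gen :: "'o \<Rightarrow> 'o \<Rightarrow> bit \<Rightarrow> 'p set"
    and \<L>0 \<L>1 :: 'o
    and X0 X1 :: "'p set"
    and P0 P1 :: "novikov set"
    and U0 U1 V0 V1 :: "('p \<Rightarrow> novikov) set"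
    and W0 W1 :: "('p \<Rightarrow> novikov) \<Rightarrow> novikov"
    and \<phi> \<psi> :: "('p \<Rightarrow> novikov) \<Rightarrow> 'p \<Rightarrow> novikov"
    and R0 R1 R01 :: "(('p \<Rightarrow> novikov) \<Rightarrow> novikov) set"
    and \<alpha> \<beta> \<gamma>0 \<gamma>1 :: "('p \<Rightarrow> novikov) \<Rightarrow> 'p \<Rightarrow> novikov"
  assumes Fuk: "filtered_unital_ainf A gen"
    and ref: "\<L>0 \<in> Ob A" "\<L>1 \<in> Ob A"
    and odd_generators: "X0 \<subseteq> gen \<L>0 \<L>0 1" "X1 \<subseteq> gen \<L>1 \<L>1 1"
    and U: "U0 = deformation_space X0 P0" "U1 = deformation_space X1 P1"
    and P: "P0 \<in> {\<Lambda>plus, \<Lambda>0}" "P1 \<in> {\<Lambda>plus, \<Lambda>0}"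
    and conv: "P0 = \<Lambda>plus \<and> P1 = \<Lambda>plus \<or>
      insertions_converge A ((\<lambda>L. (L, 0)) ` Ob A \<union> {\<L>0} \<times> U0 \<union> {\<L>1} \<times> U1)"
    and weak_MC: "\<And>b. b \<in> U0 \<Longrightarrow> dmu A (\<L>0, b) [] = W0 b \<odot> unit_of A \<L>0"
      "\<And>b. b \<in> U1 \<Longrightarrow> dmu A (\<L>1, b) [] = W1 b \<odot> unit_of A \<L>1"
    and V_open: "openin (top_of_set U0) V0" "openin (top_of_set U1) V1"
    and homeo: "homeomorphism V0 V1 \<phi> \<psi>"
    and rings: "function_ring U0 R0" "function_ring U1 R1" "function_ring V0 R01"
    and restrict: "\<And>f. f \<in> R0 \<Longrightarrow> pullback V0 id f \<in> R01"
      "\<And>f. f \<in> R1 \<Longrightarrow> pullback V0 \<phi> f \<in> R01"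
    and over: "defined_over A U0 R0 ((\<lambda>L. (L, \<lambda>_. 0)) ` Ob A \<union> {(\<L>0, \<lambda>b. b)})"
      "defined_over A U1 R1 ((\<lambda>L. (L, \<lambda>_. 0)) ` Ob A \<union> {(\<L>1, \<lambda>b. b)})"
      "defined_over A V0 R01 ((\<lambda>L. (L, \<lambda>_. 0)) ` Ob A \<union> {(\<L>0, \<lambda>b. b), (\<L>1, \<phi>)})"
    and families: "family V0 R01 (Hom A \<L>0 \<L>1 0) \<alpha>" "family V0 R01 (Hom A \<L>1 \<L>0 0) \<beta>"
      "family V0 R01 (Hom A \<L>0 \<L>0 1) \<gamma>0" "family V0 R01 (Hom A \<L>1 \<L>1 1) \<gamma>1"
    and \<alpha>_closed: "\<And>b. b \<in> V0 \<Longrightarrow> dmu A (\<L>0, b) [(\<alpha> b, (\<L>1, \<phi> b))] = 0"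
    and \<beta>_closed: "\<And>b. b \<in> V0 \<Longrightarrow> dmu A (\<L>1, \<phi> b) [(\<beta> b, (\<L>0, b))] = 0"
    and \<alpha>\<beta>: "\<And>b. b \<in> V0 \<Longrightarrow> dmu A (\<L>0, b) [(\<alpha> b, (\<L>1, \<phi> b)), (\<beta> b, (\<L>0, b))]
      = unit_of A \<L>0 + dmu A (\<L>0, b) [(\<gamma>0 b, (\<L>0, b))]"
    and \<beta>\<alpha>: "\<And>b. b \<in> V0 \<Longrightarrow> dmu A (\<L>1, \<phi> b) [(\<beta> b, (\<L>0, b)), (\<alpha> b, (\<L>1, \<phi> b))]
      = unit_of A \<L>1 + dmu A (\<L>1, \<phi> b) [(\<gamma>1 b, (\<L>1, \<phi> b))]"
    and nonzero: "\<And>b. b \<in> V0 \<Longrightarrow> \<alpha> b \<noteq> 0 \<or> \<beta> b \<noteq> 0"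
  shows
    "let W01 = pullback V0 id W0;
         MF0 = MF R0 W0; MF1 = MF R1 W1; MF01 = MF R01 W01;
         Fuk = uncurved A;
         F0 = mirror_functor A gen \<L>0 U0 R0;
         F1 = mirror_functor A gen \<L>1 U1 R1;
         r0 = restriction U0 V0 id R01;
         r1 = restriction U1 V0 \<phi> R01;
         N01 = comparison_map A gen V0 R01 \<L>1 \<phi> \<L>0 (\<lambda>b. b) \<beta>;
         N10 = comparison_map A gen V0 R01 \<L>0 (\<lambda>b. b) \<L>1 \<phi> \<alpha>;
         H0 = homotopy_map A gen V0 R01 \<L>0 (\<lambda>b. b) \<L>1 \<phi> \<alpha> \<beta> \<gamma>0;
         H1 = homotopy_map A gen V0 R01 \<L>1 \<phi> \<L>0 (\<lambda>b. b) \<beta> \<alpha> \<gamma>1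
     in
       (\<forall>b0\<in>V0. W0 b0 = W1 (\<phi> b0)) \<and>
       quasi_isomorphic Fuk (ainf_of_dg MF01) (comp_dg r0 F0) (comp_dg r1 F1) \<and>
       quasi_iso_via Fuk (ainf_of_dg MF01) (comp_dg r0 F0) (comp_dg r1 F1) N01 N10 H0 H1 \<and>
       (\<exists>Fglobal. is_ainf_functor Fuk (ainf_of_dg (hfp MF1 MF0 MF01 r1 r0)) Fglobal \<and>
          (\<forall>L\<in>Ob Fuk. fob Fglobal L = (fob F1 L, fob F0 L, N01 L [])) \<and>
          (\<forall>L as. hpath Fuk L as \<and> as \<noteq> [] \<longrightarrow>
             fmor Fglobal L as = (fmor F1 L as, fmor F0 L as, N01 L as))) \<and>
       (\<exists>Fglobal. is_ainf_functor Fuk (ainf_of_dg (hfp MF0 MF1 MF01 r0 r1)) Fglobal \<and>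
          (\<forall>L\<in>Ob Fuk. fob Fglobal L = (fob F0 L, fob F1 L, N10 L [])) \<and>
          (\<forall>L as. hpath Fuk L as \<and> as \<noteq> [] \<longrightarrow>
             fmor Fglobal L as = (fmor F0 L as, fmor F1 L as, N10 L as)))"
proof -
  \<comment> \<open>All deformed objects that occur over any of the three domains, so that they
    share one theory of deformed operations.\<close>
  let ?D = "(\<lambda>L. (L, 0)) ` Ob A \<union> {\<L>0} \<times> U0 \<union> {\<L>1} \<times> U1"
  let ?C = "(\<lambda>L. (L, \<lambda>_. 0)) ` Ob A"
  let ?Z0 = "(\<L>0, \<lambda>b. b)" and ?Z1 = "(\<L>1, \<phi>)"
  let ?W = "pullback V0 id W0"
  interpret filtered_ainf A gen by unfold_locales (rule Fuk)
  have V0: "b \<in> V0 \<Longrightarrow> b \<in> U0" and V1: "b \<in> V0 \<Longrightarrow> \<phi> b \<in> U1" for b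
    using V_open homeo by (auto simp: openin_subset homeomorphism_def dest!: openin_imp_subset)
  have odd0: "b \<in> U0 \<Longrightarrow> b \<in> Hom A \<L>0 \<L>0 1" and odd1: "b \<in> U1 \<Longrightarrow> b \<in> Hom A \<L>1 \<L>1 1" for b
    using odd_generators unfolding U Hom_iff[OF ref(1) ref(1)] Hom_iff[OF ref(2) ref(2)]
    by (auto simp: deformation_space_def hvec_def)
  interpret deformed_objects A gen ?D
  proof
    fix Z assume Z: "Z \<in> ?D"
    then show "fst Z \<in> Ob A" using ref by auto
    show "snd Z \<in> Hom A (fst Z) (fst Z) 1"
      using Z odd0 odd1 Hom_zero by auto
  qed
  have "insertions_converge A ?D"
  \<comment> \<open>Positive valuation of every deformation element forces convergence; in the
    remaining case convergence is the hypothesis \<open>conv\<close>.\<close>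
  proof (cases "P0 = \<Lambda>plus \<and> P1 = \<Lambda>plus")
    case True
    have fin: "finite X0" "finite X1"
      using finite_subset[OF odd_generators(1) gen_finite[OF ref(1) ref(1)]]
        finite_subset[OF odd_generators(2) gen_finite[OF ref(2) ref(2)]] by auto
    show ?thesis
    proof (rule insertions_converge_positive)
      fix Z assume "Z \<in> ?D"
      then consider "snd Z = 0" | "snd Z \<in> U0" | "snd Z \<in> U1" by auto
      then show "0 < vval (snd Z)"
        by cases (use True U fin deformation_space_positive vval_zero_positive in auto)
    qed
  qed (use conv in blast)
  then interpret mirror_ainf A gen ?D
    by unfold_locales auto
  have p0: "(\<L>0, b) \<in> ?D" if "b \<in> U0" for b using that by blast
  have p1: "(\<L>1, b) \<in> ?D" if "b \<in> U1" for b using that by blast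
  \<comment> \<open>The functors into \<open>MF0\<close> and \<open>MF1\<close> live over
    \<open>U0\<close> and \<open>U1\<close>; they are compared over \<open>V0\<close>, where the
    second deformation element at \<open>b\<close> is \<open>\<phi> b\<close>.\<close>
  interpret f0: mirror_family A gen ?D U0 R0 "?C \<union> {?Z0}"
    by (rule mirror_familyI[OF rings(1) over(1)]) (use ref p0 in \<open>auto simp only: ev_def fst_conv snd_conv singleton_iff\<close>)
  interpret f1: mirror_family A gen ?D U1 R1 "?C \<union> {(\<L>1, \<lambda>b. b)}"
    by (rule mirror_familyI[OF rings(2) over(2)]) (use ref p1 in \<open>auto simp only: ev_def fst_conv snd_conv singleton_iff\<close>)
  interpret f01: mirror_family A gen ?D V0 R01 "?C \<union> {?Z0, ?Z1}"
    by (rule mirror_familyI[OF rings(3) over(3)])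
       (use ref p0 p1 V0 V1 in \<open>auto simp only: ev_def fst_conv snd_conv singleton_iff insert_iff empty_iff\<close>)
  have weak0: "weak_mc (\<L>0, b) (W0 b)" if "b \<in> U0" for b
    using weak_MC(1)[OF that] that by (simp add: weak_mc_def)
  have weak1: "weak_mc (\<L>1, b) (W1 b)" if "b \<in> U1" for b
    using weak_MC(2)[OF that] that by (simp add: weak_mc_def)
  \<comment> \<open>Either \<open>\<alpha> b\<close> or \<open>\<beta> b\<close> is nonzero, and
    each serves equally well, read in opposite directions.\<close>
  have agree: "W0 b = W1 (\<phi> b)" if b: "b \<in> V0" for b
  proof (cases "\<alpha> b = 0")
    case False
    show ?thesis
      by (rule potentials_agree[OF weak0[OF V0[OF b]] weak1[OF V1[OF b]] _ False])
         (use families(1) \<alpha>_closed[OF b] b in \<open>auto simp: family_def\<close>)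
  next
    case True
    then have "\<beta> b \<noteq> 0" using nonzero[OF b] by blast
    then have "W1 (\<phi> b) = W0 b"
      by (intro potentials_agree[OF weak1[OF V1[OF b]] weak0[OF V0[OF b]]])
         (use families(2) \<beta>_closed[OF b] b in \<open>auto simp: family_def\<close>)
    then show ?thesis ..
  qed
  let ?F0 = "mirror_functor A gen \<L>0 U0 R0" and ?F1 = "mirror_functor A gen \<L>1 U1 R1"
  let ?r0 = "restriction U0 V0 id R01" and ?r1 = "restriction U1 V0 \<phi> R01"
  let ?N01 = "comparison_map A gen V0 R01 \<L>1 \<phi> \<L>0 (\<lambda>b. b) \<beta>"
  let ?N10 = "comparison_map A gen V0 R01 \<L>0 (\<lambda>b. b) \<L>1 \<phi> \<alpha>"
  let ?H0 = "homotopy_map A gen V0 R01 \<L>0 (\<lambda>b. b) \<L>1 \<phi> \<alpha> \<beta> \<gamma>0"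
  let ?H1 = "homotopy_map A gen V0 R01 \<L>1 \<phi> \<L>0 (\<lambda>b. b) \<beta> \<alpha> \<gamma>1"
  let ?B = "ainf_of_dg (MF R01 ?W)"
  have w0: "f0.weak_family ?Z0 W0"
    unfolding f0.weak_family_def ev_def fst_conv snd_conv using weak0 by blast
  have F0: "is_ainf_functor (uncurved A) (ainf_of_dg (MF R0 W0)) ?F0"
    by (rule f0.mirror_functor_is_functor[OF f0.represents_insertion_map[OF _ mirror_functor_object
          mirror_functor_morphism[OF _ ref(1)]]])
       (use w0 p0 in auto)
  have w1: "f1.weak_family (\<L>1, \<lambda>b. b) W1"
    unfolding f1.weak_family_def ev_def fst_conv snd_conv using weak1 by blast
  have F1: "is_ainf_functor (uncurved A) (ainf_of_dg (MF R1 W1)) ?F1"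
    by (rule f1.mirror_functor_is_functor[OF f1.represents_insertion_map[OF _ mirror_functor_object
          mirror_functor_morphism[OF _ ref(2)]]])
       (use w1 p1 in auto)
  have r: "f01.represents (comp_dg ?r0 ?F0) ?Z0" "f01.represents (comp_dg ?r1 ?F1) ?Z1"
    by (rule f01.represents_restriction; use rings V0 V1 in auto)+
  have weak01: "weak_mc (\<L>1, \<phi> b) (W0 b)" if "b \<in> V0" for b
    unfolding agree[OF that] by (rule weak1[OF V1[OF that]])
  \<comment> \<open>Equality of the potentials gives both families the potential \<open>?W\<close>,
    so the two restricted functors land in one category of matrix factorizations.\<close>
  have w: "f01.weak_family ?Z0 ?W" "f01.weak_family ?Z1 ?W"
    unfolding f01.weak_family_def ev_def fst_conv snd_conv pullback_def
    using weak0[OF V0] weak01 by auto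
  have iso: "f01.isomorphism ?Z0 ?Z1 \<alpha> \<beta> \<gamma>0" "f01.isomorphism ?Z1 ?Z0 \<beta> \<alpha> \<gamma>1"
    unfolding f01.isomorphism_def ev_def fst_conv snd_conv
    using families \<alpha>_closed \<beta>_closed \<alpha>\<beta> \<beta>\<alpha> by auto
  have maps: "?N01 = f01.CM ?Z1 \<beta> ?Z0" "?N10 = f01.CM ?Z0 \<alpha> ?Z1"
    "?H0 = f01.HM ?Z0 \<alpha> ?Z1 \<beta> \<gamma>0" "?H1 = f01.HM ?Z1 \<beta> ?Z0 \<alpha> \<gamma>1"
    unfolding f01.CM_def f01.HM_def fst_conv snd_conv by simp_all
  have via: "quasi_iso_via (uncurved A) ?B (comp_dg ?r0 ?F0) (comp_dg ?r1 ?F1) ?N01 ?N10 ?H0 ?H1"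
    unfolding maps by (rule f01.comparison_quasi_iso[OF r w iso])
  note via' = via[unfolded quasi_iso_via_def]
  note det = determined_degrees_MF[OF rings(1)] determined_degrees_MF[OF rings(2)] determined_degrees_MF[OF rings(3)]
  have inv01: "invertible_H0 (MF R01 ?W) (gob ?r1 (fob ?F1 K)) (gob ?r0 (fob ?F0 K)) (?N01 K [])"
    and inv10: "invertible_H0 (MF R01 ?W) (gob ?r0 (fob ?F0 K)) (gob ?r1 (fob ?F1 K)) (?N10 K [])"
    if "K \<in> Ob (uncurved A)" for K
    using f01.comparison_invertible[OF r w iso that] f01.comparison_invertible[OF r(2,1) w(2,1) iso(2,1) that]
    unfolding maps by (simp_all add: comp_dg_def)
  \<comment> \<open>\<open>N01\<close> runs from the restriction of \<open>F0\<close> to that of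
    \<open>F1\<close>, so \<open>F1\<close> takes the first place in \<open>hfp_functor\<close> and
    \<open>F0\<close> the second.\<close>
  have glob10: "is_ainf_functor (uncurved A) (ainf_of_dg (hfp (MF R1 W1) (MF R0 W0) (MF R01 ?W) ?r1 ?r0))
      \<lparr>fob = \<lambda>K. (fob ?F1 K, fob ?F0 K, ?N01 K []), fmor = \<lambda>K as. (fmor ?F1 K as, fmor ?F0 K as, ?N01 K as)\<rparr>"
    by (rule hfp_functor[OF det(2,1,3) F1 F0]) (use via' inv01 in blast)+
  have glob01: "is_ainf_functor (uncurved A) (ainf_of_dg (hfp (MF R0 W0) (MF R1 W1) (MF R01 ?W) ?r0 ?r1))
      \<lparr>fob = \<lambda>K. (fob ?F0 K, fob ?F1 K, ?N10 K []), fmor = \<lambda>K as. (fmor ?F0 K as, fmor ?F1 K as, ?N10 K as)\<rparr>"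
    by (rule hfp_functor[OF det(1,2,3) F0 F1]) (use via' inv10 in blast)+
  show ?thesis
    unfolding Let_def
  proof (intro conjI)
    show "\<forall>b0\<in>V0. W0 b0 = W1 (\<phi> b0)" using agree by blast
    show "quasi_isomorphic (uncurved A) ?B (comp_dg ?r0 ?F0) (comp_dg ?r1 ?F1)"
      unfolding quasi_isomorphic_def using via by blast
    show "quasi_iso_via (uncurved A) ?B (comp_dg ?r0 ?F0) (comp_dg ?r1 ?F1) ?N01 ?N10 ?H0 ?H1"
      by (rule via)
  qed (rule exI, intro conjI, rule glob10, simp, simp, rule exI, intro conjI, rule glob01, simp, simp)
qed

end
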